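(* Let $c\in(0,1/2)$ be a fixed constant (chosen close to $1/2$), and for $s>1$ let $\delta_c(s):=(\log\log s)^{c}$ and $\rho_c(s):=2^{(\log s)^{1-1/\delta_c(s)}}$. Unless $\mathrm{P}=\mathrm{NP}$, the minimum number of clauses of a pure Horn function $h$ on $n$ variables, given as a pure Horn CNF, cannot be approximated in time polynomial in $n$ to within a factor of \[ \rho_c(n^{\varepsilon})\;\geq\; 2^{\varepsilon(\log n)^{1-1/\delta_c(n)}} \;=\; 2^{\log^{1-o(1)} n}, \] even when the input is restricted to pure Horn CNFs with $O(n^{1+2\varepsilon})$ clauses, for some $\varepsilon\in(0,1/4]$.
   Context: A clause is a disjunction of literals (variables or negated variables) over distinct variables; it is pure (definite) Horn if it contains exactly one positive literal, i.e. it has the form $\bigwedge_{v\in S} v \rightarrow w$. A pure Horn CNF is a conjunction of pure Horn clauses; a Boolean function $h:\{0,1\}^n\to\{0,1\}$ is pure Horn if some pure Horn CNF represents it (agrees with it on all inputs). The minimum number of clauses of $h$ is $\tau(h):=\min\{\text{number of clauses of }\Phi : \Phi \text{ a pure Horn CNF representing } h\}$. The clause minimization problem: given a pure Horn CNF representing $h$, determine $\tau(h)$. Logarithms are base 2. *)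

theory Defs
  imports
    Complex_Main
    "HOL-Library.Landau_Symbols"
    "HOL-Computational_Algebra.Polynomial"
begin

section \<open>Pure Horn CNFs\<close>

datatype literal = Pos (var: nat) | Neg (var: nat)

type_synonym clause = "literal set"
type_synonym cnf = "clause list"

text \<open>
  The variables of a function on \<open>n\<close> variables are \<open>0, \<dots>, n - 1\<close>, not all of which need occur
  in a CNF representing it; points of \<open>{0,1}\<^sup>n\<close> are Boolean lists of length \<open>n\<close>.
\<close>

fun literal_true :: "bool list \<Rightarrow> literal \<Rightarrow> bool" where
  "literal_true x (Pos v) = x ! v"
| "literal_true x (Neg v) = (\<not> x ! v)"

definition clause_true :: "bool list \<Rightarrow> clause \<Rightarrow> bool" where
  "clause_true x C \<longleftrightarrow> (\<exists>l\<in>C. literal_true x l)"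

definition cnf_true :: "bool list \<Rightarrow> cnf \<Rightarrow> bool" where
  "cnf_true x \<Phi> \<longleftrightarrow> (\<forall>C\<in>set \<Phi>. clause_true x C)"

definition clause_on :: "nat \<Rightarrow> clause \<Rightarrow> bool" where
  "clause_on n C \<longleftrightarrow> var ` C \<subseteq> {..<n} \<and> inj_on var C"

definition pure_horn_clause :: "nat \<Rightarrow> clause \<Rightarrow> bool" where
  "pure_horn_clause n C \<longleftrightarrow> clause_on n C \<and> (\<exists>!v. Pos v \<in> C)"

definition pure_horn_cnf :: "nat \<Rightarrow> cnf \<Rightarrow> bool" where
  "pure_horn_cnf n \<Phi> \<longleftrightarrow> (\<forall>C\<in>set \<Phi>. pure_horn_clause n C)"

definition represents :: "nat \<Rightarrow> cnf \<Rightarrow> (bool list \<Rightarrow> bool) \<Rightarrow> bool" where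
  "represents n \<Phi> h \<longleftrightarrow> (\<forall>x. length x = n \<longrightarrow> cnf_true x \<Phi> = h x)"

text \<open>Meaningful only if \<open>h\<close> is pure Horn, that is, if the set of candidates is nonempty.\<close>

definition min_clauses :: "nat \<Rightarrow> (bool list \<Rightarrow> bool) \<Rightarrow> nat" where
  "min_clauses n h = (LEAST k. \<exists>\<Phi>. pure_horn_cnf n \<Phi> \<and> represents n \<Phi> h \<and> length \<Phi> = k)"


section \<open>Turing machines, P and NP\<close>

text \<open>
  Deterministic machines with one two-way infinite tape. The states are \<open>0, \<dots>, num_states\<close>, of
  which \<open>0\<close> is the initial and \<open>num_states\<close> the only halting state; the tape symbols are
  \<open>0, \<dots>, num_symbols - 1\<close>, where \<open>0\<close> is the blank and \<open>1\<close>, \<open>2\<close> are the two bits. Only the values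
  of \<open>trans\<close> on these finite ranges matter.
\<close>

record turing_machine =
  num_states :: nat
  num_symbols :: nat
  trans :: "nat \<Rightarrow> nat \<Rightarrow> nat \<times> nat \<times> int"

definition wf_tm :: "turing_machine \<Rightarrow> bool" where
  "wf_tm M \<longleftrightarrow> 3 \<le> num_symbols M \<and>
     (\<forall>q < num_states M. \<forall>a < num_symbols M.
        case trans M q a of (q', a', d) \<Rightarrow>
          q' \<le> num_states M \<and> a' < num_symbols M \<and> d \<in> {-1, 0, 1})"

text \<open>A configuration consists of the state, the tape and the head position.\<close>

type_synonym config = "nat \<times> (int \<Rightarrow> nat) \<times> int"

definition tm_step :: "turing_machine \<Rightarrow> config \<Rightarrow> config" where
  "tm_step M = (\<lambda>(q, tp, pos).
     if q < num_states M
     then case trans M q (tp pos) of (q', a, d) \<Rightarrow> (q', tp(pos := a), pos + d)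
     else (q, tp, pos))"

definition bit_symbol :: "bool \<Rightarrow> nat" where
  "bit_symbol b = (if b then 2 else 1)"

definition init_config :: "bool list \<Rightarrow> config" where
  "init_config x =
     (0, (\<lambda>i. if 0 \<le> i \<and> i < int (length x) then bit_symbol (x ! nat i) else 0), 0)"

text \<open>
  On input \<open>x\<close> the machine halts within \<open>t\<close> steps with output \<open>y\<close>: the output is written from
  cell \<open>0\<close> onwards and ends at the first blank.
\<close>

definition outputs_within :: "turing_machine \<Rightarrow> bool list \<Rightarrow> nat \<Rightarrow> bool list \<Rightarrow> bool" where
  "outputs_within M x t y \<longleftrightarrow>
     (case (tm_step M ^^ t) (init_config x) of (q, tp, pos) \<Rightarrow>
        q = num_states M \<and>
        (\<forall>i < length y. tp (int i) = bit_symbol (y ! i)) \<and> tp (int (length y)) = 0)"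

definition class_P :: "bool list set set" where
  "class_P = {L. \<exists>M (p :: nat poly). wf_tm M \<and>
     (\<forall>x. outputs_within M x (poly p (length x)) [x \<in> L])}"

text \<open>Self-delimiting: every bit of \<open>x\<close> is doubled, and the pair \<open>01\<close> ends \<open>x\<close>.\<close>

definition pair_bits :: "bool list \<Rightarrow> bool list \<Rightarrow> bool list" where
  "pair_bits x y = concat (map (\<lambda>b. [b, b]) x) @ [False, True] @ y"

definition class_NP :: "bool list set set" where
  "class_NP = {L. \<exists>V\<in>class_P. \<exists>p :: nat poly.
     \<forall>x. x \<in> L \<longleftrightarrow> (\<exists>y. length y \<le> poly p (length x) \<and> pair_bits x y \<in> V)}"


section \<open>Approximating the minimum number of clauses\<close>

text \<open>
  The number of variables is written in unary, followed by each clause as the two indicator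
  vectors of its positive and of its negative variables. The length is \<open>n + 1 + 2 n m\<close> for
  \<open>m\<close> clauses, hence polynomial in \<open>n\<close> whenever \<open>m\<close> is.
\<close>

definition encode_clause :: "nat \<Rightarrow> clause \<Rightarrow> bool list" where
  "encode_clause n C = map (\<lambda>i. Pos i \<in> C) [0..<n] @ map (\<lambda>i. Neg i \<in> C) [0..<n]"

definition encode_cnf :: "nat \<Rightarrow> cnf \<Rightarrow> bool list" where
  "encode_cnf n \<Phi> = replicate n True @ [False] @ concat (map (encode_clause n) \<Phi>)"

text \<open>
  Some machine, in time polynomial in the number \<open>n\<close> of variables, computes in binary (least
  significant bit first) a number between \<open>\<tau>(h)\<close> and \<open>r n \<cdot> \<tau>(h)\<close>. Nothing is required of it
  on CNFs that are not pure Horn, have more than \<open>m n\<close> clauses, or whose number of variables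
  lies outside \<open>N\<close>.
\<close>

definition min_clauses_approximable ::
    "nat set \<Rightarrow> (nat \<Rightarrow> nat) \<Rightarrow> (nat \<Rightarrow> real) \<Rightarrow> bool" where
  "min_clauses_approximable N m r \<longleftrightarrow>
     (\<exists>M (p :: nat poly). wf_tm M \<and>
       (\<forall>n\<in>N. \<forall>\<Phi> h. pure_horn_cnf n \<Phi> \<and> represents n \<Phi> h \<and> length \<Phi> \<le> m n \<longrightarrow>
          (\<exists>y. outputs_within M (encode_cnf n \<Phi>) (poly p n) y \<and>
               (let a = horner_sum of_bool 2 y :: nat in
                  min_clauses n h \<le> a \<and> real a \<le> r n * real (min_clauses n h)))))"

text \<open>
  Both functions are used only for \<open>s > 2\<close>, where \<open>log log s\<close> is positive; for \<open>1 < s < 2\<close> the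
  real power of the negative number \<open>log log s\<close> has no meaning.
\<close>

definition delta :: "real \<Rightarrow> real \<Rightarrow> real" where
  "delta c s = (log 2 (log 2 s)) powr c"

definition rho :: "real \<Rightarrow> real \<Rightarrow> real" where
  "rho c s = 2 powr ((log 2 s) powr (1 - 1 / delta c s))"

end

theory Submission
  imports Defs "HOL-Real_Asymp.Real_Asymp" "HOL-Number_Theory.Cong"
begin

text \<open>
  The hardness proof does not use the PCP theorem; the gap comes from an algebraic encoding in
  which the size of the formula, not the number of queries, pays for the soundness.

  The tableau of an NP computation is a constraint satisfaction problem with \<open>m\<close> variables, each
  constraint involving four of them. Choose \<open>T\<close> with \<open>m \<le> Dd (T - 1) ^ T\<close>, where
  \<open>Dd t = 2 ^ 2 ^ t\<close>, put \<open>K = Dd T\<close> and let \<open>q\<close> be a prime of size \<open>K\<close> to a constant power. An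
  assignment extends to a polynomial on \<open>F\<^sub>q ^ T\<close> whose restriction to every line has degree
  less than \<open>K\<close>. The \<open>K\<close> coefficients of a restriction, read as a bivariate polynomial with
  \<open>Dd (T - 1)\<close> coefficients in each direction, are described by its columns and rows, and so on
  recursively, until after \<open>T\<close> steps only strings of two coefficients remain. Horn rules check
  these descriptions exhaustively and finally derive a goal atom. The only atoms that are not
  derived are the guesses \<open>AE I c0 c1\<close> for the strings at the bottom. One guess per string suffices
  if the assignment is satisfying. Conversely, if the goal is derivable from at most \<open>K\<close> guesses
  per string on average, then few codewords are consistent with the guesses along most lines, and
  for a suitable base point \<open>z\<close> and value \<open>a\<close> at \<open>z\<close> the decoded value is unique at every point,
  so that a satisfying assignment can be read off.

  Many copies of the rules that share the guesses, rules from the goals of all copies to every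
  atom, and many seed variables implying every atom turn the number of guesses into the minimum
  number of clauses of a pure Horn function: for each seed the clauses issuing from it have to be
  at least as many as the guesses. The gap is \<open>K = 2 ^ 2 ^ T\<close> up to a constant, whereas
  \<open>log n = O(T 2 ^ T)\<close>, so \<open>log K\<close> is of order \<open>log n / log log n\<close>, which exceeds
  \<open>log \<rho>\<^sub>c(n ^ \<epsilon>) = \<epsilon> log n / 2 ^ (log (\<epsilon> log n)) ^ (1 - c)\<close> for large \<open>n\<close>.

  To produce the formula in polynomial time, all numbers involved are kept polynomially bounded
  and are computed by bounded primitive recursion (\<open>pb k f\<close>: \<open>f\<close> is computable in polynomial time
  from the input and \<open>k\<close> numbers in unary), compiled to counter programs and these to machines.
\<close>


section \<open>Asymptotics of the approximation factor\<close>

text \<open>The sizes of the parameters follow from one loss. Descending from a string to its rows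
  and columns multiplies the tolerated number of guesses per bottom string by
  \<open>4 * Dd t\<close>: every residue modulo \<open>Dd t\<close> needs a cheap copy of its row,
  and only a fraction \<open>1 / Dd t\<close> of the copies carries a given residue. Since the
  product of all \<open>Dd s\<close> with \<open>s < T\<close> is \<open>Dd T / 2\<close>, all
  levels together lose only a power of K; this is the reason for squaring the size from level to
  level. The lists stay below K^6, and a prime above K^17 makes collisions inside them rare. Depth
  and dimension are both T, so that the formula has size K^O(T).

  The obstacle to reading off an assignment is that lists have several members, which would have to
  be matched between different places. A codeword is therefore always addressed by its value at one
  position: at \<open>s\<close> in a string, at \<open>(u, v)\<close> in a square, at the base point
  \<open>z\<close> in the whole space. Rule bodies that range over all positions force each
  derivation through a position where the address is unambiguous.\<close>

lemma rho_powr_lower_bound: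
  fixes c \<epsilon> s :: real
  assumes c: "0 < c" "c < 1" and e: "0 < \<epsilon>" "\<epsilon> \<le> 1" and s: "s powr \<epsilon> > 2"
  shows "2 powr (\<epsilon> * log 2 s powr (1 - 1 / delta c s)) \<le> rho c (s powr \<epsilon>)"
proof -
  have s0: "s \<noteq> 0" using s by auto
  have lse: "log 2 (s powr \<epsilon>) = \<epsilon> * log 2 s" using s0 by (simp add: log_powr)
  define L where "L = log 2 s"
  have "log 2 (s powr \<epsilon>) > log 2 2" using s by (subst log_less_cancel_iff) auto
  then have eL: "\<epsilon> * L > 1" using lse L_def by simp
  then have Lpos: "L > 0" using e by (metis less_trans zero_less_mult_pos zero_less_one)
  have L1: "\<epsilon> * L \<le> L" using e Lpos by simp
  define u where "u = log 2 L"
  define v where "v = log 2 (\<epsilon> * L)"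
  have v0: "0 < v" using eL v_def by simp
  have vu: "v \<le> u" unfolding u_def v_def using L1 eL by simp
  \<comment> \<open>Damping form of the factor: \<open>x\<close> is divided by
    \<open>2 powr (log 2 x powr (1 - c))\<close>, which grows with \<open>x\<close>. Passing from
    \<open>L\<close> to the smaller \<open>\<epsilon> * L\<close> therefore damps less, and the
    linear part accounts for \<open>\<epsilon>\<close> exactly.\<close>
  have powr_eq: "x powr (1 - 1 / (log 2 x) powr c) = x * 2 powr (- (log 2 x powr (1 - c)))"
    if "x > 1" for x :: real
  proof -
    have w: "log 2 x > 0" using that by simp
    have x2: "x = 2 powr (log 2 x)" using that by simp
    have "x powr (- (1 / (log 2 x) powr c)) = 2 powr (log 2 x * (- (1 / (log 2 x) powr c)))"
      by (metis x2 powr_powr)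
    also have "log 2 x * (- (1 / (log 2 x) powr c)) = - (log 2 x powr (1 - c))"
      using w by (simp add: powr_diff)
    finally have "x powr (- (1 / (log 2 x) powr c)) = 2 powr (- (log 2 x powr (1 - c)))" .
    then show ?thesis using that powr_add[of x 1 "- (1 / (log 2 x) powr c)"] by simp
  qed
  have "v powr (1 - c) \<le> u powr (1 - c)" using v0 vu c by (intro powr_mono2) auto
  then have "\<epsilon> * L * 2 powr (- (u powr (1 - c))) \<le> \<epsilon> * L * 2 powr (- (v powr (1 - c)))"
    using eL by (intro mult_left_mono) auto
  moreover have "L powr (1 - 1 / delta c s) = L * 2 powr (- (u powr (1 - c)))"
    using powr_eq[of L] eL L1 unfolding delta_def L_def[symmetric] u_def by simp
  moreover have "(\<epsilon> * L) powr (1 - 1 / delta c (s powr \<epsilon>)) = \<epsilon> * L * 2 powr (- (v powr (1 - c)))"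
    using powr_eq[OF eL] unfolding delta_def lse L_def[symmetric] v_def by simp
  ultimately show ?thesis
    unfolding rho_def lse L_def[symmetric] by (simp add: mult.assoc)
qed

text \<open>The constant factor moves into the exponent: with \<open>L = log 2 n\<close> it equals
  \<open>L powr (log 2 \<epsilon> / log 2 L)\<close>, and this exponent tends to 0 together with
  \<open>1 / delta c n\<close>.\<close>

lemma log_powr_one_minus_o1:
  fixes c \<epsilon> :: real
  assumes c: "0 < c" and e: "0 < \<epsilon>" "\<epsilon> \<le> 1"
  shows "\<exists>f :: nat \<Rightarrow> real. f \<in> o(\<lambda>_. 1) \<and>
      (\<forall>n::nat. real n powr \<epsilon> > 2 \<longrightarrow>
        2 powr (\<epsilon> * log 2 (real n) powr (1 - 1 / delta c (real n)))
          = 2 powr (log 2 (real n) powr (1 - f n)))"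
proof (intro exI conjI allI impI)
  let ?f = "\<lambda>n::nat. 1 / delta c (real n) - log 2 \<epsilon> / log 2 (log 2 (real n))"
  have ll: "filterlim (\<lambda>n::nat. log 2 (log 2 (real n))) at_top at_top" by real_asymp
  have "((\<lambda>x. 1 / x powr c) \<longlongrightarrow> 0) at_top" using c by real_asymp
  moreover have "((\<lambda>x. log 2 \<epsilon> / x) \<longlongrightarrow> 0) at_top"
    by (rule tendsto_divide_0[OF tendsto_const filterlim_at_top_imp_at_infinity[OF filterlim_ident]])
  ultimately have "((\<lambda>x. 1 / x powr c - log 2 \<epsilon> / x) \<longlongrightarrow> 0) at_top"
    using tendsto_diff by fastforce
  from filterlim_compose[OF this ll] have "(?f \<longlongrightarrow> 0) at_top" unfolding delta_def .
  then show "?f \<in> o(\<lambda>_. 1)" by (intro smalloI_tendsto) auto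
  fix n :: nat assume n: "real n powr \<epsilon> > 2"
  define L where "L = log 2 (real n)"
  have n0: "real n \<noteq> 0" using n by (cases "n = 0") auto
  have "log 2 (real n powr \<epsilon>) > log 2 2" using n n0 by (subst log_less_cancel_iff) auto
  then have eL: "\<epsilon> * L > 1" using n0 L_def by (simp add: log_powr)
  then have Lpos: "L > 0" using e by (metis less_trans zero_less_mult_pos zero_less_one)
  have L1: "L > 1" using e Lpos eL mult_right_mono[of \<epsilon> 1 L] by linarith
  have "L powr (log 2 \<epsilon> / log 2 L) = \<epsilon>"
    using L1 e by (simp add: powr_def log_def)
  then have "\<epsilon> * L powr (1 - 1 / delta c (real n)) = L powr (1 - ?f n)"
    unfolding L_def[symmetric] using L1 by (simp add: powr_add[symmetric] algebra_simps flip: powr_add)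
      (metis (no_types) add.commute add_diff_eq powr_add)
  then show "2 powr (\<epsilon> * log 2 (real n) powr (1 - 1 / delta c (real n)))
      = 2 powr (log 2 (real n) powr (1 - ?f n))" unfolding L_def by simp
qed

text \<open>The two bounds on \<open>n\<close> are those that the constructed formula satisfies
  (\<open>nn_ge\<close>, \<open>nn_le\<close>) with K = 2^2^T. There log n is at most a constant
  times T 2^T, whereas \<open>rho\<close> damps it by more than
  \<open>2 powr (T powr (1 - c))\<close>, which outgrows every multiple of T. The factor 4 is spent
  in \<open>decide_by_approximation\<close>.\<close>

lemma rho_below_double_exp:
  fixes c :: real
  assumes c: "0 < c" "c < 1"
  shows "\<exists>T1. \<forall>T\<ge>T1. \<forall>n::nat. (2 ^ 2 ^ T) ^ 8 \<le> n \<and> n \<le> (2 ^ 2 ^ T) ^ (3000 * T) \<longrightarrow>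
    4 * rho c (real n powr (1 / 4)) \<le> 2 ^ 2 ^ T \<and> 2 < real n powr (1 / 4)"
proof -
  \<comment> \<open>1500 is twice 3000 / 4: the upper bound on \<open>n\<close> yields
    \<open>L \<le> 750 * T * 2 ^ T\<close>, and after damping at most half of \<open>2 ^ T\<close>
    may remain.\<close>
  have "eventually (\<lambda>T::nat. 1500 * real T \<le> 2 powr (real T powr (1 - c))) sequentially"
    using c by real_asymp
  then obtain T1 where T1: "\<And>T. T \<ge> T1 \<Longrightarrow> 1500 * real T \<le> 2 powr (real T powr (1 - c))"
    unfolding eventually_sequentially by blast
  show ?thesis
  proof (intro exI[of _ "max T1 2"] allI impI)
    fix T n :: nat
    assume T: "max T1 2 \<le> T" and n: "(2 ^ 2 ^ T) ^ 8 \<le> n \<and> n \<le> (2 ^ 2 ^ T) ^ (3000 * T)"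
    define L where "L = log 2 (real n powr (1 / 4))"
    define u where "u = log 2 L"
    have p4: "4 \<le> (2::real) ^ T" using power_increasing[of 2 T "2::real"] T by simp
    have n0: "0 < real n" using n by (metis gr0I not_numeral_le_zero of_nat_0_less_iff le_zero_eq power_not_zero zero_neq_numeral)
    have L4: "L = log 2 n / 4" using n0 by (simp add: L_def log_powr)
    have pw: "real ((2 ^ 2 ^ T) ^ k) = 2 powr (real k * 2 ^ T)" for k
    proof -
      have "real ((2 ^ 2 ^ T) ^ k) = 2 ^ (2 ^ T * k)" by (simp only: of_nat_power of_nat_numeral power_mult)
      also have "\<dots> = 2 powr real (2 ^ T * k)" by (simp only: powr_realpow[of 2] zero_less_numeral)
      finally show ?thesis by (simp add: mult.commute)
    qed
    have "real ((2 ^ 2 ^ T) ^ 8) \<le> real n" using n by (simp only: of_nat_le_iff)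
    then have "2 powr (8 * 2 ^ T) \<le> real n" unfolding pw by simp
    then have lo: "8 * 2 ^ T \<le> log 2 n" using n0 by (simp add: le_log_iff)
    have "real n \<le> real ((2 ^ 2 ^ T) ^ (3000 * T))" using n by (simp only: of_nat_le_iff)
    then have "real n \<le> 2 powr (3000 * T * 2 ^ T)" unfolding pw by simp
    then have hi: "log 2 n \<le> 3000 * T * 2 ^ T" using n0 by (simp add: log_le_iff)
    have L: "2 ^ T \<le> L" "L \<le> 750 * T * 2 ^ T" "1 < L" using lo hi p4 unfolding L4 by linarith+
    have u: "real T \<le> u" using L unfolding u_def by (simp add: le_log_iff powr_realpow)
    then have u0: "0 < u" using T by linarith
    have "u / u powr c = u powr (1 - c)" using u0 by (simp add: powr_diff)
    then have e: "L powr (1 - 1 / u powr c) = L / 2 powr (u powr (1 - c))"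
    proof -
      have Lu: "L = 2 powr u" using L by (simp add: u_def)
      have "L powr (1 - 1 / u powr c) = 2 powr (u * (1 - 1 / u powr c))" by (subst Lu) (rule powr_powr)
      also have "u * (1 - 1 / u powr c) = u - u / u powr c" by (simp add: algebra_simps)
      also have "2 powr (u - u / u powr c) = 2 powr u / 2 powr (u powr (1 - c))"
        unfolding \<open>u / u powr c = u powr (1 - c)\<close> by (rule powr_diff)
      finally show ?thesis using Lu by simp
    qed
    have "1500 * real T \<le> 2 powr (real T powr (1 - c))" using T1 T by simp
    also have "\<dots> \<le> 2 powr (u powr (1 - c))" using u c by (intro powr_mono powr_mono2) auto
    finally have q: "1500 * real T \<le> 2 powr (u powr (1 - c))" .
    have "2 * L \<le> 1500 * real T * 2 ^ T" using L(2) by simp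
    also have "\<dots> \<le> 2 powr (u powr (1 - c)) * 2 ^ T" using q by (intro mult_right_mono) auto
    finally have "L / 2 powr (u powr (1 - c)) \<le> 2 ^ T / 2" by (simp add: field_simps)
    then have "rho c (real n powr (1 / 4)) \<le> 2 powr (2 ^ T / 2)"
      unfolding rho_def delta_def L_def[symmetric] u_def[symmetric] e by simp
    then have "4 * rho c (real n powr (1 / 4)) \<le> 2 powr 2 * 2 powr (2 ^ T / 2)" by simp
    also have "\<dots> = 2 powr (2 + 2 ^ T / 2)" by (rule powr_add[symmetric])
    also have "\<dots> \<le> 2 powr (2 ^ T)" using p4 by (intro powr_mono) auto
    also have "\<dots> = 2 ^ 2 ^ T" using powr_realpow[of 2 "2 ^ T"] by simp
    finally have r: "4 * rho c (real n powr (1 / 4)) \<le> 2 ^ 2 ^ T" .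
    have "2 powr 1 < 2 powr L" using L by (intro powr_less_mono) auto
    moreover have "2 powr L = real n powr (1 / 4)" unfolding L_def using n0 by simp
    ultimately show "4 * rho c (real n powr (1 / 4)) \<le> 2 ^ 2 ^ T \<and> 2 < real n powr (1 / 4)" using r by simp
  qed
qed

section \<open>Polynomials modulo a prime and vectors of digits\<close>

definition Dd :: "nat \<Rightarrow> nat" where "Dd t = 2 ^ (2 ^ t)"

lemma Dd_0 [simp]: "Dd 0 = 2" by (simp add: Dd_def)
lemma Dd_Suc: "Dd (Suc t) = Dd t * Dd t" by (simp add: Dd_def power_add mult_2)
lemma Dd_ge2: "2 \<le> Dd t" unfolding Dd_def
  by (metis one_le_numeral power_increasing power_one_right one_le_power)
lemma Dd_pos [simp]: "0 < Dd t" by (simp add: Dd_def)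
lemma Dd_mono: "s \<le> t \<Longrightarrow> Dd s \<le> Dd t" by (simp add: Dd_def)

definition hev :: "nat \<Rightarrow> nat \<Rightarrow> (nat \<Rightarrow> nat) \<Rightarrow> nat \<Rightarrow> nat" where
  "hev q D c s = (\<Sum>j<D. c j * s ^ j) mod q"

lemma hev_less: "0 < q \<Longrightarrow> hev q D c s < q"
  by (simp add: hev_def)

text \<open>Horner's scheme from the leading coefficient downwards. The rules \<open>RP\<close> and
  \<open>RV\<close> perform one such step each, so a completed chain has used every
  coefficient.\<close>

primrec hor :: "nat \<Rightarrow> nat \<Rightarrow> (nat \<Rightarrow> nat) \<Rightarrow> nat \<Rightarrow> nat \<Rightarrow> nat" where
  "hor q D c s 0 = 0"
| "hor q D c s (Suc l) = (hor q D c s l * s + c (D - 1 - l)) mod q"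

lemma hor_partial: "l \<le> D \<Longrightarrow> hor q D c s l = (\<Sum>j<l. c (D - l + j) * s ^ j) mod q"
proof (induction l)
  case (Suc l)
  have "(\<Sum>j<Suc l. c (D - Suc l + j) * s ^ j)
      = c (D - Suc l) + (\<Sum>j<l. c (D - l + j) * s ^ j) * s"
    using Suc.prems
    by (subst sum.lessThan_Suc_shift)
       (auto simp: sum_distrib_left mult_ac Suc_diff_Suc intro!: sum.cong)
  moreover have mm: "(X mod q * s + y) mod q = (y + X * s) mod q" for X y
    by (metis add.commute mod_add_left_eq mod_mult_left_eq)
  moreover have "hor q D c s (Suc l) = ((\<Sum>j<l. c (D - l + j) * s ^ j) mod q * s + c (D - Suc l)) mod q"
    using Suc by simp
  ultimately show ?case by (simp only:)
qed simp

lemma hor_eq_hev: "hor q D c s D = hev q D c s"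
  by (simp add: hor_partial hev_def)

text \<open>Integer polynomials with divisibility stand in for the field of q elements,
  \<open>q\<close> being a variable. Splitting off a root leaves a quotient that is still nonzero
  modulo \<open>q\<close>; otherwise \<open>p\<close> would be congruent to its value at the root,
  hence to 0.\<close>

lemma poly_roots_mod_prime:
  fixes p :: "int poly" and q :: nat
  assumes "prime q" and "\<exists>i. \<not> int q dvd coeff p i"
  shows "card {s. s < q \<and> int q dvd poly p (int s)} \<le> degree p"
  using assms(2)
proof (induction "degree p" arbitrary: p rule: less_induct)
  case less
  let ?R = "\<lambda>p. {s. s < q \<and> int q dvd poly p (int s)}"
  show ?case
  proof (cases "?R p = {}")
    case False
    then obtain s0 where s0: "s0 < q" "int q dvd poly p (int s0)" by auto
    define p1 where "p1 = synthetic_div p (int s0)"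
    have eq: "p = [:- int s0, 1:] * p1 + [:poly p (int s0):]"
      using synthetic_div_correct'[where p = p and c = "int s0"] by (simp add: p1_def)
    have deg0: "degree p \<noteq> 0"
    proof
      assume "degree p = 0"
      then obtain a where "p = [:a:]" by (metis degree_eq_zeroE)
      then have "int q dvd coeff p i" for i using s0 by (cases i) auto
      then show False using less.prems by blast
    qed
    have degp1: "degree p1 = degree p - 1" by (simp add: p1_def degree_synthetic_div)
    have ex: "\<exists>i. \<not> int q dvd coeff p1 i"
    proof (rule ccontr)
      assume "\<not> ?thesis"
      then have "\<forall>i. int q dvd coeff ([:- int s0, 1:] * p1) i"
        by (auto simp: coeff_pCons split: nat.splits)
      then have "\<forall>i. int q dvd coeff p i"
        using s0(2) by (subst eq) (auto simp: coeff_pCons split: nat.splits)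
      then show False using less.prems by blast
    qed
    have sub: "?R p \<subseteq> insert s0 (?R p1)"
    proof
      fix s assume s: "s \<in> ?R p"
      have "poly p (int s) = (int s - int s0) * poly p1 (int s) + poly p (int s0)"
        by (subst eq) (simp add: algebra_simps)
      then have "int q dvd (int s - int s0) * poly p1 (int s)"
        using s s0(2) by (metis (no_types, lifting) add_diff_cancel_right' dvd_diff mem_Collect_eq)
      then have "int q dvd int s - int s0 \<or> int q dvd poly p1 (int s)"
        using assms(1) by (simp add: prime_dvd_mult_iff)
      moreover have "s = s0" if "int q dvd int s - int s0"
        using that s s0(1) by (auto simp: mod_eq_dvd_iff[symmetric] zmod_int[symmetric])
      ultimately show "s \<in> insert s0 (?R p1)" using s by auto
    qed
    have "card (?R p) \<le> card (insert s0 (?R p1))" by (rule card_mono[OF _ sub]) auto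
    also have "\<dots> \<le> Suc (card (?R p1))" by (simp add: card_insert_le_m1 card_insert_if)
    also have "card (?R p1) \<le> degree p1" using less.hyps[of p1] deg0 degp1 ex by simp
    finally show ?thesis using deg0 degp1 by simp
  qed (simp only: card.empty)
qed

lemma hev_collision:
  assumes "prime q" and "\<And>j. j < D \<Longrightarrow> c j < q" and "\<And>j. j < D \<Longrightarrow> c' j < q"
    and "j0 < D" and "c j0 \<noteq> c' j0"
  shows "card {s. s < q \<and> hev q D c s = hev q D c' s} \<le> D"
proof -
  define p :: "int poly" where "p = (\<Sum>j<D. monom (int (c j) - int (c' j)) j)"
  have co: "coeff p i = (if i < D then int (c i) - int (c' i) else 0)" for i
    by (simp add: p_def coeff_sum if_distrib cong: if_cong)
  have "\<not> int q dvd coeff p j0"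
    using assms(2-5) by (auto simp: co mod_eq_dvd_iff[symmetric] zmod_int[symmetric])
  then have "card {s. s < q \<and> int q dvd poly p (int s)} \<le> degree p"
    using poly_roots_mod_prime[OF assms(1)] by blast
  moreover have "degree p \<le> D"
    by (rule degree_le) (simp add: co)
  moreover have "(hev q D c s = hev q D c' s) = (int q dvd poly p (int s))" for s
  proof -
    have "poly p (int s) = int (\<Sum>j<D. c j * s ^ j) - int (\<Sum>j<D. c' j * s ^ j)"
      by (simp add: p_def poly_sum poly_monom left_diff_distrib sum_subtractf)
    then show ?thesis
      by (simp only: hev_def mod_eq_dvd_iff[symmetric] zmod_int[symmetric] of_nat_eq_iff)
  qed
  ultimately show ?thesis by simp
qed

text \<open>Union bound over the at most \<open>G * G\<close> pairs of members, each with at most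
  \<open>D\<close> collisions.\<close>

lemma hev_collision_family:
  assumes q: "prime q" and Y: "finite Y" "card Y \<le> G"
    and lt: "\<And>c j. c \<in> Y \<Longrightarrow> j < D \<Longrightarrow> c j < q"
  shows "card {s. s < q \<and> (\<exists>c\<in>Y. \<exists>c'\<in>Y. (\<exists>j<D. c j \<noteq> c' j) \<and> hev q D c s = hev q D c' s)}
    \<le> G * G * D"
proof -
  define B where "B x = {s. s < q \<and> (\<exists>j<D. fst x j \<noteq> snd x j) \<and> hev q D (fst x) s = hev q D (snd x) s}"
    for x :: "(nat \<Rightarrow> nat) \<times> (nat \<Rightarrow> nat)"
  let ?A = "{s. s < q \<and> (\<exists>c\<in>Y. \<exists>c'\<in>Y. (\<exists>j<D. c j \<noteq> c' j) \<and> hev q D c s = hev q D c' s)}"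
  have "?A \<subseteq> (\<Union>x\<in>Y\<times>Y. B x)"
  proof
    fix s assume "s \<in> ?A"
    then obtain c c' where "s < q" "c \<in> Y" "c' \<in> Y" "\<exists>j<D. c j \<noteq> c' j" "hev q D c s = hev q D c' s" by blast
    then have "(c,c') \<in> Y \<times> Y" "s \<in> B (c,c')" by (auto simp: B_def)
    then show "s \<in> (\<Union>x\<in>Y\<times>Y. B x)" by (rule UN_I)
  qed
  moreover have "finite (\<Union>x\<in>Y\<times>Y. B x)" using Y by (intro finite_UN_I) (auto simp: B_def)
  ultimately have "card ?A \<le> card (\<Union>x\<in>Y\<times>Y. B x)" by (intro card_mono)
  moreover have "card (\<Union>x\<in>Y\<times>Y. B x) \<le> (\<Sum>x\<in>Y\<times>Y. card (B x))"
    by (rule card_UN_le) (simp add: Y)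
  moreover have "(\<Sum>x\<in>Y\<times>Y. card (B x)) \<le> (\<Sum>x\<in>Y\<times>Y. D)"
  proof (rule sum_mono)
    fix x assume x: "x \<in> Y \<times> Y"
    show "card (B x) \<le> D"
    proof (cases "\<exists>j<D. fst x j \<noteq> snd x j")
      case True
      then obtain j where j: "j < D" "fst x j \<noteq> snd x j" by blast
      have "B x = {s. s < q \<and> hev q D (fst x) s = hev q D (snd x) s}"
        using True by (simp add: B_def)
      then show ?thesis using hev_collision[of q D "fst x" "snd x" j] q j lt x by auto
    next
      case False
      then have "B x = {}" unfolding B_def by blast
      then show ?thesis by simp
    qed
  qed
  moreover have "(\<Sum>x\<in>Y\<times>Y. D) = card Y * card Y * D" by (simp add: card_cartesian_product)
  moreover have "card Y * card Y * D \<le> G * G * D" using Y(2) by (intro mult_mono) auto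
  ultimately show ?thesis by linarith
qed


section \<open>Vectors over the field of q elements, coded by base-q digits\<close>

definition dig :: "nat \<Rightarrow> nat \<Rightarrow> nat \<Rightarrow> nat" where "dig q z k = z div q ^ k mod q"

text \<open>The point \<open>z + l * y\<close> of the \<open>d\<close>-dimensional space.\<close>

definition lin :: "nat \<Rightarrow> nat \<Rightarrow> nat \<Rightarrow> nat \<Rightarrow> nat \<Rightarrow> nat" where
  "lin q d z l y = (\<Sum>k<d. ((dig q z k + l * dig q y k) mod q) * q ^ k)"

lemma digit_sum_less: "0 < q \<Longrightarrow> (\<And>k. k < d \<Longrightarrow> f k < q) \<Longrightarrow> (\<Sum>k<d. f k * q ^ k) < (q::nat) ^ d"
proof (induction d)
  case (Suc d)
  have "f d * q ^ d \<le> (q - 1) * q ^ d" using Suc.prems(2)[of d] Suc.prems(1) by (intro mult_right_mono) auto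
  moreover have "(\<Sum>k<d. f k * q ^ k) < q ^ d" using Suc by simp
  moreover have "q * q ^ d = (q - 1) * q ^ d + q ^ d" using Suc.prems(1)
    by (metis Suc_pred' add.commute mult_Suc)
  ultimately have "(\<Sum>k<d. f k * q ^ k) + f d * q ^ d < q * q ^ d" by linarith
  then show ?case by simp
qed simp

lemma dig_sum: "0 < q \<Longrightarrow> (\<And>k. k < d \<Longrightarrow> f k < q) \<Longrightarrow> k < d \<Longrightarrow> dig q (\<Sum>k<d. f k * q ^ k) k = f k"
proof (induction d)
  case (Suc d)
  show ?case
  proof (cases "k = d")
    case True
    have "(\<Sum>k<d. f k * q ^ k) < q ^ d" using Suc.prems by (intro digit_sum_less) auto
    then show ?thesis using True Suc.prems(1) Suc.prems(2)[of d] by (simp add: dig_def)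
  next
    case False
    then have kd: "k < d" using Suc.prems by simp
    have "f d * q ^ d = q ^ k * (q * (f d * q ^ (d - Suc k)))"
    proof -
      have "q ^ d = q ^ (k + Suc (d - Suc k))" using kd by simp
      then show ?thesis by (simp only: power_add power_Suc mult_ac)
    qed
    then have "(\<Sum>k<Suc d. f k * q ^ k) = (\<Sum>k<d. f k * q ^ k) + q ^ k * (q * (f d * q ^ (d - Suc k)))"
      by (simp only: sum.lessThan_Suc)
    then have "(\<Sum>k<Suc d. f k * q ^ k) div q ^ k = (\<Sum>k<d. f k * q ^ k) div q ^ k + q * (f d * q ^ (d - Suc k))"
      using Suc.prems(1) by (simp only: div_mult_self2 power_not_zero neq0_conv not_gr_zero)
        (simp add: add.commute)
    then show ?thesis using Suc kd by (simp add: dig_def)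
  qed
qed simp

lemma dig_eq_imp_eq: "0 < q \<Longrightarrow> z < q ^ d \<Longrightarrow> z' < q ^ d \<Longrightarrow> (\<And>k. k < d \<Longrightarrow> dig q z k = dig q z' k) \<Longrightarrow> z = z'"
proof (induction d arbitrary: z z')
  case (Suc d)
  have "z div q = z' div q"
  proof (rule Suc.IH)
    show "z div q < q ^ d" "z' div q < q ^ d"
      using Suc.prems by (auto simp: less_mult_imp_div_less mult.commute)
    fix k assume "k < d"
    then show "dig q (z div q) k = dig q (z' div q) k"
      using Suc.prems(4)[of "Suc k"] by (simp add: dig_def div_mult2_eq)
  qed (use Suc in auto)
  moreover have "z mod q = z' mod q" using Suc.prems(4)[of 0] by (simp add: dig_def)
  ultimately show ?case by (metis div_mult_mod_eq)
qed simp

lemma dig_less: "0 < q \<Longrightarrow> dig q z k < q" by (simp add: dig_def)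

lemma lin_less: "0 < q \<Longrightarrow> lin q d z l y < q ^ d"
  unfolding lin_def by (rule digit_sum_less) auto

lemma dig_lin: "0 < q \<Longrightarrow> k < d \<Longrightarrow> dig q (lin q d z l y) k = (dig q z k + l * dig q y k) mod q"
  unfolding lin_def by (rule dig_sum) auto

lemma lin_eqI: "0 < q \<Longrightarrow> x < q ^ d \<Longrightarrow> (\<And>k. k < d \<Longrightarrow> (dig q z k + l * dig q y k) mod q = dig q x k) \<Longrightarrow> lin q d z l y = x"
  by (rule dig_eq_imp_eq[of q _ d]) (auto simp: lin_less dig_lin)

lemma lin_inj:
  assumes q: "prime q" and l: "0 < l" "l < q" and y: "y < q ^ d" "y' < q ^ d"
    and eq: "lin q d z l y = lin q d z l y'"
  shows "y = y'"
proof (rule dig_eq_imp_eq[of q _ d])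
  show q0: "0 < q" using q prime_gt_0_nat by blast
  fix k assume k: "k < d"
  have "(dig q z k + l * dig q y k) mod q = (dig q z k + l * dig q y' k) mod q"
    using eq dig_lin[OF q0 k] by metis
  then have "[l * dig q y k = l * dig q y' k] (mod q)"
    by (simp add: cong_def[symmetric] cong_add_lcancel_nat)
  moreover have "coprime l q" using q l
    by (metis coprime_commute nat_dvd_not_less prime_imp_coprime)
  ultimately have "[dig q y k = dig q y' k] (mod q)" by (simp add: cong_mult_lcancel_nat)
  then show "dig q y k = dig q y' k" using dig_less[OF q0] by (simp add: cong_def)
qed (use y in auto)

text \<open>The code of the line that has \<open>z\<close> at parameter \<open>t\<close> and
  \<open>p\<close> at \<open>t + 1\<close>: its direction is \<open>p - z\<close> and its base point
  \<open>z - t (p - z)\<close>, with \<open>q - 1\<close> and \<open>q - t\<close> in the roles of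
  -1 and -t. For fixed \<open>t\<close> the code determines the pair (\<open>lncode_pt\<close>,
  \<open>ln_pt1\<close>); the double counting in \<open>few_starred\<close> rests on this.\<close>

definition lncode :: "nat \<Rightarrow> nat \<Rightarrow> nat \<Rightarrow> nat \<Rightarrow> nat \<Rightarrow> nat" where
  "lncode q d z p t = lin q d z (q - t) (lin q d p (q - 1) z) + q ^ d * lin q d p (q - 1) z"

lemma lncode_less: "0 < q \<Longrightarrow> lncode q d z p t < q ^ (2 * d)"
proof -
  assume q: "0 < q"
  have a: "lin q d z (q - t) (lin q d p (q - 1) z) < q ^ d" "lin q d p (q - 1) z < q ^ d"
    using q by (auto simp: lin_less)
  have "lncode q d z p t < q ^ d + q ^ d * lin q d p (q - 1) z" using a by (simp add: lncode_def)
  also have "\<dots> = q ^ d * Suc (lin q d p (q - 1) z)" by simp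
  also have "\<dots> \<le> q ^ d * q ^ d" using a by (intro mult_left_mono) auto
  finally show ?thesis by (simp add: mult_2 power_add)
qed

lemma lncode_w: "0 < q \<Longrightarrow> lncode q d z p t mod q ^ d = lin q d z (q - t) (lin q d p (q - 1) z)"
  by (simp add: lncode_def lin_less)
lemma lncode_y: "0 < q \<Longrightarrow> lncode q d z p t div q ^ d = lin q d p (q - 1) z"
  by (simp add: lncode_def lin_less)

lemma lncode_pt:
  assumes q: "0 < q" and t: "t < q" and z: "z < q ^ d"
  shows "lin q d (lncode q d z p t mod q ^ d) t (lncode q d z p t div q ^ d) = z"
  unfolding lncode_w[OF q] lncode_y[OF q]
proof (rule lin_eqI[OF q z])
  fix k assume k: "k < d"
  let ?y = "dig q (lin q d p (q - 1) z) k"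
  have "((dig q z k + (q - t) * ?y) mod q + t * ?y) mod q = (dig q z k + ((q - t) * ?y + t * ?y)) mod q"
    by (subst mod_add_left_eq) (simp only: add.assoc)
  also have "(q - t) * ?y + t * ?y = q * ?y" using t by (simp add: add_mult_distrib[symmetric])
  finally show "(dig q (lin q d z (q - t) (lin q d p (q - 1) z)) k + t * ?y) mod q = dig q z k"
    using dig_lin[OF q k] dig_less[OF q] by simp
qed

lemma ln_pt1:
  assumes q: "0 < q" and t: "t < q" and z: "z < q ^ d" and p: "p < q ^ d"
  shows "lin q d (lncode q d z p t mod q ^ d) (Suc t) (lncode q d z p t div q ^ d) = p"
  unfolding lncode_w[OF q] lncode_y[OF q]
proof (rule lin_eqI[OF q p])
  fix k assume k: "k < d"
  let ?y = "dig q (lin q d p (q - 1) z) k"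
  have "((dig q z k + (q - t) * ?y) mod q + Suc t * ?y) mod q
      = (dig q z k + ?y + ((q - t) * ?y + t * ?y)) mod q"
    by (subst mod_add_left_eq) (simp only: add_ac mult_Suc)
  also have "(q - t) * ?y + t * ?y = q * ?y" using t by (simp add: add_mult_distrib[symmetric])
  also have "(dig q z k + ?y + q * ?y) mod q = (dig q z k + (dig q p k + (q - 1) * dig q z k)) mod q"
    using dig_lin[OF q k] by (simp add: mod_simps)
  also have "dig q z k + (dig q p k + (q - 1) * dig q z k) = dig q p k + q * dig q z k"
    using q by (cases q) auto
  finally show "(dig q (lin q d z (q - t) (lin q d p (q - 1) z)) k + Suc t * ?y) mod q = dig q p k"
    using dig_lin[OF q k] dig_less[OF q] by simp
qed

section \<open>The system of Horn rules\<close>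

text \<open>
  A string of level \<open>t\<close> consists of the \<open>Dd t\<close> coefficients of a polynomial. At level \<open>T\<close> the code
  \<open>w + q ^ d * y\<close> stands for the line \<open>w + s y\<close>; a string \<open>I\<close> of level \<open>t + 1\<close> is read as a bivariate
  polynomial, whose columns are the strings \<open>2 q I + v\<close> and whose rows are the strings
  \<open>2 q I + q + e\<close> of level \<open>t\<close>. The intended meanings are as follows.
  \<^item> \<open>AE I c0 c1\<close>: the bottom string \<open>I\<close> is \<open>c0 + c1 X\<close> (a guess);
  \<^item> \<open>AL t I s a k b\<close>: coefficient \<open>k\<close> of string \<open>I\<close>, given that its value at \<open>s\<close> is \<open>a\<close>, is \<open>b\<close>;
  \<^item> \<open>AC t I u v a k b\<close>: the same given the value \<open>a\<close> at the point \<open>(u, v)\<close> of the bivariate reading;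
  \<^item> \<open>AP t I u v a s l b\<close>: after \<open>l\<close> Horner steps at \<open>s\<close> the coefficients from \<open>AC\<close> give \<open>b\<close>;
  \<^item> \<open>AW t I u v s a k b\<close>: as \<open>AL\<close>, testified by the point \<open>(u, v)\<close>;
  \<^item> \<open>AV I s a l b\<close>: as \<open>AP\<close>, for the coefficients from \<open>AL T I s a\<close> and the point \<open>s + 1\<close>;
  \<^item> \<open>AR z a p b\<close>: the value at the point \<open>p\<close> is \<open>b\<close>, given the value \<open>a\<close> at \<open>z\<close>;
  \<^item> \<open>AQ z a p y l b\<close>: partial sum of the interpolation of the value at \<open>p\<close> from the points \<open>p + l y\<close>;
  \<^item> \<open>AX z a p b\<close>: the self-corrected value at \<open>p\<close> is \<open>b\<close>;
  \<^item> \<open>AG z a k\<close>: constraint \<open>k\<close> holds; \<open>AO z\<close>: all constraints hold; \<open>AF\<close>: the goal.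
\<close>

datatype atom =
    AE nat nat nat
  | AL nat nat nat nat nat nat
  | AW nat nat nat nat nat nat nat nat
  | AP nat nat nat nat nat nat nat nat
  | AC nat nat nat nat nat nat nat
  | AV nat nat nat nat nat
  | AR nat nat nat nat
  | AQ nat nat nat nat nat nat
  | AX nat nat nat nat
  | AG nat nat nat
  | AO nat
  | AF

datatype rule =
    RL0 nat nat nat nat nat
  | RL nat nat nat nat nat nat
  | RW nat nat nat nat nat nat nat nat nat
  | RP0 nat nat nat nat nat nat
  | RP nat nat nat nat nat nat nat nat nat
  | RC nat nat nat nat nat nat nat nat
  | RV0 nat nat nat
  | RV nat nat nat nat nat nat
  | RR nat nat nat nat
  | RQ0 nat nat nat nat
  | RQ nat nat nat nat nat nat nat
  | RX nat nat nat nat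
  | RG nat nat nat nat nat nat nat
  | RO nat nat
  | RF

locale gapsys =
  fixes q T d U nk :: nat
    and lam :: "nat \<Rightarrow> nat" and ix :: "nat \<Rightarrow> nat \<Rightarrow> nat"
    and al :: "nat \<Rightarrow> nat \<Rightarrow> nat \<Rightarrow> nat \<Rightarrow> nat \<Rightarrow> bool"
begin

text \<open>Existential choices are the parameters of a rule that do not occur in its head, such as
  \<open>a'\<close> in \<open>RW\<close> or \<open>a2\<close> in \<open>RC\<close>. Universal ones
  are the sets: all points \<open>(u, v)\<close> in \<open>RL\<close>, all copies of a row in
  \<open>RC\<close>, all placements of a pair on its line in \<open>RR\<close>, all directions in
  \<open>RX\<close>, all base points in \<open>RF\<close>. Honest guesses satisfy all of these at
  once, and the soundness proof picks convenient members. Row \<open>i\<close> exists in about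
  \<open>q / Dd t\<close> copies, one for each \<open>e\<close> with \<open>e mod Dd t = i\<close>,
  so that rows and columns have equal weight among the \<open>2 * q\<close> children of a
  string.\<close>

fun body :: "rule \<Rightarrow> atom set" where
  "body (RL0 I c0 c1 s k) = {AE I c0 c1}"
| "body (RL t I s a k b) = {AW t I u v s a k b | u v. u < q \<and> v < q}"
| "body (RW t I u v s a k b a') = {AP t I u v a' s (Dd (Suc t)) a, AC t I u v a' k b}"
| "body (RP0 t I u v a s) = {}"
| "body (RP t I u v a s l b b') = {AP t I u v a s l b, AC t I u v a (Dd (Suc t) - 1 - l) b'}"
| "body (RC t I u v a k b a2) = insert (AL t (2 * q * I + v) u a (k mod Dd t) a2)
     {AL t (2 * q * I + q + e) v a2 (k div Dd t) b | e. e < q \<and> e mod Dd t = k mod Dd t}"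
| "body (RV0 I s a) = {}"
| "body (RV I s a l b b') = {AV I s a l b, AL T I s a (Dd T - 1 - l) b'}"
| "body (RR z a p b) = {AV (lncode q d z p t) t a (Dd T) b | t. t < q}"
| "body (RQ0 z a p y) = {}"
| "body (RQ z a p y l b b') = {AQ z a p y l b, AR z a (lin q d p (Suc l) y) b'}"
| "body (RX z a p b) = {AQ z a p y (Dd T) b | y. y < q ^ d}"
| "body (RG z a k b0 b1 b2 b3) = {AX z a (ix k 0) b0, AX z a (ix k 1) b1, AX z a (ix k 2) b2, AX z a (ix k 3) b3}"
| "body (RO z a) = {AG z a k | k. k < nk}"
| "body RF = {AO z | z. z < q ^ d}"

fun head :: "rule \<Rightarrow> atom" where
  "head (RL0 I c0 c1 s k) = AL 0 I s ((c0 + c1 * s) mod q) k (if k = 0 then c0 else c1)"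
| "head (RL t I s a k b) = AL (Suc t) I s a k b"
| "head (RW t I u v s a k b a') = AW t I u v s a k b"
| "head (RP0 t I u v a s) = AP t I u v a s 0 0"
| "head (RP t I u v a s l b b') = AP t I u v a s (Suc l) ((b * s + b') mod q)"
| "head (RC t I u v a k b a2) = AC t I u v a k b"
| "head (RV0 I s a) = AV I s a 0 0"
| "head (RV I s a l b b') = AV I s a (Suc l) ((b * Suc s + b') mod q)"
| "head (RR z a p b) = AR z a p b"
| "head (RQ0 z a p y) = AQ z a p y 0 0"
| "head (RQ z a p y l b b') = AQ z a p y (Suc l) ((b + lam (Suc l) * b') mod q)"
| "head (RX z a p b) = AX z a p b"
| "head (RG z a k b0 b1 b2 b3) = AG z a k"
| "head (RO z a) = AO z"
| "head RF = AF"

fun valid :: "rule \<Rightarrow> bool" where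
  "valid (RL0 I c0 c1 s k) \<longleftrightarrow> I < U \<and> c0 < q \<and> c1 < q \<and> s < q \<and> k < 2"
| "valid (RL t I s a k b) \<longleftrightarrow> t < T \<and> I < U \<and> s < q \<and> a < q \<and> k < Dd (Suc t) \<and> b < q"
| "valid (RW t I u v s a k b a') \<longleftrightarrow> t < T \<and> I < U \<and> u < q \<and> v < q \<and> s < q \<and> a < q \<and> k < Dd (Suc t) \<and> b < q \<and> a' < q"
| "valid (RP0 t I u v a s) \<longleftrightarrow> t < T \<and> I < U \<and> u < q \<and> v < q \<and> a < q \<and> s < q"
| "valid (RP t I u v a s l b b') \<longleftrightarrow> t < T \<and> I < U \<and> u < q \<and> v < q \<and> a < q \<and> s < q \<and> l < Dd (Suc t) \<and> b < q \<and> b' < q"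
| "valid (RC t I u v a k b a2) \<longleftrightarrow> t < T \<and> I < U \<and> u < q \<and> v < q \<and> a < q \<and> k < Dd (Suc t) \<and> b < q \<and> a2 < q"
| "valid (RV0 I s a) \<longleftrightarrow> I < U \<and> s < q \<and> a < q"
| "valid (RV I s a l b b') \<longleftrightarrow> I < U \<and> s < q \<and> a < q \<and> l < Dd T \<and> b < q \<and> b' < q"
| "valid (RR z a p b) \<longleftrightarrow> z < q ^ d \<and> a < q \<and> p < q ^ d \<and> b < q"
| "valid (RQ0 z a p y) \<longleftrightarrow> z < q ^ d \<and> a < q \<and> p < q ^ d \<and> y < q ^ d"
| "valid (RQ z a p y l b b') \<longleftrightarrow> z < q ^ d \<and> a < q \<and> p < q ^ d \<and> y < q ^ d \<and> l < Dd T \<and> b < q \<and> b' < q"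
| "valid (RX z a p b) \<longleftrightarrow> z < q ^ d \<and> a < q \<and> p < q ^ d \<and> b < q"
| "valid (RG z a k b0 b1 b2 b3) \<longleftrightarrow> z < q ^ d \<and> a < q \<and> k < nk \<and> b0 < q \<and> b1 < q \<and> b2 < q \<and> b3 < q \<and> al k b0 b1 b2 b3"
| "valid (RO z a) \<longleftrightarrow> z < q ^ d \<and> a < q"
| "valid RF \<longleftrightarrow> True"

inductive der :: "(nat \<times> nat \<times> nat) set \<Rightarrow> atom \<Rightarrow> bool" for S where
  dE: "(I, c0, c1) \<in> S \<Longrightarrow> der S (AE I c0 c1)"
| dR: "valid \<rho> \<Longrightarrow> (\<And>x. x \<in> body \<rho> \<Longrightarrow> der S x) \<Longrightarrow> der S (head \<rho>)"

section \<open>Inversion of derivations\<close>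

lemma der_E: "der S (AE I c0 c1) \<Longrightarrow> (I, c0, c1) \<in> S"
  by (erule der.cases) (auto elim!: head.elims[OF sym])

lemma der_rule: "der S x \<Longrightarrow> (\<nexists>I c0 c1. x = AE I c0 c1) \<Longrightarrow> \<exists>\<rho>. valid \<rho> \<and> head \<rho> = x \<and> (\<forall>y\<in>body \<rho>. der S y)"
  by (erule der.cases) auto

lemma der_L0: assumes "der S (AL 0 I s a k b)"
  shows "\<exists>c0 c1. (I,c0,c1) \<in> S \<and> c0 < q \<and> c1 < q \<and> a = (c0 + c1 * s) mod q \<and> k < 2 \<and> b = (if k = 0 then c0 else c1)"
proof -
  from der_rule[OF assms] obtain \<rho> where r: "valid \<rho>" "head \<rho> = AL 0 I s a k b" "\<forall>y\<in>body \<rho>. der S y" by auto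
  then obtain c0 c1 where "\<rho> = RL0 I c0 c1 s k" by (auto elim!: head.elims)
  with r have "(I,c0,c1) \<in> S" by (auto dest: der_E)
  with r \<open>\<rho> = _\<close> show ?thesis by (intro exI[of _ c0] exI[of _ c1]) auto
qed

lemma der_L: assumes "der S (AL (Suc t) I s a k b)" "u < q" "v < q"
  shows "der S (AW t I u v s a k b)"
  using der_rule[OF assms(1)] assms(2,3) by (auto elim!: head.elims)

lemma der_W: assumes "der S (AW t I u v s a k b)"
  shows "\<exists>a'<q. der S (AP t I u v a' s (Dd (Suc t)) a) \<and> der S (AC t I u v a' k b)"
  using der_rule[OF assms] by (auto elim!: head.elims)

lemma der_P: assumes "der S (AP t I u v a s l b)"
  shows "(l = 0 \<and> b = 0) \<or> (\<exists>l' b0 b'. l = Suc l' \<and> l' < Dd (Suc t) \<and> b = (b0 * s + b') mod q \<and>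
     der S (AP t I u v a s l' b0) \<and> der S (AC t I u v a (Dd (Suc t) - 1 - l') b'))"
  using der_rule[OF assms] by (auto elim!: head.elims)

lemma der_C: assumes "der S (AC t I u v a k b)"
  shows "b < q \<and> a < q \<and> (\<exists>a2. der S (AL t (2 * q * I + v) u a (k mod Dd t) a2) \<and>
     (\<forall>e<q. e mod Dd t = k mod Dd t \<longrightarrow> der S (AL t (2 * q * I + q + e) v a2 (k div Dd t) b)))"
  using der_rule[OF assms] by (auto elim!: head.elims)

lemma der_V: assumes "der S (AV I s a l b)"
  shows "(l = 0 \<and> b = 0) \<or> (\<exists>l' b0 b'. l = Suc l' \<and> l' < Dd T \<and> b = (b0 * Suc s + b') mod q \<and>
     der S (AV I s a l' b0) \<and> der S (AL T I s a (Dd T - 1 - l') b'))"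
  using der_rule[OF assms] by (auto elim!: head.elims)

lemma der_R: assumes "der S (AR z a p b)" shows "\<forall>t<q. der S (AV (lncode q d z p t) t a (Dd T) b)"
  using der_rule[OF assms] by (auto elim!: head.elims)

lemma der_Q: assumes "der S (AQ z a p y l b)"
  shows "(l = 0 \<and> b = 0) \<or> (\<exists>l' b0 b'. l = Suc l' \<and> l' < Dd T \<and> b = (b0 + lam (Suc l') * b') mod q \<and>
     der S (AQ z a p y l' b0) \<and> der S (AR z a (lin q d p (Suc l') y) b'))"
  using der_rule[OF assms] by (auto elim!: head.elims)

lemma der_X: assumes "der S (AX z a p b)" shows "p < q ^ d \<and> b < q \<and> (\<forall>y<q^d. der S (AQ z a p y (Dd T) b))"
  using der_rule[OF assms] by (auto elim!: head.elims)

lemma der_G: assumes "der S (AG z a k)"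
  shows "\<exists>b0 b1 b2 b3. al k b0 b1 b2 b3 \<and> der S (AX z a (ix k 0) b0) \<and> der S (AX z a (ix k 1) b1) \<and>
    der S (AX z a (ix k 2) b2) \<and> der S (AX z a (ix k 3) b3)"
proof -
  from der_rule[OF assms] obtain \<rho> where r: "valid \<rho>" "head \<rho> = AG z a k" "\<forall>y\<in>body \<rho>. der S y" by auto
  then obtain b0 b1 b2 b3 where "\<rho> = RG z a k b0 b1 b2 b3" by (auto elim!: head.elims)
  with r show ?thesis by (intro exI[of _ b0] exI[of _ b1] exI[of _ b2] exI[of _ b3]) auto
qed

lemma der_O: assumes "der S (AO z)" shows "\<exists>a<q. \<forall>k<nk. der S (AG z a k)"
  using der_rule[OF assms] by (auto elim!: head.elims)

lemma der_F: assumes "der S AF" shows "\<forall>z<q^d. der S (AO z)"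
  using der_rule[OF assms] by (auto elim!: head.elims)

end

section \<open>Soundness of the rules\<close>

lemma card_residue_ge:
  assumes "0 < D" "i < D"
  shows "q div D \<le> card {e. e < q \<and> e mod D = (i::nat)}"
proof -
  have "i + D * j < q" if "j < q div D" for j
  proof -
    have "i + D * j < D * Suc j" using assms by simp
    also have "\<dots> \<le> D * (q div D)" using that by (intro mult_left_mono) auto
    also have "\<dots> \<le> q" by simp
    finally show ?thesis .
  qed
  then have "(\<lambda>j. i + D * j) ` {..<q div D} \<subseteq> {e. e < q \<and> e mod D = i}" using assms by auto
  moreover have "card ((\<lambda>j. i + D * j) ` {..<q div D}) = q div D"
    using assms by (subst card_image) (auto simp: inj_on_def)
  ultimately show ?thesis using card_mono[of "{e. e < q \<and> e mod D = i}" "(\<lambda>j. i + D * j) ` {..<q div D}"] by simp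
qed

text \<open>Markov's inequality with the division cleared.\<close>

lemma card_mult_le_sum:
  fixes f :: "'a \<Rightarrow> nat"
  assumes "finite A" shows "card {x\<in>A. M < f x} * M \<le> sum f A"
proof -
  have "card {x\<in>A. M < f x} * M = (\<Sum>x\<in>{x\<in>A. M < f x}. M)" by simp
  also have "\<dots> \<le> (\<Sum>x\<in>{x\<in>A. M < f x}. f x)" by (rule sum_mono) auto
  also have "\<dots> \<le> sum f A" using assms by (intro sum_mono2) auto
  finally show ?thesis .
qed

context gapsys
begin

text \<open>Every string has \<open>2 * q\<close> children, so \<open>J div (2 * q) ^ t\<close> is
  the ancestor at level \<open>t\<close> of the bottom string \<open>J\<close>. The cost of a string
  is the number of guesses below it.\<close>

definition cost :: "(nat \<times> nat \<times> nat) set \<Rightarrow> nat \<Rightarrow> nat \<Rightarrow> nat" where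
  "cost S t I = card {e \<in> S. fst e div (2 * q) ^ t = I}"

lemma cost_children:
  assumes "finite S" "0 < q" shows "(\<Sum>v<2*q. cost S t (2 * q * I + v)) \<le> cost S (Suc t) I"
proof -
  let ?A = "\<lambda>v. {e \<in> S. fst e div (2 * q) ^ t = 2 * q * I + v}"
  have "(\<Sum>v<2*q. cost S t (2 * q * I + v)) = card (\<Union>v\<in>{..<2*q}. ?A v)"
    unfolding cost_def using assms by (subst card_UN_disjoint) auto
  also have "\<dots> \<le> cost S (Suc t) I" unfolding cost_def
  proof (rule card_mono)
    show "(\<Union>v\<in>{..<2*q}. ?A v) \<subseteq> {e \<in> S. fst e div (2 * q) ^ Suc t = I}"
    proof
      fix e assume "e \<in> (\<Union>v\<in>{..<2*q}. ?A v)"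
      then obtain v where v: "v < 2*q" "e \<in> S" "fst e div (2 * q) ^ t = 2 * q * I + v" by auto
      have "fst e div (2 * q) ^ Suc t = (fst e div (2 * q) ^ t) div (2 * q)"
        by (simp only: power_Suc2 div_mult2_eq)
      also have "\<dots> = I" using v assms(2) by (simp add: div_mult_self4)
      finally show "e \<in> {e \<in> S. fst e div (2 * q) ^ Suc t = I}" using v by simp
    qed
  qed (use assms in auto)
  finally show ?thesis .
qed

lemma cost_total:
  assumes "finite S" shows "(\<Sum>I<N. cost S t I) \<le> card S"
proof -
  have "(\<Sum>I<N. cost S t I) = card (\<Union>I\<in>{..<N}. {e \<in> S. fst e div (2 * q) ^ t = I})"
    unfolding cost_def using assms by (subst card_UN_disjoint) auto
  also have "\<dots> \<le> card S" using assms by (intro card_mono) auto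
  finally show ?thesis .
qed

text \<open>At position \<open>s\<close> a codeword is addressed by its value \<open>a\<close>
  there. A position is bad if some address fails to determine a coefficient.\<close>

definition bad :: "(nat \<times> nat \<times> nat) set \<Rightarrow> nat \<Rightarrow> nat \<Rightarrow> nat set" where
  "bad S t I = {s. s < q \<and> (\<exists>a k b b'. k < Dd t \<and> der S (AL t I s a k b) \<and> der S (AL t I s a k b') \<and> b \<noteq> b')}"

definition names :: "(nat \<times> nat \<times> nat) set \<Rightarrow> nat \<Rightarrow> nat \<Rightarrow> nat \<Rightarrow> nat set" where
  "names S t I s = {a. \<exists>k b. k < Dd t \<and> der S (AL t I s a k b)}"

text \<open>What the induction retains of a list of \<open>G\<close> codewords: few addresses at
  each position, and few bad positions, the latter by counting collisions of pairs. The list itself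
  is built anew at each level.\<close>

definition listed :: "(nat \<times> nat \<times> nat) set \<Rightarrow> nat \<Rightarrow> nat \<Rightarrow> nat \<Rightarrow> bool" where
  "listed S G t I \<longleftrightarrow> (\<forall>s<q. finite (names S t I s) \<and> card (names S t I s) \<le> G) \<and> card (bad S t I) \<le> G * G * Dd t"

lemma finite_bad [simp]: "finite (bad S t I)" by (simp add: bad_def)

text \<open>If every derived coefficient belongs to a member of \<open>Y\<close>, the addresses at
  \<open>s\<close> are values of members, and at a bad position two different members share a
  value.\<close>

lemma listedI:
  assumes q: "prime q" and Y: "finite Y" "card Y \<le> G"
    and lt: "\<And>c j. c \<in> Y \<Longrightarrow> j < Dd t \<Longrightarrow> c j < q"
    and cov: "\<And>s a k b. s < q \<Longrightarrow> k < Dd t \<Longrightarrow> der S (AL t I s a k b) \<Longrightarrow> \<exists>c\<in>Y. a = hev q (Dd t) c s \<and> b = c k"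
  shows "listed S G t I"
  unfolding listed_def
proof (intro conjI allI impI)
  fix s assume s: "s < q"
  have sub: "names S t I s \<subseteq> (\<lambda>c. hev q (Dd t) c s) ` Y"
    unfolding names_def using cov[OF s] by blast
  then show "finite (names S t I s)" using Y finite_subset by blast
  show "card (names S t I s) \<le> G"
    using card_mono[OF _ sub] card_image_le[OF Y(1), of "\<lambda>c. hev q (Dd t) c s"] Y by fastforce
next
  let ?C = "{s. s < q \<and> (\<exists>c\<in>Y. \<exists>c'\<in>Y. (\<exists>j<Dd t. c j \<noteq> c' j) \<and> hev q (Dd t) c s = hev q (Dd t) c' s)}"
  have "bad S t I \<subseteq> ?C"
  proof
    fix s assume "s \<in> bad S t I"
    then obtain a k b b' where h: "s < q" "k < Dd t" "der S (AL t I s a k b)" "der S (AL t I s a k b')" "b \<noteq> b'"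
      unfolding bad_def by blast
    from cov[OF h(1,2,3)] cov[OF h(1,2,4)] h show "s \<in> ?C" by auto
  qed
  then have "card (bad S t I) \<le> card ?C" by (intro card_mono) auto
  also have "\<dots> \<le> G * G * Dd t" by (rule hev_collision_family[OF q Y]) (rule lt)
  finally show "card (bad S t I) \<le> G * G * Dd t" .
qed

lemma listed_0:
  assumes q: "prime q" and S: "finite S" and c: "cost S 0 I \<le> G"
  shows "listed S G 0 I"
proof -
  define E where "E = {e \<in> S. fst e = I \<and> fst (snd e) < q \<and> snd (snd e) < q}"
  define f where "f e = (\<lambda>k::nat. if k = 0 then fst (snd e) else snd (snd e))" for e :: "nat \<times> nat \<times> nat"
  show ?thesis
  proof (rule listedI[OF q, where Y = "f ` E"])
    show fin: "finite (f ` E)" using S by (simp add: E_def)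
    have "card (f ` E) \<le> card E" using S by (intro card_image_le) (simp add: E_def)
    also have "\<dots> \<le> cost S 0 I" unfolding cost_def E_def using S by (intro card_mono) auto
    finally show "card (f ` E) \<le> G" using c by simp
    show "\<And>c j. c \<in> f ` E \<Longrightarrow> j < Dd 0 \<Longrightarrow> c j < q" by (auto simp: f_def E_def)
    fix s a k b assume "k < Dd 0" "der S (AL 0 I s a k b)"
    from der_L0[OF this(2)] obtain c0 c1 where h: "(I,c0,c1) \<in> S" "c0 < q" "c1 < q" "a = (c0 + c1 * s) mod q" "k < 2"
      "b = (if k = 0 then c0 else c1)" by blast
    then have "(I,c0,c1) \<in> E" by (simp add: E_def)
    moreover have "a = hev q (Dd 0) (f (I,c0,c1)) s" "b = f (I,c0,c1) k"
      using h by (auto simp: hev_def f_def lessThan_Suc numeral_2_eq_2 add.commute)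
    ultimately show "\<exists>c\<in>f ` E. a = hev q (Dd 0) c s \<and> b = c k" by blast
  qed
qed

text \<open>A single point \<open>(u, v)\<close> serves the whole string. It lies in a cheap column
  \<open>v\<close> that avoids the bad positions of one cheap copy of every row, and
  \<open>u\<close> is not bad for that column. An address \<open>a\<close> at \<open>u\<close> then
  determines the coefficients of the column, that is, the values of all rows at \<open>v\<close>,
  and these values address the rows and hence all coefficients. The list of the string has thus at
  most as many members as the column has addresses at \<open>u\<close>, and \<open>G\<close> does
  not grow. As \<open>RL\<close> quantifies over all points, every derived coefficient passes
  through this one.\<close>

lemma listed_Suc:
  assumes q: "prime q" and S: "finite S"
    and c: "cost S (Suc t) I \<le> \<beta>' * (2 * q) ^ Suc t" and bt: "\<beta> = 4 * Dd t * \<beta>'" and b0: "0 < \<beta>'"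
    and big: "4 * (G * G * Dd (Suc t)) \<le> q" and G: "0 < G"
    and IH: "\<And>J. cost S t J \<le> \<beta> * (2 * q) ^ t \<Longrightarrow> listed S G t J"
  shows "listed S G (Suc t) I"
proof -
  let ?D = "Dd t" and ?ok = "\<lambda>J. cost S t J \<le> \<beta> * (2 * q) ^ t"
  have q0: "0 < q" using q prime_gt_0_nat by blast
  have D2: "2 \<le> ?D" by (rule Dd_ge2)
  have Dq: "4 * ?D \<le> q"
  proof -
    have "?D \<le> G * G * Dd (Suc t)" using G D2 by (simp add: Dd_Suc)
    then show ?thesis using big by linarith
  qed
  have tot: "(\<Sum>v<2*q. cost S t (2 * q * I + v)) \<le> \<beta>' * (2 * q) ^ Suc t"
    using cost_children[OF S q0] c le_trans by blast
  \<comment> \<open>The factor \<open>4 * ?D\<close> in \<open>bt\<close> arises here. If all copies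
    of row \<open>i\<close> were expensive, more than \<open>q / (2 * ?D)\<close> children would
    each cost above \<open>\<beta> * (2 * q) ^ t\<close>, together more than the string may cost.
    The rounding of \<open>q div ?D\<close> takes one factor 2, the number \<open>2 * q\<close> of
    children the other.\<close>
  have "\<exists>e. e < q \<and> e mod ?D = i \<and> ?ok (2 * q * I + q + e)" if i: "i < ?D" for i
  proof (rule ccontr)
    assume neg: "\<not> ?thesis"
    let ?E = "{e. e < q \<and> e mod ?D = i}"
    have cE: "q div ?D \<le> card ?E" using card_residue_ge[of ?D i q] i by simp
    have "q < 2 * ?D * (q div ?D)"
    proof -
      have "q mod ?D < ?D" "q = ?D * (q div ?D) + q mod ?D" by simp_all
      then have "q < ?D * (q div ?D) + ?D" by linarith
      moreover have "1 \<le> q div ?D" using Dq D2 by (simp add: div_greater_zero_iff Suc_le_eq)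
      then have "?D \<le> ?D * (q div ?D)" by simp
      ultimately show ?thesis by linarith
    qed
    then have "q < 2 * ?D * card ?E" using mult_le_mono2[OF cE, of "2 * ?D"] by linarith
    have "\<beta>' * (2 * q) ^ Suc t = (2 * q) * (\<beta>' * (2*q)^t)" by simp
    also have "\<dots> < 2 * (2 * ?D * card ?E) * (\<beta>' * (2*q)^t)"
      using \<open>q < 2 * ?D * card ?E\<close> b0 q0 by (intro mult_strict_right_mono) auto
    also have "\<dots> = card ?E * (\<beta> * (2 * q) ^ t)" by (simp add: bt)
    also have "\<dots> = (\<Sum>e\<in>?E. \<beta> * (2 * q) ^ t)" by simp
    also have "\<dots> \<le> (\<Sum>e\<in>?E. cost S t (2 * q * I + q + e))"
      using neg by (intro sum_mono) (auto simp: not_le intro: less_imp_le)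
    also have "\<dots> = (\<Sum>v\<in>(\<lambda>e. q + e) ` ?E. cost S t (2 * q * I + v))"
      by (subst sum.reindex) (auto simp: add.assoc)
    also have "\<dots> \<le> (\<Sum>v<2*q. cost S t (2 * q * I + v))" by (intro sum_mono2) auto
    finally show False using tot by simp
  qed
  then obtain ee where ee: "\<And>i. i < ?D \<Longrightarrow> ee i < q \<and> ee i mod ?D = i \<and> ?ok (2 * q * I + q + ee i)" by metis
  \<comment> \<open>Expensive columns: by Markov at most a quarter of all, because \<open>?D\<close>
    is at least 2.\<close>
  define V1 where "V1 = {v \<in> {..<q}. \<beta> * (2 * q) ^ t < cost S t (2 * q * I + v)}"
  have V1: "4 * card V1 \<le> q"
  proof -
    have "card V1 * (\<beta> * (2 * q) ^ t) \<le> (\<Sum>v<q. cost S t (2 * q * I + v))"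
      unfolding V1_def by (rule card_mult_le_sum) simp
    also have "\<dots> \<le> (\<Sum>v<2*q. cost S t (2 * q * I + v))" by (intro sum_mono2) auto
    also have "\<dots> \<le> \<beta>' * (2 * q) ^ Suc t" by (rule tot)
    finally have "(4 * ?D * card V1) * (\<beta>' * (2 * q) ^ t) \<le> (2 * q) * (\<beta>' * (2 * q) ^ t)"
      by (simp add: bt mult_ac)
    then have "4 * ?D * card V1 \<le> 2 * q" using b0 q0 by simp
    moreover have "8 * card V1 \<le> 4 * ?D * card V1" using D2 by (intro mult_right_mono) auto
    ultimately show ?thesis by linarith
  qed
  \<comment> \<open>Positions that are bad for one of the chosen row copies: \<open>?D\<close> rows
    with \<open>G * G * ?D\<close> positions each, again at most a quarter.\<close>
  define V2 where "V2 = (\<Union>i<?D. bad S t (2 * q * I + q + ee i))"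
  have V2: "4 * card V2 \<le> q"
  proof -
    have "card V2 \<le> (\<Sum>i<?D. card (bad S t (2 * q * I + q + ee i)))" unfolding V2_def by (rule card_UN_le) simp
    also have "\<dots> \<le> (\<Sum>i<?D. G * G * ?D)" using ee IH by (intro sum_mono) (auto simp: listed_def)
    also have "\<dots> = G * G * Dd (Suc t)" by (simp add: Dd_Suc)
    finally show ?thesis using big by simp
  qed
  have "card (V1 \<union> V2) < card {..<q}"
    using card_Un_le[of V1 V2] V1 V2 q0 by simp
  then have "\<not> {..<q} \<subseteq> V1 \<union> V2" 
    using card_mono[of "V1 \<union> V2" "{..<q}"] by (auto simp: V1_def V2_def)
  then obtain v where v: "v < q" "v \<notin> V1" "v \<notin> V2" by auto
  have lc: "listed S G t (2 * q * I + v)" using v IH by (auto simp: V1_def not_less)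
  have "card (bad S t (2 * q * I + v)) < card {..<q}"
  proof -
    have "card (bad S t (2 * q * I + v)) \<le> G * G * ?D" using lc by (simp add: listed_def)
    also have "\<dots> \<le> G * G * Dd (Suc t)" using D2 by (simp add: Dd_Suc)
    finally show ?thesis using big q0 by simp
  qed
  then have "\<not> {..<q} \<subseteq> bad S t (2 * q * I + v)" using card_mono[OF finite_bad[of S t "2 * q * I + v"], of "{..<q}"] by linarith
  then obtain u where u: "u < q" "u \<notin> bad S t (2 * q * I + v)" by auto
  let ?D' = "Dd (Suc t)"
  \<comment> \<open>Two lookups: \<open>a\<close> at \<open>u\<close> determines the coefficient
    \<open>a2\<close> of the column, which is the value at \<open>v\<close> of row
    \<open>k mod ?D\<close>; \<open>a2\<close> at \<open>v\<close> then determines coefficient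
    \<open>k div ?D\<close> of that row.\<close>
  have uniq: "b = b'" if "der S (AC t I u v a k b)" "der S (AC t I u v a k b')" "k < ?D'" for a k b b'
  proof -
    let ?i = "k mod ?D"
    have i: "?i < ?D" by simp
    have j: "k div ?D < ?D" using that(3) by (simp add: Dd_Suc less_mult_imp_div_less)
    from der_C[OF that(1)] obtain a2 where a2: "der S (AL t (2 * q * I + v) u a ?i a2)"
      "der S (AL t (2 * q * I + q + ee ?i) v a2 (k div ?D) b)" using ee[OF i] by blast
    from der_C[OF that(2)] obtain a2' where a2': "der S (AL t (2 * q * I + v) u a ?i a2')"
      "der S (AL t (2 * q * I + q + ee ?i) v a2' (k div ?D) b')" using ee[OF i] by blast
    have "a2 = a2'" using u a2(1) a2'(1) i unfolding bad_def by blast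
    moreover have "v \<notin> bad S t (2 * q * I + q + ee ?i)" using v(3) i unfolding V2_def by blast
    ultimately show "b = b'" using v(1) a2(2) a2'(2) j unfolding bad_def by blast
  qed
  define y where "y a k = (SOME b. der S (AC t I u v a k b))" for a k
  have yI: "b = y a k" if "der S (AC t I u v a k b)" "k < ?D'" for a k b
    using uniq[OF that(1) _ that(2)] someI[of "\<lambda>b. der S (AC t I u v a k b)", OF that(1)] unfolding y_def by blast
  \<comment> \<open>Only addresses for which all coefficients are derivable give codewords. Those
    that matter qualify: a complete Horner chain, as shown in \<open>P\<close>, visits every
    coefficient.\<close>
  define N where "N = {a \<in> names S t (2 * q * I + v) u. \<forall>k<?D'. \<exists>b. der S (AC t I u v a k b)}"
  have P: "l \<le> ?D' \<and> b = hor q ?D' (y a) s l \<and> (\<forall>j<?D'. ?D' - l \<le> j \<longrightarrow> (\<exists>b. der S (AC t I u v a j b)))"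
    if "der S (AP t I u v a s l b)" for a s l b
    using that
  proof (induction l arbitrary: b)
    case 0
    then show ?case using der_P[OF 0] by auto
  next
    case (Suc l)
    from der_P[OF Suc.prems] obtain b1 b2 where h: "l < ?D'" "b = (b1 * s + b2) mod q"
      "der S (AP t I u v a s l b1)" "der S (AC t I u v a (?D' - 1 - l) b2)" by auto
    have "b2 = y a (?D' - 1 - l)" using yI[OF h(4)] h(1) by simp
    moreover have "\<exists>b. der S (AC t I u v a j b)" if "j < ?D'" "?D' - Suc l \<le> j" for j
    proof (cases "j = ?D' - 1 - l")
      case True
      then show ?thesis using h(4) by blast
    next
      case False
      then have "?D' - l \<le> j" using that h(1) by linarith
      then show ?thesis using Suc.IH[OF h(3)] that by blast
    qed
    ultimately show ?case using Suc.IH[OF h(3)] h by simp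
  qed
  show ?thesis
  proof (rule listedI[OF q, where Y = "y ` N"])
    have fn: "finite (names S t (2 * q * I + v) u)" "card (names S t (2 * q * I + v) u) \<le> G"
      using lc u by (auto simp: listed_def)
    then have fN: "finite N" "card N \<le> G"
      using card_mono[of "names S t (2 * q * I + v) u" N] by (auto simp: N_def)
    then show "finite (y ` N)" "card (y ` N) \<le> G" using card_image_le[of N y] by auto
    fix c j assume "c \<in> y ` N" "j < ?D'"
    then obtain a where a: "a \<in> N" "c = y a" by blast
    then obtain b where b: "der S (AC t I u v a j b)" using \<open>j < ?D'\<close> by (auto simp: N_def)
    then have "c j = b" using yI[OF b \<open>j < ?D'\<close>] a by simp
    then show "c j < q" using der_C[OF b] by simp
  next
    fix s a k b assume h: "s < q" "k < ?D'" "der S (AL (Suc t) I s a k b)"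
    from der_W[OF der_L[OF h(3) u(1) v(1)]] obtain a' where a': "der S (AP t I u v a' s ?D' a)"
      "der S (AC t I u v a' k b)" by blast
    have "a' \<in> N" unfolding N_def names_def
    proof (intro CollectI conjI allI impI)
      show "\<exists>k b. k < Dd t \<and> der S (AL t (2 * q * I + v) u a' k b)"
      proof -
        from der_C[OF a'(2)] obtain a2 where "der S (AL t (2 * q * I + v) u a' (k mod Dd t) a2)" by blast
        then show ?thesis using mod_less_divisor[OF Dd_pos, of k t] by blast
      qed
      fix k assume "k < ?D'"
      then show "\<exists>b. der S (AC t I u v a' k b)" using P[OF a'(1)] by auto
    qed
    moreover have "a = hev q ?D' (y a') s" using P[OF a'(1)] by (simp add: hor_eq_hev)
    moreover have "b = y a' k" by (rule yI[OF a'(2) h(2)])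
    ultimately show "\<exists>c\<in>y ` N. a = hev q ?D' c s \<and> b = c k" by blast
  qed
qed

text \<open>The list size is fixed as \<open>\<beta> 0\<close>, the number of guesses tolerated for
  a bottom string, and is passed upwards unchanged. Only the tolerated average
  \<open>\<beta> t\<close> shrinks with the level.\<close>

lemma listed_all:
  assumes q: "prime q" and S: "finite S" and bt: "\<And>t. t < T \<Longrightarrow> \<beta> t = 4 * Dd t * \<beta> (Suc t)" and bT: "0 < \<beta> T"
    and big: "4 * (\<beta> 0 * \<beta> 0 * Dd T) \<le> q"
  shows "t \<le> T \<Longrightarrow> cost S t I \<le> \<beta> t * (2 * q) ^ t \<Longrightarrow> listed S (\<beta> 0) t I"
proof (induction t arbitrary: I)
  case 0
  then show ?case using listed_0[OF q S] by simp
next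
  case (Suc t)
  have pos: "0 < \<beta> (T - k)" if "k \<le> T" for k using that
  proof (induction k)
    case (Suc k)
    then have "\<beta> (T - Suc k) = 4 * Dd (T - Suc k) * \<beta> (T - k)" using bt[of "T - Suc k"] by (simp add: Suc_diff_Suc)
    then show ?case using Suc by simp
  qed (simp add: bT)
  have p: "0 < \<beta> s" if "s \<le> T" for s using pos[of "T - s"] that by simp
  have "4 * (\<beta> 0 * \<beta> 0 * Dd (Suc t)) \<le> q"
  proof -
    have "\<beta> 0 * \<beta> 0 * Dd (Suc t) \<le> \<beta> 0 * \<beta> 0 * Dd T" using Suc.prems by (intro mult_left_mono Dd_mono) auto
    then show ?thesis using big by linarith
  qed
  then show ?case
    using listed_Suc[OF q S Suc.prems(2) bt _ _ p[of 0]] Suc p[of "Suc t"] by simp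
qed

end

context gapsys
begin

section \<open>From lists on lines to unique values at points\<close>

definition starred :: "(nat \<times> nat \<times> nat) set \<Rightarrow> nat \<Rightarrow> nat set" where
  "starred S z = {p. p < q ^ d \<and> (\<exists>a b b'. der S (AR z a p b) \<and> der S (AR z a p b') \<and> b \<noteq> b')}"

lemma V_unique:
  assumes "s \<notin> bad S T I" "s < q" "der S (AV I s a l b)" "der S (AV I s a l b')"
  shows "b = b'"
  using assms(3,4)
proof (induction l arbitrary: b b')
  case 0
  then show ?case using der_V[OF 0(1)] der_V[OF 0(2)] by auto
next
  case (Suc l)
  from der_V[OF Suc.prems(1)] obtain b1 b2 where h: "l < Dd T" "b = (b1 * Suc s + b2) mod q"
    "der S (AV I s a l b1)" "der S (AL T I s a (Dd T - 1 - l) b2)" by auto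
  from der_V[OF Suc.prems(2)] obtain b1' b2' where h': "b' = (b1' * Suc s + b2') mod q"
    "der S (AV I s a l b1')" "der S (AL T I s a (Dd T - 1 - l) b2')" by auto
  have "Dd T - 1 - l < Dd T" using h by simp
  then have "b2 = b2'" using assms(1,2) h(4) h'(3) unfolding bad_def by blast
  then show ?case using Suc.IH[OF h(3) h'(2)] h(2) h'(1) by simp
qed

text \<open>\<open>RR\<close> wants agreement for every placement of the pair on its line, so
  ambiguity at \<open>p\<close> makes the position of \<open>z\<close> bad in each placement. One
  ambiguous pair costs \<open>q\<close> bad positions.\<close>

lemma starred_bad:
  assumes "p \<in> starred S z" "t < q"
  shows "t \<in> bad S T (lncode q d z p t)"
proof (rule ccontr)
  assume n: "t \<notin> bad S T (lncode q d z p t)"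
  from assms(1) obtain a b b' where h: "der S (AR z a p b)" "der S (AR z a p b')" "b \<noteq> b'"
    unfolding starred_def by blast
  then show False using V_unique[OF n assms(2)] der_R[OF h(1)] der_R[OF h(2)] assms(2) by blast
qed

text \<open>Double counting of triples \<open>(z, p, t)\<close> against bad positions of lines. Bad
  positions are a fraction of at most \<open>1 / (4 * Dd T)\<close>: half of it from lines that cost
  too much, half from the collisions on the other lines. Some \<open>z\<close> is at least as good
  as the average.\<close>

lemma few_starred:
  assumes q: "prime q" and S: "finite S" and bt: "\<And>t. t < T \<Longrightarrow> \<beta> t = 4 * Dd t * \<beta> (Suc t)"
    and bT: "\<beta> T = 8 * Dd T * B" and B: "0 < B"
    and big: "8 * (Dd T * Dd T * \<beta> 0 * \<beta> 0) \<le> q"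
    and cS: "card S \<le> B * (q ^ (2 * d) * (2 * q) ^ T)"
  shows "\<exists>z<q^d. 4 * Dd T * card (starred S z) \<le> q ^ d"
proof -
  let ?K = "Dd T" and ?N = "q ^ (2 * d)"
  have q0: "0 < q" using q prime_gt_0_nat by blast
  have big': "4 * (\<beta> 0 * \<beta> 0 * ?K) \<le> q"
  proof -
    have "4 * (\<beta> 0 * \<beta> 0 * ?K) * 1 \<le> 8 * (\<beta> 0 * \<beta> 0 * ?K) * ?K" using Suc_leI[OF Dd_pos[of T]]
      by (intro mult_mono) auto
    also have "\<dots> = 8 * (?K * ?K * \<beta> 0 * \<beta> 0)" by (simp add: mult_ac)
    finally show ?thesis using big by linarith
  qed
  \<comment> \<open>Too expensive lines. By the choice of \<open>\<beta> T\<close> they are at most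
    a fraction \<open>1 / (8 * Dd T)\<close>; on them all \<open>q\<close> positions are given
    up.\<close>
  define BI where "BI = {I \<in> {..<?N}. \<beta> T * (2 * q) ^ T < cost S T I}"
  have fBI: "finite BI" by (simp add: BI_def)
  have "card BI * (\<beta> T * (2 * q) ^ T) \<le> (\<Sum>I<?N. cost S T I)"
    unfolding BI_def by (rule card_mult_le_sum) simp
  also have "\<dots> \<le> card S" by (rule cost_total[OF S])
  also have "\<dots> \<le> B * (?N * (2 * q) ^ T)" by (rule cS)
  finally have "(card BI * (8 * ?K)) * (B * (2 * q) ^ T) \<le> ?N * (B * (2 * q) ^ T)"
    by (simp add: bT mult_ac)
  then have cBI: "card BI * (8 * ?K) \<le> ?N" using B q0 by simp
  define BP where "BP = (SIGMA I:{..<?N}. bad S T I)"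
  have fBP: "finite BP" by (simp add: BP_def)
  have sum_le: "card (bad S T I) \<le> (if I \<in> BI then q else 0) + \<beta> 0 * \<beta> 0 * ?K" if "I < ?N" for I
  proof (cases "I \<in> BI")
    case True
    have "card (bad S T I) \<le> card {..<q}" by (rule card_mono) (auto simp: bad_def)
    then show ?thesis using True by simp
  next
    case False
    then have "listed S (\<beta> 0) T I"
      using listed_all[OF q S bt _ big', of T I] that bT B by (auto simp: BI_def)
    then show ?thesis using False by (simp add: listed_def)
  qed
  have "card BP = (\<Sum>I<?N. card (bad S T I))" by (simp add: BP_def)
  also have "\<dots> \<le> (\<Sum>I<?N. (if I \<in> BI then q else 0) + \<beta> 0 * \<beta> 0 * ?K)" using sum_le by (intro sum_mono) auto
  also have "\<dots> = card BI * q + ?N * (\<beta> 0 * \<beta> 0 * ?K)"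
  proof -
    have "{..<?N} \<inter> {I. I \<in> BI} = BI" by (auto simp: BI_def)
    then show ?thesis by (simp add: sum.distrib sum.If_cases)
  qed
  finally have "8 * ?K * card BP \<le> 8 * ?K * (card BI * q + ?N * (\<beta> 0 * \<beta> 0 * ?K))" by (rule mult_left_mono) simp
  also have "\<dots> = (card BI * (8 * ?K)) * q + ?N * (8 * (?K * ?K * \<beta> 0 * \<beta> 0))" by (simp add: algebra_simps)
  also have "\<dots> \<le> ?N * q + ?N * q" using cBI big by (intro add_mono mult_mono) auto
  finally have cBP: "4 * ?K * card BP \<le> ?N * q" by simp
  \<comment> \<open>Pairs of a base point and an ambiguous point. With a placement \<open>t\<close>
    each pair maps injectively to a line and a bad position on it, because line and \<open>t\<close>
    give back both points.\<close>
  define ST where "ST = (SIGMA z:{..<q^d}. starred S z)"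
  have fst_: "finite (starred S z)" for z by (simp add: starred_def)
  have "card ST * q = card (ST \<times> {..<q})" by (simp add: card_cartesian_product)
  also have "\<dots> \<le> card BP"
  proof (rule card_inj_on_le[where f = "\<lambda>((z,p),t). (lncode q d z p t, t)"])
    show "inj_on (\<lambda>((z,p),t). (lncode q d z p t, t)) (ST \<times> {..<q})"
    proof (rule inj_onI, clarsimp simp: ST_def starred_def)
      fix z p z' p' t
      assume h: "t < q" "z < q ^ d" "p < q ^ d" "z' < q ^ d" "p' < q ^ d" "lncode q d z p t = lncode q d z' p' t"
      then show "z = z' \<and> p = p'" using lncode_pt[OF q0 h(1,2), of p] lncode_pt[OF q0 h(1,4), of p'] ln_pt1[OF q0 h(1,2,3)] ln_pt1[OF q0 h(1,4,5)] by simp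
    qed
    show "(\<lambda>((z,p),t). (lncode q d z p t, t)) ` (ST \<times> {..<q}) \<subseteq> BP"
      using starred_bad lncode_less[OF q0] by (auto simp: ST_def BP_def)
  qed (rule fBP)
  finally have "4 * ?K * (card ST * q) \<le> 4 * ?K * card BP" by (rule mult_left_mono) simp
  then have "(4 * ?K * card ST) * q \<le> ?N * q" using cBP by (simp only: mult.assoc)
  then have cST: "4 * ?K * card ST \<le> q ^ d * q ^ d" using q0 by (simp add: mult_2 power_add)
  show ?thesis
  proof (rule ccontr)
    assume "\<not> ?thesis"
    then have n: "\<forall>z<q^d. q ^ d < 4 * ?K * card (starred S z)" by (simp add: not_le)
    have "q ^ d * q ^ d = (\<Sum>z<q^d. q ^ d)" by simp
    also have "\<dots> < (\<Sum>z<q^d. 4 * ?K * card (starred S z))"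
    proof (rule sum_strict_mono)
      show "{..<q ^ d} \<noteq> {}" using q0 by (metis lessThan_iff empty_iff zero_less_power)
    qed (use n in auto)
    also have "\<dots> = 4 * ?K * card ST" using fst_ by (simp add: ST_def sum_distrib_left)
    finally show False using cST by simp
  qed
qed

text \<open>Self-correction: for each of the \<open>Dd T\<close> multiples \<open>Suc l\<close>, the
  map \<open>y \<mapsto> p + (l + 1) y\<close> is injective, so few directions hit an ambiguous
  point. Some direction avoids all of them, and since \<open>RX\<close> demands agreement in every
  direction, that one decides the value at \<open>p\<close>, even if \<open>p\<close> itself is
  ambiguous.\<close>

lemma X_unique:
  assumes q: "prime q" and K: "Dd T < q" and st: "4 * Dd T * card (starred S z) \<le> q ^ d"
    and X: "der S (AX z a p b)" "der S (AX z a p b')"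
  shows "b = b'"
proof -
  let ?K = "Dd T"
  have q0: "0 < q" using q prime_gt_0_nat by blast
  have f: "finite (starred S z)" by (simp add: starred_def)
  define Y where "Y l = {y. y < q ^ d \<and> lin q d p (Suc l) y \<in> starred S z}" for l
  have Y: "card (Y l) \<le> card (starred S z)" if "l < ?K" for l
  proof (rule card_inj_on_le[where f = "lin q d p (Suc l)"])
    show "inj_on (lin q d p (Suc l)) (Y l)"
      using lin_inj[OF q, of "Suc l"] that K by (auto simp: inj_on_def Y_def)
  qed (auto simp: Y_def f)
  have "card (\<Union>l<?K. Y l) \<le> (\<Sum>l<?K. card (Y l))" by (rule card_UN_le) simp
  also have "\<dots> \<le> (\<Sum>l<?K. card (starred S z))" using Y by (intro sum_mono) auto
  also have "\<dots> = ?K * card (starred S z)" by simp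
  also have "\<dots> < q ^ d"
  proof -
    have "0 < q ^ d" "4 * (?K * card (starred S z)) \<le> q ^ d" using q0 st by (simp_all add: mult.assoc)
    then show ?thesis by linarith
  qed
  finally have "\<not> {..<q^d} \<subseteq> (\<Union>l<?K. Y l)"
    using card_mono[of "\<Union>l<?K. Y l" "{..<q^d}"] by (auto simp: Y_def)
  then obtain y where y: "y < q ^ d" "\<And>l. l < ?K \<Longrightarrow> lin q d p (Suc l) y \<notin> starred S z"
    by (auto simp: Y_def)
  have "b = b'" if "der S (AQ z a p y l b)" "der S (AQ z a p y l b')" for l b b' using that
  proof (induction l arbitrary: b b')
    case 0
    then show ?case using der_Q[OF 0(1)] der_Q[OF 0(2)] by auto
  next
    case (Suc l)
    from der_Q[OF Suc.prems(1)] obtain b1 b2 where h: "l < Dd T" "b = (b1 + lam (Suc l) * b2) mod q"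
      "der S (AQ z a p y l b1)" "der S (AR z a (lin q d p (Suc l) y) b2)" by auto
    from der_Q[OF Suc.prems(2)] obtain b1' b2' where h': "b' = (b1' + lam (Suc l) * b2') mod q"
      "der S (AQ z a p y l b1')" "der S (AR z a (lin q d p (Suc l) y) b2')" by auto
    have "b2 = b2'" using y(2)[OF h(1)] h(4) h'(3) lin_less[OF q0] unfolding starred_def by blast
    then show ?case using Suc.IH[OF h(3) h'(2)] h(2) h'(1) by simp
  qed
  then show ?thesis using der_X[OF X(1)] der_X[OF X(2)] y(1) by blast
qed

text \<open>The base point and the value given to it by \<open>RO\<close> are the same in all
  constraints, so the unique derivable value at each point is one assignment for all of them. Points
  without a derivable value get an arbitrary one; a derived \<open>AG\<close> has derived values at
  its four points.\<close>

theorem soundness: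
  assumes q: "prime q" and S: "finite S" and bt: "\<And>t. t < T \<Longrightarrow> \<beta> t = 4 * Dd t * \<beta> (Suc t)"
    and bT: "\<beta> T = 8 * Dd T * B" and B: "0 < B"
    and big: "8 * (Dd T * Dd T * \<beta> 0 * \<beta> 0) \<le> q" and K: "Dd T < q"
    and cS: "card S \<le> B * (q ^ (2 * d) * (2 * q) ^ T)"
    and F: "der S AF"
  shows "\<exists>\<xi>. \<forall>k<nk. al k (\<xi> (ix k 0)) (\<xi> (ix k 1)) (\<xi> (ix k 2)) (\<xi> (ix k 3))"
proof -
  obtain z where z: "z < q ^ d" "4 * Dd T * card (starred S z) \<le> q ^ d"
    using few_starred[OF q S bt bT B big cS] by blast
  obtain a where a: "a < q" "\<forall>k<nk. der S (AG z a k)" using der_O[of S z] der_F[OF F] z by blast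
  define \<xi> where "\<xi> p = (SOME b. der S (AX z a p b))" for p
  have x: "b = \<xi> p" if "der S (AX z a p b)" for p b
    using X_unique[OF q K z(2) that] someI[of "\<lambda>b. der S (AX z a p b)", OF that] unfolding \<xi>_def by blast
  show ?thesis
  proof (intro exI[of _ \<xi>] allI impI)
    fix k assume "k < nk"
    then have "der S (AG z a k)" using a by blast
    from der_G[OF this] obtain b0 b1 b2 b3 where "al k b0 b1 b2 b3" "der S (AX z a (ix k 0) b0)"
      "der S (AX z a (ix k 1) b1)" "der S (AX z a (ix k 2) b2)" "der S (AX z a (ix k 3) b3)" by blast
    with x[of "ix k 0" b0] x[of "ix k 1" b1] x[of "ix k 2" b2] x[of "ix k 3" b3]
    show "al k (\<xi> (ix k 0)) (\<xi> (ix k 1)) (\<xi> (ix k 2)) (\<xi> (ix k 3))" by simp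
  qed
qed

text \<open>The honest labels at depth \<open>s\<close>, that is, at level \<open>T - s\<close>.
  Coefficient \<open>j + D * j'\<close> of the parent \<open>c\<close> belongs to the monomial X^j
  Y^j'. A child number \<open>v < q\<close> is the column Y = v, a polynomial in X; a number
  \<open>q + e\<close> is the row of X-degree \<open>e mod D\<close>, a polynomial in Y.\<close>

primrec labs :: "(nat \<Rightarrow> nat \<Rightarrow> nat) \<Rightarrow> nat \<Rightarrow> nat \<Rightarrow> nat \<Rightarrow> nat" where
  "labs rc 0 I = rc I"
| "labs rc (Suc s) I = (\<lambda>j. let D = Dd (T - Suc s); v = I mod (2 * q); c = labs rc s (I div (2 * q)) in
     if v < q then hev q D (\<lambda>j'. c (j + D * j')) v else c ((v - q) mod D + D * j))"

definition hS :: "(nat \<Rightarrow> nat \<Rightarrow> nat) \<Rightarrow> (nat \<times> nat \<times> nat) set" where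
  "hS rc = (\<lambda>I. (I, labs rc T I 0, labs rc T I 1)) ` {..<q ^ (2 * d) * (2 * q) ^ T}"

lemma finite_hS: "finite (hS rc)" by (simp add: hS_def)

lemma card_hS: "card (hS rc) = q ^ (2 * d) * (2 * q) ^ T"
  unfolding hS_def by (subst card_image) (auto simp: inj_on_def)

lemma der_headI: "valid \<rho> \<Longrightarrow> (\<And>x. x \<in> body \<rho> \<Longrightarrow> der S x) \<Longrightarrow> h = head \<rho> \<Longrightarrow> der S h"
  using dR by simp

lemma labs_less:
  assumes q0: "0 < q" and rc: "\<And>I j. rc I j < q" shows "labs rc s I j < q"
  by (induction s arbitrary: I j) (auto simp: rc Let_def hev_less[OF q0])

lemma hor_less: "0 < q \<Longrightarrow> hor q D c s l < q" by (cases l) auto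

lemma honest_L:
  assumes q0: "0 < q" and rc: "\<And>I j. rc I j < q" and U: "q ^ (2 * d) * (2 * q) ^ T \<le> U"
  shows "t \<le> T \<Longrightarrow> I < q ^ (2 * d) * (2 * q) ^ (T - t) \<Longrightarrow> s < q \<Longrightarrow> k < Dd t \<Longrightarrow>
    der (hS rc) (AL t I s (hev q (Dd t) (labs rc (T - t) I) s) k (labs rc (T - t) I k))"
proof (induction t arbitrary: I s k)
  case 0
  have c: "labs rc T I j < q" for j by (rule labs_less[OF q0 rc])
  have "(I, labs rc T I 0, labs rc T I 1) \<in> hS rc" using 0 by (auto simp: hS_def)
  then have e: "der (hS rc) (AE I (labs rc T I 0) (labs rc T I 1))" by (rule dE)
  have k: "labs rc T I k = (if k = 0 then labs rc T I 0 else labs rc T I 1)"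
    using 0(4) by (cases k) (auto simp: less_Suc_eq)
  have h: "hev q (Dd 0) (labs rc (T - 0) I) s = (labs rc T I 0 + labs rc T I 1 * s) mod q"
    by (simp add: hev_def lessThan_Suc numeral_2_eq_2 add.commute)
  have "I < U" using 0(2) U by simp
  then have v: "valid (RL0 I (labs rc T I 0) (labs rc T I 1) s k)" using 0(3,4) c by simp
  have "der (hS rc) (head (RL0 I (labs rc T I 0) (labs rc T I 1) s k))"
    by (rule dR[OF v]) (use e in simp)
  then show ?case unfolding h by (simp only: head.simps k[symmetric] diff_zero)
next
  case (Suc t)
  let ?S = "hS rc" and ?D = "Dd t" and ?D' = "Dd (Suc t)"
  define c where "c = labs rc (T - Suc t) I"
  have tT: "t < T" using Suc.prems by simp
  have st: "T - t = Suc (T - Suc t)" using tT by simp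
  have cq: "c j < q" for j unfolding c_def by (rule labs_less[OF q0 rc])
  have IU: "I < U"
  proof -
    have "(2 * q) ^ (T - Suc t) \<le> (2 * q) ^ T" using q0 by (intro power_increasing) auto
    then have "q ^ (2 * d) * (2 * q) ^ (T - Suc t) \<le> q ^ (2 * d) * (2 * q) ^ T" by simp
    then show ?thesis using Suc.prems U by linarith
  qed
  have chI: "2 * q * I + v < q ^ (2 * d) * (2 * q) ^ (T - t)" if "v < 2 * q" for v
  proof -
    have "2 * q * I + v < 2 * q * Suc I" using that by simp
    also have "\<dots> \<le> 2 * q * (q ^ (2 * d) * (2 * q) ^ (T - Suc t))" using Suc.prems by (intro mult_left_mono) auto
    also have "\<dots> = q ^ (2 * d) * (2 * q) ^ (T - t)" by (simp add: st)
    finally show ?thesis .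
  qed
  have col: "labs rc (T - t) (2 * q * I + v) = (\<lambda>i. hev q ?D (\<lambda>j. c (i + ?D * j)) v)" if "v < q" for v
    using that tT by (simp add: st c_def Let_def)
  have row: "labs rc (T - t) (2 * q * I + q + e) = (\<lambda>j. c (e mod ?D + ?D * j))" if "e < q" for e
  proof -
    have "(2 * q * I + q + e) mod (2 * q) = q + e" "(2 * q * I + q + e) div (2 * q) = I"
      using that by (simp_all add: add.assoc)
    then show ?thesis using tT by (simp add: st c_def Let_def)
  qed
  \<comment> \<open>The value at \<open>(u, v)\<close> of the bivariate reading; it is the honest
    address both in column \<open>v\<close> and in \<open>RC\<close>.\<close>
  define nm where "nm u v = hev q ?D (\<lambda>i. hev q ?D (\<lambda>j. c (i + ?D * j)) v) u" for u v
  have C: "der ?S (AC t I u v (nm u v) k (c k))" if "u < q" "v < q" "k < ?D'" for u v k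
  proof -
    have kd: "k div ?D < ?D" using that(3) by (simp add: Dd_Suc less_mult_imp_div_less)
    have b1: "der ?S (AL t (2 * q * I + v) u (nm u v) (k mod ?D) (hev q ?D (\<lambda>j. c (k mod ?D + ?D * j)) v))"
      using Suc.IH[of "2 * q * I + v" u "k mod ?D"] tT chI[of v] that col[OF that(2)] by (simp add: nm_def)
    have b2: "der ?S (AL t (2 * q * I + q + e) v (hev q ?D (\<lambda>j. c (k mod ?D + ?D * j)) v) (k div ?D) (c k))"
      if e: "e < q" "e mod ?D = k mod ?D" for e
    proof -
      have "2 * q * I + q + e < q ^ (2 * d) * (2 * q) ^ (T - t)" using chI[of "q + e"] e by (simp add: add.assoc)
      moreover have "c (k mod ?D + ?D * (k div ?D)) = c k" by simp
      ultimately show ?thesis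
        using Suc.IH[of "2 * q * I + q + e" v "k div ?D"] tT kd \<open>v < q\<close> row[OF e(1)] e(2) by simp
    qed
    show ?thesis
    proof -
      have "nm u v < q" unfolding nm_def by (rule hev_less[OF q0])
      then have "valid (RC t I u v (nm u v) k (c k) (hev q ?D (\<lambda>j. c (k mod ?D + ?D * j)) v))"
        using that tT IU cq hev_less[OF q0] by simp
      from dR[OF this, of ?S] b1 b2 show ?thesis by auto
    qed
  qed
  have nmq: "nm u v < q" for u v unfolding nm_def by (rule hev_less[OF q0])
  have hq: "hor q ?D' c s l < q" for l by (rule hor_less[OF q0])
  note sq = Suc.prems(3) and kD = Suc.prems(4)
  have P: "der ?S (AP t I u v (nm u v) s l (hor q ?D' c s l))" if uv: "u < q" "v < q" and "l \<le> ?D'" for u v l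
    using that(3)
  proof (induction l)
    case 0
    have "valid (RP0 t I u v (nm u v) s)" using uv tT IU sq nmq by simp
    from dR[OF this, of ?S] show ?case by simp
  next
    case (Suc l)
    have C': "der ?S (AC t I u v (nm u v) (?D' - 1 - l) (c (?D' - 1 - l)))" using C uv Suc.prems by simp
    have P': "der ?S (AP t I u v (nm u v) s l (hor q ?D' c s l))" using Suc by simp
    have "valid (RP t I u v (nm u v) s l (hor q ?D' c s l) (c (?D' - 1 - l)))"
      using uv tT IU sq nmq hq cq Suc.prems by simp
    from dR[OF this, of ?S] C' P' show ?case by auto
  qed
  have a: "hev q ?D' c s < q" by (rule hev_less[OF q0])
  have W: "der ?S (AW t I u v s (hev q ?D' c s) k (c k))" if uv: "u < q" "v < q" for u v
  proof -
    have "valid (RW t I u v s (hev q ?D' c s) k (c k) (nm u v))"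
      using uv tT IU sq nmq a cq kD by simp
    from dR[OF this, of ?S] C[OF uv kD] P[OF uv le_refl] show ?thesis by (auto simp: hor_eq_hev)
  qed
  have "valid (RL t I s (hev q ?D' c s) k (c k))" using tT IU sq a cq kD by simp
  from dR[OF this, of ?S] W show ?case unfolding c_def[symmetric] by auto
qed

text \<open>All choices are instantiated with the truth, in particular \<open>a\<close> with
  \<open>A z\<close>. Horner evaluation of a line at \<open>t + 1\<close> yields \<open>A p\<close>
  for every placement, and \<open>interp\<close> makes the interpolation sum end in
  \<open>A p\<close> for every direction.\<close>

theorem completeness:
  assumes q0: "0 < q" and rc: "\<And>I j. rc I j < q" and U: "q ^ (2 * d) * (2 * q) ^ T \<le> U"
    and A: "\<And>p. A p < q"
    and line: "\<And>I s. I < q ^ (2 * d) \<Longrightarrow> hev q (Dd T) (rc I) s = A (lin q d (I mod q ^ d) s (I div q ^ d))"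
    and interp: "\<And>p y. p < q ^ d \<Longrightarrow> y < q ^ d \<Longrightarrow> (\<Sum>l<Dd T. lam (Suc l) * A (lin q d p (Suc l) y)) mod q = A p"
    and ix: "\<And>k i. k < nk \<Longrightarrow> i < 4 \<Longrightarrow> ix k i < q ^ d"
    and sat: "\<And>k. k < nk \<Longrightarrow> al k (A (ix k 0)) (A (ix k 1)) (A (ix k 2)) (A (ix k 3))"
  shows "der (hS rc) AF"
proof -
  let ?S = "hS rc" and ?K = "Dd T"
  have U2: "q ^ (2 * d) \<le> U"
  proof -
    have "q ^ (2 * d) * 1 \<le> q ^ (2 * d) * (2 * q) ^ T" using q0 by (intro mult_left_mono) auto
    then show ?thesis using U by linarith
  qed
  have V: "der ?S (AV I s (A (lin q d (I mod q ^ d) s (I div q ^ d))) l (hor q ?K (rc I) (Suc s) l))"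
    if "I < q ^ (2 * d)" "s < q" "l \<le> ?K" for I s l
    using that(3)
  proof (induction l)
    case 0
    show ?case by (rule der_headI[where \<rho> = "RV0 I s (A (lin q d (I mod q ^ d) s (I div q ^ d)))"])
      (use that A U2 in auto)
  next
    case (Suc l)
    have "der ?S (AL T I s (A (lin q d (I mod q ^ d) s (I div q ^ d))) (?K - 1 - l) (rc I (?K - 1 - l)))"
      using honest_L[where rc = rc, OF q0 rc U, of T I s "?K - 1 - l"] that line[OF that(1), of s] by simp
    moreover have "der ?S (AV I s (A (lin q d (I mod q ^ d) s (I div q ^ d))) l (hor q ?K (rc I) (Suc s) l))"
      using Suc by simp
    moreover have "valid (RV I s (A (lin q d (I mod q ^ d) s (I div q ^ d))) l (hor q ?K (rc I) (Suc s) l) (rc I (?K - 1 - l)))"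
      using that(1,2) A U2 Suc.prems rc hor_less[OF q0] by simp
    ultimately show ?case using dR[of "RV I s (A (lin q d (I mod q ^ d) s (I div q ^ d))) l (hor q ?K (rc I) (Suc s) l) (rc I (?K - 1 - l))" ?S]
      by auto
  qed
  have R: "der ?S (AR z (A z) p (A p))" if "z < q ^ d" "p < q ^ d" for z p
  proof (rule der_headI[where \<rho> = "RR z (A z) p (A p)"])
    fix x assume "x \<in> body (RR z (A z) p (A p))"
    then obtain t where t: "t < q" "x = AV (lncode q d z p t) t (A z) ?K (A p)" by auto
    show "der ?S x"
      using V[OF lncode_less[OF q0, of d z p t] t(1) le_refl] line[OF lncode_less[OF q0, of d z p t], of "Suc t"]
      by (simp only: t hor_eq_hev lncode_pt[OF q0 t(1) that(1)] ln_pt1[OF q0 t(1) that])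
  qed (use that A in auto)
  define sm where "sm p y l = (\<Sum>l<l. lam (Suc l) * A (lin q d p (Suc l) y)) mod q" for p y l
  have smq: "sm p y l < q" for p y l using q0 by (simp add: sm_def)
  have sm_Suc: "sm p y (Suc l) = (sm p y l + lam (Suc l) * A (lin q d p (Suc l) y)) mod q" for p y l
    by (simp add: sm_def mod_add_left_eq)
  have Q: "der ?S (AQ z (A z) p y l (sm p y l))"
    if zpy: "z < q ^ d" "p < q ^ d" "y < q ^ d" and "l \<le> ?K" for z p y l
    using that(4)
  proof (induction l)
    case 0
    have "valid (RQ0 z (A z) p y)" using zpy A by simp
    from dR[OF this, of ?S] show ?case by (simp add: sm_def)
  next
    case (Suc l)
    have "der ?S (AR z (A z) (lin q d p (Suc l) y) (A (lin q d p (Suc l) y)))"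
      by (rule R[OF that(1) lin_less[OF q0]])
    moreover have "der ?S (AQ z (A z) p y l (sm p y l))" using Suc by simp
    moreover have "valid (RQ z (A z) p y l (sm p y l) (A (lin q d p (Suc l) y)))"
      using zpy A smq Suc.prems by simp
    ultimately show ?case using dR[of "RQ z (A z) p y l (sm p y l) (A (lin q d p (Suc l) y))" ?S]
      by (auto simp: sm_Suc)
  qed
  have X: "der ?S (AX z (A z) p (A p))" if "z < q ^ d" "p < q ^ d" for z p
  proof (rule der_headI[where \<rho> = "RX z (A z) p (A p)"])
    fix x assume "x \<in> body (RX z (A z) p (A p))"
    then obtain y where y: "y < q ^ d" "x = AQ z (A z) p y ?K (A p)" by auto
    then show "der ?S x" using Q[OF that y(1) le_refl] interp[OF that(2) y(1)] by (simp add: sm_def)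
  qed (use that A in auto)
  have G: "der ?S (AG z (A z) k)" if "z < q ^ d" "k < nk" for z k
  proof -
    have x: "der ?S (AX z (A z) (ix k i) (A (ix k i)))" if "i < 4" for i
      using X \<open>z < q ^ d\<close> ix[OF \<open>k < nk\<close> that] by simp
    have "valid (RG z (A z) k (A (ix k 0)) (A (ix k 1)) (A (ix k 2)) (A (ix k 3)))"
      using that A sat[OF that(2)] by simp
    from dR[OF this, of ?S] x[of 0] x[of 1] x[of 2] x[of 3] show ?thesis by auto
  qed
  have O: "der ?S (AO z)" if "z < q ^ d" for z
  proof -
    have "valid (RO z (A z))" using that A by simp
    from dR[OF this, of ?S] G[OF that] show ?thesis by auto
  qed
  show ?thesis using dR[of RF ?S] O by auto
qed

end

section \<open>Low-degree extensions\<close>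

text \<open>The \<open>K\<close>-th finite difference annihilates degree below \<open>K\<close>. For
  \<open>f = a + X p\<close> the constant part is an alternating sum of binomials; in the other part
  the factor \<open>l\<close> is absorbed by the binomial, which leaves the same statement for
  \<open>p\<close> shifted by 1. The alternative \<open>f = 0\<close> provides the case
  \<open>K = 0\<close>.\<close>

lemma alternating_binomial_poly:
  fixes f :: "int poly"
  assumes "degree f < K \<or> f = 0"
  shows "(\<Sum>l\<le>K. (-1) ^ l * of_nat (K choose l) * poly f (of_nat l)) = 0"
  using assms
proof (induction K arbitrary: f)
  case 0
  then show ?case by simp
next
  case (Suc K)
  obtain a p where f: "f = pCons a p" by (cases f)
  have dp: "degree p < K \<or> p = 0" using Suc.prems f by (cases "p = 0") auto
  let ?g = "pcompose p [:1,1:]"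
  have dg: "degree ?g < K \<or> ?g = 0"
  proof (cases "p = 0")
    case False
    then show ?thesis using dp degree_pcompose_le[of p "[:1,1:]"] by auto
  qed simp
  have s1: "(\<Sum>l\<le>Suc K. (-1) ^ l * of_nat (Suc K choose l)) = (0::int)"
    by (rule choose_alternating_sum) simp
  have "(\<Sum>l\<le>Suc K. (-1) ^ l * of_nat (Suc K choose l) * (of_nat l * poly p (of_nat l)))
      = (\<Sum>l\<le>K. (-1) ^ Suc l * of_nat (Suc K choose Suc l) * (of_nat (Suc l) * poly p (of_nat (Suc l))))"
    by (subst sum.atMost_Suc_shift) simp
  also have "\<dots> = (\<Sum>l\<le>K. - of_nat (Suc K) * ((-1) ^ l * of_nat (K choose l) * poly ?g (of_nat l)))"
  proof (rule sum.cong[OF refl])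
    fix l
    have pg: "poly ?g (of_nat l) = poly p (of_nat (Suc l))" by (simp add: poly_pcompose add.commute)
    have e: "of_nat (Suc K choose Suc l) * of_nat (Suc l) = of_nat (Suc K) * (of_nat (K choose l) :: int)"
      by (metis Suc_times_binomial_eq of_nat_mult)
    have g1: "(-1) ^ Suc l * x * (y * z) = - ((-1) ^ l) * ((x * y) * z)" for x y z :: int by simp
    have g2: "- ((-1) ^ l) * ((x * y) * z) = - x * ((-1) ^ l * y * z)" for x y z :: int by simp
    have "(-1) ^ Suc l * of_nat (Suc K choose Suc l) * (of_nat (Suc l) * poly p (of_nat (Suc l)))
       = - ((-1) ^ l) * ((of_nat (Suc K choose Suc l) * of_nat (Suc l)) * poly p (of_nat (Suc l)))"
      by (rule g1)
    also have "\<dots> = - of_nat (Suc K) * ((-1) ^ l * of_nat (K choose l) * poly p (of_nat (Suc l)))"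
      unfolding e by (rule g2)
    finally show "(-1) ^ Suc l * of_nat (Suc K choose Suc l) * (of_nat (Suc l) * poly p (of_nat (Suc l)))
       = - of_nat (Suc K) * ((-1) ^ l * of_nat (K choose l) * poly ?g (of_nat l))" unfolding pg .
  qed
  also have "\<dots> = 0" using Suc.IH[OF dg] by (simp add: sum_distrib_left[symmetric])
  finally have s2: "(\<Sum>l\<le>Suc K. (-1) ^ l * of_nat (Suc K choose l) * (of_nat l * poly p (of_nat l))) = 0" .
  have "(\<Sum>l\<le>Suc K. (-1) ^ l * of_nat (Suc K choose l) * poly f (of_nat l))
     = a * (\<Sum>l\<le>Suc K. (-1) ^ l * of_nat (Suc K choose l))
       + (\<Sum>l\<le>Suc K. (-1) ^ l * of_nat (Suc K choose l) * (of_nat l * poly p (of_nat l)))"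
    unfolding f poly_pCons sum_distrib_left sum.distrib[symmetric]
    by (rule sum.cong[OF refl]) (simp only: distrib_left mult_ac)
  then show ?case using s1 s2 by simp
qed

text \<open>Representatives modulo \<open>q\<close> of \<open>- (-1) ^ l * (K choose l)\<close>. The
  recursion divides by \<open>l + 1\<close> through a search below \<open>q\<close>, so no binomial
  is ever formed; this keeps the numbers small when the formula is computed.\<close>

primrec lamq :: "nat \<Rightarrow> nat \<Rightarrow> nat \<Rightarrow> nat" where
  "lamq q K 0 = q - 1"
| "lamq q K (Suc l) = (LEAST c. q dvd c * Suc l + lamq q K l * (K - l))"

declare lamq.simps(2) [simp del]

lemma coprime_prime_less: "prime (q::nat) \<Longrightarrow> 0 < l \<Longrightarrow> l < q \<Longrightarrow> coprime l q" for l :: nat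
  by (metis coprime_commute nat_dvd_not_less prime_imp_coprime)

lemma lamq_ex:
  fixes q l m :: nat
  assumes "prime q" "0 < l" "l < q"
  shows "\<exists>c<q. q dvd c * l + m"
proof -
  obtain i where i: "[l * i = 1] (mod q)"
    using cong_solve_coprime_nat[OF coprime_prime_less[OF assms]] by auto
  define c where "c = (i * ((q - 1) * m)) mod q"
  have q0: "0 < q" using assms by simp
  have "[c * l + m = (l * i) * ((q - 1) * m) + m] (mod q)"
  proof -
    have "[c = i * ((q - 1) * m)] (mod q)" by (simp add: c_def cong_def)
    then have "[c * l + m = i * ((q - 1) * m) * l + m] (mod q)" by (intro cong_add cong_mult) auto
    then show ?thesis by (simp add: mult_ac)
  qed
  also have "[(l * i) * ((q - 1) * m) + m = 1 * ((q - 1) * m) + m] (mod q)"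
    using i by (intro cong_add cong_mult) auto
  also have "1 * ((q - 1) * m) + m = q * m" using q0 by (cases q) auto
  finally have "q dvd c * l + m" by (simp add: cong_def mod_0_imp_dvd)
  then show ?thesis using q0 by (auto simp: c_def intro!: exI[of _ c])
qed

lemma lamq_Suc: assumes "prime q" "Suc l < q"
  shows "q dvd lamq q K (Suc l) * Suc l + lamq q K l * (K - l)" "lamq q K (Suc l) < q"
proof -
  obtain c where c: "c < q" "q dvd c * Suc l + lamq q K l * (K - l)" using lamq_ex[of q "Suc l"] assms by auto
  show "q dvd lamq q K (Suc l) * Suc l + lamq q K l * (K - l)"
    unfolding lamq.simps(2) by (rule LeastI[of "\<lambda>c. q dvd c * Suc l + lamq q K l * (K - l)"]) (rule c(2))
  show "lamq q K (Suc l) < q" unfolding lamq.simps(2)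
    using c by (meson Least_le le_less_trans)
qed

text \<open>The absorption identity \<open>(K - l) * (K choose l) = Suc l * (K choose Suc l)\<close>
  is the recursion of \<open>lamq\<close>, and \<open>Suc l\<close> can be cancelled because it is
  below the prime.\<close>

lemma lamq_cong:
  assumes q: "prime q" and K: "K < q" shows "l \<le> K \<Longrightarrow> [int (lamq q K l) = - ((-1) ^ l * int (K choose l))] (mod int q)"
proof (induction l)
  case 0
  have "int (q - 1) = int q - 1" using K by simp
  then show ?case by (simp add: cong_iff_dvd_diff)
next
  case (Suc l)
  have "int q dvd int (lamq q K (Suc l) * Suc l + lamq q K l * (K - l))"
    using lamq_Suc(1)[OF q, of l K] Suc.prems K by (simp only: of_nat_dvd_iff)
  then have "[int (lamq q K (Suc l)) * int (Suc l) = - (int (lamq q K l) * int (K - l))] (mod int q)"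
    by (simp only: cong_iff_dvd_diff diff_minus_eq_add of_nat_add of_nat_mult)
  also have "[- (int (lamq q K l) * int (K - l)) = - (- ((-1) ^ l * int (K choose l)) * int (K - l))] (mod int q)"
    using Suc by (intro cong_minus_minus_iff[THEN iffD2] cong_mult) auto
  also have "- (- ((-1) ^ l * int (K choose l)) * int (K - l)) = (-1) ^ l * int ((K - l) * (K choose l))"
    by (simp add: mult_ac)
  also have "(K - l) * (K choose l) = Suc l * (K choose Suc l)"
    using binomial_absorb_comp[of K l] binomial_absorption[of l K] by simp
  finally have "[int (Suc l) * int (lamq q K (Suc l)) = int (Suc l) * - ((-1) ^ Suc l * int (K choose Suc l))] (mod int q)"
    by (simp add: algebra_simps)
  moreover have "coprime (int (Suc l)) (int q)"
    using coprime_prime_less[OF q, of "Suc l"] Suc.prems K by (simp only: coprime_int_iff)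
  ultimately show ?case by (simp only: cong_mult_lcancel)
qed

text \<open>The vanishing finite difference solved for its term at 0; the sign is part of
  \<open>lamq\<close>.\<close>

lemma interpolate_at_0:
  assumes q: "prime q" and K: "K < q" and f: "degree f < K"
  shows "[(\<Sum>l<K. int (lamq q K (Suc l)) * poly f (int (Suc l))) = poly f 0] (mod int q)"
proof -
  have "[(\<Sum>l<K. int (lamq q K (Suc l)) * poly f (int (Suc l)))
       = (\<Sum>l<K. - ((-1) ^ Suc l * int (K choose Suc l)) * poly f (int (Suc l)))] (mod int q)"
    by (intro cong_sum cong_mult cong_refl lamq_cong[OF q K]) simp
  also have "(\<Sum>l<K. - ((-1) ^ Suc l * int (K choose Suc l)) * poly f (int (Suc l))) = poly f 0"
  proof -
    have "(\<Sum>l\<le>K. (-1) ^ l * int (K choose l) * poly f (int l))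
        = poly f 0 + (\<Sum>l<K. (-1) ^ Suc l * int (K choose Suc l) * poly f (int (Suc l)))"
      by (simp only: lessThan_Suc_atMost[symmetric] sum.lessThan_Suc_shift) simp
    then show ?thesis using alternating_binomial_poly[of f K] f by (simp add: sum_negf)
  qed
  finally show ?thesis .
qed

text \<open>Lagrange basis polynomial for the nodes \<open>0, ..., D - 1\<close>, kept over the
  integers, with an inverse modulo \<open>q\<close> of the denominator as leading factor.\<close>

definition lag :: "nat \<Rightarrow> nat \<Rightarrow> nat \<Rightarrow> int poly" where
  "lag q D i = (let P = (\<Prod>j\<in>{..<D} - {i}. [:- int j, 1:]) in
     smult (SOME c. [poly P (int i) * c = 1] (mod int q)) P)"

lemma lag_degree: "i < D \<Longrightarrow> degree (lag q D i) \<le> D - 1"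
proof -
  assume i: "i < D"
  have "degree (\<Prod>j\<in>{..<D} - {i}. [:- int j, 1:]) \<le> (\<Sum>j\<in>{..<D} - {i}. degree [:- int j, 1:])"
    by (rule degree_prod_sum_le[unfolded o_def]) simp
  also have "\<dots> = D - 1" using i by simp
  finally show ?thesis unfolding lag_def Let_def using degree_smult_le le_trans by blast
qed

lemma lag_value:
  assumes q: "prime q" and D: "D \<le> q" and i: "i < D" and j: "j < D"
  shows "[poly (lag q D i) (int j) = (if i = j then 1 else 0)] (mod int q)"
proof -
  define P :: "int poly" where "P = (\<Prod>j\<in>{..<D} - {i}. [:- int j, 1:])"
  have ev: "poly P (int x) = (\<Prod>j\<in>{..<D} - {i}. int x - int j)" for x
    by (simp add: P_def poly_prod)
  show ?thesis
  proof (cases "i = j")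
    case False
    then have "poly P (int j) = 0" using j by (auto simp: ev)
    then show ?thesis using False by (simp add: lag_def P_def[symmetric])
  next
    case True
    have "coprime (poly P (int i)) (int q)"
      unfolding ev
    proof (rule prod_coprime_left)
      fix j assume "j \<in> {..<D} - {i}"
      then have "\<not> int q dvd int i - int j"
        using D i by (auto simp: mod_eq_dvd_iff[symmetric] zmod_int[symmetric])
      then show "coprime (int i - int j) (int q)"
        using q by (metis coprime_commute prime_imp_coprime prime_int_iff prime_nat_int_transfer)
    qed
    then obtain c where "[poly P (int i) * c = 1] (mod int q)" using cong_solve_coprime_int by blast
    then have "[poly P (int i) * (SOME c. [poly P (int i) * c = 1] (mod int q)) = 1] (mod int q)" by (rule someI)
    moreover have "poly (lag q D i) (int i) = poly P (int i) * (SOME c. [poly P (int i) * c = 1] (mod int q))"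
      by (simp only: lag_def Let_def P_def poly_smult mult.commute)
    ultimately show ?thesis unfolding True[symmetric] by (simp only: if_True refl)
  qed
qed

lemma poly_cong: "[a = b] (mod m) \<Longrightarrow> [poly p a = poly p b] (mod (m::int))"
  by (induction p) (auto intro!: cong_add cong_mult)

text \<open>The grid point whose coordinates are the base-\<open>D\<close> digits of
  \<open>k\<close>: these digits are read again in base \<open>q\<close>.\<close>

definition bp :: "nat \<Rightarrow> nat \<Rightarrow> nat \<Rightarrow> nat \<Rightarrow> nat" where
  "bp q D d k = (\<Sum>i<d. dig D k i * q ^ i)"

text \<open>Interpolation on the grid of side \<open>D\<close> has degree at most
  \<open>D - 1\<close> in each coordinate, so on a line total degree at most
  \<open>d * (D - 1) < K\<close>. The five conclusions are the premises of
  \<open>completeness\<close> together with the agreement on the grid.\<close>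

lemma low_degree_extension:
  assumes q: "prime q" and D: "0 < D" "D \<le> q" and dK: "d * (D - 1) < K" and Kq: "K < q"
    and xi: "\<And>k. \<xi> k < q"
  shows "\<exists>A rc. (\<forall>p. A p < q) \<and> (\<forall>I j. rc I j < q) \<and>
    (\<forall>I s. hev q K (rc I) s = A (lin q d (I mod q ^ d) s (I div q ^ d))) \<and>
    (\<forall>p y. p < q ^ d \<longrightarrow> y < q ^ d \<longrightarrow> (\<Sum>l<K. lamq q K (Suc l) * A (lin q d p (Suc l) y)) mod q = A p) \<and>
    (\<forall>k<D^d. A (bp q D d k) = \<xi> k)"
proof -
  have q0: "0 < q" using q prime_gt_0_nat by blast
  \<comment> \<open>The line is substituted into every Lagrange factor over the integers; reduction
    modulo \<open>q\<close> takes place only in \<open>A\<close> and \<open>rc\<close>. The degree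
    bound is thus one on honest integer polynomials.\<close>
  define L :: "nat \<Rightarrow> nat \<Rightarrow> int poly" where
    "L w y = (\<Sum>e<D^d. smult (int (\<xi> e)) (\<Prod>k<d. pcompose (lag q D (dig D e k)) [:int (dig q w k), int (dig q y k):]))" for w y
  define A where "A p = nat ((\<Sum>e<D^d. int (\<xi> e) * (\<Prod>k<d. poly (lag q D (dig D e k)) (int (dig q p k)))) mod int q)" for p
  define rc where "rc I j = nat (coeff (L (I mod q^d) (I div q^d)) j mod int q)" for I j
  have Aq: "A p < q" for p using q0 by (simp add: A_def nat_less_iff)
  have rcq: "rc I j < q" for I j using q0 by (simp add: rc_def nat_less_iff)
  have Ai: "[int (A p) = (\<Sum>e<D^d. int (\<xi> e) * (\<Prod>k<d. poly (lag q D (dig D e k)) (int (dig q p k))))] (mod int q)" for p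
    using q0 by (simp add: A_def cong_def)
  have degL: "degree (L w y) < K" for w y
  proof -
    have "degree (L w y) \<le> d * (D - 1)" unfolding L_def
    proof (rule degree_sum_le)
      fix e assume "e \<in> {..<D^d}"
      have "degree (\<Prod>k<d. pcompose (lag q D (dig D e k)) [:int (dig q w k), int (dig q y k):])
          \<le> (\<Sum>k<d. degree (pcompose (lag q D (dig D e k)) [:int (dig q w k), int (dig q y k):]))"
        by (rule degree_prod_sum_le[unfolded o_def]) simp
      also have "\<dots> \<le> (\<Sum>k<d. D - 1)"
      proof (rule sum_mono)
        fix k
        have "degree (pcompose (lag q D (dig D e k)) [:int (dig q w k), int (dig q y k):])
           \<le> degree (lag q D (dig D e k)) * degree [:int (dig q w k), int (dig q y k):]" by (rule degree_pcompose_le)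
        also have "\<dots> \<le> (D - 1) * 1" using lag_degree[OF dig_less[OF D(1)], of q e k] by (intro mult_mono) auto
        finally show "degree (pcompose (lag q D (dig D e k)) [:int (dig q w k), int (dig q y k):]) \<le> D - 1" by simp
      qed
      finally show "degree (smult (int (\<xi> e)) (\<Prod>k<d. pcompose (lag q D (dig D e k)) [:int (dig q w k), int (dig q y k):])) \<le> d * (D - 1)"
        using degree_smult_le le_trans by fastforce
    qed simp
    then show ?thesis using dK by simp
  qed
  have Lev: "[poly (L w y) (int s) = int (A (lin q d w s y))] (mod int q)" for w y s
  proof -
    have e1: "poly (L w y) (int s) = (\<Sum>e<D^d. int (\<xi> e) * (\<Prod>k<d. poly (lag q D (dig D e k)) (int (dig q w k + s * dig q y k))))"
      by (simp add: L_def poly_sum poly_prod poly_pcompose)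
    have e2: "[(\<Sum>e<D^d. int (\<xi> e) * (\<Prod>k<d. poly (lag q D (dig D e k)) (int (dig q w k + s * dig q y k))))
      = (\<Sum>e<D^d. int (\<xi> e) * (\<Prod>k<d. poly (lag q D (dig D e k)) (int (dig q (lin q d w s y) k))))] (mod int q)"
    proof (rule cong_sum, rule cong_mult[OF cong_refl], rule cong_prod, rule poly_cong)
      fix k assume "k \<in> {..<d}"
      then have "dig q (lin q d w s y) k = (dig q w k + s * dig q y k) mod q" using dig_lin[OF q0, of k d w s y] by simp
      then have "[dig q w k + s * dig q y k = dig q (lin q d w s y) k] (mod q)" by (simp add: cong_def)
      then show "[int (dig q w k + s * dig q y k) = int (dig q (lin q d w s y) k)] (mod int q)"
        by (simp only: cong_int_iff)
    qed
    show ?thesis unfolding e1 by (rule cong_trans[OF e2 cong_sym[OF Ai]])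
  qed
  have line: "hev q K (rc I) s = A (lin q d (I mod q ^ d) s (I div q ^ d))" for I s
  proof -
    let ?L = "L (I mod q^d) (I div q^d)"
    have "poly ?L (int s) = (\<Sum>j<K. coeff ?L j * int s ^ j)"
    proof -
      have "poly ?L (int s) = (\<Sum>j\<le>degree ?L. coeff ?L j * int s ^ j)" by (rule poly_altdef)
      also have "\<dots> = (\<Sum>j<K. coeff ?L j * int s ^ j)"
        using degL by (intro sum.mono_neutral_left) (auto simp: coeff_eq_0 le_less_trans)
      finally show ?thesis .
    qed
    moreover have "[int (\<Sum>j<K. rc I j * s ^ j) = (\<Sum>j<K. coeff ?L j * int s ^ j)] (mod int q)"
      unfolding of_nat_sum of_nat_mult of_nat_power
      using q0 by (intro cong_sum cong_mult[OF _ cong_refl]) (simp add: rc_def cong_def)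
    ultimately have "[int (\<Sum>j<K. rc I j * s ^ j) = int (A (lin q d (I mod q ^ d) s (I div q ^ d)))] (mod int q)"
      using cong_trans[OF _ Lev[of "I mod q^d" "I div q^d" s]] by simp
    then have "[(\<Sum>j<K. rc I j * s ^ j) = A (lin q d (I mod q ^ d) s (I div q ^ d))] (mod q)"
      by (simp only: cong_int_iff)
    then show ?thesis using Aq by (simp add: hev_def cong_def)
  qed
  have interp: "(\<Sum>l<K. lamq q K (Suc l) * A (lin q d p (Suc l) y)) mod q = A p" if "p < q ^ d" for p y
  proof -
    have lp: "lin q d p 0 y = p" by (rule lin_eqI[OF q0 that]) (simp add: dig_less[OF q0])
    have "[int (\<Sum>l<K. lamq q K (Suc l) * A (lin q d p (Suc l) y))
       = (\<Sum>l<K. int (lamq q K (Suc l)) * poly (L p y) (int (Suc l)))] (mod int q)"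
      unfolding of_nat_sum of_nat_mult by (rule cong_sum, rule cong_mult[OF cong_refl], rule cong_sym[OF Lev])
    also have "[(\<Sum>l<K. int (lamq q K (Suc l)) * poly (L p y) (int (Suc l))) = poly (L p y) 0] (mod int q)" by (rule interpolate_at_0[OF q Kq degL])
    also have "[poly (L p y) 0 = int (A p)] (mod int q)" using Lev[of p y 0] lp by simp
    finally have "[(\<Sum>l<K. lamq q K (Suc l) * A (lin q d p (Suc l) y)) = A p] (mod q)" by (simp only: cong_int_iff)
    then show ?thesis using Aq by (simp add: cong_def)
  qed
  \<comment> \<open>At a grid point the product of Lagrange factors is the Kronecker delta, because
    distinct indices below \<open>D ^ d\<close> differ in a digit.\<close>
  have base: "A (bp q D d k) = \<xi> k" if k: "k < D ^ d" for k
  proof -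
    have dg: "dig q (bp q D d k) i = dig D k i" if "i < d" for i
      unfolding bp_def using that dig_less[OF D(1)] D(2) by (intro dig_sum[OF q0]) (auto intro: less_le_trans)
    have pr: "[(\<Prod>i<d. poly (lag q D (dig D e i)) (int (dig q (bp q D d k) i))) = (if e = k then 1 else 0)] (mod int q)"
      if e: "e < D ^ d" for e
    proof -
      have c1: "[(\<Prod>i<d. poly (lag q D (dig D e i)) (int (dig q (bp q D d k) i))) = (\<Prod>i<d. if dig D e i = dig D k i then 1 else 0)] (mod int q)"
        using dg by (intro cong_prod) (simp add: lag_value[OF q D(2) dig_less[OF D(1)] dig_less[OF D(1)]])
      have c2: "(\<Prod>i<d. if dig D e i = dig D k i then 1 else 0) = (if e = k then 1 else 0 :: int)"
      proof (cases "e = k")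
        case False
        then obtain i where "i < d" "dig D e i \<noteq> dig D k i" using dig_eq_imp_eq[OF D(1) e k] by blast
        then show ?thesis using False by (auto intro!: prod_zero)
      qed simp
      show ?thesis using c1 unfolding c2 .
    qed
    have c3: "[int (A (bp q D d k)) = (\<Sum>e<D^d. int (\<xi> e) * (if e = k then 1 else 0))] (mod int q)"
      using Ai[of "bp q D d k"] by (rule cong_trans) (rule cong_sum, rule cong_mult[OF cong_refl], rule pr, simp)
    have c4: "(\<Sum>e<D^d. int (\<xi> e) * (if e = k then 1 else 0)) = int (\<xi> k)" using k by (simp add: if_distrib cong: if_cong)
    have "[A (bp q D d k) = \<xi> k] (mod q)" using c3 unfolding c4 by (simp only: cong_int_iff)
    then show ?thesis using Aq xi by (simp add: cong_def)
  qed
  show ?thesis using Aq rcq line interp base by (intro exI[of _ A] exI[of _ rc]) blast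
qed

section \<open>Minimum number of clauses and closures\<close>

definition hcl :: "nat set \<times> nat \<Rightarrow> clause" where
  "hcl r = insert (Pos (snd r)) (Neg ` fst r)"

lemma clause_true_hcl: "clause_true x (hcl r) \<longleftrightarrow> ((\<forall>b\<in>fst r. x ! b) \<longrightarrow> x ! snd r)"
  by (auto simp: clause_true_def hcl_def)

lemma pure_horn_hcl:
  "pure_horn_clause n (hcl r) \<longleftrightarrow> fst r \<subseteq> {..<n} \<and> snd r < n \<and> snd r \<notin> fst r"
  by (auto simp: pure_horn_clause_def clause_on_def hcl_def inj_on_def image_subset_iff)

lemma pure_horn_clause_hcl:
  assumes "pure_horn_clause n C" shows "\<exists>r. C = hcl r"
proof -
  from assms have "\<exists>!v. Pos v \<in> C" by (simp add: pure_horn_clause_def)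
  then have "\<exists>v. Pos v \<in> C \<and> (\<forall>w. Pos w \<in> C \<longrightarrow> w = v)" unfolding Ex1_def .
  then obtain v where v0: "Pos v \<in> C \<and> (\<forall>w. Pos w \<in> C \<longrightarrow> w = v)" by (rule exE)
  have "C = hcl ({b. Neg b \<in> C}, v)"
    unfolding hcl_def fst_conv snd_conv
  proof (intro set_eqI)
    fix l
    show "l \<in> C \<longleftrightarrow> l \<in> insert (Pos v) (Neg ` {b. Neg b \<in> C})"
    proof (cases l)
      case (Pos w) show ?thesis using v0 by (auto simp only: Pos literal.inject insert_iff image_iff literal.distinct simp_thms bex_simps)
    next
      case (Neg w) show ?thesis by (auto simp: Neg)
    qed
  qed
  then show ?thesis by (rule exI)
qed

inductive_set hclos :: "(nat set \<times> nat) set \<Rightarrow> nat set \<Rightarrow> nat set" for R X where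
  base: "v \<in> X \<Longrightarrow> v \<in> hclos R X"
| step: "(B, h) \<in> R \<Longrightarrow> (\<And>b. b \<in> B \<Longrightarrow> b \<in> hclos R X) \<Longrightarrow> h \<in> hclos R X"

lemma hclos_least:
  assumes "X \<subseteq> Y" "\<And>B h. (B, h) \<in> R \<Longrightarrow> B \<subseteq> Y \<Longrightarrow> h \<in> Y"
  shows "hclos R X \<subseteq> Y"
proof
  fix v assume "v \<in> hclos R X" then show "v \<in> Y"
    by induction (use assms in blast)+
qed

definition seed_rules :: "nat \<Rightarrow> nat \<Rightarrow> nat set \<Rightarrow> (nat set \<times> nat) set" where
  "seed_rules m0 Ts S = {({m0 + i}, v) | i v. i < Ts \<and> v \<in> S}"

lemma ball_seed_rules: "(\<forall>r\<in>seed_rules m0 Ts S. P r) \<longleftrightarrow> (\<forall>i<Ts. \<forall>v\<in>S. P ({m0 + i}, v))"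
  by (auto simp: seed_rules_def)

definition chi :: "nat \<Rightarrow> nat set \<Rightarrow> bool list" where "chi n X = map (\<lambda>v. v \<in> X) [0..<n]"

lemma length_chi [simp]: "length (chi n X) = n" by (simp add: chi_def)
lemma nth_chi [simp]: "v < n \<Longrightarrow> chi n X ! v \<longleftrightarrow> v \<in> X" by (simp add: chi_def)

text \<open>Variables below \<open>m0\<close> are atoms, the next \<open>Ts\<close> are seeds, and
  each seed implies each atom. The bound \<open>m0 + Ts \<le> n\<close> leaves room for
  padding.\<close>

locale horn_instance =
  fixes n m0 Ts :: nat and \<Gamma> :: "(nat set \<times> nat) set" and \<Phi> :: cnf and h :: "bool list \<Rightarrow> bool"
  assumes n: "m0 + Ts \<le> n"
    and G: "\<And>B v. (B, v) \<in> \<Gamma> \<Longrightarrow> B \<subseteq> {..<m0} \<and> v < m0 \<and> v \<notin> B"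
    and Phi: "set \<Phi> = hcl ` (\<Gamma> \<union> seed_rules m0 Ts {..<m0})"
    and rep: "represents n \<Phi> h"
begin

lemma pure_Phi: "pure_horn_cnf n \<Phi>"
  unfolding pure_horn_cnf_def Phi
proof (clarify)
  fix B v assume "(B, v) \<in> \<Gamma> \<union> seed_rules m0 Ts {..<m0}"
  then show "pure_horn_clause n (hcl (B, v))"
    using n G[of B v] by (fastforce simp: pure_horn_hcl seed_rules_def)
qed

lemma h_iff: "length x = n \<Longrightarrow> h x \<longleftrightarrow>
    (\<forall>r\<in>\<Gamma>. (\<forall>b\<in>fst r. x ! b) \<longrightarrow> x ! snd r) \<and> (\<forall>i<Ts. \<forall>v<m0. x ! (m0 + i) \<longrightarrow> x ! v)"
proof -
  assume "length x = n"
  then have "h x \<longleftrightarrow> cnf_true x \<Phi>" using rep by (simp add: represents_def)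
  also have "\<dots> \<longleftrightarrow> (\<forall>r\<in>\<Gamma> \<union> seed_rules m0 Ts {..<m0}. clause_true x (hcl r))"
    by (simp add: cnf_true_def Phi)
  also have "\<dots> \<longleftrightarrow> (\<forall>r\<in>\<Gamma>. (\<forall>b\<in>fst r. x ! b) \<longrightarrow> x ! snd r) \<and> (\<forall>i<Ts. \<forall>v<m0. x ! (m0 + i) \<longrightarrow> x ! v)"
    unfolding clause_true_hcl ball_Un ball_seed_rules by auto
  finally show ?thesis .
qed

lemma h_chi_iff: "X \<subseteq> {..<n} \<Longrightarrow> h (chi n X) \<longleftrightarrow>
    (\<forall>(B,v)\<in>\<Gamma>. B \<subseteq> X \<longrightarrow> v \<in> X) \<and> (\<forall>i<Ts. m0 + i \<in> X \<longrightarrow> {..<m0} \<subseteq> X)"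
proof -
  assume X: "X \<subseteq> {..<n}"
  have a: "(\<forall>b\<in>B. chi n X ! b) \<longleftrightarrow> B \<subseteq> X" "chi n X ! v \<longleftrightarrow> v \<in> X" if "(B, v) \<in> \<Gamma>" for B v
  proof -
    have "B \<subseteq> {..<n}" "v < n" using G[OF that] n by auto
    then show "(\<forall>b\<in>B. chi n X ! b) \<longleftrightarrow> B \<subseteq> X" "chi n X ! v \<longleftrightarrow> v \<in> X" by (auto simp: subset_iff)
  qed
  have b: "chi n X ! (m0 + i) \<longleftrightarrow> m0 + i \<in> X" if "i < Ts" for i using that n by simp
  have c: "chi n X ! v \<longleftrightarrow> v \<in> X" if "v < m0" for v using that n by simp
  have "(\<forall>r\<in>\<Gamma>. (\<forall>b\<in>fst r. chi n X ! b) \<longrightarrow> chi n X ! snd r) \<longleftrightarrow> (\<forall>(B,v)\<in>\<Gamma>. B \<subseteq> X \<longrightarrow> v \<in> X)"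
  proof (rule ball_cong[OF refl])
    fix r assume "r \<in> \<Gamma>"
    then show "((\<forall>b\<in>fst r. chi n X ! b) \<longrightarrow> chi n X ! snd r) = (case r of (B, v) \<Rightarrow> B \<subseteq> X \<longrightarrow> v \<in> X)"
      using a[of "fst r" "snd r"] by (cases r) simp
  qed
  moreover have "(\<forall>i<Ts. \<forall>v<m0. chi n X ! (m0 + i) \<longrightarrow> chi n X ! v) \<longleftrightarrow> (\<forall>i<Ts. m0 + i \<in> X \<longrightarrow> {..<m0} \<subseteq> X)"
    using b c by (auto simp: subset_iff)
  ultimately show ?thesis unfolding h_iff[OF length_chi] by (simp only:)
qed

text \<open>A seed need only imply a generating set; the clauses of \<open>\<Gamma>\<close> supply
  the other atoms.\<close>

lemma min_clauses_le:
  assumes Gl: "set \<Gamma>l = \<Gamma>" and S: "finite S" "S \<subseteq> {..<m0}" and cl: "{..<m0} \<subseteq> hclos \<Gamma> S"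
  shows "min_clauses n h \<le> length \<Gamma>l + Ts * card S"
proof -
  obtain Sl where Sl: "set Sl = S" "length Sl = card S"
    using finite_distinct_list[OF S(1)] distinct_card by metis
  define \<Psi> where "\<Psi> = map hcl (\<Gamma>l @ concat (map (\<lambda>i. map (\<lambda>v. ({m0 + i}, v)) Sl) [0..<Ts]))"
  have set: "set \<Psi> = hcl ` (\<Gamma> \<union> seed_rules m0 Ts S)"
  proof -
    have "set (concat (map (\<lambda>i. map (\<lambda>v. ({m0 + i}, v)) Sl) [0..<Ts])) = seed_rules m0 Ts S"
      by (auto simp: Sl seed_rules_def)
    then show ?thesis by (simp only: \<Psi>_def set_map set_append Gl)
  qed
  have "length \<Psi> = length \<Gamma>l + Ts * card S"
    by (simp add: \<Psi>_def Sl length_concat o_def sum_list_const_mult[of "card S" "\<lambda>_. 1", simplified] sum_list_triv)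
  moreover have "pure_horn_cnf n \<Psi>"
  proof -
    have "set \<Psi> \<subseteq> set \<Phi>" unfolding set Phi using S by (auto simp: seed_rules_def)
    then show ?thesis using pure_Phi by (auto simp: pure_horn_cnf_def)
  qed
  moreover have "represents n \<Psi> h"
    unfolding represents_def
  proof (intro allI impI)
    fix x :: "bool list" assume x: "length x = n"
    have "cnf_true x \<Psi> \<longleftrightarrow> (\<forall>r\<in>\<Gamma> \<union> seed_rules m0 Ts S. clause_true x (hcl r))"
      by (simp add: cnf_true_def set)
    also have "\<dots> \<longleftrightarrow> (\<forall>r\<in>\<Gamma>. (\<forall>b\<in>fst r. x ! b) \<longrightarrow> x ! snd r) \<and> (\<forall>i<Ts. \<forall>v\<in>S. x ! (m0 + i) \<longrightarrow> x ! v)"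
      unfolding clause_true_hcl ball_Un ball_seed_rules by auto
    also have "\<dots> \<longleftrightarrow> h x"
    proof
      assume H: "(\<forall>r\<in>\<Gamma>. (\<forall>b\<in>fst r. x ! b) \<longrightarrow> x ! snd r) \<and> (\<forall>i<Ts. \<forall>v\<in>S. x ! (m0 + i) \<longrightarrow> x ! v)"
      have "x ! v" if "i < Ts" "v < m0" "x ! (m0 + i)" for i v
      proof -
        have "hclos \<Gamma> S \<subseteq> {v. x ! v}"
        proof (rule hclos_least)
          show "S \<subseteq> {v. x ! v}" using H that by blast
          fix B w assume "(B, w) \<in> \<Gamma>" "B \<subseteq> {v. x ! v}"
          then show "w \<in> {v. x ! v}" using bspec[OF conjunct1[OF H], of "(B, w)"] by (auto simp: subset_iff)
        qed
        then show ?thesis using cl that by auto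
      qed
      then show "h x" using H by (simp add: h_iff[OF x])
    next
      assume "h x"
      then show "(\<forall>r\<in>\<Gamma>. (\<forall>b\<in>fst r. x ! b) \<longrightarrow> x ! snd r) \<and> (\<forall>i<Ts. \<forall>v\<in>S. x ! (m0 + i) \<longrightarrow> x ! v)"
        using S by (auto simp: h_iff[OF x])
    qed
    finally show "cnf_true x \<Psi> = h x" .
  qed
  ultimately show ?thesis unfolding min_clauses_def by (intro Least_le) blast
qed

text \<open>An arbitrary pure Horn CNF of \<open>h\<close> is examined through its models. Let
  \<open>H i\<close> consist of the atoms that are heads of clauses with seed \<open>i\<close> as
  the only seed in the body. The closure of \<open>H i\<close> under \<open>\<Gamma>\<close>,
  extended by the seed, satisfies the CNF and hence \<open>h\<close>, so it contains all atoms. Thus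
  \<open>H i\<close> generates everything, and clauses counted for different seeds are
  different.\<close>

lemma min_clauses_ge:
  assumes low: "\<And>H. H \<subseteq> {..<m0} \<Longrightarrow> {..<m0} \<subseteq> hclos \<Gamma> H \<Longrightarrow> c \<le> card H"
  shows "Ts * c \<le> min_clauses n h"
proof -
  have "\<exists>\<Psi>. pure_horn_cnf n \<Psi> \<and> represents n \<Psi> h \<and> length \<Psi> = min_clauses n h"
    unfolding min_clauses_def by (rule LeastI) (use pure_Phi rep in blast)
  then obtain \<Psi> where P: "pure_horn_cnf n \<Psi>" "represents n \<Psi> h" "length \<Psi> = min_clauses n h" by blast
  define R where "R = {r. hcl r \<in> set \<Psi>}"
  have setP: "set \<Psi> = hcl ` R"
  proof
    show "set \<Psi> \<subseteq> hcl ` R"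
    proof
      fix C assume C: "C \<in> set \<Psi>"
      then obtain r where "C = hcl r" using P(1) pure_horn_clause_hcl[of n C] unfolding pure_horn_cnf_def by blast
      then show "C \<in> hcl ` R" using C by (simp add: R_def)
    qed
  qed (auto simp: R_def)
  have Rn: "B \<subseteq> {..<n}" "v < n" "v \<notin> B" if "(B, v) \<in> R" for B v
    using that P(1) pure_horn_hcl[of n "(B,v)"] unfolding R_def pure_horn_cnf_def by auto
  have hR: "h (chi n X) \<longleftrightarrow> (\<forall>(B,v)\<in>R. B \<subseteq> X \<longrightarrow> v \<in> X)" if "X \<subseteq> {..<n}" for X
  proof -
    have "cnf_true (chi n X) \<Psi> = h (chi n X)" using P(2) by (simp add: represents_def)
    then have "h (chi n X) \<longleftrightarrow> (\<forall>r\<in>R. clause_true (chi n X) (hcl r))"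
      unfolding cnf_true_def setP by simp
    also have "\<dots> \<longleftrightarrow> (\<forall>(B,v)\<in>R. B \<subseteq> X \<longrightarrow> v \<in> X)"
    proof (rule ball_cong[OF refl])
      fix r assume "r \<in> R"
      then have "fst r \<subseteq> {..<n}" "snd r < n" using Rn[of "fst r" "snd r"] by auto
      then show "clause_true (chi n X) (hcl r) = (case r of (B, v) \<Rightarrow> B \<subseteq> X \<longrightarrow> v \<in> X)"
        by (cases r) (auto simp: clause_true_hcl subset_iff)
    qed
    finally show ?thesis .
  qed
  define H where "H i = {v. v < m0 \<and> (\<exists>B. (B, v) \<in> R \<and> B \<inter> {m0..<m0+Ts} = {m0 + i})}" for i
  have cH: "c \<le> card (H i)" if i: "i < Ts" for i
  proof (rule low)
    show Hm: "H i \<subseteq> {..<m0}" by (auto simp: H_def)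
    define X where "X = hclos \<Gamma> (H i)"
    have Xm: "X \<subseteq> {..<m0}" unfolding X_def
    proof (rule hclos_least[OF Hm])
      fix B w assume "(B, w) \<in> \<Gamma>" then show "w \<in> {..<m0}" using G[of B w] by simp
    qed
    have Xcl: "v \<in> X" if "(B, v) \<in> \<Gamma>" "B \<subseteq> X" for B v
      using that unfolding X_def by (auto intro: hclos.step)
    have Xn': "X \<subseteq> {..<n}" using Xm n by auto
    have hX: "h (chi n X)" unfolding h_chi_iff[OF Xn'] using Xcl Xm by fastforce
    let ?X = "insert (m0 + i) X"
    have Xn: "?X \<subseteq> {..<n}" using Xm i n by auto
    have "h (chi n ?X)"
      unfolding hR[OF Xn]
    proof (intro ballI)
      fix rr assume rr: "rr \<in> R"
      obtain B v where Bv: "rr = (B, v)" by (cases rr)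
      have "v \<in> ?X" if "B \<subseteq> ?X"
      proof (cases "m0 + i \<in> B")
        case True
        have r: "(B, v) \<in> R" "B \<subseteq> ?X" using rr Bv that by auto
        from True have B: "B \<inter> {m0..<m0+Ts} = {m0 + i}" using r(2) Xm i by auto
        show ?thesis
        proof (cases "v < m0")
          case True
          then have "v \<in> H i" using r B by (auto simp: H_def)
          then show ?thesis by (simp add: X_def hclos.base)
        next
          case False
          \<comment> \<open>All atoms together with seed \<open>i\<close> form a model as well, so a
            head outside the atoms can only be the seed itself, which already lies in
            \<open>?X\<close>.\<close>
          let ?Y = "insert (m0 + i) {..<m0}"
          have Yn: "?Y \<subseteq> {..<n}" using i n by auto
          have "h (chi n ?Y)" unfolding h_chi_iff[OF Yn]
          proof (intro conjI ballI)
            fix r assume "r \<in> \<Gamma>"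
            then show "case r of (B, v) \<Rightarrow> B \<subseteq> ?Y \<longrightarrow> v \<in> ?Y" using G[of "fst r" "snd r"] by (cases r) auto
          qed auto
          then have "v \<in> ?Y" using r Xm unfolding hR[OF Yn] by blast
          then show ?thesis using False by auto
        qed
      next
        case False
        then have "B \<subseteq> X" using that by auto
        then show ?thesis using hX rr Bv unfolding hR[OF Xn'] by blast
      qed
      then show "case rr of (B, v) \<Rightarrow> B \<subseteq> ?X \<longrightarrow> v \<in> ?X" by (simp add: Bv)
    qed
    then have "{..<m0} \<subseteq> ?X" using i unfolding h_chi_iff[OF Xn] by auto
    then show "{..<m0} \<subseteq> hclos \<Gamma> (H i)" unfolding X_def by auto
  qed
  \<comment> \<open>Recovers from a clause its only seed and its head, which shows that no clause is
    counted twice.\<close>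
  define g where "g C = ((THE i. i < Ts \<and> {b. Neg b \<in> C} \<inter> {m0..<m0+Ts} = {m0 + i}), (THE v. Pos v \<in> C))" for C :: clause
  have "Ts * c = (\<Sum>i<Ts. c)" by simp
  also have "\<dots> \<le> (\<Sum>i<Ts. card (H i))" using cH by (intro sum_mono) auto
  also have "\<dots> = card (SIGMA i:{..<Ts}. H i)"
    by (subst card_SigmaI) (auto simp: H_def)
  also have "\<dots> \<le> card (g ` set \<Psi>)"
  proof (rule card_mono)
    show "(SIGMA i:{..<Ts}. H i) \<subseteq> g ` set \<Psi>"
    proof (clarify)
      fix i v assume "i < Ts" "v \<in> H i"
      then obtain B where B: "(B, v) \<in> R" "B \<inter> {m0..<m0+Ts} = {m0 + i}" by (auto simp: H_def)
      have "{b. Neg b \<in> hcl (B, v)} = B" by (auto simp: hcl_def)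
      then have "(THE i. i < Ts \<and> {b. Neg b \<in> hcl (B, v)} \<inter> {m0..<m0+Ts} = {m0 + i}) = i"
        using B \<open>i < Ts\<close> by (intro the_equality) auto
      moreover have "(THE w. Pos w \<in> hcl (B, v)) = v" by (rule the_equality) (auto simp: hcl_def)
      ultimately have "g (hcl (B, v)) = (i, v)" by (simp add: g_def)
      moreover have "hcl (B, v) \<in> set \<Psi>" using B by (simp add: R_def)
      ultimately show "(i, v) \<in> g ` set \<Psi>" by (metis image_eqI)
    qed
  qed simp
  also have "\<dots> \<le> card (set \<Psi>)" by (rule card_image_le) simp
  also have "\<dots> \<le> min_clauses n h" using card_length[of \<Psi>] P(3) by simp
  finally show ?thesis .
qed

end

section \<open>Primes of polynomial size\<close>

text \<open>Leibniz' harmonic triangle: \<open>1 / (k * (n choose k))\<close> satisfies the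
  difference rule u(n, k + 1) = u(n - 1, k) - u(n, k). Multiplied by \<open>L\<close>, the right
  side is an integer \<open>b - a\<close> by induction.\<close>

lemma leibniz_dvd:
  assumes L: "\<And>j. 1 \<le> j \<Longrightarrow> j \<le> N \<Longrightarrow> j dvd (L::nat)"
  shows "1 \<le> k \<Longrightarrow> k \<le> n \<Longrightarrow> n \<le> N \<Longrightarrow> k * (n choose k) dvd L"
proof (induction k arbitrary: n)
  case (Suc k)
  show ?case
  proof (cases "k = 0")
    case True
    then show ?thesis using L[of n] Suc.prems by simp
  next
    case False
    define c where "c = (n - 1) choose (k - 1)"
    have n: "n = Suc (n - 1)" "k = Suc (k - 1)" using Suc.prems False by auto
    have e1: "k * (n choose k) = n * c" unfolding c_def using Suc_times_binomial_eq[of "n - 1" "k - 1"] n by (metis mult.commute)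
    have e2: "k * ((n - 1) choose k) = (n - k) * c"
    proof -
      have "k * ((n - 1) choose k) = (n - 1 - (k - 1)) * ((n - 1) choose (k - 1))"
        using binomial_absorb_comp[of "n - 1" "k - 1"] binomial_absorption[of "k - 1" "n - 1"] n by simp
      then show ?thesis using False Suc.prems by (simp add: c_def)
    qed
    have e3: "Suc k * (n choose Suc k) = n * ((n - 1) choose k)"
      using Suc_times_binomial_eq[of "n - 1" k] n by (metis mult.commute)
    have d1: "n * c dvd L" using Suc.IH[of n] Suc.prems False unfolding e1 by simp
    have d2: "(n - k) * c dvd L" using Suc.IH[of "n - 1"] Suc.prems False unfolding e2 by simp
    obtain a where a: "L = (n * c) * a" using d1 by (auto elim: dvdE)
    obtain b where b: "L = ((n - k) * c) * b" using d2 by (auto elim: dvdE)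
    define g where "g = (n - 1) choose k"
    have kg: "k * g = (n - k) * c" using e2 by (simp add: g_def)
    have c0: "0 < c" unfolding c_def using Suc.prems by (simp add: zero_less_binomial_iff)
    have ab: "n * a = (n - k) * b" using a b c0 by (metis mult.assoc mult.left_commute mult_left_cancel neq0_conv)
    have "n * g * (b - a) = L"
    proof -
      have "k * (n * g * (b - a)) = n * (k * g) * (b - a)" by (simp add: mult_ac)
      also have "\<dots> = n * ((n - k) * b * c) - (n - k) * (n * a * c)"
      proof -
        have "n * (r * c) * (b - a) = n * (r * b * c) - r * (n * a * c)" for r by (simp add: diff_mult_distrib2 mult_ac)
        then show ?thesis unfolding kg .
      qed
      also have "\<dots> = n * ((n - k) * b * c) - (n - k) * ((n - k) * b * c)" unfolding ab ..
      also have "\<dots> = (n - (n - k)) * ((n - k) * b * c)" by (simp add: diff_mult_distrib)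
      also have "\<dots> = k * L" using Suc.prems b by (simp add: mult_ac)
      finally show ?thesis using False by simp
    qed
    then show ?thesis unfolding e3 g_def[symmetric] by (metis dvd_triv_left)
  qed
qed simp

lemma two_power_le_central: "2 ^ n \<le> (2 * n) choose n"
proof (induction n)
  case (Suc n)
  have "2 * n choose n \<le> Suc (2 * n) choose n" "2 * n choose n \<le> Suc (2 * n) choose Suc n"
  proof -
    show "2 * n choose n \<le> Suc (2 * n) choose n" by (cases n) auto
    show "2 * n choose n \<le> Suc (2 * n) choose Suc n" by simp
  qed
  moreover have "(2 * Suc n) choose Suc n = (Suc (2 * n) choose n) + (Suc (2 * n) choose Suc n)" by simp
  ultimately show ?case using Suc by (simp del: binomial_Suc_Suc)
qed simp

lemma small_power: "1 \<le> a \<Longrightarrow> (8 * a\<^sup>2) ^ a < 2 ^ (4 * a\<^sup>2)" for a :: nat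
proof -
  assume a: "1 \<le> a"
  have "8 * a\<^sup>2 < 16 ^ a"
    using a
  proof (induction a rule: dec_induct)
    case (step n)
    have "8 * (Suc n)\<^sup>2 \<le> 8 * (2 * n)\<^sup>2" using step by (intro mult_left_mono power_mono) auto
    also have "\<dots> = 8 * (4 * n\<^sup>2)" by (simp add: power_mult_distrib)
    also have "\<dots> < 16 * 16 ^ n" using step by simp
    finally show ?case by simp
  qed simp
  then have "(8 * a\<^sup>2) ^ a < (16 ^ a) ^ a" using a by (intro power_strict_mono) auto
  also have "\<dots> = (2 ^ 4) ^ (a * a)" by (simp add: power_mult)
  also have "\<dots> = 2 ^ (4 * a\<^sup>2)" by (simp only: power_mult[symmetric] power2_eq_square)
  finally show ?thesis .
qed

text \<open>Put m = 8 a^2. If the primes up to m were all at most a, the product of their largest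
  powers below m would be a common multiple of 1, ..., m of size at most m^a. By
  \<open>leibniz_dvd\<close> it is divisible by a multiple of a central binomial coefficient, hence
  at least 2^(m/2), which exceeds m^a by \<open>small_power\<close>.\<close>

lemma prime_in_range:
  fixes a :: nat
  assumes "1 \<le> a" shows "\<exists>p. prime p \<and> a < p \<and> p \<le> 8 * a\<^sup>2"
proof (rule ccontr)
  assume neg: "\<not> ?thesis"
  define m where "m = 8 * a\<^sup>2"
  define P where "P = {p. prime p \<and> p \<le> a}"
  have fP: "finite P" "card P \<le> a"
  proof -
    have "P \<subseteq> {1..a}" using prime_ge_1_nat by (auto simp: P_def)
    then show "finite P" "card P \<le> a" using card_mono[of "{1..a}" P] finite_subset by auto
  qed
  have m1: "1 \<le> m" using assms by (simp add: m_def power2_eq_square)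
  define e where "e p = Max {i. p ^ i \<le> m}" for p :: nat
  have fin: "finite {i. p ^ i \<le> m}" if "prime p" for p :: nat
  proof -
    have "i \<le> m" if "p ^ i \<le> m" for i
    proof -
      have "i < 2 ^ i" by (rule less_exp)
      also have "\<dots> \<le> p ^ i" using \<open>prime p\<close> prime_ge_2_nat by (intro power_mono) auto
      finally show ?thesis using that by simp
    qed
    then have "{i. p ^ i \<le> m} \<subseteq> {..m}" by auto
    then show ?thesis using finite_subset by blast
  qed
  have e1: "p ^ e p \<le> m" if "prime p" for p
    using Max_in[OF fin[OF that]] m1 unfolding e_def by (metis (mono_tags) empty_iff mem_Collect_eq power_0)
  have e2: "i \<le> e p" if "prime p" "p ^ i \<le> m" for p i
    unfolding e_def by (rule Max_ge[OF fin[OF that(1)]]) (use that in simp)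
  define L where "L = (\<Prod>p\<in>P. p ^ e p)"
  have "j dvd L" if j: "1 \<le> j" "j \<le> m" for j
  proof -
    have sub: "prime_factors j \<subseteq> P"
    proof
      fix p assume p: "p \<in> prime_factors j"
      then have "prime p" "p dvd j" by (auto simp: prime_factors_dvd)
      then have "p \<le> m" using j dvd_imp_le[of p j] by simp
      then show "p \<in> P" using neg \<open>prime p\<close> by (auto simp: P_def m_def not_less)
    qed
    have "j = (\<Prod>p\<in>prime_factors j. p ^ multiplicity p j)" using prime_factorization_nat[of j] j by simp
    also have "\<dots> dvd (\<Prod>p\<in>prime_factors j. p ^ e p)"
    proof (rule prod_dvd_prod)
      fix p assume p: "p \<in> prime_factors j"
      then have pr: "prime p" by auto
      have "p ^ multiplicity p j \<le> m" using dvd_imp_le[OF multiplicity_dvd[of p j]] j by simp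
      then show "p ^ multiplicity p j dvd p ^ e p" using e2[OF pr] by (simp add: le_imp_power_dvd)
    qed
    also have "\<dots> dvd L" unfolding L_def by (rule prod_dvd_prod_subset[OF fP(1) sub])
    finally show ?thesis .
  qed
  then have "4 * a\<^sup>2 * ((2 * (4 * a\<^sup>2)) choose (4 * a\<^sup>2)) dvd L"
    by (intro leibniz_dvd[of m L]) (use assms in \<open>auto simp: m_def power2_eq_square\<close>)
  moreover have L0: "0 < L" unfolding L_def by (intro prod_pos) (auto simp: P_def prime_gt_0_nat)
  ultimately have "4 * a\<^sup>2 * ((2 * (4 * a\<^sup>2)) choose (4 * a\<^sup>2)) \<le> L" using dvd_imp_le by blast
  moreover have "L \<le> m ^ a"
  proof -
    have "L \<le> (\<Prod>p\<in>P. m)" unfolding L_def using e1 by (intro prod_mono) (auto simp: P_def)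
    also have "\<dots> = m ^ card P" by simp
    also have "\<dots> \<le> m ^ a" using fP(2) m1 by (intro power_increasing) auto
    finally show ?thesis .
  qed
  moreover have "2 ^ (4 * a\<^sup>2) \<le> 4 * a\<^sup>2 * ((2 * (4 * a\<^sup>2)) choose (4 * a\<^sup>2))"
  proof -
    have "1 * 2 ^ (4 * a\<^sup>2) \<le> 4 * a\<^sup>2 * ((2 * (4 * a\<^sup>2)) choose (4 * a\<^sup>2))"
      using two_power_le_central[of "4 * a\<^sup>2"] assms by (intro mult_mono) (auto simp: power2_eq_square)
    then show ?thesis by simp
  qed
  ultimately show False using small_power[OF assms] unfolding m_def by linarith
qed

section \<open>Machines over arbitrary finite state and symbol sets\<close>

definition astep :: "('q \<Rightarrow> 's \<Rightarrow> 'q \<times> 's \<times> int) \<Rightarrow> 'q \<Rightarrow> 'q \<times> (int \<Rightarrow> 's) \<times> int \<Rightarrow> 'q \<times> (int \<Rightarrow> 's) \<times> int" where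
  "astep \<delta> qh = (\<lambda>(q, tp, p). if q = qh then (q, tp, p)
     else (fst (\<delta> q (tp p)), tp(p := fst (snd (\<delta> q (tp p)))), p + snd (snd (\<delta> q (tp p)))))"

lemma distinct_index:
  assumes "distinct l" shows "\<exists>e :: 'a \<Rightarrow> nat. \<forall>i<length l. e (l ! i) = i"
proof -
  define e where "e a = (THE i. i < length l \<and> l ! i = a)" for a
  have "e (l ! i) = i" if "i < length l" for i
    unfolding e_def using that assms by (intro the_equality) (auto simp: nth_eq_iff_index_eq)
  then show ?thesis by blast
qed

text \<open>States are numbered with \<open>q0\<close> first and \<open>qh\<close> last, symbols
  with the blank and the two bits first, as the conventions of \<open>turing_machine\<close> demand.
  The same function \<open>e\<close> translates the whole tape, so step counts agree
  exactly.\<close>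

lemma implement:
  fixes \<delta> :: "'q \<Rightarrow> 's \<Rightarrow> 'q \<times> 's \<times> int"
  assumes Q: "finite Q" "q0 \<in> Q" "qh \<in> Q" "q0 \<noteq> qh"
    and A: "finite A" "{b0, b1, b2} \<subseteq> A" "b0 \<noteq> b1" "b0 \<noteq> b2" "b1 \<noteq> b2"
    and cl: "\<And>q a. q \<in> Q \<Longrightarrow> q \<noteq> qh \<Longrightarrow> a \<in> A \<Longrightarrow> fst (\<delta> q a) \<in> Q \<and> fst (snd (\<delta> q a)) \<in> A \<and> snd (snd (\<delta> q a)) \<in> {-1, 0, 1}"
  shows "\<exists>M e. wf_tm M \<and> e b0 = 0 \<and> e b1 = 1 \<and> e b2 = 2 \<and>
    (\<forall>tp p t tp' p'. (\<forall>i. tp i \<in> A) \<longrightarrow> (astep \<delta> qh ^^ t) (q0, tp, p) = (qh, tp', p') \<longrightarrow>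
       (tm_step M ^^ t) (0, e \<circ> tp, p) = (num_states M, e \<circ> tp', p'))"
proof -
  obtain Al' where Al': "set Al' = A - {b0, b1, b2}" "distinct Al'" using A(1) finite_distinct_list by (metis finite_Diff)
  define Al where "Al = b0 # b1 # b2 # Al'"
  have Al: "set Al = A" "distinct Al" using A Al' by (auto simp: Al_def)
  obtain Ql' where Ql': "set Ql' = Q - {q0, qh}" "distinct Ql'" using Q(1) finite_distinct_list by (metis finite_Diff)
  define Ql where "Ql = q0 # Ql' @ [qh]"
  have Ql: "set Ql = Q" "distinct Ql" using Q Ql' by (auto simp: Ql_def)
  obtain e where e: "\<And>i. i < length Al \<Longrightarrow> e (Al ! i) = i" using distinct_index[OF Al(2)] by blast
  obtain f where f: "\<And>i. i < length Ql \<Longrightarrow> f (Ql ! i) = i" using distinct_index[OF Ql(2)] by blast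
  have eA: "e a < length Al \<and> Al ! e a = a" if a: "a \<in> A" for a
  proof -
    obtain i where "i < length Al" "Al ! i = a" using a Al(1) by (metis in_set_conv_nth)
    then show ?thesis using e by auto
  qed
  have fQ: "f q < length Ql \<and> Ql ! f q = q" if a: "q \<in> Q" for q
  proof -
    obtain i where "i < length Ql" "Ql ! i = q" using a Ql(1) by (metis in_set_conv_nth)
    then show ?thesis using f by auto
  qed
  define N where "N = length Ql - 1"
  have lQ: "length Ql = Suc N" by (simp add: N_def Ql_def)
  have fqh: "f qh = N"
  proof -
    have "Ql ! N = qh" by (simp add: N_def Ql_def nth_append)
    then show ?thesis using f[of N] lQ by simp
  qed
  have fq0: "f q0 = 0" using f[of 0] by (simp add: Ql_def)
  have fN: "f q < N" if "q \<in> Q" "q \<noteq> qh" for q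
  proof -
    have "f q \<noteq> N" using fQ[OF that(1)] fQ[OF Q(3)] fqh that(2) by metis
    then show ?thesis using fQ[OF that(1)] lQ by simp
  qed
  have QlN: "Ql ! i \<in> Q \<and> Ql ! i \<noteq> qh" if "i < N" for i
  proof -
    have "Ql ! i \<in> Q" using that lQ Ql(1) nth_mem[of i Ql] by auto
    moreover have "f (Ql ! i) = i" using f that lQ by simp
    ultimately show ?thesis using fqh that by auto
  qed
  define M :: turing_machine where "M = \<lparr>num_states = N, num_symbols = length Al,
    trans = (\<lambda>q a. (f (fst (\<delta> (Ql ! q) (Al ! a))), e (fst (snd (\<delta> (Ql ! q) (Al ! a)))), snd (snd (\<delta> (Ql ! q) (Al ! a)))))\<rparr>"
  have wf: "wf_tm M"
    unfolding wf_tm_def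
  proof (intro conjI allI impI)
    show "3 \<le> num_symbols M" by (simp add: M_def Al_def)
    fix q a assume "q < num_states M" "a < num_symbols M"
    then have q: "Ql ! q \<in> Q" "Ql ! q \<noteq> qh" and a: "Al ! a \<in> A"
      using QlN[of q] Al(1) nth_mem[of a Al] by (auto simp: M_def)
    note c = cl[OF q a]
    show "case trans M q a of (q', a', d) \<Rightarrow> q' \<le> num_states M \<and> a' < num_symbols M \<and> d \<in> {-1, 0, 1}"
      using c fQ[of "fst (\<delta> (Ql ! q) (Al ! a))"] eA[of "fst (snd (\<delta> (Ql ! q) (Al ! a)))"] lQ
      by (auto simp: M_def)
  qed
  have sim: "(\<forall>i. fst (snd c) i \<in> A) \<Longrightarrow> fst c \<in> Q \<Longrightarrow>
      (\<forall>i. fst (snd ((astep \<delta> qh ^^ t) c)) i \<in> A) \<and> fst ((astep \<delta> qh ^^ t) c) \<in> Q \<and>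
      (tm_step M ^^ t) (f (fst c), e \<circ> fst (snd c), snd (snd c))
        = (f (fst ((astep \<delta> qh ^^ t) c)), e \<circ> fst (snd ((astep \<delta> qh ^^ t) c)), snd (snd ((astep \<delta> qh ^^ t) c)))" for c t
  proof (induction t)
    case 0
    then show ?case by simp
  next
    case (Suc t)
    obtain q tp p where c: "(astep \<delta> qh ^^ t) c = (q, tp, p)" by (metis prod_cases3)
    have IH: "\<forall>i. tp i \<in> A" "q \<in> Q" "(tm_step M ^^ t) (f (fst c), e \<circ> fst (snd c), snd (snd c)) = (f q, e \<circ> tp, p)"
      using Suc c by (simp_all add: comp_def)
    show ?case
    proof (cases "q = qh")
      case True
      have s1: "astep \<delta> qh (q, tp, p) = (q, tp, p)" using True by (simp add: astep_def)
      have "f q = num_states M" using True fqh by (simp add: M_def)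
      then have s2: "tm_step M (f q, e \<circ> tp, p) = (f q, e \<circ> tp, p)" by (simp add: tm_step_def)
      show ?thesis using IH c s1 s2 by (simp add: comp_def)
    next
      case False
      have a: "tp p \<in> A" using IH by blast
      note cc = cl[OF IH(2) False a]
      have s: "astep \<delta> qh (q, tp, p) = (fst (\<delta> q (tp p)), tp(p := fst (snd (\<delta> q (tp p)))), p + snd (snd (\<delta> q (tp p))))"
        using False by (simp add: astep_def)
      have "tm_step M (f q, e \<circ> tp, p) = (f (fst (\<delta> q (tp p))), (e \<circ> tp)(p := e (fst (snd (\<delta> q (tp p))))), p + snd (snd (\<delta> q (tp p))))"
        using fN[OF IH(2) False] fQ[OF IH(2)] eA[OF a] by (simp add: tm_step_def M_def)
      moreover have "(e \<circ> tp)(p := e (fst (snd (\<delta> q (tp p))))) = e \<circ> tp(p := fst (snd (\<delta> q (tp p))))" by auto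
      ultimately show ?thesis using IH c s cc by (auto simp: comp_def)
    qed
  qed
  show ?thesis
  proof (intro exI[of _ M] exI[of _ e] conjI allI impI)
    show "wf_tm M" by (rule wf)
    show "e b0 = 0" using e[of 0] by (simp add: Al_def)
    show "e b1 = 1" using e[of 1] by (simp add: Al_def)
    show "e b2 = 2" using e[of 2] by (simp add: Al_def)
    fix tp p t tp' p' assume h: "\<forall>i. tp i \<in> A" "(astep \<delta> qh ^^ t) (q0, tp, p) = (qh, tp', p')"
    have "num_states M = N" by (simp add: M_def)
    then show "(tm_step M ^^ t) (0, e \<circ> tp, p) = (num_states M, e \<circ> tp', p')"
      using sim[of "(q0, tp, p)" t] h Q(2) fq0 fqh by simp
  qed
qed

section \<open>Counter programs\<close>

text \<open>Tests for a nonzero register, for a given input symbol at the position stored in a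
  register, and for a nonblank input symbol there. \<open>Wr\<close> writes to a separate work
  track, also at the position stored in a register.\<close>

datatype tst = NZ nat | In nat nat | Nb nat

datatype cmd = Inc nat | Dec nat | Wr nat nat | If tst "cmd list" | While tst "cmd list"

definition insym :: "bool list \<Rightarrow> int \<Rightarrow> nat" where
  "insym x i = (if 0 \<le> i \<and> i < int (length x) then bit_symbol (x ! nat i) else 0)"

fun treg :: "tst \<Rightarrow> nat" where "treg (NZ r) = r" | "treg (In r b) = r" | "treg (Nb r) = r"

fun tval :: "bool list \<Rightarrow> (nat \<Rightarrow> nat) \<Rightarrow> tst \<Rightarrow> bool" where
  "tval x \<rho> (NZ r) = (\<rho> r \<noteq> 0)"
| "tval x \<rho> (In r b) = (insym x (int (\<rho> r)) = b)"
| "tval x \<rho> (Nb r) = (insym x (int (\<rho> r)) \<noteq> 0)"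

type_synonym cst = "(nat \<Rightarrow> nat) \<times> (int \<Rightarrow> nat)"

text \<open>Big-step execution with a time bound: \<open>2 * \<rho> r + 5\<close> pays for the walk
  from the origin to cell \<open>\<rho> r\<close>, the action, and the way back.\<close>

inductive ex :: "bool list \<Rightarrow> cmd list \<Rightarrow> cst \<Rightarrow> cst \<Rightarrow> nat \<Rightarrow> bool" for x where
  ex_Nil: "ex x [] s s 0"
| ex_Inc: "ex x cs (\<rho>(r := Suc (\<rho> r)), w) s c \<Longrightarrow> ex x (Inc r # cs) (\<rho>, w) s (c + (2 * \<rho> r + 5))"
| ex_Dec: "ex x cs (\<rho>(r := \<rho> r - 1), w) s c \<Longrightarrow> ex x (Dec r # cs) (\<rho>, w) s (c + (2 * \<rho> r + 5))"
| ex_Wr: "ex x cs (\<rho>, w(int (\<rho> r) := b)) s c \<Longrightarrow> ex x (Wr r b # cs) (\<rho>, w) s (c + (2 * \<rho> r + 5))"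
| ex_If: "ex x (if tval x \<rho> t then bd @ cs else cs) (\<rho>, w) s c \<Longrightarrow> ex x (If t bd # cs) (\<rho>, w) s (c + (2 * \<rho> (treg t) + 5))"
| ex_While: "ex x (if tval x \<rho> t then bd @ While t bd # cs else cs) (\<rho>, w) s c \<Longrightarrow>
    ex x (While t bd # cs) (\<rho>, w) s (c + (2 * \<rho> (treg t) + 5))"

lemma ex_append: "ex x cs s s1 c \<Longrightarrow> ex x ds s1 s2 c' \<Longrightarrow> ex x (cs @ ds) s s2 (c + c')"
proof (induction rule: ex.induct)
  case (ex_Nil s)
  then show ?case by simp
next
  case (ex_Inc cs \<rho> r w s c)
  then show ?case using ex.ex_Inc[of x "cs @ ds" \<rho> r w s2 "c + c'"] by (simp add: add_ac)
next
  case (ex_Dec cs \<rho> r w s c)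
  then show ?case using ex.ex_Dec[of x "cs @ ds" \<rho> r w s2 "c + c'"] by (simp add: add_ac)
next
  case (ex_Wr cs \<rho> w r b s c)
  then show ?case using ex.ex_Wr[of x "cs @ ds" \<rho> w r b s2 "c + c'"] by (simp add: add_ac)
next
  case (ex_If \<rho> t bd cs w s c)
  have "ex x (if tval x \<rho> t then bd @ cs @ ds else cs @ ds) (\<rho>, w) s2 (c + c')"
    using ex_If by (cases "tval x \<rho> t") auto
  then show ?case using ex.ex_If[of x \<rho> t bd "cs @ ds" w s2 "c + c'"] by (simp add: add_ac)
next
  case (ex_While \<rho> t bd cs w s c)
  have "ex x (if tval x \<rho> t then bd @ While t bd # cs @ ds else cs @ ds) (\<rho>, w) s2 (c + c')"
    using ex_While by (cases "tval x \<rho> t") auto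
  then show ?case using ex.ex_While[of x \<rho> t bd "cs @ ds" w s2 "c + c'"] by (simp add: add_ac)
qed

text \<open>The finitely many continuations that execution of a program can reach.\<close>

fun cnts :: "cmd list \<Rightarrow> cmd list \<Rightarrow> cmd list set" where
  "cnts [] k = {k}"
| "cnts (If t bd # cs) k = insert (If t bd # cs @ k) (cnts bd (cs @ k) \<union> cnts cs k)"
| "cnts (While t bd # cs) k = insert (While t bd # cs @ k) (cnts bd (While t bd # cs @ k) \<union> cnts cs k)"
| "cnts (c # cs) k = insert (c # cs @ k) (cnts cs k)"

lemma finite_cnts [simp]: "finite (cnts cs k)" by (induction cs k rule: cnts.induct) auto
lemma self_cnts: "cs @ k \<in> cnts cs k" by (cases "(cs, k)" rule: cnts.cases) auto
fun nxts :: "cmd list \<Rightarrow> cmd list set" where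
  "nxts [] = {}"
| "nxts (If t bd # cs) = {bd @ cs, cs}"
| "nxts (While t bd # cs) = {bd @ While t bd # cs, cs}"
| "nxts (c # cs) = {cs}"

lemma nxts_cnts: "ds \<in> cnts cs k \<Longrightarrow> ds = k \<or> nxts ds \<subseteq> cnts cs k"
proof (induction cs k rule: cnts.induct)
  case (1 k)
  then show ?case by simp
next
  case (2 t bd cs k)
  have s: "cs @ k \<in> cnts cs k" "bd @ cs @ k \<in> cnts bd (cs @ k)" by (rule self_cnts)+
  from "2.prems" consider "ds = If t bd # cs @ k" | "ds \<in> cnts bd (cs @ k)" | "ds \<in> cnts cs k" by auto
  then show ?case
  proof cases
    case 1
    then show ?thesis using s by auto
  next
    case 2
    from "2.IH"(1)[OF 2] show ?thesis
    proof
      assume "ds = cs @ k"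
      then have "ds \<in> cnts cs k" using s by simp
      from "2.IH"(2)[OF this] show ?thesis by auto
    qed auto
  next
    case 3
    from "2.IH"(2)[OF 3] show ?thesis by auto
  qed
next
  case (3 t bd cs k)
  let ?W = "While t bd # cs @ k"
  have s: "cs @ k \<in> cnts cs k" "bd @ ?W \<in> cnts bd ?W" by (rule self_cnts)+
  from "3.prems" consider "ds = ?W" | "ds \<in> cnts bd ?W" | "ds \<in> cnts cs k" by auto
  then show ?case
  proof cases
    case 1
    then show ?thesis using s by auto
  next
    case 2
    from "3.IH"(1)[OF 2] show ?thesis
    proof
      assume "ds = ?W"
      then show ?thesis using s by auto
    qed auto
  next
    case 3
    from "3.IH"(2)[OF 3] show ?thesis by auto
  qed
next
  case ("4_1" v cs k)
  then show ?case using self_cnts[of cs k] by auto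
next
  case ("4_2" v cs k)
  then show ?case using self_cnts[of cs k] by auto
next
  case ("4_3" v va cs k)
  then show ?case using self_cnts[of cs k] by auto
qed

text \<open>Four tracks: the input symbol, the mark of the origin, the work symbol, and the set of
  registers whose value exceeds the position of the cell. A register is thus a unary block that
  starts at the origin.\<close>

type_synonym sym = "nat \<times> bool \<times> nat \<times> nat set"

text \<open>\<open>Pr cs ph\<close> executes the continuation \<open>cs\<close>; phase 0 walks
  right, 1 returns to the origin, 2 is the extra step of a decrement. \<open>Sm\<close> simulates
  the given machine, \<open>Sc\<close> scans its output, \<open>Bk\<close> carries the answer to the
  origin.\<close>

datatype st = St0 | Pr "cmd list" nat | Sm nat bool | Sc | Bk bool | Fn | Hl

fun tcell :: "tst \<Rightarrow> sym \<Rightarrow> bool option" where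
  "tcell (NZ r) (s, og, m, g) = Some (r \<in> g)"
| "tcell (In r b) (s, og, m, g) = (if r \<in> g then None else Some (s = b))"
| "tcell (Nb r) (s, og, m, g) = (if r \<in> g then None else Some (s \<noteq> 0))"

fun prd :: "cmd list \<Rightarrow> nat \<Rightarrow> sym \<Rightarrow> st \<times> sym \<times> int" where
  "prd [] ph a = (Sm 0 False, a, 0)"
| "prd (Inc r # cs) ph (s, og, m, g) = (if r \<in> g then (Pr (Inc r # cs) 0, (s, og, m, g), 1)
     else (Pr cs 1, (s, og, m, insert r g), 0))"
| "prd (Dec r # cs) ph (s, og, m, g) = (if ph = 2 then (Pr cs 1, (s, og, m, g - {r}), 0)
     else if r \<in> g then (Pr (Dec r # cs) 0, (s, og, m, g), 1)
     else if og then (Pr cs 1, (s, og, m, g), 0) else (Pr (Dec r # cs) 2, (s, og, m, g), -1))"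
| "prd (Wr r b # cs) ph (s, og, m, g) = (if r \<in> g then (Pr (Wr r b # cs) 0, (s, og, m, g), 1)
     else (Pr cs 1, (s, og, b, g), 0))"
| "prd (If t bd # cs) ph a = (case tcell t a of None \<Rightarrow> (Pr (If t bd # cs) 0, a, 1)
     | Some v \<Rightarrow> (Pr (if v then bd @ cs else cs) 1, a, 0))"
| "prd (While t bd # cs) ph a = (case tcell t a of None \<Rightarrow> (Pr (While t bd # cs) 0, a, 1)
     | Some v \<Rightarrow> (Pr (if v then bd @ While t bd # cs else cs) 1, a, 0))"

fun cok :: "nat \<Rightarrow> nat \<Rightarrow> cmd list \<Rightarrow> bool" where
  "cok k n [] \<longleftrightarrow> True"
| "cok k n (Inc r # cs) \<longleftrightarrow> r < k \<and> cok k n cs"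
| "cok k n (Dec r # cs) \<longleftrightarrow> r < k \<and> cok k n cs"
| "cok k n (Wr r b # cs) \<longleftrightarrow> r < k \<and> b < n \<and> cok k n cs"
| "cok k n (If t bd # cs) \<longleftrightarrow> treg t < k \<and> cok k n bd \<and> cok k n cs"
| "cok k n (While t bd # cs) \<longleftrightarrow> treg t < k \<and> cok k n bd \<and> cok k n cs"

lemma cok_append [simp]: "cok k n (cs @ ds) \<longleftrightarrow> cok k n cs \<and> cok k n ds"
  by (induction k n cs rule: cok.induct) auto

lemma cok_mono: "cok k n cs \<Longrightarrow> k \<le> k' \<Longrightarrow> n \<le> n' \<Longrightarrow> cok k' n' cs"
  by (induction k n cs rule: cok.induct) auto

lemma cok_ex: "\<exists>k n. cok k n cs"
proof -
  have "\<exists>k. \<forall>k'\<ge>k. cok k' k' cs" for cs :: "cmd list"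
  proof (induction "0::nat" "0::nat" cs rule: cok.induct)
    case (2 r cs) then obtain k where "\<forall>k'\<ge>k. cok k' k' cs" by blast
    then show ?case by (intro exI[of _ "k + Suc r"]) auto
  next
    case (3 r cs) then obtain k where "\<forall>k'\<ge>k. cok k' k' cs" by blast
    then show ?case by (intro exI[of _ "k + Suc r"]) auto
  next
    case (4 r b cs) then obtain k where "\<forall>k'\<ge>k. cok k' k' cs" by blast
    then show ?case by (intro exI[of _ "k + Suc r + Suc b"]) auto
  next
    case (5 t bd cs) then obtain k k2 where "\<forall>k'\<ge>k. cok k' k' bd" "\<forall>k'\<ge>k2. cok k' k' cs" by blast
    then show ?case by (intro exI[of _ "k + k2 + Suc (treg t)"]) auto
  next
    case (6 t bd cs) then obtain k k2 where "\<forall>k'\<ge>k. cok k' k' bd" "\<forall>k'\<ge>k2. cok k' k' cs" by blast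
    then show ?case by (intro exI[of _ "k + k2 + Suc (treg t)"]) auto
  qed auto
  then show ?thesis by blast
qed

lemma cok_cnts: "ds \<in> cnts cs K \<Longrightarrow> cok k n cs \<Longrightarrow> cok k n K \<Longrightarrow> cok k n ds"
  by (induction cs K rule: cnts.induct) auto

locale mach =
  fixes prog :: "cmd list" and k thr :: nat and M :: turing_machine and NS :: nat and fl :: bool
  assumes wfM: "wf_tm M" and cokp: "cok k NS prog" and thr: "thr < k" and NS: "num_symbols M \<le> NS"
begin

text \<open>The simulated machine changes only the work track, so the origin mark and the register
  \<open>thr\<close> survive. As its tape is infinite on both sides, the flag of \<open>Sm\<close>
  records on which side of the origin the head is, \<open>True\<close> for the left one. The answer
  is \<open>fl\<close> if a bit 1 stands at position \<open>\<rho> thr\<close> or beyond; the last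
  two steps leave a single bit followed by a blank.\<close>

fun dl :: "st \<Rightarrow> sym \<Rightarrow> st \<times> sym \<times> int" where
  "dl St0 (s, og, m, g) = (Pr prog 0, (s, True, m, g), 0)"
| "dl (Pr cs ph) a = (if ph = 1 then (if fst (snd a) then (Pr cs 0, a, 0) else (Pr cs 1, a, -1)) else prd cs ph a)"
| "dl (Sm q sd) (s, og, m, g) = (if q < num_states M \<and> m < num_symbols M then
     (Sm (fst (trans M q m)) (if og then snd (snd (trans M q m)) = -1 else sd), (s, og, fst (snd (trans M q m)), g), snd (snd (trans M q m)))
     else if og then (Sc, (s, og, m, g), 0) else (Sm q sd, (s, og, m, g), if sd then 1 else -1))"
| "dl Sc (s, og, m, g) = (if m = 0 then (Bk (\<not> fl), (s, og, m, g), 0)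
     else if m = 2 \<and> thr \<notin> g then (Bk fl, (s, og, m, g), 0) else (Sc, (s, og, m, g), 1))"
| "dl (Bk b) (s, og, m, g) = (if og then (Fn, (bit_symbol b, False, 0, {}), 1) else (Bk b, (s, og, m, g), -1))"
| "dl Fn a = (Hl, (0, False, 0, {}), 0)"
| "dl Hl a = (Hl, a, 0)"

abbreviation "AS \<equiv> astep dl Hl"

definition SQ :: "st set" where
  "SQ = {St0, Sc, Fn, Hl, Bk True, Bk False} \<union> (\<lambda>(cs, ph). Pr cs ph) ` (cnts prog [] \<times> {0, 1, 2})
     \<union> (\<lambda>(q, b). Sm q b) ` ({..num_states M} \<times> UNIV)"

definition SA :: "sym set" where "SA = {..2} \<times> UNIV \<times> {..<NS} \<times> Pow {..<k}"

lemma finite_SQ: "finite SQ" by (simp add: SQ_def)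
lemma finite_SA: "finite SA" by (simp add: SA_def)

lemma PrI: "cs \<in> cnts prog [] \<Longrightarrow> ph \<in> {0,1,2} \<Longrightarrow> Pr cs ph \<in> SQ"
  unfolding SQ_def by force
lemma SmI: "q \<le> num_states M \<Longrightarrow> Sm q b \<in> SQ"
  unfolding SQ_def by force

lemma NS3: "3 \<le> NS" using wfM NS by (simp add: wf_tm_def)

lemma prd_closed:
  assumes "cs \<in> cnts prog []" "ph \<in> {0, 2}" "a \<in> SA"
  shows "fst (prd cs ph a) \<in> SQ \<and> fst (snd (prd cs ph a)) \<in> SA \<and> snd (snd (prd cs ph a)) \<in> {-1, 0, 1}"
proof -
  obtain s og m g where a: "a = (s, og, m, g)" by (metis prod_cases4)
  have ok: "cok k NS cs" using cok_cnts[OF assms(1) cokp] by simp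
  have nx: "ds \<in> nxts cs \<Longrightarrow> ds \<in> cnts prog []" for ds
    using nxts_cnts[OF assms(1)] by (cases cs) auto
  show ?thesis
  proof (cases cs)
    case Nil
    then show ?thesis using assms SmI by (simp add: a)
  next
    case (Cons c cs')
    have P0: "Pr (c # cs') 0 \<in> SQ" "Pr (c # cs') 2 \<in> SQ" using PrI[OF assms(1)] Cons by auto
    have gk: "s \<le> 2" "m < NS" "g \<subseteq> {..<k}" using assms(3) by (auto simp: a SA_def)
    show ?thesis
    proof (cases c)
      case (Inc r)
      have P1: "Pr cs' 1 \<in> SQ" using PrI nx[of cs'] Cons Inc by simp
      have "r < k" using ok Cons Inc by simp
      then show ?thesis using P0 P1 gk by (simp add: a SA_def Cons Inc)
    next
      case (Dec r)
      have P1: "Pr cs' 1 \<in> SQ" using PrI nx[of cs'] Cons Dec by simp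
      have "g - {r} \<subseteq> {..<k}" using gk by blast
      then show ?thesis using P0 P1 gk by (simp add: a SA_def Cons Dec)
    next
      case (Wr r b)
      have P1: "Pr cs' 1 \<in> SQ" using PrI nx[of cs'] Cons Wr by simp
      have "b < NS" using ok Cons Wr by simp
      then show ?thesis using P0 P1 gk by (simp add: a SA_def Cons Wr)
    next
      case (If t bd)
      have "cs' \<in> nxts cs" "bd @ cs' \<in> nxts cs" unfolding Cons If by simp_all
      then have P1: "Pr cs' 1 \<in> SQ" "Pr (bd @ cs') 1 \<in> SQ" using PrI[OF nx] by simp_all
      show ?thesis
      proof (cases "tcell t a")
        case None
        then show ?thesis using P0(1) assms(3) unfolding Cons If by simp
      next
        case (Some v)
        then show ?thesis using P1 assms(3) unfolding Cons If by (cases v) simp_all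
      qed
    next
      case (While t bd)
      have "cs' \<in> nxts cs" "bd @ While t bd # cs' \<in> nxts cs" unfolding Cons While by simp_all
      then have P1: "Pr cs' 1 \<in> SQ" "Pr (bd @ While t bd # cs') 1 \<in> SQ" using PrI[OF nx] by simp_all
      show ?thesis
      proof (cases "tcell t a")
        case None
        then show ?thesis using P0(1) assms(3) unfolding Cons While by simp
      next
        case (Some v)
        then show ?thesis using P1 assms(3) unfolding Cons While by (cases v) simp_all
      qed
    qed
  qed
qed

lemma trans_ok:
  assumes "q < num_states M" "m < num_symbols M"
  shows "fst (trans M q m) \<le> num_states M \<and> fst (snd (trans M q m)) < num_symbols M \<and> snd (snd (trans M q m)) \<in> {-1, 0, 1}"
proof -
  have "case trans M q m of (q', a', d) \<Rightarrow> q' \<le> num_states M \<and> a' < num_symbols M \<and> d \<in> {-1, 0, 1}"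
    by (rule wfM[unfolded wf_tm_def, THEN conjunct2, rule_format, OF assms])
  then show ?thesis by (simp add: split_beta)
qed

lemma closed:
  assumes "q \<in> SQ" "a \<in> SA"
  shows "fst (dl q a) \<in> SQ \<and> fst (snd (dl q a)) \<in> SA \<and> snd (snd (dl q a)) \<in> {-1, 0, 1}"
proof -
  obtain s og m g where a: "a = (s, og, m, g)" by (metis prod_cases4)
  have pr0: "Pr prog 0 \<in> SQ" using PrI[of prog 0] self_cnts[of prog "[]"] by simp
  have mem: "Sc \<in> SQ" "Fn \<in> SQ" "Hl \<in> SQ" "Bk b \<in> SQ" for b by (cases b; simp add: SQ_def)+
  show ?thesis
  proof (cases q)
    case St0
    then show ?thesis using pr0 assms a by (simp add: SA_def)
  next
    case (Pr cs ph)
    then have cp: "cs \<in> cnts prog []" "ph \<in> {0,1,2}" using assms(1) by (auto simp: SQ_def)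
    show ?thesis
    proof (cases "ph = 1")
      case True
      then show ?thesis using Pr assms PrI[OF cp(1)] by simp
    next
      case False
      then show ?thesis using prd_closed[OF cp(1) _ assms(2), of ph] cp(2) Pr by simp
    qed
  next
    case (Sm q' sd)
    then have q': "q' \<le> num_states M" using assms(1) by (auto simp: SQ_def)
    show ?thesis
    proof (cases "q' < num_states M \<and> m < num_symbols M")
      case True
      then show ?thesis using trans_ok[of q' m] SmI Sm assms(2) a NS by (auto simp: SA_def)
    next
      case False
      then show ?thesis using Sm SmI[OF q'] mem assms(2) a by (auto simp: SA_def)
    qed
  next
    case Sc
    then show ?thesis using mem assms a by (simp add: SA_def)
  next
    case (Bk b)
    then show ?thesis using mem assms a NS3 by (simp add: SA_def bit_symbol_def)
  next
    case Fn
    then show ?thesis using mem NS3 by (simp add: SA_def)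
  next
    case Hl
    then show ?thesis using mem assms by simp
  qed
qed

lemma funpow_trans: "(f ^^ t) a = b \<Longrightarrow> (f ^^ t') b = c \<Longrightarrow> (f ^^ (t + t')) a = c"
  by (metis add.commute comp_apply funpow_add)

lemma scan_right:
  assumes "Q \<noteq> Hl" "\<And>i. 0 \<le> i \<Longrightarrow> i < int n \<Longrightarrow> dl Q (tp i) = (Q, tp i, 1)"
  shows "(AS ^^ n) (Q, tp, 0) = (Q, tp, int n)"
  using assms(2)
proof (induction n)
  case (Suc n)
  have "(AS ^^ n) (Q, tp, 0) = (Q, tp, int n)" using Suc by simp
  then show ?case using Suc.prems[of "int n"] assms(1) by (simp add: astep_def fun_upd_idem)
qed simp

lemma scan_left:
  assumes "Q \<noteq> Hl" "\<And>i. 0 < i \<Longrightarrow> i \<le> int n \<Longrightarrow> dl Q (tp i) = (Q, tp i, -1)"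
  shows "(AS ^^ n) (Q, tp, int n) = (Q, tp, 0)"
  using assms(2)
proof (induction n)
  case (Suc n)
  have "AS (Q, tp, int (Suc n)) = (Q, tp, int n)" using Suc.prems[of "int (Suc n)"] assms(1) by (simp add: astep_def fun_upd_idem)
  moreover have "(AS ^^ n) (Q, tp, int n) = (Q, tp, 0)" using Suc by simp
  ultimately show ?case by (simp add: funpow_swap1[symmetric] del: funpow.simps) (metis comp_apply funpow_Suc_right)
qed simp

definition tape :: "bool list \<Rightarrow> cst \<Rightarrow> int \<Rightarrow> sym" where
  "tape x s i = (insym x i, i = 0, snd s i, {r. r < k \<and> 0 \<le> i \<and> i < int (fst s r)})"

lemma go_back: "(AS ^^ (n + 1)) (Pr cs 1, tape x s, int n) = (Pr cs 0, tape x s, 0)"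
proof -
  have "(AS ^^ n) (Pr cs 1, tape x s, int n) = (Pr cs 1, tape x s, 0)"
    by (rule scan_left) (auto simp: tape_def)
  moreover have "(AS ^^ 1) (Pr cs 1, tape x s, 0) = (Pr cs 0, tape x s, 0)"
    by (simp add: astep_def tape_def fun_upd_idem)
  ultimately show ?thesis by (rule funpow_trans)
qed

lemma act:
  assumes sc1: "\<And>i. 0 \<le> i \<Longrightarrow> i < int n \<Longrightarrow> dl (Pr cs 0) (tape x s i) = (Pr cs 0, tape x s i, 1)"
    and att: "dl (Pr cs 0) (tape x s (int n)) = (Pr cs' 1, a, 0)" and tpe: "(tape x s)(int n := a) = tape x s'"
  shows "(AS ^^ (2 * n + 2)) (Pr cs 0, tape x s, 0) = (Pr cs' 0, tape x s', 0)"
proof -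
  have 1: "(AS ^^ n) (Pr cs 0, tape x s, 0) = (Pr cs 0, tape x s, int n)"
    using sc1 by (intro scan_right) auto
  have 2: "(AS ^^ 1) (Pr cs 0, tape x s, int n) = (Pr cs' 1, tape x s', int n)"
    using att tpe by (simp add: astep_def)
  have "2 * n + 2 = n + (1 + (n + 1))" by simp
  show ?thesis unfolding \<open>2 * n + 2 = n + (1 + (n + 1))\<close> by (rule funpow_trans[OF 1 funpow_trans[OF 2 go_back]])
qed

lemma run_Inc: "r < k \<Longrightarrow> (AS ^^ (2 * \<rho> r + 2)) (Pr (Inc r # cs) 0, tape x (\<rho>, w), 0)
   = (Pr cs 0, tape x (\<rho>(r := Suc (\<rho> r)), w), 0)"
  by (rule act[where a = "(insym x (int (\<rho> r)), \<rho> r = 0, w (int (\<rho> r)), insert r {r'. r' < k \<and> \<rho> r < \<rho> r'})"])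
     (auto simp: tape_def fun_eq_iff)

lemma run_Wr: "r < k \<Longrightarrow> (AS ^^ (2 * \<rho> r + 2)) (Pr (Wr r b # cs) 0, tape x (\<rho>, w), 0)
   = (Pr cs 0, tape x (\<rho>, w(int (\<rho> r) := b)), 0)"
  by (rule act[where a = "(insym x (int (\<rho> r)), \<rho> r = 0, b, {r'. r' < k \<and> \<rho> r < \<rho> r'})"])
     (auto simp: tape_def fun_eq_iff)

text \<open>The cell to be unmarked is the last one of the block, which is recognised only from the
  first cell after it; hence one step back. Meeting that cell at the origin means 0, which stays
  0.\<close>

lemma run_Dec: assumes "r < k"
  shows "\<exists>t\<le>2 * \<rho> r + 3. (AS ^^ t) (Pr (Dec r # cs) 0, tape x (\<rho>, w), 0)
   = (Pr cs 0, tape x (\<rho>(r := \<rho> r - 1), w), 0)"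
proof (cases "\<rho> r")
  case 0
  have "(AS ^^ (2 * 0 + 2)) (Pr (Dec r # cs) 0, tape x (\<rho>, w), 0) = (Pr cs 0, tape x (\<rho>(r := \<rho> r - 1), w), 0)"
    by (rule act[where a = "tape x (\<rho>, w) 0"]) (use 0 in \<open>auto simp: tape_def fun_eq_iff\<close>)
  then show ?thesis by (intro exI[of _ "2 * 0 + 2"] conjI) simp
next
  case (Suc n)
  let ?Q = "Pr (Dec r # cs) 0"
  have 1: "(AS ^^ Suc n) (?Q, tape x (\<rho>, w), 0) = (?Q, tape x (\<rho>, w), int (Suc n))"
    using assms Suc by (intro scan_right) (auto simp: tape_def)
  have 2: "(AS ^^ 1) (?Q, tape x (\<rho>, w), int (Suc n)) = (Pr (Dec r # cs) 2, tape x (\<rho>, w), int n)"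
    using Suc by (simp add: astep_def tape_def fun_upd_idem)
  have "(tape x (\<rho>, w))(int n := (insym x (int n), n = 0, w (int n), {r'. r' < k \<and> n < \<rho> r'} - {r})) = tape x (\<rho>(r := \<rho> r - 1), w)"
    using Suc by (auto simp: tape_def fun_eq_iff)
  then have 3: "(AS ^^ 1) (Pr (Dec r # cs) 2, tape x (\<rho>, w), int n) = (Pr cs 1, tape x (\<rho>(r := \<rho> r - 1), w), int n)"
    by (simp add: astep_def tape_def)
  have "(AS ^^ (Suc n + (1 + (1 + (n + 1))))) (?Q, tape x (\<rho>, w), 0) = (Pr cs 0, tape x (\<rho>(r := \<rho> r - 1), w), 0)"
    by (rule funpow_trans[OF 1 funpow_trans[OF 2 funpow_trans[OF 3 go_back]]])
  then show ?thesis using Suc by (intro exI[of _ "Suc n + (1 + (1 + (n + 1)))"]) simp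
qed

lemma tcell_tape:
  assumes "treg t < k"
  shows "\<exists>n\<le>\<rho> (treg t). (\<forall>i. 0 \<le> i \<longrightarrow> i < int n \<longrightarrow> tcell t (tape x (\<rho>, w) i) = None) \<and>
     tcell t (tape x (\<rho>, w) (int n)) = Some (tval x \<rho> t)"
proof (cases t)
  case (NZ r)
  then show ?thesis using assms by (intro exI[of _ 0]) (auto simp: tape_def)
next
  case (In r b)
  then show ?thesis using assms by (intro exI[of _ "\<rho> r"]) (auto simp: tape_def)
next
  case (Nb r)
  then show ?thesis using assms by (intro exI[of _ "\<rho> r"]) (auto simp: tape_def)
qed

lemma run_If: assumes "treg t < k"
  shows "\<exists>n\<le>2 * \<rho> (treg t) + 2. (AS ^^ n) (Pr (If t bd # cs) 0, tape x (\<rho>, w), 0)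
    = (Pr (if tval x \<rho> t then bd @ cs else cs) 0, tape x (\<rho>, w), 0)"
proof -
  obtain n where n: "n \<le> \<rho> (treg t)" "\<forall>i. 0 \<le> i \<longrightarrow> i < int n \<longrightarrow> tcell t (tape x (\<rho>, w) i) = None"
    "tcell t (tape x (\<rho>, w) (int n)) = Some (tval x \<rho> t)" using tcell_tape[OF assms] by blast
  have "(AS ^^ (2 * n + 2)) (Pr (If t bd # cs) 0, tape x (\<rho>, w), 0)
    = (Pr (if tval x \<rho> t then bd @ cs else cs) 0, tape x (\<rho>, w), 0)"
    by (rule act[where a = "tape x (\<rho>, w) (int n)"]) (use n in \<open>auto simp: fun_upd_idem\<close>)
  then show ?thesis using n(1) by (intro exI[of _ "2 * n + 2"]) simp
qed

lemma run_While: assumes "treg t < k"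
  shows "\<exists>n\<le>2 * \<rho> (treg t) + 2. (AS ^^ n) (Pr (While t bd # cs) 0, tape x (\<rho>, w), 0)
    = (Pr (if tval x \<rho> t then bd @ While t bd # cs else cs) 0, tape x (\<rho>, w), 0)"
proof -
  obtain n where n: "n \<le> \<rho> (treg t)" "\<forall>i. 0 \<le> i \<longrightarrow> i < int n \<longrightarrow> tcell t (tape x (\<rho>, w) i) = None"
    "tcell t (tape x (\<rho>, w) (int n)) = Some (tval x \<rho> t)" using tcell_tape[OF assms] by blast
  have "(AS ^^ (2 * n + 2)) (Pr (While t bd # cs) 0, tape x (\<rho>, w), 0)
    = (Pr (if tval x \<rho> t then bd @ While t bd # cs else cs) 0, tape x (\<rho>, w), 0)"
    by (rule act[where a = "tape x (\<rho>, w) (int n)"]) (use n in \<open>auto simp: fun_upd_idem\<close>)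
  then show ?thesis using n(1) by (intro exI[of _ "2 * n + 2"]) simp
qed

lemma run_prog: "ex x cs s s' c \<Longrightarrow> cok k NS cs \<Longrightarrow>
   \<exists>t\<le>c. (AS ^^ t) (Pr cs 0, tape x s, 0) = (Pr [] 0, tape x s', 0)"
proof (induction rule: ex.induct)
  case (ex_Nil s)
  then show ?case by (intro exI[of _ 0]) simp
next
  case (ex_Inc cs \<rho> r w s c)
  then obtain t where t: "t \<le> c" "(AS ^^ t) (Pr cs 0, tape x (\<rho>(r := Suc (\<rho> r)), w), 0) = (Pr [] 0, tape x s, 0)" by auto
  show ?case using funpow_trans[OF run_Inc t(2)] t(1) ex_Inc.prems
    by (intro exI[of _ "2 * \<rho> r + 2 + t"]) simp
next
  case (ex_Dec cs \<rho> r w s c)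
  then obtain t where t: "t \<le> c" "(AS ^^ t) (Pr cs 0, tape x (\<rho>(r := \<rho> r - 1), w), 0) = (Pr [] 0, tape x s, 0)" by auto
  obtain t' where t': "t' \<le> 2 * \<rho> r + 3" "(AS ^^ t') (Pr (Dec r # cs) 0, tape x (\<rho>, w), 0)
   = (Pr cs 0, tape x (\<rho>(r := \<rho> r - 1), w), 0)" using run_Dec[of r] ex_Dec.prems by fastforce
  show ?case using funpow_trans[OF t'(2) t(2)] t(1) t'(1)
    by (intro exI[of _ "t' + t"]) simp
next
  case (ex_Wr cs \<rho> w r b s c)
  then obtain t where t: "t \<le> c" "(AS ^^ t) (Pr cs 0, tape x (\<rho>, w(int (\<rho> r) := b)), 0) = (Pr [] 0, tape x s, 0)" by auto
  show ?case using funpow_trans[OF run_Wr t(2)] t(1) ex_Wr.prems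
    by (intro exI[of _ "2 * \<rho> r + 2 + t"]) simp
next
  case (ex_If \<rho> t bd cs w s c)
  then obtain n where n: "n \<le> c" "(AS ^^ n) (Pr (if tval x \<rho> t then bd @ cs else cs) 0, tape x (\<rho>, w), 0) = (Pr [] 0, tape x s, 0)"
    by (auto split: if_splits)
  obtain n' where n': "n' \<le> 2 * \<rho> (treg t) + 2" "(AS ^^ n') (Pr (If t bd # cs) 0, tape x (\<rho>, w), 0)
    = (Pr (if tval x \<rho> t then bd @ cs else cs) 0, tape x (\<rho>, w), 0)" using run_If[of t] ex_If.prems by fastforce
  show ?case using funpow_trans[OF n'(2) n(2)] n(1) n'(1) by (intro exI[of _ "n' + n"]) simp
next
  case (ex_While \<rho> t bd cs w s c)
  then obtain n where n: "n \<le> c" "(AS ^^ n) (Pr (if tval x \<rho> t then bd @ While t bd # cs else cs) 0, tape x (\<rho>, w), 0) = (Pr [] 0, tape x s, 0)"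
    by (auto split: if_splits)
  obtain n' where n': "n' \<le> 2 * \<rho> (treg t) + 2" "(AS ^^ n') (Pr (While t bd # cs) 0, tape x (\<rho>, w), 0)
    = (Pr (if tval x \<rho> t then bd @ While t bd # cs else cs) 0, tape x (\<rho>, w), 0)" using run_While[of t] ex_While.prems by fastforce
  show ?case using funpow_trans[OF n'(2) n(2)] n(1) n'(1) by (intro exI[of _ "n' + n"]) simp
qed

end

section \<open>Running the given machine on the generated instance\<close>

lemma tm_far:
  assumes "wf_tm M" "\<And>i. w i < num_symbols M" "(tm_step M ^^ t) (0, w, 0) = (q, w', p)"
  shows "q \<le> num_states M \<and> (\<forall>i. w' i < num_symbols M) \<and> \<bar>p\<bar> \<le> int t \<and> (\<forall>i\<ge>int t. w' i = w i)"
  using assms(3)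
proof (induction t arbitrary: q w' p)
  case 0
  then show ?case using assms(2) by auto
next
  case (Suc t)
  obtain q1 w1 p1 where c: "(tm_step M ^^ t) (0, w, 0) = (q1, w1, p1)" by (metis prod_cases3)
  note IH = Suc.IH[OF c]
  have st: "tm_step M (q1, w1, p1) = (q, w', p)" using Suc.prems c by simp
  show ?case
  proof (cases "q1 < num_states M")
    case True
    have "case trans M q1 (w1 p1) of (q', a', d) \<Rightarrow> q' \<le> num_states M \<and> a' < num_symbols M \<and> d \<in> {-1, 0, 1}"
      by (rule assms(1)[unfolded wf_tm_def, THEN conjunct2, rule_format, OF True]) (use IH in blast)
    then have tr: "fst (trans M q1 (w1 p1)) \<le> num_states M" "fst (snd (trans M q1 (w1 p1))) < num_symbols M"
      "snd (snd (trans M q1 (w1 p1))) \<in> {-1, 0, 1}" by (simp_all add: split_beta)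
    have e: "q = fst (trans M q1 (w1 p1))" "w' = w1(p1 := fst (snd (trans M q1 (w1 p1))))" "p = p1 + snd (snd (trans M q1 (w1 p1)))"
      using st True by (auto simp: tm_step_def split_beta)
    have "\<bar>p\<bar> \<le> int (Suc t)" using IH tr(3) unfolding e(3) by auto
    moreover have "w' i = w i" if "int (Suc t) \<le> i" for i using IH that unfolding e(2) by auto
    moreover have "w' i < num_symbols M" for i using IH tr(2) unfolding e(2) by auto
    ultimately show ?thesis using tr(1) e(1) by blast
  next
    case False
    then have "q = q1" "w' = w1" "p = p1" using st by (auto simp: tm_step_def)
    then show ?thesis using IH by auto
  qed
qed

lemma tm_halted: "fst c = num_states M \<Longrightarrow> (tm_step M ^^ t) c = c"
proof (induction t)
  case (Suc t)
  obtain q w p where c: "c = (q, w, p)" by (metis prod_cases3)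
  have "tm_step M c = c" using Suc.prems by (simp add: c tm_step_def)
  then show ?case using Suc by simp
qed simp

context mach
begin

lemma sim_M:
  assumes w: "\<And>i. w i < num_symbols M"
    and run: "\<And>t'. t' < t \<Longrightarrow> fst ((tm_step M ^^ t') (0, w, 0)) < num_states M"
    and c: "(tm_step M ^^ t) (0, w, 0) = (q, w', p)"
  shows "\<exists>sd. (AS ^^ t) (Sm 0 False, tape x (\<rho>, w), 0) = (Sm q sd, tape x (\<rho>, w'), p) \<and> (p \<noteq> 0 \<longrightarrow> sd = (p < 0))"
  using run c
proof (induction t arbitrary: q w' p)
  case 0
  then show ?case by auto
next
  case (Suc t)
  obtain q1 w1 p1 where c: "(tm_step M ^^ t) (0, w, 0) = (q1, w1, p1)" by (metis prod_cases3)
  have q1: "q1 < num_states M" using Suc.prems(1)[of t] c by simp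
  obtain sd where sd: "(AS ^^ t) (Sm 0 False, tape x (\<rho>, w), 0) = (Sm q1 sd, tape x (\<rho>, w1), p1)" "p1 \<noteq> 0 \<longrightarrow> sd = (p1 < 0)"
    using Suc.IH[OF _ c] Suc.prems(1) by auto
  have m: "w1 p1 < num_symbols M" using tm_far[OF wfM w c] by blast
  let ?tr = "trans M q1 (w1 p1)"
  have st: "tm_step M (q1, w1, p1) = (q, w', p)" using Suc.prems c by simp
  have e: "q = fst ?tr" "w' = w1(p1 := fst (snd ?tr))" "p = p1 + snd (snd ?tr)"
    using st q1 by (auto simp: tm_step_def split_beta)
  have d: "snd (snd ?tr) \<in> {-1, 0, 1}" using trans_ok[OF q1 m] by blast
  let ?sd = "if p1 = 0 then snd (snd ?tr) = -1 else sd"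
  have "(tape x (\<rho>, w1))(p1 := (insym x p1, p1 = 0, fst (snd ?tr), {r. r < k \<and> 0 \<le> p1 \<and> p1 < int (\<rho> r)})) = tape x (\<rho>, w')"
    by (auto simp: tape_def fun_eq_iff e)
  then have "AS (Sm q1 sd, tape x (\<rho>, w1), p1) = (Sm q ?sd, tape x (\<rho>, w'), p)"
    using q1 m by (simp add: astep_def tape_def e)
  moreover have "p \<noteq> 0 \<longrightarrow> ?sd = (p < 0)" using sd(2) d e(3) by auto
  ultimately show ?case using sd(1) by (intro exI[of _ ?sd]) simp
qed

lemma go_home:
  assumes "p \<noteq> 0 \<longrightarrow> sd = (p < 0)"
  shows "(AS ^^ (nat \<bar>p\<bar> + 1)) (Sm (num_states M) sd, tape x s, p) = (Sc, tape x s, 0)"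
  using assms
proof (induction "nat \<bar>p\<bar>" arbitrary: p)
  case 0
  then show ?case by (simp add: astep_def tape_def fun_upd_idem)
next
  case (Suc n)
  let ?p = "p + (if sd then 1 else -1)"
  have p: "p \<noteq> 0" using Suc.hyps(2) by auto
  have n: "n = nat \<bar>?p\<bar>" "?p \<noteq> 0 \<longrightarrow> sd = (?p < 0)" using Suc p by auto
  have "AS (Sm (num_states M) sd, tape x s, p) = (Sm (num_states M) sd, tape x s, ?p)"
    using p by (simp add: astep_def tape_def fun_upd_idem)
  then have "(AS ^^ 1) (Sm (num_states M) sd, tape x s, p) = (Sm (num_states M) sd, tape x s, ?p)" by simp
  from funpow_trans[OF this Suc.hyps(1)[OF n]]
  have "(AS ^^ (1 + (nat \<bar>?p\<bar> + 1))) (Sm (num_states M) sd, tape x s, p) = (Sc, tape x s, 0)" .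
  moreover have "nat \<bar>p\<bar> + 1 = 1 + (nat \<bar>?p\<bar> + 1)" using Suc.hyps(2) n(1) by simp
  ultimately show ?case by simp
qed

lemma final_scan:
  assumes y: "\<And>i. i < length y \<Longrightarrow> w (int i) = bit_symbol (y ! i)" "w (int (length y)) = 0"
  shows "\<exists>t\<le>2 * length y + 3. \<exists>tp. (AS ^^ t) (Sc, tape x (\<rho>, w), 0) = (Hl, tp, 1) \<and>
     tp 0 = (bit_symbol (fl = (\<exists>i<length y. \<rho> thr \<le> i \<and> y ! i)), False, 0, {}) \<and> tp 1 = (0, False, 0, {})"
proof -
  let ?P = "\<lambda>i. i < length y \<and> \<rho> thr \<le> i \<and> y ! i"
  define b where "b = (\<exists>i. ?P i)"
  define j where "j = (if b then LEAST i. ?P i else length y)"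
  have j: "j \<le> length y" "b \<longrightarrow> ?P j" "\<And>i. i < j \<Longrightarrow> i < length y \<and> \<not> ?P i"
  proof -
    show 1: "b \<longrightarrow> ?P j" unfolding j_def b_def using LeastI_ex[of ?P] by auto
    then show "j \<le> length y" by (cases b) (auto simp: j_def)
    fix i assume i: "i < j"
    show "i < length y \<and> \<not> ?P i"
    proof (cases b)
      case True
      then have "i < (LEAST i. ?P i)" using i by (simp add: j_def)
      then show ?thesis using not_less_Least[of i ?P] 1 True i by auto
    next
      case False
      then have "j = length y" by (simp add: j_def)
      then show ?thesis using i False unfolding b_def by blast
    qed
  qed
  let ?tp = "tape x (\<rho>, w)"
  have 1: "(AS ^^ j) (Sc, ?tp, 0) = (Sc, ?tp, int j)"
  proof (rule scan_right)
    fix i :: int assume i: "0 \<le> i" "i < int j"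
    then obtain n where n: "i = int n" "n < j" using nat_0_le by (metis nat_less_iff)
    have "w i = bit_symbol (y ! n)" using y(1) j(3)[OF n(2)] n by simp
    then show "dl Sc (?tp i) = (Sc, ?tp i, 1)" using j(3)[OF n(2)] n(1) thr by (auto simp: tape_def bit_symbol_def)
  qed simp
  have 2: "(AS ^^ 1) (Sc, ?tp, int j) = (Bk (fl = b), ?tp, int j)"
  proof (cases b)
    case True
    then show ?thesis using j(2) y(1)[of j] thr by (auto simp: astep_def tape_def bit_symbol_def fun_upd_idem)
  next
    case False
    then show ?thesis using y(2) by (simp add: astep_def tape_def j_def fun_upd_idem)
  qed
  have 3: "(AS ^^ j) (Bk (fl = b), ?tp, int j) = (Bk (fl = b), ?tp, 0)" by (rule scan_left) (auto simp: tape_def)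
  let ?tp1 = "?tp(0 := (bit_symbol (fl = b), False, 0, {}))"
  have 4: "(AS ^^ 1) (Bk (fl = b), ?tp, 0) = (Fn, ?tp1, 1)" by (simp add: astep_def tape_def)
  let ?tp2 = "?tp1(1 := (0, False, 0, {}))"
  have 5: "(AS ^^ 1) (Fn, ?tp1, 1) = (Hl, ?tp2, 1)" by (simp add: astep_def)
  have r: "(AS ^^ (j + (1 + (j + (1 + 1))))) (Sc, ?tp, 0) = (Hl, ?tp2, 1)"
    by (rule funpow_trans[OF 1 funpow_trans[OF 2 funpow_trans[OF 3 funpow_trans[OF 4 5]]]])
  have bb: "b = (\<exists>i<length y. \<rho> thr \<le> i \<and> y ! i)" by (auto simp: b_def)
  show ?thesis
    by (rule exI[of _ "j + (1 + (j + (1 + 1)))"], rule conjI, use j(1) in simp, rule exI[of _ ?tp2])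
       (use r bb in auto)
qed

lemma full_run:
  assumes e: "ex x prog (\<lambda>_. 0, \<lambda>_. 0) (\<rho>, insym fx) c" and o: "outputs_within M fx t y"
  shows "\<exists>T\<le>c + 4 * t + 2 * length fx + 10. \<exists>tp. (AS ^^ T) (St0, (\<lambda>i. (insym x i, False, 0, {})), 0) = (Hl, tp, 1) \<and>
     tp 0 = (bit_symbol (fl = (\<exists>i<length y. \<rho> thr \<le> i \<and> y ! i)), False, 0, {}) \<and> tp 1 = (0, False, 0, {})"
proof -
  have ini: "init_config fx = (0, insym fx, 0)" by (simp add: init_config_def insym_def fun_eq_iff)
  have w: "insym fx i < num_symbols M" for i using wfM by (auto simp: insym_def bit_symbol_def wf_tm_def)
  obtain q w' p where ct: "(tm_step M ^^ t) (0, insym fx, 0) = (q, w', p)" by (metis prod_cases3)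
  have oo: "q = num_states M" "\<And>i. i < length y \<Longrightarrow> w' (int i) = bit_symbol (y ! i)" "w' (int (length y)) = 0"
    using o ct by (auto simp: outputs_within_def ini)
  \<comment> \<open>The composite machine leaves the simulation at the first halting configuration,
    whereas \<open>outputs_within\<close> inspects time \<open>t\<close>; a halted machine is
    constant in between.\<close>
  define t0 where "t0 = (LEAST t'. fst ((tm_step M ^^ t') (0, insym fx, 0)) = num_states M)"
  have ht: "fst ((tm_step M ^^ t) (0, insym fx, 0)) = num_states M" using ct oo by simp
  have t0: "t0 \<le> t" "fst ((tm_step M ^^ t0) (0, insym fx, 0)) = num_states M"
    unfolding t0_def
    by (rule Least_le[of "\<lambda>t'. fst ((tm_step M ^^ t') (0, insym fx, 0)) = num_states M", OF ht],
        rule LeastI[of "\<lambda>t'. fst ((tm_step M ^^ t') (0, insym fx, 0)) = num_states M", OF ht])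
  have "(tm_step M ^^ t) (0, insym fx, 0) = (tm_step M ^^ (t - t0)) ((tm_step M ^^ t0) (0, insym fx, 0))"
    using t0(1) by (metis comp_apply funpow_add le_add_diff_inverse2)
  then have ct0: "(tm_step M ^^ t0) (0, insym fx, 0) = (q, w', p)" using tm_halted[OF t0(2)] ct by metis
  have run: "fst ((tm_step M ^^ t') (0, insym fx, 0)) < num_states M" if "t' < t0" for t'
  proof -
    obtain q1 w1 p1 where c1: "(tm_step M ^^ t') (0, insym fx, 0) = (q1, w1, p1)" by (metis prod_cases3)
    have "q1 \<le> num_states M" using tm_far[OF wfM w c1] by blast
    moreover have "q1 \<noteq> num_states M" using not_less_Least[OF that[unfolded t0_def]] c1 by simp
    ultimately show ?thesis using c1 by simp
  qed
  obtain sd where sim: "(AS ^^ t0) (Sm 0 False, tape x (\<rho>, insym fx), 0) = (Sm q sd, tape x (\<rho>, w'), p)" "p \<noteq> 0 \<longrightarrow> sd = (p < 0)"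
    using sim_M[OF w run ct0] by blast
  have far: "\<bar>p\<bar> \<le> int t0" "\<And>i. int t0 \<le> i \<Longrightarrow> w' i = insym fx i" using tm_far[OF wfM w ct0] by auto
  \<comment> \<open>Cells beyond the instance that the machine has had no time to reach are blank,
    so the output is short and its scan is paid for.\<close>
  have ly: "length y \<le> t + length fx"
  proof (rule ccontr)
    assume "\<not> ?thesis"
    then have l: "t + length fx < length y" by simp
    have "w' (int (t + length fx)) = insym fx (int (t + length fx))" using t0(1) by (intro far(2)) simp
    also have "\<dots> = 0" by (simp add: insym_def)
    finally show False using oo(2)[OF l] by (auto simp: bit_symbol_def split: if_splits)
  qed
  have s0: "(AS ^^ 1) (St0, (\<lambda>i. (insym x i, False, 0, {})), 0) = (Pr prog 0, tape x (\<lambda>_. 0, \<lambda>_. 0), 0)"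
  proof -
    have "(\<lambda>i. (insym x i, False, 0::nat, {}::nat set))(0 := (insym x 0, True, 0, {})) = tape x (\<lambda>_. 0, \<lambda>_. 0)"
      by (auto simp: tape_def fun_eq_iff)
    then show ?thesis by (simp add: astep_def)
  qed
  obtain t1 where t1: "t1 \<le> c" "(AS ^^ t1) (Pr prog 0, tape x (\<lambda>_. 0, \<lambda>_. 0), 0) = (Pr [] 0, tape x (\<rho>, insym fx), 0)"
    using run_prog[OF e cokp] by blast
  have s2: "(AS ^^ 1) (Pr [] 0, tape x (\<rho>, insym fx), 0) = (Sm 0 False, tape x (\<rho>, insym fx), 0)"
    by (simp add: astep_def fun_upd_idem)
  have s3: "(AS ^^ (nat \<bar>p\<bar> + 1)) (Sm q sd, tape x (\<rho>, w'), p) = (Sc, tape x (\<rho>, w'), 0)"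
    unfolding oo(1) by (rule go_home[OF sim(2)])
  obtain t2 tp where t2: "t2 \<le> 2 * length y + 3" "(AS ^^ t2) (Sc, tape x (\<rho>, w'), 0) = (Hl, tp, 1)"
     "tp 0 = (bit_symbol (fl = (\<exists>i<length y. \<rho> thr \<le> i \<and> y ! i)), False, 0, {})" "tp 1 = (0, False, 0, {})"
    using final_scan[OF oo(2,3)] by blast
  let ?T = "1 + (t1 + (1 + (t0 + ((nat \<bar>p\<bar> + 1) + t2))))"
  have "(AS ^^ ?T) (St0, (\<lambda>i. (insym x i, False, 0, {})), 0) = (Hl, tp, 1)"
    by (rule funpow_trans[OF s0 funpow_trans[OF t1(2) funpow_trans[OF s2 funpow_trans[OF sim(1) funpow_trans[OF s3 t2(2)]]]]])
  moreover have "?T \<le> c + 4 * t + 2 * length fx + 10"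
  proof -
    have "nat \<bar>p\<bar> \<le> t" using far(1) t0(1) by simp
    then show ?thesis using t1(1) t0(1) t2(1) ly by linarith
  qed
  ultimately show ?thesis using t2(3,4) by blast
qed

end

text \<open>One machine generates the instance \<open>fx x\<close>, runs \<open>M\<close> on it and
  compares the output with the threshold \<open>e x\<close>. Because a halting configuration
  persists, the actual running time may be replaced by the polynomial bound.\<close>

theorem reduction_class_P:
  assumes wf: "wf_tm M"
    and prog: "\<And>x. \<exists>c \<rho>. c \<le> (length x + 2) ^ C1 \<and> ex x prog (\<lambda>_. 0, \<lambda>_. 0) (\<rho>, insym (fx x)) c \<and> \<rho> thr = e x"
    and out: "\<And>x. outputs_within M (fx x) (tt x) (y x)"
    and tt: "\<And>x. tt x \<le> (length x + 2) ^ C2" and len: "\<And>x. length (fx x) \<le> (length x + 2) ^ C3"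
  shows "{x. fl = (\<exists>i<length (y x). e x \<le> i \<and> y x ! i)} \<in> class_P"
proof -
  obtain k0 n0 where cok0: "cok k0 n0 prog" using cok_ex by blast
  define k where "k = k0 + Suc thr"
  define NS where "NS = n0 + num_symbols M"
  interpret mach prog k thr M NS fl
    by unfold_locales (use wf cok_mono[OF cok0, of k NS] in \<open>auto simp: k_def NS_def\<close>)
  let ?b = "\<lambda>n::nat. (n, False, 0::nat, {}::nat set)"
  have "\<exists>M' en. wf_tm M' \<and> en (?b 0) = 0 \<and> en (?b 1) = 1 \<and> en (?b 2) = 2 \<and>
    (\<forall>tp p t tp' p'. (\<forall>i. tp i \<in> SA) \<longrightarrow> (AS ^^ t) (St0, tp, p) = (Hl, tp', p') \<longrightarrow>
       (tm_step M' ^^ t) (0, en \<circ> tp, p) = (num_states M', en \<circ> tp', p'))"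
    by (rule implement[OF finite_SQ _ _ _ finite_SA]) (use closed NS3 in \<open>auto simp: SQ_def SA_def\<close>)
  then obtain M' en where M': "wf_tm M'" "en (?b 0) = 0" "en (?b 1) = 1" "en (?b 2) = 2"
    "\<And>tp p t tp' p'. (\<forall>i. tp i \<in> SA) \<Longrightarrow> (AS ^^ t) (St0, tp, p) = (Hl, tp', p') \<Longrightarrow>
       (tm_step M' ^^ t) (0, en \<circ> tp, p) = (num_states M', en \<circ> tp', p')" by blast
  define P :: "nat poly" where "P = [:2,1:] ^ C1 + [:4:] * [:2,1:] ^ C2 + [:2:] * [:2,1:] ^ C3 + [:10:]"
  have P: "poly P n = (n + 2) ^ C1 + 4 * (n + 2) ^ C2 + 2 * (n + 2) ^ C3 + 10" for n
    by (simp add: P_def add.commute)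
  let ?L = "{x. fl = (\<exists>i<length (y x). e x \<le> i \<and> y x ! i)}"
  have "outputs_within M' x (poly P (length x)) [x \<in> ?L]" for x
  proof -
    obtain c \<rho> where c: "c \<le> (length x + 2) ^ C1" "ex x prog (\<lambda>_. 0, \<lambda>_. 0) (\<rho>, insym (fx x)) c" "\<rho> thr = e x"
      using prog by blast
    obtain T tp where T: "T \<le> c + 4 * tt x + 2 * length (fx x) + 10"
      "(AS ^^ T) (St0, (\<lambda>i. (insym x i, False, 0, {})), 0) = (Hl, tp, 1)"
      "tp 0 = ?b (bit_symbol (fl = (\<exists>i<length (y x). \<rho> thr \<le> i \<and> y x ! i)))" "tp 1 = ?b 0"
      using full_run[OF c(2) out] by blast
    have TP: "T \<le> poly P (length x)" unfolding P using T(1) c(1) tt[of x] len[of x] by linarith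
    have ini: "\<forall>i. (insym x i, False, 0, {}) \<in> SA" using NS3 by (auto simp: SA_def insym_def bit_symbol_def)
    have en: "en \<circ> (\<lambda>i. (insym x i, False, 0, {})) = insym x"
      using M'(2-4) by (auto simp: fun_eq_iff insym_def bit_symbol_def)
    have r: "(tm_step M' ^^ T) (0, insym x, 0) = (num_states M', en \<circ> tp, 1)"
      using M'(5)[OF ini T(2)] en by simp
    have "(tm_step M' ^^ poly P (length x)) (0, insym x, 0) = (tm_step M' ^^ (poly P (length x) - T)) (num_states M', en \<circ> tp, 1)"
      using TP r by (metis comp_apply funpow_add le_add_diff_inverse2)
    also have "\<dots> = (num_states M', en \<circ> tp, 1)" by (rule tm_halted) simp
    finally have fin: "(tm_step M' ^^ poly P (length x)) (0, insym x, 0) = (num_states M', en \<circ> tp, 1)" .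
    have i: "init_config x = (0, insym x, 0)" by (simp add: init_config_def insym_def fun_eq_iff)
    have "en (tp 0) = bit_symbol (x \<in> ?L)" using T(3) M'(3,4) c(3) by (auto simp: bit_symbol_def)
    moreover have "en (tp 1) = 0" using T(4) M'(2) by simp
    ultimately show ?thesis by (simp add: outputs_within_def i fin)
  qed
  then show ?thesis unfolding class_P_def using M'(1) by blast
qed

section \<open>Polynomially bounded primitive recursion\<close>

text \<open>The base \<open>n + 2\<close> is at least 2, so constants, sums and products are
  absorbed by a larger exponent, even for the empty input.\<close>

definition pol :: "(nat \<Rightarrow> nat) \<Rightarrow> bool" where "pol g \<longleftrightarrow> (\<exists>C. \<forall>n. g n \<le> (n + 2) ^ C)"

lemma polI: "(\<And>n. g n \<le> (n + 2) ^ C) \<Longrightarrow> pol g" by (auto simp: pol_def)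

lemma pow_ge_Suc: "m + 1 \<le> (n + 2) ^ m" for m n :: nat
proof (induction m)
  case (Suc m)
  have "Suc m + 1 \<le> 2 * (m + 1)" by simp
  also have "\<dots> \<le> (n + 2) * (n + 2) ^ m" using Suc by (intro mult_mono) auto
  finally show ?case by simp
qed simp

lemma pol_const: "pol (\<lambda>_. c)"
proof (rule polI)
  fix n show "c \<le> (n + 2) ^ c" using pow_ge_Suc[of c n] by simp
qed

lemma pol_id: "pol (\<lambda>n. n)" by (rule polI[where C = 1]) simp

lemma pol_add: "pol f \<Longrightarrow> pol g \<Longrightarrow> pol (\<lambda>n. f n + g n)"
proof -
  assume "pol f" "pol g"
  then obtain C D where C: "\<And>n. f n \<le> (n + 2) ^ C" and D: "\<And>n. g n \<le> (n + 2) ^ D" unfolding pol_def by blast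
  show ?thesis
  proof (rule polI)
    fix n
    have "f n + g n \<le> (n + 2) ^ (C + D) + (n + 2) ^ (C + D)"
      using C[of n] D[of n] power_increasing[of C "C + D" "n + 2"] power_increasing[of D "C + D" "n + 2"]
      by (intro add_mono) (auto intro: le_trans)
    also have "\<dots> \<le> (n + 2) ^ (C + D + 1)" by simp
    finally show "f n + g n \<le> (n + 2) ^ (C + D + 1)" .
  qed
qed

lemma pol_mult: "pol f \<Longrightarrow> pol g \<Longrightarrow> pol (\<lambda>n. f n * g n)"
proof -
  assume "pol f" "pol g"
  then obtain C D where C: "\<And>n. f n \<le> (n + 2) ^ C" and D: "\<And>n. g n \<le> (n + 2) ^ D" unfolding pol_def by blast
  show ?thesis by (rule polI[where C = "C + D"]) (use C D in \<open>auto simp: power_add intro: mult_mono\<close>)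
qed

lemma pol_pow: "pol f \<Longrightarrow> pol (\<lambda>n. f n ^ c)"
  by (induction c) (auto intro: pol_const pol_mult)

lemmas pol_intros = pol_const pol_id pol_add pol_mult pol_pow

section \<open>Execution up to a time bound, and moving registers\<close>

definition exs :: "bool list \<Rightarrow> cmd list \<Rightarrow> cst \<Rightarrow> cst \<Rightarrow> nat \<Rightarrow> bool" where
  "exs x cs s s' B \<longleftrightarrow> (\<exists>c\<le>B. ex x cs s s' c)"

lemma exs_Nil: "exs x [] s s 0" unfolding exs_def using ex_Nil by blast

lemma exs_append: "exs x cs s s1 B \<Longrightarrow> exs x ds s1 s2 B' \<Longrightarrow> exs x (cs @ ds) s s2 (B + B')"
  unfolding exs_def by (meson add_mono ex_append)

lemma exs_mono: "exs x cs s s' B \<Longrightarrow> B \<le> B' \<Longrightarrow> exs x cs s s' B'"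
  unfolding exs_def using le_trans by blast

lemma exs_Inc: "exs x [Inc r] (\<rho>, w) (\<rho>(r := Suc (\<rho> r)), w) (2 * \<rho> r + 5)"
  unfolding exs_def using ex_Inc[OF ex_Nil] by fastforce
lemma exs_Dec: "exs x [Dec r] (\<rho>, w) (\<rho>(r := \<rho> r - 1), w) (2 * \<rho> r + 5)"
  unfolding exs_def using ex_Dec[OF ex_Nil] by fastforce
lemma exs_Wr: "exs x [Wr r b] (\<rho>, w) (\<rho>, w(int (\<rho> r) := b)) (2 * \<rho> r + 5)"
  unfolding exs_def using ex_Wr[OF ex_Nil] by fastforce
lemma exs_If_True: "tval x \<rho> t \<Longrightarrow> exs x bd (\<rho>, w) s B \<Longrightarrow> exs x [If t bd] (\<rho>, w) s (2 * \<rho> (treg t) + 5 + B)"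
  unfolding exs_def
proof (elim exE conjE)
  fix c assume h: "tval x \<rho> t" "c \<le> B" "ex x bd (\<rho>, w) s c"
  then show "\<exists>c\<le>2 * \<rho> (treg t) + 5 + B. ex x [If t bd] (\<rho>, w) s c"
    using ex_If[of x \<rho> t bd "[]" w s c] by (intro exI[of _ "c + (2 * \<rho> (treg t) + 5)"]) simp
qed
lemma exs_If_False: "\<not> tval x \<rho> t \<Longrightarrow> exs x [If t bd] (\<rho>, w) (\<rho>, w) (2 * \<rho> (treg t) + 5)"
  unfolding exs_def using ex_If[of x \<rho> t bd "[]" w "(\<rho>, w)" 0] ex_Nil by fastforce
lemma exs_While_False: "\<not> tval x \<rho> t \<Longrightarrow> exs x [While t bd] (\<rho>, w) (\<rho>, w) (2 * \<rho> (treg t) + 5)"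
  unfolding exs_def using ex_While[of x \<rho> t bd "[]" w "(\<rho>, w)" 0] ex_Nil by fastforce
lemma exs_While_True:
  assumes "tval x \<rho> t" "exs x bd (\<rho>, w) s1 B" "exs x [While t bd] s1 s2 B'"
  shows "exs x [While t bd] (\<rho>, w) s2 (2 * \<rho> (treg t) + 5 + B + B')"
proof -
  from exs_append[OF assms(2,3)] obtain c where c: "c \<le> B + B'" "ex x (bd @ [While t bd]) (\<rho>, w) s2 c"
    unfolding exs_def by blast
  then show ?thesis unfolding exs_def
    using ex_While[of x \<rho> t bd "[]" w s2 c] assms(1) by (intro exI[of _ "c + (2 * \<rho> (treg t) + 5)"]) simp
qed

definition clr :: "nat \<Rightarrow> cmd list" where "clr r = [While (NZ r) [Dec r]]"
definition mv :: "nat \<Rightarrow> nat \<Rightarrow> cmd list" where "mv r s = [While (NZ r) ([Dec r] @ [Inc s])]"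
definition mv2 :: "nat \<Rightarrow> nat \<Rightarrow> nat \<Rightarrow> cmd list" where "mv2 r s u = [While (NZ r) (([Dec r] @ [Inc s]) @ [Inc u])]"

lemma exs_clr: "\<rho> r = n \<Longrightarrow> exs x (clr r) (\<rho>, w) (\<rho>(r := 0), w) (Suc n * (4 * n + 10))"
proof (induction n arbitrary: \<rho>)
  case 0
  have a: "exs x (clr r) (\<rho>, w) (\<rho>, w) (2 * \<rho> (treg (NZ r)) + 5)"
    unfolding clr_def using 0 by (intro exs_While_False) simp
  have e: "\<rho>(r := 0) = \<rho>" by (rule fun_upd_idem) (rule 0)
  show ?case unfolding e by (rule exs_mono[OF a]) (simp add: 0)
next
  case (Suc n)
  have "(\<rho>(r := \<rho> r - 1)) r = n" using Suc.prems by simp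
  from Suc.IH[of "\<rho>(r := \<rho> r - 1)", OF this] have "exs x (clr r) (\<rho>(r := \<rho> r - 1), w) (\<rho>(r := 0), w) (Suc n * (4 * n + 10))"
    unfolding fun_upd_upd .
  moreover have "tval x \<rho> (NZ r)" using Suc.prems by simp
  ultimately have "exs x (clr r) (\<rho>, w) (\<rho>(r := 0), w) (2 * \<rho> (treg (NZ r)) + 5 + (2 * \<rho> r + 5) + Suc n * (4 * n + 10))"
    unfolding clr_def by (intro exs_While_True[OF _ exs_Dec])
  then show ?case by (rule exs_mono) (use Suc.prems in \<open>simp add: algebra_simps\<close>)
qed

lemma exs_mv: "r \<noteq> s \<Longrightarrow> \<rho> r = n \<Longrightarrow> \<rho> s = m \<Longrightarrow>
   exs x (mv r s) (\<rho>, w) (\<rho>(r := 0, s := m + n), w) (Suc n * (4 * (n + m) + 15))"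
proof (induction n arbitrary: \<rho> m)
  case 0
  have a: "exs x (mv r s) (\<rho>, w) (\<rho>, w) (2 * \<rho> (treg (NZ r)) + 5)"
    unfolding mv_def using 0 by (intro exs_While_False) simp
  have e: "\<rho>(r := 0, s := m + 0) = \<rho>" using 0 by (auto simp: fun_eq_iff)
  show ?case unfolding e by (rule exs_mono[OF a]) (simp add: 0)
next
  case (Suc n)
  let ?\<rho> = "\<rho>(r := \<rho> r - 1, s := Suc (\<rho> s))"
  have "exs x (mv r s) (?\<rho>, w) (?\<rho>(r := 0, s := Suc m + n), w) (Suc n * (4 * (n + Suc m) + 15))"
    using Suc.prems by (intro Suc.IH) auto
  moreover have "?\<rho>(r := 0, s := Suc m + n) = \<rho>(r := 0, s := m + Suc n)" using Suc.prems(1) by (auto simp: fun_eq_iff)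
  moreover have "exs x ([Dec r] @ [Inc s]) (\<rho>, w) (?\<rho>, w) ((2 * \<rho> r + 5) + (2 * \<rho> s + 5))"
    using exs_append[OF exs_Dec[of x r \<rho> w] exs_Inc[of x s "\<rho>(r := \<rho> r - 1)" w]] Suc.prems(1) by simp
  ultimately have a: "exs x (mv r s) (?\<rho>, w) (\<rho>(r := 0, s := m + Suc n), w) (Suc n * (4 * (n + Suc m) + 15))"
    "exs x ([Dec r] @ [Inc s]) (\<rho>, w) (?\<rho>, w) ((2 * \<rho> r + 5) + (2 * \<rho> s + 5))" by simp_all
  have "tval x \<rho> (NZ r)" using Suc.prems by simp
  from exs_While_True[OF this a(2) a(1)[unfolded mv_def]]
  have "exs x (mv r s) (\<rho>, w) (\<rho>(r := 0, s := m + Suc n), w)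
     (2 * \<rho> (treg (NZ r)) + 5 + ((2 * \<rho> r + 5) + (2 * \<rho> s + 5)) + Suc n * (4 * (n + Suc m) + 15))"
    unfolding mv_def .
  then show ?case by (rule exs_mono) (use Suc.prems in \<open>simp add: algebra_simps\<close>)
qed

lemma exs_mv2: "r \<noteq> s \<Longrightarrow> r \<noteq> u \<Longrightarrow> s \<noteq> u \<Longrightarrow> \<rho> r = n \<Longrightarrow> \<rho> s = m \<Longrightarrow> \<rho> u = m \<Longrightarrow>
   exs x (mv2 r s u) (\<rho>, w) (\<rho>(r := 0, s := m + n, u := m + n), w) (Suc n * (4 * (n + m) + 20))"
proof (induction n arbitrary: \<rho> m)
  case 0
  have a: "exs x (mv2 r s u) (\<rho>, w) (\<rho>, w) (2 * \<rho> (treg (NZ r)) + 5)"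
    unfolding mv2_def using 0 by (intro exs_While_False) simp
  have e: "\<rho>(r := 0, s := m + 0, u := m + 0) = \<rho>" using 0 by (auto simp: fun_eq_iff)
  show ?case unfolding e by (rule exs_mono[OF a]) (simp add: 0)
next
  case (Suc n)
  let ?\<rho>1 = "\<rho>(r := \<rho> r - 1, s := Suc (\<rho> s))"
  let ?\<rho> = "?\<rho>1(u := Suc (\<rho> u))"
  have "exs x (mv2 r s u) (?\<rho>, w) (?\<rho>(r := 0, s := Suc m + n, u := Suc m + n), w) (Suc n * (4 * (n + Suc m) + 20))"
    using Suc.prems by (intro Suc.IH) auto
  moreover have "?\<rho>(r := 0, s := Suc m + n, u := Suc m + n) = \<rho>(r := 0, s := m + Suc n, u := m + Suc n)"
    using Suc.prems(1-3) by (auto simp: fun_eq_iff)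
  moreover have "exs x ([Dec r] @ [Inc s]) (\<rho>, w) (?\<rho>1, w) ((2 * \<rho> r + 5) + (2 * \<rho> s + 5))"
    using exs_append[OF exs_Dec[of x r \<rho> w] exs_Inc[of x s "\<rho>(r := \<rho> r - 1)" w]] Suc.prems(1) by simp
  from exs_append[OF this exs_Inc[of x u ?\<rho>1 w]]
  have "exs x (([Dec r] @ [Inc s]) @ [Inc u]) (\<rho>, w) (?\<rho>, w) ((2 * \<rho> r + 5) + (2 * \<rho> s + 5) + (2 * \<rho> u + 5))"
    using Suc.prems(2,3) by simp
  ultimately have a: "exs x (mv2 r s u) (?\<rho>, w) (\<rho>(r := 0, s := m + Suc n, u := m + Suc n), w) (Suc n * (4 * (n + Suc m) + 20))"
    "exs x (([Dec r] @ [Inc s]) @ [Inc u]) (\<rho>, w) (?\<rho>, w) ((2 * \<rho> r + 5) + (2 * \<rho> s + 5) + (2 * \<rho> u + 5))" by simp_all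
  have "tval x \<rho> (NZ r)" using Suc.prems by simp
  from exs_While_True[OF this a(2) a(1)[unfolded mv2_def]]
  have "exs x (mv2 r s u) (\<rho>, w) (\<rho>(r := 0, s := m + Suc n, u := m + Suc n), w)
     (2 * \<rho> (treg (NZ r)) + 5 + ((2 * \<rho> r + 5) + (2 * \<rho> s + 5) + (2 * \<rho> u + 5)) + Suc n * (4 * (n + Suc m) + 20))"
    unfolding mv2_def .
  then show ?case by (rule exs_mono) (use Suc.prems in \<open>simp add: algebra_simps\<close>)
qed

type_synonym env = "bool list \<times> nat list"

definition sz :: "env \<Rightarrow> nat" where "sz \<omega> = length (fst \<omega>) + sum_list (snd \<omega>)"

definition pbound :: "nat \<Rightarrow> (env \<Rightarrow> nat) \<Rightarrow> bool" where
  "pbound k f \<longleftrightarrow> (\<exists>C. \<forall>x a. length a = k \<longrightarrow> f (x, a) \<le> (sz (x, a) + 2) ^ C)"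

text \<open>A calling convention: the arguments lie in registers below \<open>h\<close>, everything
  from \<open>h\<close> on is zero, and afterwards only \<open>h\<close> has changed. Quantifying
  over \<open>h\<close> and \<open>rs\<close> makes programs composable like frames of a stack. The
  bound on the value is part of the notion because values are stored in unary and their size is
  time.\<close>

definition pb :: "nat \<Rightarrow> (env \<Rightarrow> nat) \<Rightarrow> bool" where
  "pb k f \<longleftrightarrow> pbound k f \<and> (\<forall>h rs. length rs = k \<longrightarrow> (\<forall>r\<in>set rs. r < h) \<longrightarrow>
     (\<exists>cs C. \<forall>x \<rho> w. (\<forall>r\<ge>h. \<rho> r = 0) \<longrightarrow>
        exs x cs (\<rho>, w) (\<rho>(h := f (x, map \<rho> rs)), w) ((sz (x, map \<rho> rs) + 2) ^ C)))"

lemma pbI: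
  assumes "pbound k f"
    and "\<And>h rs. length rs = k \<Longrightarrow> \<forall>r\<in>set rs. r < h \<Longrightarrow> \<exists>cs g. pol g \<and> (\<forall>x \<rho> w. (\<forall>r\<ge>h. \<rho> r = 0) \<longrightarrow>
        exs x cs (\<rho>, w) (\<rho>(h := f (x, map \<rho> rs)), w) (g (sz (x, map \<rho> rs))))"
  shows "pb k f"
  unfolding pb_def
proof (intro conjI allI impI)
  show "pbound k f" by (rule assms)
  fix h and rs :: "nat list" assume "length rs = k" "\<forall>r\<in>set rs. r < h"
  from assms(2)[OF this] obtain cs g where g: "pol g" "\<forall>x \<rho> w. (\<forall>r\<ge>h. \<rho> r = 0) \<longrightarrow>
        exs x cs (\<rho>, w) (\<rho>(h := f (x, map \<rho> rs)), w) (g (sz (x, map \<rho> rs)))" by blast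
  from g(1) obtain C where C: "\<And>n. g n \<le> (n + 2) ^ C" unfolding pol_def by blast
  show "\<exists>cs C. \<forall>x \<rho> w. (\<forall>r\<ge>h. \<rho> r = 0) \<longrightarrow>
        exs x cs (\<rho>, w) (\<rho>(h := f (x, map \<rho> rs)), w) ((sz (x, map \<rho> rs) + 2) ^ C)"
    by (intro exI[of _ cs] exI[of _ C] allI impI) (use g(2) exs_mono[OF _ C] in blast)
qed

lemma pbE:
  assumes "pb k f" "length rs = k" "\<forall>r\<in>set rs. r < h"
  obtains cs C where "\<And>x \<rho> w. \<forall>r\<ge>h. \<rho> r = 0 \<Longrightarrow>
        exs x cs (\<rho>, w) (\<rho>(h := f (x, map \<rho> rs)), w) ((sz (x, map \<rho> rs) + 2) ^ C)"
proof -
  from assms(1) have "\<forall>h rs. length rs = k \<longrightarrow> (\<forall>r\<in>set rs. r < h) \<longrightarrow>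
     (\<exists>cs C. \<forall>x \<rho> w. (\<forall>r\<ge>h. \<rho> r = 0) \<longrightarrow>
        exs x cs (\<rho>, w) (\<rho>(h := f (x, map \<rho> rs)), w) ((sz (x, map \<rho> rs) + 2) ^ C))"
    unfolding pb_def by (rule conjunct2)
  from this[THEN spec, THEN spec, THEN mp, OF assms(2), THEN mp, OF assms(3)]
  obtain cs C where c: "\<forall>x \<rho> w. (\<forall>r\<ge>h. \<rho> r = 0) \<longrightarrow>
        exs x cs (\<rho>, w) (\<rho>(h := f (x, map \<rho> rs)), w) ((sz (x, map \<rho> rs) + 2) ^ C)" by (elim exE)
  show thesis by (rule that[of cs C]) (use c in simp)
qed

lemma pb_boundE:
  assumes "pb k f" obtains C where "\<And>x a. length a = k \<Longrightarrow> f (x, a) \<le> (sz (x, a) + 2) ^ C"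
  using assms unfolding pb_def pbound_def by blast

lemma pbound_polI: "pol g \<Longrightarrow> (\<And>x a. length a = k \<Longrightarrow> f (x, a) \<le> g (sz (x, a))) \<Longrightarrow> pbound k f"
  unfolding pol_def pbound_def by (meson le_trans)

lemma pb_cong:
  assumes "pb k f" "\<And>x a. length a = k \<Longrightarrow> f (x, a) = f' (x, a)" shows "pb k f'"
proof (rule pbI)
  obtain C where "\<And>x a. length a = k \<Longrightarrow> f (x, a) \<le> (sz (x, a) + 2) ^ C" using pb_boundE[OF assms(1)] by blast
  then show "pbound k f'" unfolding pbound_def using assms(2) by metis
  fix h and rs :: "nat list" assume h: "length rs = k" "\<forall>r\<in>set rs. r < h"
  obtain cs C where c: "\<And>x \<rho> w. \<forall>r\<ge>h. \<rho> r = 0 \<Longrightarrow>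
        exs x cs (\<rho>, w) (\<rho>(h := f (x, map \<rho> rs)), w) ((sz (x, map \<rho> rs) + 2) ^ C)" using pbE[OF assms(1) h] by blast
  have e: "f (x, map \<rho> rs) = f' (x, map \<rho> rs)" for x \<rho> using assms(2) h(1) by simp
  show "\<exists>cs g. pol g \<and> (\<forall>x \<rho> w. (\<forall>r\<ge>h. \<rho> r = 0) \<longrightarrow>
        exs x cs (\<rho>, w) (\<rho>(h := f' (x, map \<rho> rs)), w) (g (sz (x, map \<rho> rs))))"
    by (intro exI[of _ cs] exI[of _ "\<lambda>n. (n + 2) ^ C"] conjI pol_intros) (use c e in simp)
qed

lemma pb_0: "pb k (\<lambda>_. 0)"
proof (rule pbI)
  show "pbound k (\<lambda>_. 0)" by (simp add: pbound_def)
  show "\<exists>cs g. pol g \<and> (\<forall>x \<rho> w. (\<forall>r\<ge>h. \<rho> r = 0) \<longrightarrow>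
        exs x cs (\<rho>, w) (\<rho>(h := 0), w) (g (sz (x, map \<rho> rs))))" for h rs
    by (intro exI[of _ "[]"] exI[of _ "\<lambda>n. 0"] conjI pol_const) (auto simp: fun_upd_idem exs_Nil)
qed

lemma pb_Suc: assumes "pb k f" shows "pb k (\<lambda>\<omega>. Suc (f \<omega>))"
proof (rule pbI)
  obtain B where B: "\<And>x a. length a = k \<Longrightarrow> f (x, a) \<le> (sz (x, a) + 2) ^ B" using pb_boundE[OF assms] by blast
  have "pol (\<lambda>n. (n + 2) ^ B + 1)" by (intro pol_intros)
  then show "pbound k (\<lambda>\<omega>. Suc (f \<omega>))" by (rule pbound_polI) (use B in simp)
  fix h and rs :: "nat list" assume h: "length rs = k" "\<forall>r\<in>set rs. r < h"
  obtain cs C where c: "\<And>x \<rho> w. \<forall>r\<ge>h. \<rho> r = 0 \<Longrightarrow>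
        exs x cs (\<rho>, w) (\<rho>(h := f (x, map \<rho> rs)), w) ((sz (x, map \<rho> rs) + 2) ^ C)" using pbE[OF assms h] by blast
  show "\<exists>cs g. pol g \<and> (\<forall>x \<rho> w. (\<forall>r\<ge>h. \<rho> r = 0) \<longrightarrow>
        exs x cs (\<rho>, w) (\<rho>(h := Suc (f (x, map \<rho> rs))), w) (g (sz (x, map \<rho> rs))))"
  proof (intro exI[of _ "cs @ [Inc h]"] exI[of _ "\<lambda>n. (n + 2) ^ C + (2 * (n + 2) ^ B + 5)"] conjI allI impI)
    show "pol (\<lambda>n. (n + 2) ^ C + (2 * (n + 2) ^ B + 5))" by (intro pol_intros)
    fix x \<rho> w assume z: "\<forall>r\<ge>h. \<rho> r = (0::nat)"
    from exs_append[OF c[OF z] exs_Inc[of x h "\<rho>(h := f (x, map \<rho> rs))" w]]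
    show "exs x (cs @ [Inc h]) (\<rho>, w) (\<rho>(h := Suc (f (x, map \<rho> rs))), w)
        ((sz (x, map \<rho> rs) + 2) ^ C + (2 * (sz (x, map \<rho> rs) + 2) ^ B + 5))"
      using B[of "map \<rho> rs" x] h(1) by (auto elim!: exs_mono)
  qed
qed

definition vr :: "nat \<Rightarrow> env \<Rightarrow> nat" where "vr i \<omega> = snd \<omega> ! i"

text \<open>Moving a register empties it; the value is therefore moved into two registers at once
  and one of them is moved back.\<close>

lemma pb_vr: assumes "i < k" shows "pb k (vr i)"
proof (rule pbI)
  have le: "a ! i \<le> sz (x, a)" if "length a = k" for x a
    using member_le_sum_list[of "a ! i" a] that assms by (simp add: sz_def)
  show "pbound k (vr i)" by (rule pbound_polI[OF pol_id]) (use le in \<open>simp add: vr_def\<close>)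
  fix h and rs :: "nat list" assume h: "length rs = k" "\<forall>r\<in>set rs. r < h"
  let ?r = "rs ! i"
  have r: "?r < h" using h assms by simp
  show "\<exists>cs g. pol g \<and> (\<forall>x \<rho> w. (\<forall>r\<ge>h. \<rho> r = 0) \<longrightarrow>
        exs x cs (\<rho>, w) (\<rho>(h := vr i (x, map \<rho> rs)), w) (g (sz (x, map \<rho> rs))))"
  proof (intro exI[of _ "mv2 ?r h (Suc h) @ mv (Suc h) ?r"] exI[of _ "\<lambda>n. (n + 1) * (4 * n + 20) + (n + 1) * (4 * n + 15)"] conjI allI impI)
    show "pol (\<lambda>n. (n + 1) * (4 * n + 20) + (n + 1) * (4 * n + 15))" by (intro pol_intros)
    fix x \<rho> w assume z: "\<forall>r\<ge>h. \<rho> r = (0::nat)"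
    let ?v = "\<rho> ?r"
    have v: "vr i (x, map \<rho> rs) = ?v" using assms h by (simp add: vr_def)
    have vle: "?v \<le> sz (x, map \<rho> rs)" using le[of "map \<rho> rs" x] h(1) assms by simp
    let ?\<rho>1 = "\<rho>(?r := 0, h := ?v, Suc h := ?v)"
    have 1: "exs x (mv2 ?r h (Suc h)) (\<rho>, w) (?\<rho>1, w) (Suc ?v * (4 * ?v + 20))"
      using exs_mv2[of ?r h "Suc h" \<rho> ?v 0 x w] r z by simp
    have 2: "exs x (mv (Suc h) ?r) (?\<rho>1, w) (?\<rho>1(Suc h := 0, ?r := 0 + ?v), w) (Suc ?v * (4 * (?v + 0) + 15))"
      using r by (intro exs_mv) auto
    have "?\<rho>1(Suc h := 0, ?r := 0 + ?v) = \<rho>(h := ?v)" using r z by (auto simp: fun_eq_iff)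
    then have "exs x (mv2 ?r h (Suc h) @ mv (Suc h) ?r) (\<rho>, w) (\<rho>(h := ?v), w) (Suc ?v * (4 * ?v + 20) + Suc ?v * (4 * (?v + 0) + 15))"
      using exs_append[OF 1 2] by simp
    then show "exs x (mv2 ?r h (Suc h) @ mv (Suc h) ?r) (\<rho>, w) (\<rho>(h := vr i (x, map \<rho> rs)), w)
       ((sz (x, map \<rho> rs) + 1) * (4 * sz (x, map \<rho> rs) + 20) + (sz (x, map \<rho> rs) + 1) * (4 * sz (x, map \<rho> rs) + 15))"
      unfolding v by (rule exs_mono) (use vle in \<open>intro add_mono mult_mono, auto\<close>)
  qed
qed

lemma pb_let:
  assumes g: "pb k g" and f: "pb (Suc k) f"
  shows "pb k (\<lambda>\<omega>. f (fst \<omega>, g \<omega> # snd \<omega>))"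
proof (rule pbI)
  obtain B where B: "\<And>x a. length a = k \<Longrightarrow> g (x, a) \<le> (sz (x, a) + 2) ^ B" using pb_boundE[OF g] by blast
  obtain B' where B': "\<And>x a. length a = Suc k \<Longrightarrow> f (x, a) \<le> (sz (x, a) + 2) ^ B'" using pb_boundE[OF f] by blast
  let ?n' = "\<lambda>n. (n + (n + 2) ^ B + 2)"
  have sz: "sz (x, g (x, a) # a) + 2 \<le> ?n' (sz (x, a))" if "length a = k" for x a
    using B[OF that, of x] by (simp add: sz_def)
  have f_le: "f (x, g (x, a) # a) \<le> ?n' (sz (x, a)) ^ B'" if "length a = k" for x a
    using B'[of "g (x, a) # a" x] that power_mono[OF sz[OF that, of x], of B'] by (simp add: order_trans)
  have "pol (\<lambda>n. ?n' n ^ B')" by (intro pol_intros)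
  then show "pbound k (\<lambda>\<omega>. f (fst \<omega>, g \<omega> # snd \<omega>))" by (rule pbound_polI) (use f_le in simp)
  fix h and rs :: "nat list" assume h: "length rs = k" "\<forall>r\<in>set rs. r < h"
  obtain cs C where c: "\<And>x \<rho> w. \<forall>r\<ge>h. \<rho> r = 0 \<Longrightarrow>
        exs x cs (\<rho>, w) (\<rho>(h := g (x, map \<rho> rs)), w) ((sz (x, map \<rho> rs) + 2) ^ C)" using pbE[OF g h] by blast
  have h2: "length (h # rs) = Suc k" "\<forall>r\<in>set (h # rs). r < Suc h" using h by auto
  obtain ds D where d: "\<And>x \<rho> w. \<forall>r\<ge>Suc h. \<rho> r = 0 \<Longrightarrow>
        exs x ds (\<rho>, w) (\<rho>(Suc h := f (x, map \<rho> (h # rs))), w) ((sz (x, map \<rho> (h # rs)) + 2) ^ D)"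
    using pbE[OF f h2] by blast
  let ?G = "\<lambda>n. (n + 2) ^ C + ?n' n ^ D + (((n + 2) ^ B + 1) * (4 * (n + 2) ^ B + 10)) + ((?n' n ^ B' + 1) * (4 * ?n' n ^ B' + 15))"
  show "\<exists>cs g'. pol g' \<and> (\<forall>x \<rho> w. (\<forall>r\<ge>h. \<rho> r = 0) \<longrightarrow>
        exs x cs (\<rho>, w) (\<rho>(h := f (fst (x, map \<rho> rs), g (x, map \<rho> rs) # snd (x, map \<rho> rs))), w) (g' (sz (x, map \<rho> rs))))"
  proof (intro exI[of _ "((cs @ ds) @ clr h) @ mv (Suc h) h"] exI[of _ ?G] conjI allI impI)
    show "pol ?G" by (intro pol_intros)
    fix x \<rho> w assume z: "\<forall>r\<ge>h. \<rho> r = (0::nat)"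
    let ?n = "sz (x, map \<rho> rs)" and ?gv = "g (x, map \<rho> rs)"
    let ?fv = "f (x, ?gv # map \<rho> rs)"
    let ?\<rho>1 = "\<rho>(h := ?gv)"
    have m1: "map ?\<rho>1 (h # rs) = ?gv # map \<rho> rs" using h(2) by auto
    have len: "length (map \<rho> rs) = k" using h by simp
    have 1: "exs x cs (\<rho>, w) (?\<rho>1, w) ((?n + 2) ^ C)" by (rule c[OF z])
    have "exs x ds (?\<rho>1, w) (?\<rho>1(Suc h := ?fv), w) ((sz (x, ?gv # map \<rho> rs) + 2) ^ D)"
      using d[of ?\<rho>1 x w] z unfolding m1 by simp
    then have 2: "exs x ds (?\<rho>1, w) (?\<rho>1(Suc h := ?fv), w) (?n' ?n ^ D)"
      by (rule exs_mono) (rule power_mono[OF sz[OF len]], simp)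
    have 3: "exs x (clr h) (?\<rho>1(Suc h := ?fv), w) (?\<rho>1(Suc h := ?fv, h := 0), w) (Suc ?gv * (4 * ?gv + 10))"
      by (rule exs_clr) simp
    have 4: "exs x (mv (Suc h) h) (?\<rho>1(Suc h := ?fv, h := 0), w) (?\<rho>1(Suc h := ?fv, h := 0, Suc h := 0, h := 0 + ?fv), w) (Suc ?fv * (4 * (?fv + 0) + 15))"
      by (rule exs_mv) auto
    have e: "?\<rho>1(Suc h := ?fv, h := 0, Suc h := 0, h := 0 + ?fv) = \<rho>(h := ?fv)" using z by (auto simp: fun_eq_iff)
    have all: "exs x (((cs @ ds) @ clr h) @ mv (Suc h) h) (\<rho>, w) (\<rho>(h := ?fv), w)
       ((?n + 2) ^ C + ?n' ?n ^ D + Suc ?gv * (4 * ?gv + 10) + Suc ?fv * (4 * (?fv + 0) + 15))"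
      using exs_append[OF exs_append[OF exs_append[OF 1 2] 3] 4] unfolding e .
    show "exs x (((cs @ ds) @ clr h) @ mv (Suc h) h) (\<rho>, w)
       (\<rho>(h := f (fst (x, map \<rho> rs), g (x, map \<rho> rs) # snd (x, map \<rho> rs))), w) (?G ?n)"
      unfolding fst_conv snd_conv
      by (rule exs_mono[OF all], intro add_mono mult_mono) (use B[OF len, of x] f_le[OF len, of x] in simp_all)
  qed
qed

text \<open>Reindexing of arguments. Weakening and the exchange of bound variables are instances,
  and only addresses change, so the same program serves.\<close>

lemma pb_proj:
  assumes f: "pb j f" and js: "length js = j" "\<And>i. i \<in> set js \<Longrightarrow> i < k"
  shows "pb k (\<lambda>\<omega>. f (fst \<omega>, map (\<lambda>i. snd \<omega> ! i) js))"
proof (rule pbI)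
  have szle: "sz (x, map (\<lambda>i. a ! i) js) \<le> Suc j * sz (x, a)" if a: "length a = k" for x and a :: "nat list"
  proof -
    have "sum_list (map (\<lambda>i. a ! i) js) \<le> sum_list (map (\<lambda>i. sum_list a) js)"
      using js(2) a by (intro sum_list_mono member_le_sum_list) auto
    also have "\<dots> = j * sum_list a" using js(1) by (simp add: sum_list_triv)
    finally show ?thesis unfolding sz_def by (simp add: algebra_simps)
  qed
  obtain B where B: "\<And>x a. length a = j \<Longrightarrow> f (x, a) \<le> (sz (x, a) + 2) ^ B" using pb_boundE[OF f] by blast
  have pl: "pol (\<lambda>n. (Suc j * n + 2) ^ C)" for C by (intro pol_intros)
  show "pbound k (\<lambda>\<omega>. f (fst \<omega>, map (\<lambda>i. snd \<omega> ! i) js))"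
  proof (rule pbound_polI[OF pl[of B]])
    fix x and a :: "nat list" assume a: "length a = k"
    have "f (x, map (\<lambda>i. a ! i) js) \<le> (sz (x, map (\<lambda>i. a ! i) js) + 2) ^ B" using B js(1) by simp
    also have "\<dots> \<le> (Suc j * sz (x, a) + 2) ^ B" using szle[OF a, of x] by (intro power_mono) auto
    finally show "f (fst (x, a), map (\<lambda>i. snd (x, a) ! i) js) \<le> (Suc j * sz (x, a) + 2) ^ B" by simp
  qed
  fix h and rs :: "nat list" assume h: "length rs = k" "\<forall>r\<in>set rs. r < h"
  have h2: "length (map (\<lambda>i. rs ! i) js) = j" "\<forall>r\<in>set (map (\<lambda>i. rs ! i) js). r < h" using h js by auto
  obtain cs C where c: "\<And>x \<rho> w. \<forall>r\<ge>h. \<rho> r = 0 \<Longrightarrow>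
        exs x cs (\<rho>, w) (\<rho>(h := f (x, map \<rho> (map (\<lambda>i. rs ! i) js))), w) ((sz (x, map \<rho> (map (\<lambda>i. rs ! i) js)) + 2) ^ C)"
    using pbE[OF f h2] by blast
  have m: "map \<rho> (map (\<lambda>i. rs ! i) js) = map (\<lambda>i. map \<rho> rs ! i) js" for \<rho> :: "nat \<Rightarrow> nat" using js(2) h(1) by auto
  show "\<exists>cs g. pol g \<and> (\<forall>x \<rho> w. (\<forall>r\<ge>h. \<rho> r = 0) \<longrightarrow>
        exs x cs (\<rho>, w) (\<rho>(h := f (fst (x, map \<rho> rs), map (\<lambda>i. snd (x, map \<rho> rs) ! i) js)), w) (g (sz (x, map \<rho> rs))))"
  proof (intro exI[of _ cs] exI[of _ "\<lambda>n. (Suc j * n + 2) ^ C"] conjI pl allI impI)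
    fix x \<rho> w assume z: "\<forall>r\<ge>h. \<rho> r = (0::nat)"
    have "(sz (x, map (\<lambda>i. map \<rho> rs ! i) js) + 2) ^ C \<le> (Suc j * sz (x, map \<rho> rs) + 2) ^ C"
      using szle[of "map \<rho> rs" x] h(1) by (intro power_mono) auto
    from exs_mono[OF c[OF z, of x w, unfolded m] this]
    show "exs x cs (\<rho>, w) (\<rho>(h := f (fst (x, map \<rho> rs), map (\<lambda>i. snd (x, map \<rho> rs) ! i) js)), w) ((Suc j * sz (x, map \<rho> rs) + 2) ^ C)"
      by simp
  qed
qed

text \<open>Argument lists are environments in the manner of de Bruijn: \<open>vr 0\<close> is the
  variable bound last, and \<open>drp\<close> leaves its scope.\<close>

definition drp :: "env \<Rightarrow> env" where "drp \<omega> = (fst \<omega>, tl (snd \<omega>))"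

lemma fst_drp [simp]: "fst (drp \<omega>) = fst \<omega>" by (simp add: drp_def)
lemma drp_Cons [simp]: "drp (x, n # a) = (x, a)" by (simp add: drp_def)
lemma vr_0 [simp]: "vr 0 (x, n # a) = n" by (simp add: vr_def)
lemma vr_Suc [simp]: "vr (Suc i) (x, n # a) = vr i (x, a)" by (simp add: vr_def)
lemma vr_1 [simp]: "vr 1 (x, n # a) = vr 0 (x, a)" by (simp add: vr_def)

lemma pb_weak: assumes "pb k f" shows "pb (Suc k) (\<lambda>\<omega>. f (drp \<omega>))"
proof (rule pb_cong[OF pb_proj[OF assms, of "[1..<Suc k]" "Suc k"]])
  fix x and a :: "nat list" assume "length a = Suc k"
  then have "map (\<lambda>i. a ! i) [1..<Suc k] = tl a" by (intro nth_equalityI) (auto simp: nth_tl simp del: upt_Suc)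
  then show "f (fst (x, a), map (\<lambda>i. snd (x, a) ! i) [1..<Suc k]) = f (drp (x, a))" by (simp add: drp_def del: upt_Suc)
qed auto

lemma pb_take: assumes "pb j f" "j \<le> k" shows "pb k (\<lambda>\<omega>. f (fst \<omega>, take j (snd \<omega>)))"
proof (rule pb_cong[OF pb_proj[OF assms(1), of "[0..<j]" k]])
  fix x and a :: "nat list" assume "length a = k"
  then have "map (\<lambda>i. a ! i) [0..<j] = take j a" using assms(2) by (intro nth_equalityI) auto
  then show "f (fst (x, a), map (\<lambda>i. snd (x, a) ! i) [0..<j]) = f (fst (x, a), take j (snd (x, a)))" by simp
qed (use assms in auto)

lemma pb_op1: assumes "pb 1 (\<lambda>\<omega>. F (fst \<omega>) (vr 0 \<omega>))" "pb k f" shows "pb k (\<lambda>\<omega>. F (fst \<omega>) (f \<omega>))"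
  by (rule pb_cong[OF pb_let[OF assms(2) pb_take[OF assms(1)]]]) auto

lemma pb_op2: assumes "pb 2 (\<lambda>\<omega>. F (vr 1 \<omega>) (vr 0 \<omega>))" "pb k f" "pb k g" shows "pb k (\<lambda>\<omega>. F (f \<omega>) (g \<omega>))"
proof -
  have "pb (Suc k) (\<lambda>\<omega>. g (drp \<omega>))" by (rule pb_weak[OF assms(3)])
  from pb_let[OF this pb_take[OF assms(1), of "Suc (Suc k)"]]
  have "pb (Suc k) (\<lambda>\<omega>. F (vr 1 (fst \<omega>, take 2 (g (drp \<omega>) # snd \<omega>))) (g (drp \<omega>)))" by simp
  from pb_let[OF assms(2) this] show ?thesis by (rule pb_cong) (simp add: numeral_2_eq_2)
qed

lemma pb_const: "pb k (\<lambda>_. c)"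
  by (induction c) (auto intro: pb_0 pb_Suc)

primrec prec :: "(env \<Rightarrow> nat) \<Rightarrow> (env \<Rightarrow> nat) \<Rightarrow> env \<Rightarrow> nat \<Rightarrow> nat" where
  "prec b s \<omega> 0 = b \<omega>"
| "prec b s \<omega> (Suc n) = s (fst \<omega>, n # prec b s \<omega> n # snd \<omega>)"

text \<open>Recursion becomes a counting loop. The uniform bound \<open>bd\<close> on all
  intermediate values is essential: iterated doubling has harmless steps but exponential
  values.\<close>

lemma pb_rec:
  assumes g: "pb k g" and b: "pb k b" and s: "pb (Suc (Suc k)) s"
    and bd: "\<And>x a n. length a = k \<Longrightarrow> n \<le> g (x, a) \<Longrightarrow> prec b s (x, a) n \<le> (sz (x, a) + 2) ^ C0"
  shows "pb k (\<lambda>\<omega>. prec b s \<omega> (g \<omega>))"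
proof (rule pbI)
  show "pbound k (\<lambda>\<omega>. prec b s \<omega> (g \<omega>))" unfolding pbound_def using bd by blast
  obtain Bg where Bg: "\<And>x a. length a = k \<Longrightarrow> g (x, a) \<le> (sz (x, a) + 2) ^ Bg" using pb_boundE[OF g] by blast
  fix h and rs :: "nat list" assume h: "length rs = k" "\<forall>r\<in>set rs. r < h"
  obtain cg Cg where cg: "\<And>x \<rho> w. \<forall>r\<ge>h. \<rho> r = 0 \<Longrightarrow>
      exs x cg (\<rho>, w) (\<rho>(h := g (x, map \<rho> rs)), w) ((sz (x, map \<rho> rs) + 2) ^ Cg)" using pbE[OF g h] by blast
  have h1: "\<forall>r\<in>set rs. r < h + 1" using h by auto
  obtain cb Cb where cb: "\<And>x \<rho> w. \<forall>r\<ge>h + 1. \<rho> r = 0 \<Longrightarrow>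
      exs x cb (\<rho>, w) (\<rho>(h + 1 := b (x, map \<rho> rs)), w) ((sz (x, map \<rho> rs) + 2) ^ Cb)" using pbE[OF b h(1) h1] by blast
  have h3: "length ((h + 2) # (h + 1) # rs) = Suc (Suc k)" "\<forall>r\<in>set ((h + 2) # (h + 1) # rs). r < h + 3" using h by auto
  obtain cs Cs where cs: "\<And>x \<rho> w. \<forall>r\<ge>h + 3. \<rho> r = 0 \<Longrightarrow>
      exs x cs (\<rho>, w) (\<rho>(h + 3 := s (x, map \<rho> ((h + 2) # (h + 1) # rs))), w) ((sz (x, map \<rho> ((h + 2) # (h + 1) # rs)) + 2) ^ Cs)"
    using pbE[OF s h3] by blast
  let ?G = "\<lambda>n::nat. (n + 2) ^ Bg" and ?V = "\<lambda>n::nat. (n + 2) ^ C0"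
  let ?it = "\<lambda>n. (2 * ?G n + 5) + (n + ?G n + ?V n + 2) ^ Cs + (?V n + 1) * (4 * ?V n + 10) + (?V n + 1) * (4 * ?V n + 15) + (2 * ?G n + 5)"
  let ?body = "((([Dec h] @ cs) @ clr (h + 1)) @ mv (h + 3) (h + 1)) @ [Inc (h + 2)]"
  let ?prog = "(((cg @ cb) @ [While (NZ h) ?body]) @ clr (h + 2)) @ mv (h + 1) h"
  let ?tot = "\<lambda>n. (n + 2) ^ Cg + (n + 2) ^ Cb + (?G n + 1) * (2 * ?G n + 5 + ?it n) + (?G n + 1) * (4 * ?G n + 10) + (?V n + 1) * (4 * ?V n + 15)"
  show "\<exists>cs g'. pol g' \<and> (\<forall>x \<rho> w. (\<forall>r\<ge>h. \<rho> r = 0) \<longrightarrow>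
      exs x cs (\<rho>, w) (\<rho>(h := prec b s (x, map \<rho> rs) (g (x, map \<rho> rs))), w) (g' (sz (x, map \<rho> rs))))"
  proof (intro exI[of _ ?prog] exI[of _ ?tot] conjI allI impI)
    show "pol ?tot" by (intro pol_intros)
    fix x and \<rho> :: "nat \<Rightarrow> nat" and w assume z: "\<forall>r\<ge>h. \<rho> r = 0"
    let ?a = "map \<rho> rs" and ?n = "sz (x, map \<rho> rs)"
    define N where "N = g (x, ?a)"
    define R where "R j = prec b s (x, ?a) j" for j
    have la: "length ?a = k" using h by simp
    have NB: "N \<le> ?G ?n" using Bg[OF la] by (simp add: N_def)
    have RB: "R j \<le> ?V ?n" if "j \<le> N" for j using bd[OF la, of j x] that by (simp add: R_def N_def)
    \<comment> \<open>Layout of the loop: remaining rounds in \<open>h\<close>, the accumulator in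
      \<open>h + 1\<close>, the index in \<open>h + 2\<close>; \<open>h + 3\<close> receives the
      result of a step.\<close>
    define st where "st j = \<rho>(h := N - j, h + 1 := R j, h + 2 := j)" for j
    have mapst: "map (\<rho>(h := p, h + 1 := p', h + 2 := p'')) rs = ?a" for p p' p'' using h(2) by auto
    have body: "exs x ?body (st j, w) (st (Suc j), w) (?it ?n)" if j: "j < N" for j
    proof -
      let ?s1 = "(st j)(h := N - Suc j)"
      have 1: "exs x [Dec h] (st j, w) (?s1, w) (2 * ?G ?n + 5)"
      proof -
        have "st j h = N - j" "st j h - 1 = N - Suc j" by (simp_all add: st_def)
        then show ?thesis using exs_Dec[of x h "st j" w] NB by (auto elim!: exs_mono)
      qed
      have m: "map ?s1 ((h + 2) # (h + 1) # rs) = j # R j # ?a"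
        using h(2) by (auto simp: st_def)
      have "\<forall>r\<ge>h + 3. ?s1 r = 0" using z by (auto simp: st_def)
      from cs[of ?s1 x w, OF this, unfolded m]
      have "exs x cs (?s1, w) (?s1(h + 3 := R (Suc j)), w) ((sz (x, j # R j # ?a) + 2) ^ Cs)" by (simp add: R_def)
      moreover have "sz (x, j # R j # ?a) + 2 \<le> ?n + ?G ?n + ?V ?n + 2"
        using RB[of j] NB j by (simp add: sz_def)
      ultimately have 2: "exs x cs (?s1, w) (?s1(h + 3 := R (Suc j)), w) ((?n + ?G ?n + ?V ?n + 2) ^ Cs)"
        by (rule exs_mono[OF _ power_mono]) simp
      let ?s2 = "?s1(h + 3 := R (Suc j))"
      have "exs x (clr (h + 1)) (?s2, w) (?s2(h + 1 := 0), w) (Suc (R j) * (4 * R j + 10))"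
        by (rule exs_clr) (simp add: st_def)
      then have 3: "exs x (clr (h + 1)) (?s2, w) (?s2(h + 1 := 0), w) ((?V ?n + 1) * (4 * ?V ?n + 10))"
        by (rule exs_mono) (use RB[of j] j in \<open>intro mult_mono, auto\<close>)
      let ?s3 = "?s2(h + 1 := 0)"
      have "exs x (mv (h + 3) (h + 1)) (?s3, w) (?s3(h + 3 := 0, h + 1 := 0 + R (Suc j)), w) (Suc (R (Suc j)) * (4 * (R (Suc j) + 0) + 15))"
        by (rule exs_mv) auto
      then have 4: "exs x (mv (h + 3) (h + 1)) (?s3, w) (?s3(h + 3 := 0, h + 1 := 0 + R (Suc j)), w) ((?V ?n + 1) * (4 * ?V ?n + 15))"
        by (rule exs_mono) (use RB[of "Suc j"] j in \<open>intro mult_mono, auto\<close>)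
      let ?s4 = "?s3(h + 3 := 0, h + 1 := 0 + R (Suc j))"
      have s4: "?s4 (h + 2) = j" by (simp add: st_def)
      have e: "?s4(h + 2 := Suc (?s4 (h + 2))) = st (Suc j)" unfolding s4 using z by (auto simp: st_def fun_eq_iff)
      have "exs x [Inc (h + 2)] (?s4, w) (st (Suc j), w) (2 * ?s4 (h + 2) + 5)"
        using exs_Inc[of x "h + 2" ?s4 w] unfolding e .
      then have 5: "exs x [Inc (h + 2)] (?s4, w) (st (Suc j), w) (2 * ?G ?n + 5)"
        unfolding s4 by (rule exs_mono) (use NB j in simp)
      show ?thesis by (rule exs_append[OF exs_append[OF exs_append[OF exs_append[OF 1 2] 3] 4] 5])
    qed
    have loop: "exs x [While (NZ h) ?body] (st (N - i), w) (st N, w) (Suc i * (2 * ?G ?n + 5 + ?it ?n))" if "i \<le> N" for i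
      using that
    proof (induction i)
      case 0
      have "\<not> tval x (st N) (NZ h)" by (simp add: st_def)
      from exs_While_False[OF this, of ?body w] show ?case
        unfolding diff_zero by (rule exs_mono) (simp add: st_def)
    next
      case (Suc i)
      have "tval x (st (N - Suc i)) (NZ h)" using Suc.prems by (simp add: st_def)
      moreover have "exs x ?body (st (N - Suc i), w) (st (N - i), w) (?it ?n)"
        using body[of "N - Suc i"] Suc.prems by (simp add: Suc_diff_Suc)
      moreover have "exs x [While (NZ h) ?body] (st (N - i), w) (st N, w) (Suc i * (2 * ?G ?n + 5 + ?it ?n))"
        using Suc by simp
      ultimately have w: "exs x [While (NZ h) ?body] (st (N - Suc i), w) (st N, w)
         (2 * st (N - Suc i) (treg (NZ h)) + 5 + ?it ?n + Suc i * (2 * ?G ?n + 5 + ?it ?n))"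
        by (rule exs_While_True)
      have "st (N - Suc i) (treg (NZ h)) \<le> ?G ?n" using NB by (simp add: st_def)
      then have "2 * st (N - Suc i) (treg (NZ h)) + 5 + ?it ?n + Suc i * (2 * ?G ?n + 5 + ?it ?n) \<le> (2 * ?G ?n + 5 + ?it ?n) + Suc i * (2 * ?G ?n + 5 + ?it ?n)"
        by (intro add_mono) auto
      also have "\<dots> = Suc (Suc i) * (2 * ?G ?n + 5 + ?it ?n)" by (simp only: mult_Suc)
      finally show ?case by (rule exs_mono[OF w])
    qed
    have 1: "exs x cg (\<rho>, w) (\<rho>(h := N), w) ((?n + 2) ^ Cg)" using cg[OF z] by (simp add: N_def)
    have m: "map (\<rho>(h := N)) rs = ?a" using h(2) by auto
    have "\<forall>r\<ge>h + 1. (\<rho>(h := N)) r = 0" using z by auto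
    from cb[of "\<rho>(h := N)" x w, OF this, unfolded m]
    have "exs x cb (\<rho>(h := N), w) (\<rho>(h := N, h + 1 := R 0), w) ((?n + 2) ^ Cb)" by (simp add: R_def)
    moreover have "\<rho>(h := N, h + 1 := R 0) = st 0" using z by (auto simp: st_def fun_eq_iff)
    ultimately have 2: "exs x cb (\<rho>(h := N), w) (st 0, w) ((?n + 2) ^ Cb)" by simp
    have 3: "exs x [While (NZ h) ?body] (st 0, w) (st N, w) ((?G ?n + 1) * (2 * ?G ?n + 5 + ?it ?n))"
      by (rule exs_mono[OF loop[of N, OF le_refl, unfolded diff_self_eq_0]], rule mult_right_mono) (use NB in auto)
    have "exs x (clr (h + 2)) (st N, w) ((st N)(h + 2 := 0), w) (Suc N * (4 * N + 10))" by (rule exs_clr) (simp add: st_def)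
    then have 4: "exs x (clr (h + 2)) (st N, w) ((st N)(h + 2 := 0), w) ((?G ?n + 1) * (4 * ?G ?n + 10))"
      by (rule exs_mono) (use NB in \<open>intro mult_mono, auto\<close>)
    let ?s = "(st N)(h + 2 := 0)"
    have "exs x (mv (h + 1) h) (?s, w) (?s(h + 1 := 0, h := 0 + R N), w) (Suc (R N) * (4 * (R N + 0) + 15))"
      by (rule exs_mv) (auto simp: st_def)
    then have 5: "exs x (mv (h + 1) h) (?s, w) (?s(h + 1 := 0, h := 0 + R N), w) ((?V ?n + 1) * (4 * ?V ?n + 15))"
      by (rule exs_mono) (use RB[of N] in \<open>intro mult_mono, auto\<close>)
    have e: "?s(h + 1 := 0, h := 0 + R N) = \<rho>(h := R N)" using z by (auto simp: st_def fun_eq_iff)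
    have "exs x ?prog (\<rho>, w) (?s(h + 1 := 0, h := 0 + R N), w) (?tot ?n)"
      by (rule exs_append[OF exs_append[OF exs_append[OF exs_append[OF 1 2] 3] 4] 5])
    then show "exs x ?prog (\<rho>, w) (\<rho>(h := prec b s (x, map \<rho> rs) (g (x, map \<rho> rs))), w) (?tot ?n)"
      unfolding e by (simp only: R_def N_def)
  qed
qed

lemma pb_recn:
  assumes g: "pb k g" and b: "pb k b" and s: "pb (Suc (Suc k)) (\<lambda>\<omega>. F (drp (drp \<omega>)) (vr 0 \<omega>) (vr 1 \<omega>))"
    and bd: "pol B" "\<And>x a n. length a = k \<Longrightarrow> n \<le> g (x, a) \<Longrightarrow> rec_nat (b (x, a)) (F (x, a)) n \<le> B (sz (x, a))"
  shows "pb k (\<lambda>\<omega>. rec_nat (b \<omega>) (F \<omega>) (g \<omega>))"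
proof -
  let ?s = "\<lambda>\<omega>. F (drp (drp \<omega>)) (vr 0 \<omega>) (vr 1 \<omega>)"
  have e: "prec b ?s \<omega> n = rec_nat (b \<omega>) (F \<omega>) n" for \<omega> n
    by (induction n) (auto simp: drp_def vr_def)
  obtain C where C: "\<And>n. B n \<le> (n + 2) ^ C" using bd(1) unfolding pol_def by blast
  have "pb k (\<lambda>\<omega>. prec b ?s \<omega> (g \<omega>))"
    by (rule pb_rec[OF g b s, where ?C0.0 = C]) (use bd(2) C e le_trans in metis)
  then show ?thesis by (simp only: e)
qed

section \<open>Closure under arithmetic, predicates and bounded search\<close>

lemma vr_le_sz: "i < length a \<Longrightarrow> vr i (x, a) \<le> sz (x, a)"
  using member_le_sum_list[of "a ! i" a] by (simp add: sz_def vr_def)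

lemma pb_add: assumes "pb k f" "pb k g" shows "pb k (\<lambda>\<omega>. f \<omega> + g \<omega>)"
proof (rule pb_op2[OF _ assms])
  have r: "rec_nat m (\<lambda>n acc. Suc acc) n = m + n" for m n :: nat by (induction n) auto
  have "pb 2 (\<lambda>\<omega>. rec_nat (vr 1 \<omega>) (\<lambda>n acc. Suc acc) (vr 0 \<omega>))"
  proof (rule pb_recn[where B = "\<lambda>n. n + n"])
    show "pb (Suc (Suc 2)) (\<lambda>\<omega>. Suc (vr 1 \<omega>))" by (rule pb_Suc, rule pb_vr) simp
    show "pol (\<lambda>n. n + n)" by (intro pol_intros)
    fix x a n assume "length (a::nat list) = 2" "n \<le> vr 0 (x, a)"
    then show "rec_nat (vr 1 (x, a)) (\<lambda>n acc. Suc acc) n \<le> sz (x, a) + sz (x, a)"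
      using vr_le_sz[of 0 a x] vr_le_sz[of 1 a x] unfolding r by simp
  qed (rule pb_vr, simp)+
  then show "pb 2 (\<lambda>\<omega>. vr 1 \<omega> + vr 0 \<omega>)" by (simp only: r)
qed

lemma pb_pred: assumes "pb k f" shows "pb k (\<lambda>\<omega>. f \<omega> - 1)"
proof -
  have r: "rec_nat 0 (\<lambda>n acc. n) n = n - 1" for n :: nat by (cases n) auto
  obtain C where C: "\<And>x a. length a = k \<Longrightarrow> f (x, a) \<le> (sz (x, a) + 2) ^ C" using pb_boundE[OF assms] by blast
  have "pb k (\<lambda>\<omega>. rec_nat 0 (\<lambda>n acc. n) (f \<omega>))"
  proof (rule pb_recn[where b = "\<lambda>_. 0" and F = "\<lambda>_ n acc. n", OF assms pb_0])
    show "pb (Suc (Suc k)) (vr 0)" by (rule pb_vr) simp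
    show "pol (\<lambda>n. (n + 2) ^ C)" by (intro pol_intros)
    fix x a n assume h: "length (a::nat list) = k" "n \<le> f (x, a)"
    show "rec_nat 0 (\<lambda>n acc. n) n \<le> (sz (x, a) + 2) ^ C" unfolding r using C[OF h(1), of x] h(2) by linarith
  qed
  then show ?thesis by (simp only: r)
qed

lemma pb_diff: assumes "pb k f" "pb k g" shows "pb k (\<lambda>\<omega>. f \<omega> - g \<omega>)"
proof (rule pb_op2[OF _ assms])
  have r: "rec_nat m (\<lambda>n acc. acc - 1) n = m - n" for m n :: nat by (induction n) auto
  have "pb 2 (\<lambda>\<omega>. rec_nat (vr 1 \<omega>) (\<lambda>n acc. acc - 1) (vr 0 \<omega>))"
  proof (rule pb_recn[where B = "\<lambda>n. n"])
    show "pb (Suc (Suc 2)) (\<lambda>\<omega>. vr 1 \<omega> - 1)" by (rule pb_pred, rule pb_vr) simp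
    show "pol (\<lambda>n. n)" by (intro pol_intros)
    fix x a n assume "length (a::nat list) = 2" "n \<le> vr 0 (x, a)"
    then show "rec_nat (vr 1 (x, a)) (\<lambda>n acc. acc - 1) n \<le> sz (x, a)"
      using vr_le_sz[of 1 a x] unfolding r by simp
  qed (rule pb_vr, simp)+
  then show "pb 2 (\<lambda>\<omega>. vr 1 \<omega> - vr 0 \<omega>)" by (simp only: r)
qed

lemma pb_sum: assumes f: "pb (Suc k) (\<lambda>\<omega>. F (drp \<omega>) (vr 0 \<omega>))" and b: "pb k b"
  shows "pb k (\<lambda>\<omega>. \<Sum>y<b \<omega>. F \<omega> y)"
proof -
  have r: "rec_nat 0 (\<lambda>n acc. acc + F \<omega> n) n = (\<Sum>y<n. F \<omega> y)" for \<omega> n by (induction n) auto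
  obtain B where B: "\<And>x a. length a = k \<Longrightarrow> b (x, a) \<le> (sz (x, a) + 2) ^ B" using pb_boundE[OF b] by blast
  obtain C where C: "\<And>x a. length a = Suc k \<Longrightarrow> F (drp (x, a)) (vr 0 (x, a)) \<le> (sz (x, a) + 2) ^ C" using pb_boundE[OF f] by blast
  have "pb k (\<lambda>\<omega>. rec_nat 0 (\<lambda>n acc. acc + F \<omega> n) (b \<omega>))"
  proof (rule pb_recn[where b = "\<lambda>_. 0" and F = "\<lambda>\<omega> n acc. acc + F \<omega> n" and B = "\<lambda>n. (n + 2) ^ B * (n + (n + 2) ^ B + 2) ^ C", OF b pb_0])
    \<comment> \<open>The body of the loop sees index, accumulator and arguments; the summand
      depends on index and arguments, so the accumulator is projected away.\<close>
    have "pb (Suc (Suc k)) (\<lambda>\<omega>. (\<lambda>\<omega>. F (drp \<omega>) (vr 0 \<omega>)) (fst \<omega>, map (\<lambda>i. snd \<omega> ! i) (0 # [2..<Suc (Suc k)])))"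
      by (rule pb_proj[OF f]) auto
    then have "pb (Suc (Suc k)) (\<lambda>\<omega>. F (drp (drp \<omega>)) (vr 0 \<omega>))"
    proof (rule pb_cong)
      fix x and a :: "nat list" assume "length a = Suc (Suc k)"
      then have "map (\<lambda>i. a ! i) [2..<Suc (Suc k)] = tl (tl a)" by (intro nth_equalityI) (auto simp: nth_tl numeral_2_eq_2 simp del: upt_Suc)
      then show "F (drp (fst (x, a), map (\<lambda>i. snd (x, a) ! i) (0 # [2..<Suc (Suc k)]))) (vr 0 (fst (x, a), map (\<lambda>i. snd (x, a) ! i) (0 # [2..<Suc (Suc k)])))
         = F (drp (drp (x, a))) (vr 0 (x, a))" by (simp add: drp_def vr_def del: upt_Suc)
    qed
    then show "pb (Suc (Suc k)) (\<lambda>\<omega>. vr 1 \<omega> + F (drp (drp \<omega>)) (vr 0 \<omega>))"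
      by (rule pb_add[rotated]) (rule pb_vr, simp)
    show "pol (\<lambda>n. (n + 2) ^ B * (n + (n + 2) ^ B + 2) ^ C)" by (intro pol_intros)
    fix x a n assume h: "length (a::nat list) = k" "n \<le> b (x, a)"
    have "(\<Sum>y<n. F (x, a) y) \<le> (\<Sum>y<n. (sz (x, a) + (sz (x, a) + 2) ^ B + 2) ^ C)"
    proof (rule sum_mono)
      fix y assume y: "y \<in> {..<n}"
      have "F (x, a) y \<le> (sz (x, y # a) + 2) ^ C" using C[of "y # a" x] h(1) by simp
      also have "sz (x, y # a) + 2 \<le> sz (x, a) + (sz (x, a) + 2) ^ B + 2" using y h B[OF h(1), of x] by (simp add: sz_def)
      then have "(sz (x, y # a) + 2) ^ C \<le> (sz (x, a) + (sz (x, a) + 2) ^ B + 2) ^ C" by (rule power_mono) simp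
      finally show "F (x, a) y \<le> (sz (x, a) + (sz (x, a) + 2) ^ B + 2) ^ C" .
    qed
    also have "\<dots> = n * (sz (x, a) + (sz (x, a) + 2) ^ B + 2) ^ C" by simp
    also have "\<dots> \<le> (sz (x, a) + 2) ^ B * (sz (x, a) + (sz (x, a) + 2) ^ B + 2) ^ C"
      using h(2) B[OF h(1), of x] by (intro mult_right_mono) auto
    finally show "rec_nat 0 (\<lambda>n acc. acc + F (x, a) n) n \<le> (sz (x, a) + 2) ^ B * (sz (x, a) + (sz (x, a) + 2) ^ B + 2) ^ C"
      unfolding r .
  qed
  then show ?thesis by (simp only: r)
qed

lemma pb_mult: assumes "pb k f" "pb k g" shows "pb k (\<lambda>\<omega>. f \<omega> * g \<omega>)"
proof -
  have "pb k (\<lambda>\<omega>. \<Sum>y<f \<omega>. g \<omega>)" by (rule pb_sum[where F = "\<lambda>\<omega> y. g \<omega>", OF pb_weak[OF assms(2)] assms(1)])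
  then show ?thesis by simp
qed

definition pbP :: "nat \<Rightarrow> (env \<Rightarrow> bool) \<Rightarrow> bool" where "pbP k P \<longleftrightarrow> pb k (\<lambda>\<omega>. of_bool (P \<omega>))"

lemma pbP_I: "pb k f \<Longrightarrow> (\<And>x a. length a = k \<Longrightarrow> f (x, a) = of_bool (P (x, a))) \<Longrightarrow> pbP k P"
  unfolding pbP_def by (rule pb_cong)

lemma pbP_le: "pb k f \<Longrightarrow> pb k g \<Longrightarrow> pbP k (\<lambda>\<omega>. f \<omega> \<le> g \<omega>)"
  by (rule pbP_I[where f = "\<lambda>\<omega>. 1 - (f \<omega> - g \<omega>)"]) (auto intro: pb_diff pb_const)
lemma pbP_less: "pb k f \<Longrightarrow> pb k g \<Longrightarrow> pbP k (\<lambda>\<omega>. f \<omega> < g \<omega>)"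
  using pbP_le[of k "\<lambda>\<omega>. Suc (f \<omega>)" g] pb_Suc[of k f] by (simp add: Suc_le_eq)
lemma pbP_not: "pbP k P \<Longrightarrow> pbP k (\<lambda>\<omega>. \<not> P \<omega>)"
  unfolding pbP_def by (rule pb_cong[where f = "\<lambda>\<omega>. 1 - of_bool (P \<omega>)"]) (auto intro: pb_diff pb_const)
lemma pbP_conj: "pbP k P \<Longrightarrow> pbP k Q \<Longrightarrow> pbP k (\<lambda>\<omega>. P \<omega> \<and> Q \<omega>)"
  unfolding pbP_def by (rule pb_cong[where f = "\<lambda>\<omega>. of_bool (P \<omega>) * of_bool (Q \<omega>)"]) (auto intro: pb_mult)
lemma pbP_disj: "pbP k P \<Longrightarrow> pbP k Q \<Longrightarrow> pbP k (\<lambda>\<omega>. P \<omega> \<or> Q \<omega>)"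
  using pbP_not[OF pbP_conj[OF pbP_not pbP_not], of k P Q] by simp
lemma pbP_imp: "pbP k P \<Longrightarrow> pbP k Q \<Longrightarrow> pbP k (\<lambda>\<omega>. P \<omega> \<longrightarrow> Q \<omega>)"
  using pbP_disj[OF pbP_not, of k P Q] by simp
lemma pbP_eq: "pb k f \<Longrightarrow> pb k g \<Longrightarrow> pbP k (\<lambda>\<omega>. f \<omega> = g \<omega>)"
  using pbP_conj[OF pbP_le[of k f g] pbP_le[of k g f]] by (simp add: order_eq_iff)
lemma pbP_const: "pbP k (\<lambda>\<omega>. c)" unfolding pbP_def by (rule pb_const)

lemma pbP_bex: assumes "pbP (Suc k) (\<lambda>\<omega>. P (drp \<omega>) (vr 0 \<omega>))" "pb k b"
  shows "pbP k (\<lambda>\<omega>. \<exists>y<b \<omega>. P \<omega> y)"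
proof -
  have "pbP k (\<lambda>\<omega>. 0 < (\<Sum>y<b \<omega>. of_bool (P \<omega> y) :: nat))"
    by (rule pbP_less[OF pb_0], rule pb_sum[where F = "\<lambda>\<omega> y. of_bool (P \<omega> y)", OF assms(1)[unfolded pbP_def] assms(2)])
  moreover have "0 < (\<Sum>y<b \<omega>. of_bool (P \<omega> y) :: nat) \<longleftrightarrow> (\<exists>y<b \<omega>. P \<omega> y)" for \<omega>
    by (auto simp: sum_pos2 neq0_conv[symmetric] simp del: neq0_conv)
  ultimately show ?thesis by (simp only:)
qed

lemma pbP_ball: assumes "pbP (Suc k) (\<lambda>\<omega>. P (drp \<omega>) (vr 0 \<omega>))" "pb k b"
  shows "pbP k (\<lambda>\<omega>. \<forall>y<b \<omega>. P \<omega> y)"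
  using pbP_not[OF pbP_bex[where P = "\<lambda>\<omega> y. \<not> P \<omega> y", OF pbP_not[OF assms(1)] assms(2)]] by simp

lemma pb_if: assumes "pbP k P" "pb k f" "pb k g" shows "pb k (\<lambda>\<omega>. if P \<omega> then f \<omega> else g \<omega>)"
  by (rule pb_cong[where f = "\<lambda>\<omega>. of_bool (P \<omega>) * f \<omega> + (1 - of_bool (P \<omega>)) * g \<omega>"])
     (use assms in \<open>auto intro!: pb_add pb_mult pb_diff pb_const simp: pbP_def\<close>)

lemma pb_of_bool: "pbP k P \<Longrightarrow> pb k (\<lambda>\<omega>. of_bool (P \<omega>))" by (simp add: pbP_def)

lemma pb_min: "pb k f \<Longrightarrow> pb k g \<Longrightarrow> pb k (\<lambda>\<omega>. min (f \<omega>) (g \<omega>))"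
  by (rule pb_cong[where f = "\<lambda>\<omega>. f \<omega> - (f \<omega> - g \<omega>)"]) (auto intro: pb_diff)

lemma div_count: "(\<Sum>j<a. of_bool (0 < b \<and> Suc j * b \<le> a)) = a div (b::nat)"
proof (cases "b = 0")
  case False
  have "j < a \<and> Suc j * b \<le> a \<longleftrightarrow> j < a div b" for j
  proof -
    have "Suc j * b \<le> a \<longleftrightarrow> Suc j \<le> a div b" using False by (simp only: less_eq_div_iff_mult_less_eq neq0_conv)
    moreover have "j < a" if "j < a div b" using that div_le_dividend[of a b] by linarith
    ultimately show ?thesis by (auto simp only: Suc_le_eq)
  qed
  then have "{j. j < a \<and> Suc j * b \<le> a} = {..<a div b}" by auto
  moreover have "(\<Sum>j<a. of_bool (0 < b \<and> Suc j * b \<le> a)) = card {j. j < a \<and> Suc j * b \<le> a}"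
    using False by (simp add: sum_of_bool_eq Int_def del: mult_Suc)
  ultimately show ?thesis by simp
qed simp

lemma pb_div: assumes "pb k f" "pb k g" shows "pb k (\<lambda>\<omega>. f \<omega> div g \<omega>)"
proof -
  have "pb k (\<lambda>\<omega>. \<Sum>j<f \<omega>. of_bool (0 < g \<omega> \<and> Suc j * g \<omega> \<le> f \<omega>))"
    by (rule pb_sum[where F = "\<lambda>\<omega> j. of_bool (0 < g \<omega> \<and> Suc j * g \<omega> \<le> f \<omega>)"])
       (intro pb_of_bool pbP_conj pbP_less pbP_le pb_0 pb_weak pb_mult pb_Suc pb_vr assms zero_less_Suc)+
  then show ?thesis by (simp only: div_count)
qed

lemma pb_mod: assumes "pb k f" "pb k g" shows "pb k (\<lambda>\<omega>. f \<omega> mod g \<omega>)"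
  by (rule pb_cong[OF pb_diff[OF assms(1) pb_mult[OF pb_div[OF assms] assms(2)]]]) (simp add: minus_div_mult_eq_mod)

text \<open>Bounded minimisation as a sum: it counts the \<open>y\<close> up to which no witness has
  occurred, and equals \<open>n\<close> if there is none.\<close>

definition mu :: "nat \<Rightarrow> (nat \<Rightarrow> bool) \<Rightarrow> nat" where
  "mu n P = (\<Sum>y<n. of_bool (\<forall>z<Suc y. \<not> P z))"

lemma mu_Least: assumes "P y" "y < n" shows "mu n P = (LEAST y. P y)"
proof -
  let ?m = "LEAST y. P y"
  have m: "P ?m" "?m < n" using LeastI[of P y] Least_le[of P y] assms by auto
  have "(\<forall>z<Suc y. \<not> P z) \<longleftrightarrow> y < ?m" for y
    using m(1) not_less_Least[of _ P] by (metis less_Suc_eq_le less_le_trans not_le le_imp_less_Suc)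
  then have "mu n P = card {y. y < n \<and> y < ?m}" by (simp add: mu_def sum_of_bool_eq Int_def)
  also have "{y. y < n \<and> y < ?m} = {..<?m}" using m(2) by auto
  finally show ?thesis by simp
qed

lemma pb_mu: assumes "pbP (Suc k) (\<lambda>\<omega>. P (drp \<omega>) (vr 0 \<omega>))" "pb k b"
  shows "pb k (\<lambda>\<omega>. mu (b \<omega>) (P \<omega>))"
  unfolding mu_def
proof (rule pb_sum[OF _ assms(2)], rule pb_of_bool, rule pbP_ball[where P = "\<lambda>\<omega> z. \<not> P (drp \<omega>) z"])
  have "pb (Suc (Suc k)) (\<lambda>\<omega>. (\<lambda>\<omega>. of_bool (P (drp \<omega>) (vr 0 \<omega>))) (fst \<omega>, map (\<lambda>i. snd \<omega> ! i) (0 # [2..<Suc (Suc k)])))"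
    by (rule pb_proj[OF assms(1)[unfolded pbP_def]]) auto
  then have "pbP (Suc (Suc k)) (\<lambda>\<omega>. P (drp (drp \<omega>)) (vr 0 \<omega>))"
  proof (rule pbP_I)
    fix x and a :: "nat list" assume "length a = Suc (Suc k)"
    then have "map (\<lambda>i. a ! i) [2..<Suc (Suc k)] = tl (tl a)" by (intro nth_equalityI) (auto simp: nth_tl numeral_2_eq_2 simp del: upt_Suc)
    then show "of_bool (P (drp (fst (x, a), map (\<lambda>i. snd (x, a) ! i) (0 # [2..<Suc (Suc k)]))) (vr 0 (fst (x, a), map (\<lambda>i. snd (x, a) ! i) (0 # [2..<Suc (Suc k)]))))
         = of_bool (P (drp (drp (x, a))) (vr 0 (x, a)))" by (simp add: drp_def vr_def del: upt_Suc)
  qed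
  then show "pbP (Suc (Suc k)) (\<lambda>\<omega>. \<not> P (drp (drp \<omega>)) (vr 0 \<omega>))" by (rule pbP_not)
  show "pb (Suc k) (\<lambda>\<omega>. Suc (vr 0 \<omega>))" by (rule pb_Suc, rule pb_vr) simp
qed

text \<open>Powers leave every polynomial bound, so they are computed with a cap. Capping after
  every multiplication gives the same as capping at the end, since a factor of at least 1 does not
  bring a product below the cap again and a factor 0 yields 0 in both cases.\<close>

lemma pb_powt: assumes "pb k b" "pb k e" "pb k c" shows "pb k (\<lambda>\<omega>. min (b \<omega> ^ e \<omega>) (c \<omega>))"
proof -
  have r: "rec_nat (min 1 (c \<omega>)) (\<lambda>n acc. min (acc * b \<omega>) (c \<omega>)) n = min (b \<omega> ^ n) (c \<omega>)" for \<omega> n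
  proof (induction n)
    case (Suc n)
    have "min (min (b \<omega> ^ n) (c \<omega>) * b \<omega>) (c \<omega>) = min (b \<omega> ^ n * b \<omega>) (c \<omega>)"
    proof (cases "b \<omega> = 0 \<or> b \<omega> ^ n \<le> c \<omega>")
      case True
      then show ?thesis by (auto simp: min_absorb1)
    next
      case False
      then have b: "1 \<le> b \<omega>" "c \<omega> < b \<omega> ^ n" by auto
      have "b \<omega> ^ n * 1 \<le> b \<omega> ^ n * b \<omega>" "c \<omega> * 1 \<le> c \<omega> * b \<omega>" using b(1) by (intro mult_left_mono; simp)+
      then have "c \<omega> \<le> b \<omega> ^ n * b \<omega>" "c \<omega> \<le> c \<omega> * b \<omega>" using b(2) by linarith+
      then show ?thesis using less_imp_le[OF b(2)] by (simp only: min_absorb2)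
    qed
    then show ?case using Suc by (simp add: mult.commute)
  qed simp
  obtain C where C: "\<And>x a. length a = k \<Longrightarrow> c (x, a) \<le> (sz (x, a) + 2) ^ C" using pb_boundE[OF assms(3)] by blast
  have "pb k (\<lambda>\<omega>. rec_nat (min 1 (c \<omega>)) (\<lambda>n acc. min (acc * b \<omega>) (c \<omega>)) (e \<omega>))"
  proof (rule pb_recn[where b = "\<lambda>\<omega>. min 1 (c \<omega>)" and F = "\<lambda>\<omega> n acc. min (acc * b \<omega>) (c \<omega>)" and B = "\<lambda>n. (n + 2) ^ C", OF assms(2)])
    show "pb k (\<lambda>\<omega>. min 1 (c \<omega>))" by (intro pb_min pb_const assms)
    show "pb (Suc (Suc k)) (\<lambda>\<omega>. min (vr 1 \<omega> * b (drp (drp \<omega>))) (c (drp (drp \<omega>))))"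
    proof (intro pb_min pb_mult)
      show "pb (Suc (Suc k)) (vr 1)" by (rule pb_vr) simp
      show "pb (Suc (Suc k)) (\<lambda>\<omega>. b (drp (drp \<omega>)))" by (rule pb_weak[OF pb_weak[OF assms(1)]])
      show "pb (Suc (Suc k)) (\<lambda>\<omega>. c (drp (drp \<omega>)))" by (rule pb_weak[OF pb_weak[OF assms(3)]])
    qed
    show "pol (\<lambda>n. (n + 2) ^ C)" by (intro pol_intros)
    fix x a n assume "length (a::nat list) = k"
    then show "rec_nat (min 1 (c (x, a))) (\<lambda>n acc. min (acc * b (x, a)) (c (x, a))) n \<le> (sz (x, a) + 2) ^ C"
      unfolding r using C by (simp add: min.coboundedI2)
  qed
  then show ?thesis by (simp only: r)
qed

lemma pb_insym: assumes "pb k f" shows "pb k (\<lambda>\<omega>. insym (fst \<omega>) (int (f \<omega>)))"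
proof (rule pb_op1[where F = "\<lambda>x n. insym x (int n)", OF _ assms], rule pbI)
  have v: "insym x i = 0 \<or> insym x i = 1 \<or> insym x i = 2" for x i by (auto simp: insym_def bit_symbol_def)
  have "insym x i \<le> 2" for x i by (auto simp: insym_def bit_symbol_def)
  then show "pbound 1 (\<lambda>\<omega>. insym (fst \<omega>) (int (vr 0 \<omega>)))" by (intro pbound_polI[OF pol_const]) simp
  fix h and rs :: "nat list" assume h: "length rs = 1" "\<forall>r\<in>set rs. r < h"
  obtain r where r: "rs = [r]" using h(1) by (metis One_nat_def length_0_conv length_Suc_conv)
  have rh: "r \<noteq> h" using h(2) r by auto
  let ?cs = "[If (In r 1) [Inc h]] @ [If (In r 2) ([Inc h] @ [Inc h])]"
  show "\<exists>cs g. pol g \<and> (\<forall>x \<rho> w. (\<forall>r\<ge>h. \<rho> r = 0) \<longrightarrow>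
      exs x cs (\<rho>, w) (\<rho>(h := insym (fst (x, map \<rho> rs)) (int (vr 0 (x, map \<rho> rs)))), w) (g (sz (x, map \<rho> rs))))"
  proof (intro exI[of _ ?cs] exI[of _ "\<lambda>n. 4 * n + 50"] conjI allI impI)
    show "pol (\<lambda>n. 4 * n + 50)" by (intro pol_intros)
    fix x and \<rho> :: "nat \<Rightarrow> nat" and w assume z: "\<forall>r\<ge>h. \<rho> r = 0"
    let ?v = "insym x (int (\<rho> r))"
    have sz: "\<rho> r \<le> sz (x, [\<rho> r])" by (simp add: sz_def)
    have I1: "exs x [Inc h] (\<rho>, w) (\<rho>(h := 1), w) 5" using exs_Inc[of x h \<rho> w] z by simp
    have I2: "exs x [Inc h] (\<rho>(h := 1), w) (\<rho>(h := 2), w) 7" using exs_Inc[of x h "\<rho>(h := 1)" w] by (simp add: numeral_2_eq_2)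
    have "exs x ?cs (\<rho>, w) (\<rho>(h := ?v), w) (4 * \<rho> r + 50)"
      using v[of x "int (\<rho> r)"]
    proof (elim disjE)
      assume v0: "?v = 0"
      have e: "\<rho>(h := ?v) = \<rho>" unfolding v0 by (rule fun_upd_idem) (use z in simp)
      have "exs x ?cs (\<rho>, w) (\<rho>, w) ((2 * \<rho> (treg (In r 1)) + 5) + (2 * \<rho> (treg (In r 2)) + 5))"
        by (rule exs_append[OF exs_If_False exs_If_False]) (use v0 in simp_all)
      then show ?thesis unfolding e by (rule exs_mono) simp
    next
      assume v1: "?v = 1"
      have "exs x [If (In r 2) ([Inc h] @ [Inc h])] (\<rho>(h := 1), w) (\<rho>(h := 1), w) (2 * (\<rho>(h := 1)) (treg (In r 2)) + 5)"
        by (rule exs_If_False) (use v1 rh in simp)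
      from exs_append[OF exs_If_True[OF _ I1, of "In r 1"] this]
      have "exs x ?cs (\<rho>, w) (\<rho>(h := 1), w) ((2 * \<rho> (treg (In r 1)) + 5 + 5) + (2 * (\<rho>(h := 1)) (treg (In r 2)) + 5))" using v1 by simp
      then show ?thesis unfolding v1 by (rule exs_mono) (use rh in simp)
    next
      assume v2: "?v = 2"
      have "exs x [If (In r 1) [Inc h]] (\<rho>, w) (\<rho>, w) (2 * \<rho> (treg (In r 1)) + 5)"
        by (rule exs_If_False) (use v2 in simp)
      from exs_append[OF this exs_If_True[OF _ exs_append[OF I1 I2], of "In r 2"]]
      have "exs x ?cs (\<rho>, w) (\<rho>(h := 2), w) ((2 * \<rho> (treg (In r 1)) + 5) + (2 * \<rho> (treg (In r 2)) + 5 + (5 + 7)))" using v2 by simp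
      then show ?thesis unfolding v2 by (rule exs_mono) simp
    qed
    then show "exs x ?cs (\<rho>, w) (\<rho>(h := insym (fst (x, map \<rho> rs)) (int (vr 0 (x, map \<rho> rs)))), w) (4 * sz (x, map \<rho> rs) + 50)"
      unfolding r list.map vr_0 fst_conv by (rule exs_mono) (use sz in simp)
  qed
qed

lemma pb_len: "pb k (\<lambda>\<omega>. length (fst \<omega>))"
proof (rule pbI)
  show "pbound k (\<lambda>\<omega>. length (fst \<omega>))" by (rule pbound_polI[OF pol_id]) (simp add: sz_def)
  fix h and rs :: "nat list"
  let ?W = "[While (Nb h) [Inc h]]"
  show "\<exists>cs g. pol g \<and> (\<forall>x \<rho> w. (\<forall>r\<ge>h. \<rho> r = 0) \<longrightarrow>
      exs x cs (\<rho>, w) (\<rho>(h := length (fst (x, map \<rho> rs))), w) (g (sz (x, map \<rho> rs))))"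
  proof (intro exI[of _ ?W] exI[of _ "\<lambda>n. (n + 1) * (4 * n + 10)"] conjI allI impI)
    show "pol (\<lambda>n. (n + 1) * (4 * n + 10))" by (intro pol_intros)
    fix x :: "bool list" and \<rho> :: "nat \<Rightarrow> nat" and w assume z: "\<forall>r\<ge>h. \<rho> r = 0"
    let ?N = "length x"
    have loop: "exs x ?W (\<rho>(h := ?N - i), w) (\<rho>(h := ?N), w) (Suc i * (4 * ?N + 10))" if "i \<le> ?N" for i
      using that
    proof (induction i)
      case 0
      have "\<not> tval x (\<rho>(h := ?N)) (Nb h)" by (simp add: insym_def)
      have "exs x ?W (\<rho>(h := ?N), w) (\<rho>(h := ?N), w) (2 * (\<rho>(h := ?N)) (treg (Nb h)) + 5)"
        by (rule exs_While_False) fact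
      then show ?case unfolding diff_zero by (rule exs_mono) simp
    next
      case (Suc i)
      have t: "tval x (\<rho>(h := ?N - Suc i)) (Nb h)" using Suc.prems by (auto simp: insym_def bit_symbol_def)
      have "exs x [Inc h] (\<rho>(h := ?N - Suc i), w) (\<rho>(h := ?N - i), w) (2 * (?N - Suc i) + 5)"
        using exs_Inc[of x h "\<rho>(h := ?N - Suc i)" w] Suc.prems by (simp add: Suc_diff_Suc)
      moreover have "exs x ?W (\<rho>(h := ?N - i), w) (\<rho>(h := ?N), w) (Suc i * (4 * ?N + 10))"
        by (rule Suc.IH) (use Suc.prems in simp)
      ultimately have "exs x ?W (\<rho>(h := ?N - Suc i), w) (\<rho>(h := ?N), w)
         (2 * (\<rho>(h := ?N - Suc i)) (treg (Nb h)) + 5 + (2 * (?N - Suc i) + 5) + Suc i * (4 * ?N + 10))"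
        by (rule exs_While_True[OF t])
      then show ?case by (rule exs_mono) simp
    qed
    have e: "\<rho>(h := ?N - ?N) = \<rho>" using z by (intro fun_upd_idem) simp
    from loop[of ?N] have "exs x ?W (\<rho>, w) (\<rho>(h := ?N), w) (Suc ?N * (4 * ?N + 10))" unfolding e by simp
    then show "exs x ?W (\<rho>, w) (\<rho>(h := length (fst (x, map \<rho> rs))), w) ((sz (x, map \<rho> rs) + 1) * (4 * sz (x, map \<rho> rs) + 10))"
      unfolding fst_conv by (rule exs_mono, intro mult_mono) (simp_all add: sz_def)
  qed
qed

lemmas pb_rules = pb_const pb_Suc pb_add pb_mult pb_diff pb_div pb_mod pb_min pb_if pb_of_bool pb_powt pb_insym pb_len
  pbP_const pbP_le pbP_less pbP_eq pbP_not pbP_conj pbP_disj pbP_imp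

text \<open>The instance is written bit by bit, so that registers hold a position and one bit but
  never the instance.\<close>

lemma generator:
  assumes bitf: "pb 1 bitf" and lenf: "pb 0 lenf" and thrf: "pb 0 thrf"
  shows "\<exists>prog C. \<forall>x. \<exists>c \<rho>. c \<le> (length x + 2) ^ C \<and>
    ex x prog (\<lambda>_. 0, \<lambda>_. 0) (\<rho>, insym (map (\<lambda>i. bitf (x, [i]) \<noteq> 0) [0..<lenf (x, [])])) c \<and> \<rho> 0 = thrf (x, [])"
proof -
  obtain ct Ct where ct: "\<And>x \<rho> w. \<forall>r\<ge>0. \<rho> r = 0 \<Longrightarrow>
      exs x ct (\<rho>, w) (\<rho>(0 := thrf (x, map \<rho> [])), w) ((sz (x, map \<rho> []) + 2) ^ Ct)" by (rule pbE[OF thrf, of "[]" 0]) auto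
  obtain cl Cl where cl: "\<And>x \<rho> w. \<forall>r\<ge>1. \<rho> r = 0 \<Longrightarrow>
      exs x cl (\<rho>, w) (\<rho>(1 := lenf (x, map \<rho> [])), w) ((sz (x, map \<rho> []) + 2) ^ Cl)" by (rule pbE[OF lenf, of "[]" 1]) auto
  obtain cb Cb where cb: "\<And>x \<rho> w. \<forall>r\<ge>3. \<rho> r = 0 \<Longrightarrow>
      exs x cb (\<rho>, w) (\<rho>(3 := bitf (x, map \<rho> [2])), w) ((sz (x, map \<rho> [2]) + 2) ^ Cb)" by (rule pbE[OF bitf, of "[2]" 3]) auto
  obtain Bl where Bl: "\<And>x. lenf (x, []) \<le> (length x + 2) ^ Bl" using pb_boundE[OF lenf] by (metis add_0_right fst_conv list.size(3) snd_conv sum_list.Nil sz_def)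
  obtain Bb where Bb: "\<And>x a. length a = 1 \<Longrightarrow> bitf (x, a) \<le> (sz (x, a) + 2) ^ Bb" using pb_boundE[OF bitf] by blast
  \<comment> \<open>Register 1 counts down, 2 is the position, 3 holds the bit. Symbol 1 is written
    first and replaced by 2 if the bit is nonzero. Register 0 keeps the threshold for the final
    scan.\<close>
  let ?body = "((((([Dec 1] @ cb) @ [Wr 2 1]) @ [If (NZ 3) [Wr 2 2]]) @ clr 3) @ [Inc 2])"
  let ?prog = "(ct @ cl) @ [While (NZ 1) ?body]"
  let ?G = "\<lambda>n::nat. (n + 2) ^ Bl"
  let ?V = "\<lambda>n. (n + ?G n + 2) ^ Bb"
  let ?it = "\<lambda>n. (2 * ?G n + 5) + (n + ?G n + 2) ^ Cb + (2 * ?G n + 5) + (2 * ?V n + 5 + (2 * ?G n + 5)) + (?V n + 1) * (4 * ?V n + 10) + (2 * ?G n + 5)"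
  let ?tot = "\<lambda>n. (n + 2) ^ Ct + (n + 2) ^ Cl + (?G n + 1) * (2 * ?G n + 5 + ?it n)"
  have "pol ?tot" by (intro pol_intros)
  then obtain C where C: "\<And>n. ?tot n \<le> (n + 2) ^ C" unfolding pol_def by blast
  show ?thesis
  proof (rule exI[of _ ?prog], rule exI[of _ C], rule allI)
    fix x :: "bool list"
    let ?n = "length x"
    define N where "N = lenf (x, [])"
    define e where "e = thrf (x, [])"
    define bt where "bt i = (bitf (x, [i]) \<noteq> 0)" for i
    define st :: "nat \<Rightarrow> nat \<Rightarrow> nat" where "st j = (\<lambda>_. 0)(0 := e, 1 := N - j, 2 := j)" for j
    define wt where "wt j i = (if 0 \<le> i \<and> i < int j then bit_symbol (bt (nat i)) else 0)" for j :: nat and i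
    have NB: "N \<le> ?G ?n" using Bl by (simp add: N_def)
    have body: "exs x ?body (st j, wt j) (st (Suc j), wt (Suc j)) (?it ?n)" if j: "j < N" for j
    proof -
      let ?s1 = "(st j)(1 := N - Suc j)"
      have "st j 1 = N - j" "st j 1 - 1 = N - Suc j" by (simp_all add: st_def)
      then have 1: "exs x [Dec 1] (st j, wt j) (?s1, wt j) (2 * ?G ?n + 5)"
        using exs_mono[OF exs_Dec[of x 1 "st j" "wt j"], of "2 * ?G ?n + 5"] NB by simp
      have m: "map ?s1 [2] = [j]" by (simp add: st_def)
      have z: "\<forall>r\<ge>3. ?s1 r = 0" by (auto simp: st_def)
      let ?b = "bitf (x, [j])"
      have "exs x cb (?s1, wt j) (?s1(3 := ?b), wt j) ((sz (x, [j]) + 2) ^ Cb)"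
        using cb[of ?s1 x "wt j", OF z] unfolding m .
      moreover have "sz (x, [j]) + 2 \<le> ?n + ?G ?n + 2" using NB j by (simp add: sz_def)
      ultimately have 2: "exs x cb (?s1, wt j) (?s1(3 := ?b), wt j) ((?n + ?G ?n + 2) ^ Cb)"
        by (rule exs_mono[OF _ power_mono]) simp
      have bV: "?b \<le> ?V ?n"
        using Bb[of "[j]" x] power_mono[OF \<open>sz (x, [j]) + 2 \<le> ?n + ?G ?n + 2\<close>, of Bb] by simp
      let ?s2 = "?s1(3 := ?b)"
      have s2: "?s2 2 = j" "?s2 3 = ?b" by (simp_all add: st_def)
      have 3: "exs x [Wr 2 1] (?s2, wt j) (?s2, (wt j)(int j := 1)) (2 * ?G ?n + 5)"
        using exs_mono[OF exs_Wr[of x 2 1 ?s2 "wt j"], of "2 * ?G ?n + 5"] NB j unfolding s2 by simp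
      have weq: "(wt j)(int j := bit_symbol (bt j)) = wt (Suc j)"
        by (auto simp: wt_def fun_eq_iff)
      have 4: "exs x [If (NZ 3) [Wr 2 2]] (?s2, (wt j)(int j := 1)) (?s2, wt (Suc j)) (2 * ?V ?n + 5 + (2 * ?G ?n + 5))"
      proof (cases "?b = 0")
        case True
        then have "wt (Suc j) = (wt j)(int j := 1)" unfolding weq[symmetric] by (simp add: bt_def bit_symbol_def)
        moreover have "exs x [If (NZ 3) [Wr 2 2]] (?s2, (wt j)(int j := 1)) (?s2, (wt j)(int j := 1)) (2 * ?s2 (treg (NZ 3)) + 5)"
          by (rule exs_If_False) (use True s2 in simp)
        ultimately show ?thesis using bV by (auto elim!: exs_mono)
      next
        case False
        then have "wt (Suc j) = ((wt j)(int j := 1))(int j := 2)" unfolding weq[symmetric] by (simp add: bt_def bit_symbol_def)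
        moreover have "exs x [If (NZ 3) [Wr 2 2]] (?s2, (wt j)(int j := 1)) (?s2, ((wt j)(int j := 1))(int (?s2 2) := 2)) (2 * ?s2 (treg (NZ 3)) + 5 + (2 * ?s2 2 + 5))"
          by (rule exs_If_True[OF _ exs_Wr]) (use False s2 in simp)
        ultimately have "exs x [If (NZ 3) [Wr 2 2]] (?s2, (wt j)(int j := 1)) (?s2, wt (Suc j)) (2 * ?b + 5 + (2 * j + 5))"
          unfolding s2 by (simp add: s2)
        then show ?thesis by (rule exs_mono) (use bV NB j in simp)
      qed
      have "exs x (clr 3) (?s2, wt (Suc j)) (?s2(3 := 0), wt (Suc j)) (Suc ?b * (4 * ?b + 10))" by (rule exs_clr) simp
      then have 5: "exs x (clr 3) (?s2, wt (Suc j)) (?s2(3 := 0), wt (Suc j)) ((?V ?n + 1) * (4 * ?V ?n + 10))"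
        by (rule exs_mono) (use bV in \<open>intro mult_mono, auto\<close>)
      have sj: "st j 2 = j" by (simp add: st_def)
      have "?s2(3 := 0, 2 := Suc ((?s2(3 := 0)) 2)) = st (Suc j)" by (auto simp: st_def fun_eq_iff)
      then have 6: "exs x [Inc 2] (?s2(3 := 0), wt (Suc j)) (st (Suc j), wt (Suc j)) (2 * ?G ?n + 5)"
        using exs_mono[OF exs_Inc[of x 2 "?s2(3 := 0)" "wt (Suc j)"], of "2 * ?G ?n + 5"] NB j by (simp add: sj)
      show ?thesis by (rule exs_append[OF exs_append[OF exs_append[OF exs_append[OF exs_append[OF 1 2] 3] 4] 5] 6])
    qed
    have loop: "exs x [While (NZ 1) ?body] (st (N - i), wt (N - i)) (st N, wt N) (Suc i * (2 * ?G ?n + 5 + ?it ?n))" if "i \<le> N" for i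
      using that
    proof (induction i)
      case 0
      have "\<not> tval x (st N) (NZ 1)" by (simp add: st_def)
      from exs_While_False[OF this, of ?body "wt N"] show ?case
        unfolding diff_zero by (rule exs_mono) (simp add: st_def)
    next
      case (Suc i)
      have "tval x (st (N - Suc i)) (NZ 1)" using Suc.prems by (simp add: st_def)
      moreover have "exs x ?body (st (N - Suc i), wt (N - Suc i)) (st (N - i), wt (N - i)) (?it ?n)"
        using body[of "N - Suc i"] Suc.prems by (simp add: Suc_diff_Suc)
      moreover have "exs x [While (NZ 1) ?body] (st (N - i), wt (N - i)) (st N, wt N) (Suc i * (2 * ?G ?n + 5 + ?it ?n))"
        using Suc by simp
      ultimately have w: "exs x [While (NZ 1) ?body] (st (N - Suc i), wt (N - Suc i)) (st N, wt N)
         (2 * st (N - Suc i) (treg (NZ 1)) + 5 + ?it ?n + Suc i * (2 * ?G ?n + 5 + ?it ?n))"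
        by (rule exs_While_True)
      have "st (N - Suc i) (treg (NZ 1)) \<le> ?G ?n" using NB by (simp add: st_def)
      then have "2 * st (N - Suc i) (treg (NZ 1)) + 5 + ?it ?n + Suc i * (2 * ?G ?n + 5 + ?it ?n) \<le> (2 * ?G ?n + 5 + ?it ?n) + Suc i * (2 * ?G ?n + 5 + ?it ?n)"
        by (intro add_mono) auto
      also have "\<dots> = Suc (Suc i) * (2 * ?G ?n + 5 + ?it ?n)" by (simp only: mult_Suc)
      finally show ?case by (rule exs_mono[OF w])
    qed
    have sn: "sz (x, []) = ?n" by (simp add: sz_def)
    have w0: "(\<lambda>_. 0) = wt 0" by (auto simp: wt_def fun_eq_iff)
    have 1: "exs x ct (\<lambda>_. 0, wt 0) ((\<lambda>_. 0)(0 := e), wt 0) ((?n + 2) ^ Ct)"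
      using ct[of "\<lambda>_. 0" x "wt 0"] by (simp add: sn e_def)
    have "exs x cl ((\<lambda>_. 0)(0 := e), wt 0) ((\<lambda>_. 0)(0 := e, 1 := N), wt 0) ((?n + 2) ^ Cl)"
      using cl[of "(\<lambda>_. 0)(0 := e)" x "wt 0"] by (simp add: sn N_def)
    moreover have "(\<lambda>_. 0)(0 := e, 1 := N) = st 0" by (auto simp: st_def fun_eq_iff)
    ultimately have 2: "exs x cl ((\<lambda>_. 0)(0 := e), wt 0) (st 0, wt 0) ((?n + 2) ^ Cl)" by simp
    have 3: "exs x [While (NZ 1) ?body] (st 0, wt 0) (st N, wt N) ((?G ?n + 1) * (2 * ?G ?n + 5 + ?it ?n))"
      by (rule exs_mono[OF loop[of N, OF le_refl, unfolded diff_self_eq_0]], rule mult_right_mono) (use NB in auto)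
    have "exs x ?prog (\<lambda>_. 0, wt 0) (st N, wt N) (?tot ?n)"
      by (rule exs_append[OF exs_append[OF 1 2] 3])
    then obtain c where c: "c \<le> ?tot ?n" "ex x ?prog (\<lambda>_. 0, wt 0) (st N, wt N) c" unfolding exs_def by blast
    have wN: "wt N = insym (map (\<lambda>i. bitf (x, [i]) \<noteq> 0) [0..<lenf (x, [])])"
      by (auto simp: wt_def insym_def fun_eq_iff N_def bt_def nat_less_iff)
    show "\<exists>c \<rho>. c \<le> (length x + 2) ^ C \<and>
      ex x ?prog (\<lambda>_. 0, \<lambda>_. 0) (\<rho>, insym (map (\<lambda>i. bitf (x, [i]) \<noteq> 0) [0..<lenf (x, [])])) c \<and> \<rho> 0 = thrf (x, [])"
      by (intro exI[of _ c] exI[of _ "st N"] conjI) (use c C[of ?n] w0 wN in \<open>auto simp: st_def e_def\<close>)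
  qed
qed

theorem pb_reduction:
  assumes wf: "wf_tm M" and bitf: "pb 1 bitf" and lenf: "pb 0 lenf" and thrf: "pb 0 thrf"
    and out: "\<And>x. outputs_within M (map (\<lambda>i. bitf (x, [i]) \<noteq> 0) [0..<lenf (x, [])]) (tt x) (y x)"
    and tt: "\<And>x. tt x \<le> (length x + 2) ^ C2"
  shows "{x. fl = (\<exists>i<length (y x). thrf (x, []) \<le> i \<and> y x ! i)} \<in> class_P"
proof -
  obtain prog C1 where prog: "\<And>x. \<exists>c \<rho>. c \<le> (length x + 2) ^ C1 \<and>
    ex x prog (\<lambda>_. 0, \<lambda>_. 0) (\<rho>, insym (map (\<lambda>i. bitf (x, [i]) \<noteq> 0) [0..<lenf (x, [])])) c \<and> \<rho> 0 = thrf (x, [])"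
    using generator[OF bitf lenf thrf] by blast
  obtain C3 where C3: "\<And>x a. length a = 0 \<Longrightarrow> lenf (x, a) \<le> (sz (x, a) + 2) ^ C3" using pb_boundE[OF lenf] by blast
  have "length (map (\<lambda>i. bitf (x, [i]) \<noteq> 0) [0..<lenf (x, [])]) \<le> (length x + 2) ^ C3" for x
    using C3[of "[]" x] by (simp add: sz_def)
  from reduction_class_P[OF wf prog out tt this] show ?thesis .
qed

lemma pb_poly: "pb k f \<Longrightarrow> pb k (\<lambda>\<omega>. poly p (f \<omega>))" for p :: "nat poly"
  by (induction p) (auto intro: pb_const pb_add pb_mult)

text \<open>A function given without any program is computable on a fixed finite range, by nested
  case distinctions. The transition function of a machine is treated in this way.\<close>

lemma pb_table: assumes "pb k f" shows "pb k (\<lambda>\<omega>. if f \<omega> < c then G (f \<omega>) else 0)"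
proof (induction c)
  case 0
  then show ?case by (simp add: pb_const)
next
  case (Suc c)
  have "pb k (\<lambda>\<omega>. if f \<omega> = c then G c else (if f \<omega> < c then G (f \<omega>) else 0))"
    by (intro pb_if pbP_eq assms pb_const Suc)
  then show ?case by (rule pb_cong) auto
qed

section \<open>Computation tableaux\<close>

lemma tm_far_abs:
  assumes "(tm_step M ^^ t) (0, w, 0) = (q, w', p)"
    and "wf_tm M" "\<And>i. w i < num_symbols M"
  shows "\<bar>p\<bar> \<le> int t \<and> (\<forall>i. int t \<le> \<bar>i\<bar> \<longrightarrow> w' i = w i)"
  using assms(1)
proof (induction t arbitrary: q w' p)
  case (Suc t)
  obtain q1 w1 p1 where c: "(tm_step M ^^ t) (0, w, 0) = (q1, w1, p1)" by (metis prod_cases3)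
  note IH = Suc.IH[OF c]
  have sy: "w1 p1 < num_symbols M" using tm_far[OF assms(2,3) c] by blast
  have st: "tm_step M (q1, w1, p1) = (q, w', p)" using Suc.prems c by simp
  show ?case
  proof (cases "q1 < num_states M")
    case True
    have "case trans M q1 (w1 p1) of (q', a', d) \<Rightarrow> q' \<le> num_states M \<and> a' < num_symbols M \<and> d \<in> {-1, 0, 1}"
      by (rule assms(2)[unfolded wf_tm_def, THEN conjunct2, rule_format, OF True sy])
    then have d: "snd (snd (trans M q1 (w1 p1))) \<in> {-1, 0, 1}" by (simp add: split_beta)
    have e: "w' = w1(p1 := fst (snd (trans M q1 (w1 p1))))" "p = p1 + snd (snd (trans M q1 (w1 p1)))"
      using st True by (auto simp: tm_step_def split_beta)
    have "\<bar>p\<bar> \<le> int (Suc t)" using IH d unfolding e(2) by auto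
    moreover have "w' i = w i" if "int (Suc t) \<le> \<bar>i\<bar>" for i using IH that unfolding e(1) by auto
    ultimately show ?thesis by blast
  next
    case False
    then have "w' = w1" "p = p1" using st by (auto simp: tm_step_def)
    then show ?thesis using IH by auto
  qed
qed auto

text \<open>Content of a cell as one number: the symbol plus \<open>num_symbols M\<close> times a
  marker, which is 0 away from the head and otherwise the state plus 1.\<close>

definition cont :: "turing_machine \<Rightarrow> config \<Rightarrow> int \<Rightarrow> nat" where
  "cont M c i = fst (snd c) i + num_symbols M * (if snd (snd c) = i then Suc (fst c) else 0)"


text \<open>The local rule of the tableau: a head stays, arrives from the left or arrives from the
  right. In a run at most one of the three cells carries the head, and a halted head is
  kept.\<close>

definition nxt :: "turing_machine \<Rightarrow> nat \<Rightarrow> nat \<Rightarrow> nat \<Rightarrow> nat" where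
  "nxt M a b c = (let n = num_symbols M;
     mv = (\<lambda>e d. 0 < e div n \<and> e div n - 1 < num_states M \<and> snd (snd (trans M (e div n - 1) (e mod n))) = d);
     st = (\<lambda>e. Suc (fst (trans M (e div n - 1) (e mod n))))
     in (if 0 < b div n \<and> b div n - 1 < num_states M then fst (snd (trans M (b div n - 1) (b mod n))) else b mod n)
        + n * (if 0 < b div n \<and> \<not> b div n - 1 < num_states M then b div n
               else if mv b 0 then st b else if mv a 1 then st a else if mv c (-1) then st c else 0))"

lemma cont_step:
  assumes wf: "wf_tm M" and sy: "\<And>i. tp i < num_symbols M" and q: "q \<le> num_states M"
  shows "cont M (tm_step M (q, tp, p)) i = nxt M (cont M (q, tp, p) (i - 1)) (cont M (q, tp, p) i) (cont M (q, tp, p) (i + 1))"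
proof -
  let ?n = "num_symbols M"
  have n0: "0 < ?n" using wf by (simp add: wf_tm_def)
  have dm: "cont M (q, tp, p) j div ?n = (if p = j then Suc q else 0)" "cont M (q, tp, p) j mod ?n = tp j" for j
    using sy[of j] n0 by (auto simp: cont_def)
  show ?thesis
  proof (cases "q < num_states M")
    case False
    then have "tm_step M (q, tp, p) = (q, tp, p)" by (simp add: tm_step_def)
    then show ?thesis using False unfolding nxt_def Let_def dm by (auto simp: cont_def)
  next
    case True
    let ?tr = "trans M q (tp p)"
    have "case trans M q (tp p) of (q', a', d) \<Rightarrow> q' \<le> num_states M \<and> a' < num_symbols M \<and> d \<in> {-1, 0, 1}"
      by (rule wf[unfolded wf_tm_def, THEN conjunct2, rule_format, OF True sy])
    then have d: "snd (snd ?tr) = -1 \<or> snd (snd ?tr) = 0 \<or> snd (snd ?tr) = 1" by (simp add: split_beta)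
    have st: "tm_step M (q, tp, p) = (fst ?tr, tp(p := fst (snd ?tr)), p + snd (snd ?tr))"
      using True by (simp add: tm_step_def split_beta)
    consider "i = p" | "i = p + 1" | "i = p - 1" | "i \<noteq> p" "i \<noteq> p + 1" "i \<noteq> p - 1" by blast
    then show ?thesis
    proof cases
      case 1
      then show ?thesis using True d unfolding nxt_def Let_def dm st by (auto simp: cont_def)
    next
      case 2
      then show ?thesis using True d unfolding nxt_def Let_def dm st by (auto simp: cont_def)
    next
      case 3
      then show ?thesis using True d unfolding nxt_def Let_def dm st by (auto simp: cont_def)
    next
      case 4
      then have "p \<noteq> i" "p \<noteq> i - 1" "p \<noteq> i + 1" "p + snd (snd ?tr) \<noteq> i" using d by auto
      then show ?thesis using 4 unfolding nxt_def Let_def dm st by (simp add: cont_def)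
    qed
  qed
qed

lemma poly_nat_mono: "(a::nat) \<le> b \<Longrightarrow> poly p a \<le> poly p b"
  by (induction p) (auto intro!: add_mono mult_mono)

text \<open>The first \<open>2 * length x + 2\<close> symbols of \<open>pair_bits x y\<close>, which
  do not depend on \<open>y\<close>.\<close>

definition presym :: "bool list \<Rightarrow> nat \<Rightarrow> nat" where
  "presym x i = (if i < 2 * length x then insym x (int (i div 2)) else if i = 2 * length x then 1 else 2)"

lemma length_pair_bits: "length (pair_bits x y) = 2 * length x + 2 + length y"
  by (induction x) (auto simp: pair_bits_def)

lemma pair_bits_prefix:
  "i < 2 * length x + 2 \<Longrightarrow> bit_symbol (pair_bits x y ! i) = presym x i"
proof (induction x arbitrary: i)
  case Nil
  then show ?case by (auto simp: pair_bits_def presym_def bit_symbol_def less_Suc_eq numeral_2_eq_2)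
next
  case (Cons b x)
  have p: "pair_bits (b # x) y = b # b # pair_bits x y" by (simp add: pair_bits_def)
  show ?case
  proof (cases "i < 2")
    case True
    then have "i = 0 \<or> i = 1" by auto
    then show ?thesis unfolding p by (auto simp: presym_def insym_def)
  next
    case False
    then obtain j where j: "i = Suc (Suc j)" by (metis add_2_eq_Suc le_Suc_ex not_less)
    have "presym (b # x) i = presym x j"
      by (auto simp: presym_def insym_def j nat_add_distrib)
    then show ?thesis using Cons.IH[of j] Cons.prems unfolding p j by simp
  qed
qed

lemma pair_bits_suffix: "pair_bits x y ! (2 * length x + 2 + j) = y ! j"
proof -
  have "length (concat (map (\<lambda>b. [b, b]) x) @ [False, True]) = 2 * length x + 2" by (induction x) auto
  then show ?thesis unfolding pair_bits_def by (metis append_assoc nth_append_length_plus)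
qed

locale tableau =
  fixes M :: turing_machine and V :: "bool list set" and p py :: "nat poly"
  assumes wf: "wf_tm M" and dec: "\<And>w. outputs_within M w (poly p (length w)) [w \<in> V]"
begin

text \<open>Dimensions of the tableau: rows \<open>0, ..., tm x\<close> and columns
  \<open>0, ..., 2 * zz x\<close>, with the origin of the tape in column \<open>zz x\<close>. As
  \<open>zz x\<close> exceeds both the running time and the length of the word, the border columns
  stay blank; cells are numbered row by row.\<close>

definition pl :: "bool list \<Rightarrow> nat" where "pl x = 2 * length x + 2"
definition wl :: "bool list \<Rightarrow> nat" where "wl x = pl x + poly py (length x)"
definition tm :: "bool list \<Rightarrow> nat" where "tm x = poly p (wl x)"
definition zz :: "bool list \<Rightarrow> nat" where "zz x = tm x + wl x + 2"
definition ss :: "bool list \<Rightarrow> nat" where "ss x = 2 * zz x + 1"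
definition nkk :: "bool list \<Rightarrow> nat" where "nkk x = Suc (tm x) * ss x"
definition cb :: nat where "cb = num_symbols M * (num_states M + 2)"

text \<open>Row 0: blanks outside the word, the prescribed part of the pair with the head on its
  first cell, then the certificate. In the latter, a cell after a blank is blank, so that the row
  spells a word of some length up to the bound.\<close>

definition ini :: "bool list \<Rightarrow> nat \<Rightarrow> nat \<Rightarrow> nat \<Rightarrow> bool" where
  "ini x c b0 b1 \<longleftrightarrow> (if c < zz x \<or> zz x + wl x \<le> c then b0 = 0
     else if c < zz x + pl x then b0 = presym x (c - zz x) + (if c = zz x then num_symbols M else 0)
     else b0 < 3 \<and> (zz x + pl x < c \<and> b1 = 0 \<longrightarrow> b0 = 0))"

text \<open>One constraint per cell: \<open>b0\<close> is its own content, \<open>b1\<close>,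
  \<open>b2\<close>, \<open>b3\<close> are those above it. The last conjunct demands that the run
  ends with the bit 1 at the origin.\<close>

definition alw :: "bool list \<Rightarrow> nat \<Rightarrow> nat \<Rightarrow> nat \<Rightarrow> nat \<Rightarrow> nat \<Rightarrow> bool" where
  "alw x k b0 b1 b2 b3 \<longleftrightarrow>
     (if k < ss x then ini x k b0 b1
      else if k mod ss x = 0 \<or> k mod ss x = 2 * zz x then b0 = 0
      else b1 < cb \<and> b2 < cb \<and> b3 < cb \<and> b0 = nxt M b1 b2 b3)
     \<and> (k = tm x * ss x + zz x \<longrightarrow> b0 mod num_symbols M = 2)"

text \<open>In row 0 the left neighbour takes the place of the cells above. Truncated subtraction at
  a border gives a wrong index, but there \<open>alw\<close> looks at \<open>b0\<close>
  only.\<close>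

definition ixx :: "bool list \<Rightarrow> nat \<Rightarrow> nat \<Rightarrow> nat" where
  "ixx x k i = (if i = 0 then k else if k < ss x then k - 1
     else if i = 1 then k - ss x - 1 else if i = 2 then k - ss x else k - ss x + 1)"

lemma n0: "3 \<le> num_symbols M" using wf by (simp add: wf_tm_def)

lemma insym_less: "insym w i < num_symbols M" using n0 by (auto simp: insym_def bit_symbol_def)

abbreviation cf :: "bool list \<Rightarrow> nat \<Rightarrow> config" where "cf w t \<equiv> (tm_step M ^^ t) (0, insym w, 0)"

lemma cf_ok: "cf w t = (q, tp, pos) \<Longrightarrow> q \<le> num_states M \<and> (\<forall>i. tp i < num_symbols M) \<and> \<bar>pos\<bar> \<le> int t
    \<and> (\<forall>i. int t \<le> \<bar>i\<bar> \<longrightarrow> tp i = insym w i)"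
  using tm_far[where w = "insym w", OF wf insym_less] tm_far_abs[where w = "insym w", OF _ wf insym_less] by blast

lemma cont_cf_Suc: "cont M (cf w (Suc t)) i = nxt M (cont M (cf w t) (i - 1)) (cont M (cf w t) i) (cont M (cf w t) (i + 1))"
proof -
  obtain q tp pos where c: "cf w t = (q, tp, pos)" by (metis prod_cases3)
  show ?thesis using cont_step[OF wf, of tp q pos i] cf_ok[OF c] c by simp
qed

lemma cont_less: "cont M (cf w t) i < cb"
proof -
  obtain q tp pos where c: "cf w t = (q, tp, pos)" by (metis prod_cases3)
  have "tp i < num_symbols M" "q \<le> num_states M" using cf_ok[OF c] by auto
  then have "cont M (cf w t) i < num_symbols M + num_symbols M * Suc (num_states M)"
    unfolding c cont_def by (simp add: add_less_le_mono del: mult_Suc_right)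
  then show ?thesis by (simp add: cb_def algebra_simps)
qed

lemma cont_far: "length w \<le> wl x \<Longrightarrow> t \<le> tm x \<Longrightarrow> \<bar>i\<bar> = int (zz x) \<Longrightarrow> cont M (cf w t) i = 0"
proof -
  assume h: "length w \<le> wl x" "t \<le> tm x" "\<bar>i\<bar> = int (zz x)"
  obtain q tp pos where c: "cf w t = (q, tp, pos)" by (metis prod_cases3)
  note o = cf_ok[OF c]
  have "int t \<le> \<bar>i\<bar>" using h by (simp add: zz_def)
  then have "tp i = insym w i" using o by blast
  also have "\<dots> = 0" using h by (auto simp: insym_def zz_def)
  finally have "tp i = 0" .
  moreover have "pos \<noteq> i" using o h by (auto simp: zz_def)
  ultimately show ?thesis by (simp add: c cont_def)
qed

lemma cf_accept: assumes "length w \<le> wl x" shows "cont M (cf w (tm x)) 0 mod num_symbols M = bit_symbol (w \<in> V)"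
proof -
  have le: "poly p (length w) \<le> tm x" unfolding tm_def by (rule poly_nat_mono[OF assms])
  have i: "init_config w = (0, insym w, 0)" by (simp add: init_config_def insym_def fun_eq_iff)
  obtain q tp pos where c: "cf w (poly p (length w)) = (q, tp, pos)" by (metis prod_cases3)
  have o: "q = num_states M" "tp 0 = bit_symbol (w \<in> V)" using dec[of w] c by (auto simp: outputs_within_def i)
  have "cf w (tm x) = (tm_step M ^^ (tm x - poly p (length w))) (cf w (poly p (length w)))"
    using le by (metis comp_apply funpow_add le_add_diff_inverse2)
  also have "\<dots> = (q, tp, pos)" unfolding c by (rule tm_halted) (simp add: o)
  finally show ?thesis using o n0 by (auto simp: cont_def bit_symbol_def)
qed

lemma div_mod_idx: "c < ss x \<Longrightarrow> (t * ss x + c) div ss x = t \<and> (t * ss x + c) mod ss x = c" by simp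

lemma cont_init: "cont M (cf w 0) i = insym w i + (if i = 0 then num_symbols M else 0)"
  by (auto simp: cont_def)

lemma tableau_complete:
  assumes y: "length y \<le> poly py (length x)" "pair_bits x y \<in> V"
  shows "\<exists>\<xi>. (\<forall>k. \<xi> k < cb) \<and> (\<forall>k<nkk x. alw x k (\<xi> (ixx x k 0)) (\<xi> (ixx x k 1)) (\<xi> (ixx x k 2)) (\<xi> (ixx x k 3)))"
proof -
  define w where "w = pair_bits x y"
  have lw: "length w \<le> wl x" "length w = pl x + length y" using y by (auto simp: w_def length_pair_bits wl_def pl_def)
  define \<xi> where "\<xi> k = cont M (cf w (k div ss x)) (int (k mod ss x) - int (zz x))" for k
  have S: "0 < ss x" "ss x = 2 * zz x + 1" by (simp_all add: ss_def)
  have xi: "\<xi> (t * ss x + c) = cont M (cf w t) (int c - int (zz x))" if "c < ss x" for t c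
    unfolding \<xi>_def using div_mod_idx[OF that] by simp
  have "alw x k (\<xi> (ixx x k 0)) (\<xi> (ixx x k 1)) (\<xi> (ixx x k 2)) (\<xi> (ixx x k 3))" if k: "k < nkk x" for k
  proof -
    define t where "t = k div ss x"
    define c where "c = k mod ss x"
    have kc: "k = t * ss x + c" "c < ss x" unfolding t_def c_def using mod_less_divisor[OF S(1)] by (simp_all only: div_mult_mod_eq)
    have t: "t \<le> tm x" using k S by (simp add: nkk_def t_def less_mult_imp_div_less less_Suc_eq_le[symmetric])
    have x0: "\<xi> (ixx x k 0) = cont M (cf w t) (int c - int (zz x))" unfolding ixx_def using xi[OF kc(2), of t] kc(1) by simp
    have acc: "k = tm x * ss x + zz x \<longrightarrow> \<xi> (ixx x k 0) mod num_symbols M = 2"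
    proof
      assume "k = tm x * ss x + zz x"
      then have "t = tm x" "c = zz x" unfolding t_def c_def using S div_mod_idx[of "zz x" x "tm x"] by simp_all
      then have "\<xi> (ixx x k 0) mod num_symbols M = bit_symbol (w \<in> V)" using x0 cf_accept[OF lw(1)] by simp
      then show "\<xi> (ixx x k 0) mod num_symbols M = 2" using y(2) by (simp add: w_def bit_symbol_def)
    qed
    show ?thesis
    proof (cases "k < ss x")
      case True
      then have tc: "t = 0" "c = k" by (simp_all add: t_def c_def)
      have b0: "\<xi> (ixx x k 0) = insym w (int k - int (zz x)) + (if k = zz x then num_symbols M else 0)"
        unfolding x0 tc cont_init by simp
      have b1: "\<xi> (ixx x k 1) = insym w (int (k - 1) - int (zz x)) + (if k - 1 = zz x then num_symbols M else 0)"
        using True xi[of "k - 1" 0] cont_init[of w "int (k - 1) - int (zz x)"] by (simp add: ixx_def)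
      have "ini x k (\<xi> (ixx x k 0)) (\<xi> (ixx x k 1))"
      proof -
        consider "k < zz x \<or> zz x + wl x \<le> k" | "zz x \<le> k" "k < zz x + pl x" | "zz x + pl x \<le> k" "k < zz x + wl x" by linarith
        then show ?thesis
        proof cases
          case 1
          then have "k \<noteq> zz x" using lw by (auto simp: wl_def pl_def)
          then show ?thesis using 1 b0 lw by (auto simp: ini_def insym_def)
        next
          case 2
          then have "insym w (int k - int (zz x)) = presym x (k - zz x)"
            using pair_bits_prefix[of "k - zz x" x y] lw by (auto simp: insym_def w_def pl_def nat_diff_distrib)
          moreover have "\<not> (k < zz x \<or> zz x + wl x \<le> k)" using 2 by (auto simp: wl_def)
          ultimately show ?thesis using 2 b0 by (simp add: ini_def)
        next
          case 3
          have nz: "k \<noteq> zz x" using 3 by (auto simp: pl_def)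
          then have "\<xi> (ixx x k 0) < 3" using b0 by (auto simp: insym_def bit_symbol_def)
          moreover have "\<xi> (ixx x k 0) = 0" if "zz x + pl x < k" "\<xi> (ixx x k 1) = 0"
          proof -
            have "insym w (int (k - 1) - int (zz x)) = 0" using that(2) b1 by simp
            then have "int (length w) \<le> int (k - 1) - int (zz x)" using that(1) by (auto simp: insym_def bit_symbol_def pl_def split: if_splits)
            then show ?thesis using b0 nz by (auto simp: insym_def)
          qed
          ultimately show ?thesis using 3 nz by (simp add: ini_def)
        qed
      qed
      then show ?thesis unfolding alw_def by (intro conjI[OF _ acc]) (use True in simp)
    next
      case False
      obtain t' where t': "t = Suc t'" using False kc by (cases t) auto
      show ?thesis
      proof (cases "c = 0 \<or> c = 2 * zz x")
        case True
        then have "\<bar>int c - int (zz x)\<bar> = int (zz x)" by auto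
        then have z: "\<xi> (ixx x k 0) = 0" using x0 cont_far[OF lw(1) t] by simp
        show ?thesis unfolding alw_def c_def[symmetric] by (rule conjI[OF _ acc]) (use True False z in simp)
      next
        case c: False
        have e: "k - ss x - 1 = t' * ss x + (c - 1)" "k - ss x = t' * ss x + c" "k - ss x + 1 = t' * ss x + (c + 1)"
          using kc t' c by auto
        have cs: "c - 1 < ss x" "c + 1 < ss x" using kc(2) c S by auto
        have i: "ixx x k 1 = t' * ss x + (c - 1)" "ixx x k 2 = t' * ss x + c" "ixx x k 3 = t' * ss x + (c + 1)"
          using False unfolding ixx_def e[symmetric] by simp_all
        let ?i = "int c - int (zz x)"
        have ci: "int (c - 1) - int (zz x) = ?i - 1" "int (c + 1) - int (zz x) = ?i + 1" using c by auto
        have "\<xi> (ixx x k 1) = cont M (cf w t') (?i - 1)" "\<xi> (ixx x k 2) = cont M (cf w t') ?i" "\<xi> (ixx x k 3) = cont M (cf w t') (?i + 1)"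
          unfolding i xi[OF cs(1)] xi[OF kc(2)] xi[OF cs(2)] ci by simp_all
        then show ?thesis unfolding alw_def c_def[symmetric]
          by (intro conjI[OF _ acc]) (use False c x0 cont_less cont_cf_Suc[where w = w and t = t' and i = ?i] t' in \<open>simp del: funpow.simps\<close>)
      qed
    qed
  qed
  then show ?thesis using cont_less by (intro exI[of _ \<xi>]) (auto simp: \<xi>_def)
qed

lemma tableau_sound:
  assumes al: "\<And>k. k < nkk x \<Longrightarrow> alw x k (\<xi> (ixx x k 0)) (\<xi> (ixx x k 1)) (\<xi> (ixx x k 2)) (\<xi> (ixx x k 3))"
  shows "\<exists>y. length y \<le> poly py (length x) \<and> pair_bits x y \<in> V"
proof -
  let ?Y = "poly py (length x)" and ?z = "zz x + pl x"
  have S: "0 < ss x" "ss x = 2 * zz x + 1" by (simp_all add: ss_def)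
  \<comment> \<open>The certificate ends at the first blank of its part of row 0, or fills that
    part.\<close>
  define m where "m = (LEAST j. j = ?Y \<or> \<xi> (?z + j) = 0)"
  have m1: "m = ?Y \<or> \<xi> (?z + m) = 0" unfolding m_def by (rule LeastI[of _ ?Y]) simp
  have m2: "m \<le> ?Y" unfolding m_def by (rule Least_le) simp
  have m3: "\<xi> (?z + j) \<noteq> 0" if "j < m" for j using not_less_Least[OF that[unfolded m_def]] by blast
  define y where "y = map (\<lambda>j. \<xi> (?z + j) = 2) [0..<m]"
  define w where "w = pair_bits x y"
  have lw: "length w = pl x + m" "length w \<le> wl x" using m2 by (auto simp: w_def length_pair_bits y_def wl_def pl_def)
  have zl: "zz x + wl x < ss x" by (simp add: ss_def zz_def)
  have ini: "ini x c (\<xi> c) (\<xi> (c - 1))" if "c < ss x" for c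
  proof -
    have "c < nkk x" using that by (simp add: nkk_def)
    from al[OF this] show ?thesis using that by (simp add: alw_def ixx_def)
  qed
  have row0: "\<xi> c = cont M (cf w 0) (int c - int (zz x))" if c: "c < ss x" for c
  proof -
    consider "c < zz x \<or> zz x + wl x \<le> c" | "zz x \<le> c" "c < ?z" | "?z \<le> c" "c < zz x + wl x" by linarith
    then show ?thesis
    proof cases
      case 1
      then have "\<xi> c = 0" "c \<noteq> zz x" using ini[OF c] by (auto simp: ini_def wl_def pl_def)
      then show ?thesis using 1 lw unfolding cont_init by (auto simp: insym_def)
    next
      case 2
      then have "\<xi> c = presym x (c - zz x) + (if c = zz x then num_symbols M else 0)" using ini[OF c] by (simp add: ini_def wl_def)
      moreover have "insym w (int c - int (zz x)) = presym x (c - zz x)"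
        using 2 pair_bits_prefix[of "c - zz x" x y] lw by (auto simp: insym_def w_def pl_def nat_diff_distrib)
      ultimately show ?thesis unfolding cont_init by simp
    next
      case 3
      define j where "j = c - ?z"
      have cj: "c = ?z + j" "j < ?Y" using 3 by (auto simp: j_def wl_def)
      have nz: "c \<noteq> zz x" using 3 by (auto simp: pl_def)
      have lt3: "\<xi> (?z + i) < 3" if "i < ?Y" for i
        using ini[of "?z + i"] that zl by (simp add: ini_def wl_def)
      have z: "\<xi> (?z + i) = 0" if "m \<le> i" "i < ?Y" for i
        using that
      proof (induction i)
        case 0
        then show ?case using m1 by auto
      next
        case (Suc i)
        show ?case
        proof (cases "m = Suc i")
          case True
          then show ?thesis using m1 Suc.prems by auto
        next
          case False
          then have "\<xi> (?z + i) = 0" using Suc by simp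
          then show ?thesis using ini[of "?z + Suc i"] Suc.prems zl by (simp add: ini_def wl_def)
        qed
      qed
      have "insym w (int c - int (zz x)) = \<xi> c"
      proof (cases "j < m")
        case True
        have "w ! (pl x + j) = (\<xi> c = 2)" unfolding w_def pl_def pair_bits_suffix using True by (simp add: y_def cj pl_def)
        moreover have "nat (int c - int (zz x)) = pl x + j" using cj by simp
        moreover have "int c - int (zz x) < int (length w)" "0 \<le> int c - int (zz x)" using True cj lw by auto
        ultimately have "insym w (int c - int (zz x)) = bit_symbol (\<xi> c = 2)" by (simp add: insym_def)
        moreover have "\<xi> c \<noteq> 0" "\<xi> c < 3" using m3[OF True] lt3[OF cj(2)] cj by auto
        ultimately show ?thesis by (auto simp: bit_symbol_def)
      next
        case False
        then show ?thesis using z[of j] cj lw by (simp add: insym_def)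
      qed
      then show ?thesis unfolding cont_init using nz by simp
    qed
  qed
  have rows: "t \<le> tm x \<Longrightarrow> c < ss x \<Longrightarrow> \<xi> (t * ss x + c) = cont M (cf w t) (int c - int (zz x))" for t c
  proof (induction t arbitrary: c)
    case 0
    then show ?case using row0 by simp
  next
    case (Suc t)
    let ?k = "Suc t * ss x + c"
    have kn: "?k < nkk x"
    proof -
      have "?k < Suc t * ss x + ss x" using Suc.prems by simp
      also have "\<dots> = Suc (Suc t) * ss x" by simp
      also have "\<dots> \<le> nkk x" unfolding nkk_def using Suc.prems by (intro mult_right_mono) auto
      finally show ?thesis .
    qed
    have ks: "\<not> ?k < ss x" by simp
    have km: "?k mod ss x = c" using div_mod_idx[OF Suc.prems(2), of "Suc t"] by blast
    have i0: "ixx x ?k 0 = ?k" by (simp add: ixx_def)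
    show ?case
    proof (cases "c = 0 \<or> c = 2 * zz x")
      case True
      then have "\<bar>int c - int (zz x)\<bar> = int (zz x)" by auto
      then have "cont M (cf w (Suc t)) (int c - int (zz x)) = 0" using cont_far[OF lw(2) Suc.prems(1)] by blast
      moreover have "\<xi> ?k = 0" using al[OF kn] ks True unfolding alw_def km i0 by auto
      ultimately show ?thesis by simp
    next
      case False
      have i: "ixx x ?k 1 = t * ss x + (c - 1)" "ixx x ?k 2 = t * ss x + c" "ixx x ?k 3 = t * ss x + (c + 1)"
        using ks False by (auto simp: ixx_def)
      have "\<xi> ?k = nxt M (\<xi> (t * ss x + (c - 1))) (\<xi> (t * ss x + c)) (\<xi> (t * ss x + (c + 1)))"
        using al[OF kn] ks False unfolding alw_def km i0 i by auto
      moreover have "\<xi> (t * ss x + (c - 1)) = cont M (cf w t) (int c - int (zz x) - 1)"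
        using Suc.IH[of "c - 1"] Suc.prems False by (simp add: of_nat_diff algebra_simps)
      moreover have "\<xi> (t * ss x + c) = cont M (cf w t) (int c - int (zz x))" using Suc by simp
      moreover have "\<xi> (t * ss x + (c + 1)) = cont M (cf w t) (int c - int (zz x) + 1)"
        using Suc.IH[of "c + 1"] Suc.prems False S by (simp add: algebra_simps)
      ultimately show ?thesis using cont_cf_Suc[where w = w and t = t and i = "int c - int (zz x)"] by (simp del: funpow.simps)
    qed
  qed
  have "tm x * ss x + zz x < nkk x" using S by (simp add: nkk_def)
  from al[OF this] have "\<xi> (tm x * ss x + zz x) mod num_symbols M = 2" by (simp add: alw_def ixx_def)
  moreover have "\<xi> (tm x * ss x + zz x) = cont M (cf w (tm x)) 0" using rows[of "tm x" "zz x"] S by simp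
  ultimately have "bit_symbol (w \<in> V) = 2" using cf_accept[OF lw(2)] by simp
  then have "w \<in> V" by (auto simp: bit_symbol_def split: if_splits)
  then show ?thesis using m2 by (intro exI[of _ y]) (simp add: w_def y_def)
qed

end

section \<open>The Horn formula\<close>

fun tag :: "atom \<Rightarrow> nat" where
  "tag (AE _ _ _) = 0" | "tag (AL _ _ _ _ _ _) = 1" | "tag (AW _ _ _ _ _ _ _ _) = 2"
| "tag (AP _ _ _ _ _ _ _ _) = 3" | "tag (AC _ _ _ _ _ _ _) = 4" | "tag (AV _ _ _ _ _) = 5"
| "tag (AR _ _ _ _) = 6" | "tag (AQ _ _ _ _ _ _) = 7" | "tag (AX _ _ _ _) = 8"
| "tag (AG _ _ _) = 9" | "tag (AO _) = 10" | "tag AF = 11"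

fun args :: "atom \<Rightarrow> nat list" where
  "args (AE a b c) = [a,b,c]" | "args (AL a b c d e f) = [a,b,c,d,e,f]"
| "args (AW a b c d e f g h) = [a,b,c,d,e,f,g,h]" | "args (AP a b c d e f g h) = [a,b,c,d,e,f,g,h]"
| "args (AC a b c d e f g) = [a,b,c,d,e,f,g]" | "args (AV a b c d e) = [a,b,c,d,e]"
| "args (AR a b c d) = [a,b,c,d]" | "args (AQ a b c d e f) = [a,b,c,d,e,f]" | "args (AX a b c d) = [a,b,c,d]"
| "args (AG a b c) = [a,b,c]" | "args (AO a) = [a]" | "args AF = []"

primrec lc :: "nat \<Rightarrow> nat list \<Rightarrow> nat" where
  "lc W [] = 0" | "lc W (a # as) = a + W * lc W as"

lemma lc_less: "0 < W \<Longrightarrow> \<forall>a\<in>set as. a < W \<Longrightarrow> lc W as < W ^ length as"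
proof (induction as)
  case (Cons a as)
  then have "lc W as < W ^ length as" "a < W" by auto
  then have "a + W * lc W as < W * Suc (lc W as)" by simp
  also have "\<dots> \<le> W * W ^ length as" using \<open>lc W as < W ^ length as\<close> by (intro mult_left_mono) auto
  finally show ?case by simp
qed simp

lemma lc_digit: "0 < W \<Longrightarrow> \<forall>a\<in>set as. a < W \<Longrightarrow> i < length as \<Longrightarrow> lc W as div W ^ i mod W = as ! i"
proof (induction as arbitrary: i)
  case (Cons a as)
  show ?case
  proof (cases i)
    case 0
    then show ?thesis using Cons.prems by simp
  next
    case (Suc j)
    have "(a + W * lc W as) div W ^ Suc j = (a + W * lc W as) div W div W ^ j" by (simp add: div_mult2_eq)
    also have "(a + W * lc W as) div W = lc W as" using Cons.prems by simp
    finally show ?thesis using Cons Suc by simp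
  qed
qed simp

definition ec :: "nat \<Rightarrow> nat \<Rightarrow> nat list \<Rightarrow> nat" where "ec W t as = t + 12 * lc W as"

definition enc :: "nat \<Rightarrow> atom \<Rightarrow> nat" where "enc W a = ec W (tag a) (args a)"

text \<open>Reads argument \<open>i\<close> back from a code; this lets \<open>bodyq\<close> recover
  bound variables without a search.\<close>

definition ag :: "nat \<Rightarrow> nat \<Rightarrow> nat \<Rightarrow> nat" where "ag W v i = v div 12 div W ^ i mod W"

definition okat :: "nat \<Rightarrow> atom \<Rightarrow> bool" where "okat W a \<longleftrightarrow> (\<forall>x\<in>set (args a). x < W)"

lemma tag_less: "tag a < 12" by (cases a) auto
lemma len_args: "length (args a) \<le> 8" by (cases a) auto

lemma enc_mod: "enc W a mod 12 = tag a" and enc_div: "enc W a div 12 = lc W (args a)"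
  using tag_less[of a] by (simp_all add: enc_def ec_def)

lemma ag_enc: "0 < W \<Longrightarrow> okat W a \<Longrightarrow> i < length (args a) \<Longrightarrow> ag W (enc W a) i = args a ! i"
  unfolding ag_def enc_div okat_def by (rule lc_digit)

lemma enc_less: assumes "0 < W" "okat W a" shows "enc W a < 12 * W ^ 8"
proof -
  have "lc W (args a) < W ^ length (args a)" using lc_less assms by (simp add: okat_def)
  also have "\<dots> \<le> W ^ 8" using len_args assms(1) by (intro power_increasing) auto
  finally show ?thesis using tag_less[of a] by (simp add: enc_def ec_def)
qed

lemma atom_eqI: "tag a = tag b \<Longrightarrow> args a = args b \<Longrightarrow> a = b"
  by (cases a; cases b) auto

lemma enc_inj: assumes "0 < W" "okat W a" "okat W b" "enc W a = enc W b" shows "a = b"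
proof (rule atom_eqI)
  show t: "tag a = tag b" using enc_mod assms(4) by metis
  have l: "length (args a) = length (args b)" using t by (cases a; cases b) auto
  show "args a = args b"
    by (rule nth_equalityI[OF l]) (use ag_enc[OF assms(1,2)] ag_enc[OF assms(1,3)] assms(4) l in metis)
qed

context gapsys
begin

text \<open>Rules with their parameters in a function, so that a number can be decoded into a rule:
  the kind is the residue modulo 15, the parameters are base-\<open>W\<close> digits. Conditions and
  heads become arithmetic on these.\<close>

definition dr :: "nat \<Rightarrow> (nat \<Rightarrow> nat) \<Rightarrow> rule" where
  "dr tg p = (if tg = 0 then RL0 (p 0) (p 1) (p 2) (p 3) (p 4)
     else if tg = 1 then RL (p 0) (p 1) (p 2) (p 3) (p 4) (p 5)
     else if tg = 2 then RW (p 0) (p 1) (p 2) (p 3) (p 4) (p 5) (p 6) (p 7) (p 8)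
     else if tg = 3 then RP0 (p 0) (p 1) (p 2) (p 3) (p 4) (p 5)
     else if tg = 4 then RP (p 0) (p 1) (p 2) (p 3) (p 4) (p 5) (p 6) (p 7) (p 8)
     else if tg = 5 then RC (p 0) (p 1) (p 2) (p 3) (p 4) (p 5) (p 6) (p 7)
     else if tg = 6 then RV0 (p 0) (p 1) (p 2)
     else if tg = 7 then RV (p 0) (p 1) (p 2) (p 3) (p 4) (p 5)
     else if tg = 8 then RR (p 0) (p 1) (p 2) (p 3)
     else if tg = 9 then RQ0 (p 0) (p 1) (p 2) (p 3)
     else if tg = 10 then RQ (p 0) (p 1) (p 2) (p 3) (p 4) (p 5) (p 6)
     else if tg = 11 then RX (p 0) (p 1) (p 2) (p 3)
     else if tg = 12 then RG (p 0) (p 1) (p 2) (p 3) (p 4) (p 5) (p 6)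
     else if tg = 13 then RO (p 0) (p 1) else RF)"

text \<open>\<open>D\<close> stands for \<open>Dd\<close>. The computation replaces it by a version
  capped at \<open>Dd T\<close>, which agrees on the levels up to \<open>T\<close> and remains
  polynomially bounded.\<close>

definition validq :: "(nat \<Rightarrow> nat) \<Rightarrow> nat \<Rightarrow> (nat \<Rightarrow> nat) \<Rightarrow> bool" where
  "validq D tg p \<longleftrightarrow>
     (if tg = 0 then p 0 < U \<and> p 1 < q \<and> p 2 < q \<and> p 3 < q \<and> p 4 < 2
      else if tg = 1 then p 0 < T \<and> p 1 < U \<and> p 2 < q \<and> p 3 < q \<and> p 4 < D (Suc (p 0)) \<and> p 5 < q
      else if tg = 2 then p 0 < T \<and> p 1 < U \<and> p 2 < q \<and> p 3 < q \<and> p 4 < q \<and> p 5 < q \<and> p 6 < D (Suc (p 0)) \<and> p 7 < q \<and> p 8 < q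
      else if tg = 3 then p 0 < T \<and> p 1 < U \<and> p 2 < q \<and> p 3 < q \<and> p 4 < q \<and> p 5 < q
      else if tg = 4 then p 0 < T \<and> p 1 < U \<and> p 2 < q \<and> p 3 < q \<and> p 4 < q \<and> p 5 < q \<and> p 6 < D (Suc (p 0)) \<and> p 7 < q \<and> p 8 < q
      else if tg = 5 then p 0 < T \<and> p 1 < U \<and> p 2 < q \<and> p 3 < q \<and> p 4 < q \<and> p 5 < D (Suc (p 0)) \<and> p 6 < q \<and> p 7 < q
      else if tg = 6 then p 0 < U \<and> p 1 < q \<and> p 2 < q
      else if tg = 7 then p 0 < U \<and> p 1 < q \<and> p 2 < q \<and> p 3 < D T \<and> p 4 < q \<and> p 5 < q
      else if tg = 8 then p 0 < q ^ d \<and> p 1 < q \<and> p 2 < q ^ d \<and> p 3 < q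
      else if tg = 9 then p 0 < q ^ d \<and> p 1 < q \<and> p 2 < q ^ d \<and> p 3 < q ^ d
      else if tg = 10 then p 0 < q ^ d \<and> p 1 < q \<and> p 2 < q ^ d \<and> p 3 < q ^ d \<and> p 4 < D T \<and> p 5 < q \<and> p 6 < q
      else if tg = 11 then p 0 < q ^ d \<and> p 1 < q \<and> p 2 < q ^ d \<and> p 3 < q
      else if tg = 12 then p 0 < q ^ d \<and> p 1 < q \<and> p 2 < nk \<and> p 3 < q \<and> p 4 < q \<and> p 5 < q \<and> p 6 < q \<and> al (p 2) (p 3) (p 4) (p 5) (p 6)
      else if tg = 13 then p 0 < q ^ d \<and> p 1 < q else True)"

definition validp where "validp = validq Dd"

lemma validp: "validp tg p \<longleftrightarrow> valid (dr tg p)"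
  unfolding validp_def validq_def dr_def by simp

definition headp :: "nat \<Rightarrow> nat \<Rightarrow> (nat \<Rightarrow> nat) \<Rightarrow> nat" where
  "headp W tg p =
     (if tg = 0 then ec W 1 [0, p 0, p 3, (p 1 + p 2 * p 3) mod q, p 4, if p 4 = 0 then p 1 else p 2]
      else if tg = 1 then ec W 1 [Suc (p 0), p 1, p 2, p 3, p 4, p 5]
      else if tg = 2 then ec W 2 [p 0, p 1, p 2, p 3, p 4, p 5, p 6, p 7]
      else if tg = 3 then ec W 3 [p 0, p 1, p 2, p 3, p 4, p 5, 0, 0]
      else if tg = 4 then ec W 3 [p 0, p 1, p 2, p 3, p 4, p 5, Suc (p 6), (p 7 * p 5 + p 8) mod q]
      else if tg = 5 then ec W 4 [p 0, p 1, p 2, p 3, p 4, p 5, p 6]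
      else if tg = 6 then ec W 5 [p 0, p 1, p 2, 0, 0]
      else if tg = 7 then ec W 5 [p 0, p 1, p 2, Suc (p 3), (p 4 * Suc (p 1) + p 5) mod q]
      else if tg = 8 then ec W 6 [p 0, p 1, p 2, p 3]
      else if tg = 9 then ec W 7 [p 0, p 1, p 2, p 3, 0, 0]
      else if tg = 10 then ec W 7 [p 0, p 1, p 2, p 3, Suc (p 4), (p 5 + lam (Suc (p 4)) * p 6) mod q]
      else if tg = 11 then ec W 8 [p 0, p 1, p 2, p 3]
      else if tg = 12 then ec W 9 [p 0, p 1, p 2]
      else if tg = 13 then ec W 10 [p 0] else ec W 11 [])"

lemma headp: "headp W tg p = enc W (head (dr tg p))"
  unfolding headp_def dr_def enc_def by simp

text \<open>A membership test for the body. Where the body is a set comprehension, its bound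
  variables are extracted from the candidate \<open>v\<close>, which is then compared with the code
  rebuilt from them.\<close>

definition bodyq :: "(nat \<Rightarrow> nat) \<Rightarrow> nat \<Rightarrow> nat \<Rightarrow> (nat \<Rightarrow> nat) \<Rightarrow> nat \<Rightarrow> bool" where
  "bodyq D W tg p v \<longleftrightarrow>
     (if tg = 0 then v = ec W 0 [p 0, p 1, p 2]
      else if tg = 1 then v = ec W 2 [p 0, p 1, ag W v 2, ag W v 3, p 2, p 3, p 4, p 5] \<and> ag W v 2 < q \<and> ag W v 3 < q
      else if tg = 2 then v = ec W 3 [p 0, p 1, p 2, p 3, p 8, p 4, D (Suc (p 0)), p 5] \<or> v = ec W 4 [p 0, p 1, p 2, p 3, p 8, p 6, p 7]
      else if tg = 3 then False
      else if tg = 4 then v = ec W 3 [p 0, p 1, p 2, p 3, p 4, p 5, p 6, p 7] \<or> v = ec W 4 [p 0, p 1, p 2, p 3, p 4, D (Suc (p 0)) - 1 - p 6, p 8]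
      else if tg = 5 then v = ec W 1 [p 0, 2 * q * p 1 + p 3, p 2, p 4, p 5 mod D (p 0), p 7] \<or>
        (v = ec W 1 [p 0, ag W v 1, p 3, p 7, p 5 div D (p 0), p 6] \<and> 2 * q * p 1 + q \<le> ag W v 1 \<and> ag W v 1 < 2 * q * p 1 + q + q
          \<and> (ag W v 1 - (2 * q * p 1 + q)) mod D (p 0) = p 5 mod D (p 0))
      else if tg = 6 then False
      else if tg = 7 then v = ec W 5 [p 0, p 1, p 2, p 3, p 4] \<or> v = ec W 1 [T, p 0, p 1, p 2, D T - 1 - p 3, p 5]
      else if tg = 8 then v = ec W 5 [lncode q d (p 0) (p 2) (ag W v 1), ag W v 1, p 1, D T, p 3] \<and> ag W v 1 < q
      else if tg = 9 then False
      else if tg = 10 then v = ec W 7 [p 0, p 1, p 2, p 3, p 4, p 5] \<or> v = ec W 6 [p 0, p 1, lin q d (p 2) (Suc (p 4)) (p 3), p 6]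
      else if tg = 11 then v = ec W 7 [p 0, p 1, p 2, ag W v 3, D T, p 3] \<and> ag W v 3 < q ^ d
      else if tg = 12 then v = ec W 8 [p 0, p 1, ix (p 2) 0, p 3] \<or> v = ec W 8 [p 0, p 1, ix (p 2) 1, p 4]
        \<or> v = ec W 8 [p 0, p 1, ix (p 2) 2, p 5] \<or> v = ec W 8 [p 0, p 1, ix (p 2) 3, p 6]
      else if tg = 13 then v = ec W 9 [p 0, p 1, ag W v 2] \<and> ag W v 2 < nk
      else v = ec W 10 [ag W v 0] \<and> ag W v 0 < q ^ d)"

definition bodyp where "bodyp = bodyq Dd"

lemma validq_cong: "(\<And>t. t \<le> T \<Longrightarrow> D t = Dd t) \<Longrightarrow> validq D tg p = validp tg p"
  unfolding validp_def validq_def by (simp cong: conj_cong if_cong)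

lemma bodyq_cong: "(\<And>t. t \<le> T \<Longrightarrow> D t = Dd t) \<Longrightarrow> validp tg p \<Longrightarrow> bodyq D W tg p v = bodyp W tg p v"
  unfolding validp_def validq_def bodyp_def bodyq_def by (simp split: if_splits)

end

text \<open>\<open>W\<close> exceeds every argument of every atom in a valid rule, so that codes in
  base \<open>W\<close> are injective.\<close>

locale inst = gapsys +
  fixes W Mc :: nat
  assumes q2: "2 \<le> q" and W: "2 * q * U + 2 * q \<le> W" "q ^ (2 * d) \<le> W" "Dd T < W" "T < W" "nk \<le> W" "q ^ d \<le> W" "U \<le> W"
    and ixW: "\<And>k i. k < nk \<Longrightarrow> i < 4 \<Longrightarrow> ix k i < W"
begin

lemma q0: "0 < q" and qW: "q < W" and W0: "0 < W" and W2: "2 < W" using q2 W by auto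

lemma DdW: "t < T \<Longrightarrow> k \<le> Dd (Suc t) \<Longrightarrow> k < W"
  using Dd_mono[of "Suc t" T] W(3) by simp

lemma ok_body: assumes "valid \<rho>" "a \<in> body \<rho>" shows "okat W a"
proof (cases \<rho>)
  case (RC t I u v a k b a2)
  have I: "2 * q * I + 2 * q \<le> W"
  proof -
    have "2 * q * I \<le> 2 * q * U" using assms RC by (intro mult_left_mono) auto
    then show ?thesis using W(1) by linarith
  qed
  have k: "k < W" "k mod Dd t < W" "k div Dd t < W" using assms RC DdW[of t k] by (auto intro: le_less_trans[OF mod_less_eq_dividend] le_less_trans[OF div_le_dividend])
  show ?thesis using assms RC I k qW W by (auto simp: okat_def)
next
  case (RR z a p b)
  have "lncode q d z p t < W" for t using lncode_less[OF q0, of d z p t] W(2) by linarith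
  then show ?thesis using assms RR qW W by (auto simp: okat_def)
next
  case (RQ z a p y l b b')
  have "lin q d p (Suc l) y < W" using lin_less[OF q0, of d p "Suc l" y] W(6) by linarith
  then show ?thesis using assms RQ qW W by (auto simp: okat_def)
next
  case (RG z a k b0 b1 b2 b3)
  then show ?thesis using assms qW W ixW[of k 0] ixW[of k 1] ixW[of k 2] ixW[of k 3] by (auto simp: okat_def)
next
  case (RW t I u v s a k b a')
  then show ?thesis using assms qW W DdW[of t k] DdW[of t "Dd (Suc t)"] by (auto simp: okat_def)
next
  case (RP t I u v a s l b b')
  then show ?thesis using assms qW W DdW[of t l] DdW[of t "Dd (Suc t) - Suc l"] by (auto simp: okat_def)
next
  case (RL t I s a k b)
  then show ?thesis using assms qW W DdW[of t k] by (auto simp: okat_def)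
qed (use assms qW W in \<open>auto simp: okat_def\<close>)

lemma ok_head: assumes "valid \<rho>" shows "okat W (head \<rho>)"
proof (cases \<rho>)
  case (RL t I s a k b)
  then show ?thesis using assms qW W DdW[of t k] by (auto simp: okat_def)
next
  case (RW t I u v s a k b a')
  then show ?thesis using assms qW W DdW[of t k] by (auto simp: okat_def)
next
  case (RP t I u v a s l b b')
  have "(b * s + b') mod q < W" using q0 qW by (meson less_trans mod_less_divisor)
  then show ?thesis using assms qW W DdW[of t "Suc l"] RP by (auto simp: okat_def)
next
  case (RC t I u v a k b a2)
  then show ?thesis using assms qW W DdW[of t k] by (auto simp: okat_def)
next
  case (RV I s a l b b')
  have "(b * Suc s + b') mod q < W" using q0 qW by (meson less_trans mod_less_divisor)
  then show ?thesis using assms qW W RV by (auto simp: okat_def)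
next
  case (RQ z a p y l b b')
  have "(b + lam (Suc l) * b') mod q < W" using q0 qW by (meson less_trans mod_less_divisor)
  then show ?thesis using assms qW W RQ by (auto simp: okat_def)
next
  case (RL0 I c0 c1 s k)
  have "(c0 + c1 * s) mod q < W" using q0 qW by (meson less_trans mod_less_divisor)
  then show ?thesis using assms qW W W2 RL0 by (auto simp: okat_def)
qed (use assms qW W in \<open>auto simp: okat_def\<close>)

lemma head_notin_body: "head \<rho> \<notin> body \<rho>" by (cases \<rho>) auto
lemma tag_head: "tag (head \<rho>) \<noteq> 0" by (cases \<rho>) auto

lemma dr_surj: assumes "valid \<rho>" shows "\<exists>r<15 * W ^ 9. dr (r mod 15) (\<lambda>i. r div 15 div W ^ i mod W) = \<rho>"
proof -
  have fin: "\<exists>r<15 * W ^ 9. dr (r mod 15) (\<lambda>i. r div 15 div W ^ i mod W) = \<rho>"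
    if ps: "\<forall>a\<in>set ps. a < W" "length ps \<le> 9" and tg: "tg < 15"
      and e: "\<And>p. (\<And>i. i < length ps \<Longrightarrow> p i = ps ! i) \<Longrightarrow> dr tg p = \<rho>" for tg ps
  proof (intro exI[of _ "tg + 15 * lc W ps"] conjI)
    have "lc W ps < W ^ length ps" by (rule lc_less[OF W0 ps(1)])
    also have "\<dots> \<le> W ^ 9" using ps(2) W0 by (intro power_increasing) auto
    finally show "tg + 15 * lc W ps < 15 * W ^ 9" using tg by simp
    have m: "(tg + 15 * lc W ps) mod 15 = tg" "(tg + 15 * lc W ps) div 15 = lc W ps" using tg by simp_all
    show "dr ((tg + 15 * lc W ps) mod 15) (\<lambda>i. (tg + 15 * lc W ps) div 15 div W ^ i mod W) = \<rho>"
      unfolding m by (rule e) (rule lc_digit[OF W0 ps(1)])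
  qed
  have k: "k < W" if "k < Dd (Suc t)" "t < T" for k t using DdW[OF that(2)] that(1) by simp
  show ?thesis
  proof (cases \<rho>)
    case (RL0 I c0 c1 s k)
    show ?thesis by (rule fin[of "[I,c0,c1,s,k]" 0]) (use assms RL0 qW W W2 in \<open>auto simp: dr_def\<close>)
  next
    case (RL t I s a k b)
    show ?thesis by (rule fin[of "[t,I,s,a,k,b]" 1]) (use assms RL qW W k in \<open>auto simp: dr_def\<close>)
  next
    case (RW t I u v s a k b a')
    show ?thesis by (rule fin[of "[t,I,u,v,s,a,k,b,a']" 2]) (use assms RW qW W k in \<open>auto simp: dr_def\<close>)
  next
    case (RP0 t I u v a s)
    show ?thesis by (rule fin[of "[t,I,u,v,a,s]" 3]) (use assms RP0 qW W in \<open>auto simp: dr_def\<close>)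
  next
    case (RP t I u v a s l b b')
    show ?thesis by (rule fin[of "[t,I,u,v,a,s,l,b,b']" 4]) (use assms RP qW W k in \<open>auto simp: dr_def\<close>)
  next
    case (RC t I u v a k b a2)
    show ?thesis by (rule fin[of "[t,I,u,v,a,k,b,a2]" 5]) (use assms RC qW W k in \<open>auto simp: dr_def\<close>)
  next
    case (RV0 I s a)
    show ?thesis by (rule fin[of "[I,s,a]" 6]) (use assms RV0 qW W in \<open>auto simp: dr_def\<close>)
  next
    case (RV I s a l b b')
    show ?thesis by (rule fin[of "[I,s,a,l,b,b']" 7]) (use assms RV qW W in \<open>auto simp: dr_def\<close>)
  next
    case (RR z a p b)
    show ?thesis by (rule fin[of "[z,a,p,b]" 8]) (use assms RR qW W in \<open>auto simp: dr_def\<close>)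
  next
    case (RQ0 z a p y)
    show ?thesis by (rule fin[of "[z,a,p,y]" 9]) (use assms RQ0 qW W in \<open>auto simp: dr_def\<close>)
  next
    case (RQ z a p y l b b')
    show ?thesis by (rule fin[of "[z,a,p,y,l,b,b']" 10]) (use assms RQ qW W in \<open>auto simp: dr_def\<close>)
  next
    case (RX z a p b)
    show ?thesis by (rule fin[of "[z,a,p,b]" 11]) (use assms RX qW W in \<open>auto simp: dr_def\<close>)
  next
    case (RG z a k b0 b1 b2 b3)
    show ?thesis by (rule fin[of "[z,a,k,b0,b1,b2,b3]" 12]) (use assms RG qW W in \<open>auto simp: dr_def\<close>)
  next
    case (RO z a)
    show ?thesis by (rule fin[of "[z,a]" 13]) (use assms RO qW W in \<open>auto simp: dr_def\<close>)
  next
    case RF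
    show ?thesis by (rule fin[of "[]" 14]) (use RF in \<open>auto simp: dr_def\<close>)
  qed
qed

lemma ag_body: "valid \<rho> \<Longrightarrow> a \<in> body \<rho> \<Longrightarrow> i < length (args a) \<Longrightarrow> ag W (enc W a) i = args a ! i"
  by (rule ag_enc[OF W0 ok_body])

lemma bodyp:
  assumes v: "valid (dr tg p)"
  shows "bodyp W tg p v \<longleftrightarrow> v \<in> enc W ` body (dr tg p)"
proof
  assume "bodyp W tg p v"
  then show "v \<in> enc W ` body (dr tg p)"
    unfolding bodyp_def bodyq_def dr_def
    apply (simp split: if_splits)
    subgoal by (simp add: enc_def)
    subgoal by (rule image_eqI[of _ _ "AW (p 0) (p 1) (ag W v 2) (ag W v 3) (p 2) (p 3) (p 4) (p 5)"]) (auto simp: enc_def)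
    subgoal by (auto simp: enc_def)
    subgoal by (auto simp: enc_def)
    subgoal apply (elim disjE conjE)
      subgoal by (simp add: enc_def)
      subgoal by (rule disjI2, rule image_eqI[of _ _ "AL (p 0) (ag W v 1) (p 3) (p 7) (p 5 div Dd (p 0)) (p 6)"])
         (auto simp: enc_def intro!: exI[of _ "ag W v 1 - (2 * q * p 1 + q)"])
      done
    subgoal by (auto simp: enc_def)
    subgoal by (rule image_eqI[of _ _ "AV (lncode q d (p 0) (p 2) (ag W v 1)) (ag W v 1) (p 1) (Dd T) (p 3)"]) (auto simp: enc_def)
    subgoal by (auto simp: enc_def)
    subgoal by (rule image_eqI[of _ _ "AQ (p 0) (p 1) (p 2) (ag W v 3) (Dd T) (p 3)"]) (auto simp: enc_def)
    subgoal by (auto simp: enc_def)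
    subgoal by (rule image_eqI[of _ _ "AG (p 0) (p 1) (ag W v 2)"]) (auto simp: enc_def)
    subgoal by (rule image_eqI[of _ _ "AO (ag W v 0)"]) (auto simp: enc_def)
    done
next
  assume "v \<in> enc W ` body (dr tg p)"
  then obtain a where a: "a \<in> body (dr tg p)" "v = enc W a" by blast
  note g = ag_body[OF v a(1)]
  show "bodyp W tg p v"
    using a(1) g unfolding a(2) bodyp_def bodyq_def dr_def
    by (auto split: if_splits simp: enc_def)
qed


text \<open>Block 0 of \<open>A0\<close> variables contains the shared guesses, block
  \<open>j\<close> the other atoms of copy \<open>j\<close>. \<open>Gn\<close> clauses do not
  involve seeds, and there are just as many seeds, so those clauses weigh like one more guess per
  seed. Padding makes \<open>nn\<close> exceed the number \<open>NC\<close> of clauses, which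
  permits the clause bound \<open>n\<close>.\<close>

definition A0 where "A0 = 12 * W ^ 8"
definition m0 where "m0 = Suc Mc * A0"
definition Rn where "Rn = 15 * W ^ 9"
definition Gn where "Gn = Mc * Rn + m0"
definition NC where "NC = Gn + Gn * m0"
definition nn where "nn = NC + m0"
definition goals where "goals = {v. A0 \<le> v \<and> v < m0 \<and> v mod A0 = 11}"
definition vj where "vj j a = (if tag a = 0 then enc W a else j * A0 + enc W a)"
text \<open>A number that decodes to no valid rule yields \<open>(goals, 0)\<close>, which is one of
  the clauses from the goals anyway.\<close>

definition ruj :: "nat \<Rightarrow> nat \<Rightarrow> (nat \<Rightarrow> nat) \<Rightarrow> nat set \<times> nat" where
  "ruj j tg p = (if validp tg p then (vj j ` body (dr tg p), vj j (head (dr tg p))) else (goals, 0))"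
text \<open>Enumeration of all clauses: rules by copy, then the clauses from all goals to an atom,
  then the seeds. If that atom is a goal, 0 takes its place, as the head must not occur in the
  body.\<close>

definition rl :: "nat \<Rightarrow> nat set \<times> nat" where
  "rl k = (if k < Mc * Rn then ruj (Suc (k div Rn)) (k mod Rn mod 15) (\<lambda>i. k mod Rn div 15 div W ^ i mod W)
    else if k < Gn then (goals, if k - Mc * Rn \<in> goals then 0 else k - Mc * Rn)
    else ({m0 + (k - Gn) div m0}, (k - Gn) mod m0))"
definition Gam where "Gam = rl ` {..<Gn}"
definition Phi where "Phi = map (\<lambda>k. hcl (rl k)) [0..<NC]"
definition hfun where "hfun x = cnf_true x Phi"

lemma A0: "11 < A0" "0 < A0"
proof -
  have "0 < W ^ 8" using W0 by simp
  then show "11 < A0" "0 < A0" unfolding A0_def by linarith+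
qed
lemma m0: "0 < m0" "A0 \<le> m0" using A0 by (auto simp: m0_def)
lemma Rn0: "0 < Rn" using W0 by (simp add: Rn_def)
lemma goals0: "0 \<notin> goals" using A0 by (simp add: goals_def)

lemma block_less: "j \<le> Mc \<Longrightarrow> e < A0 \<Longrightarrow> j * A0 + e < m0"
proof -
  assume "j \<le> Mc" "e < A0"
  then have "j * A0 + e < Suc j * A0" by simp
  also have "\<dots> \<le> m0" unfolding m0_def using \<open>j \<le> Mc\<close> by (intro mult_le_mono1) simp
  finally show ?thesis .
qed

lemma goals_mem: "1 \<le> j \<Longrightarrow> j \<le> Mc \<Longrightarrow> j * A0 + 11 \<in> goals"
  using block_less[of j 11] A0 mod_mult_self3[of j A0 11] by (cases j) (auto simp: goals_def simp del: mod_mult_self3)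

lemma goals_elim: assumes "v \<in> goals" obtains j where "1 \<le> j" "j \<le> Mc" "v = j * A0 + 11"
proof (rule that[of "v div A0"])
  show "v = v div A0 * A0 + 11" using assms div_mult_mod_eq[of v A0] by (simp add: goals_def)
  show "1 \<le> v div A0" using assms A0 by (simp add: goals_def div_greater_zero_iff Suc_le_eq)
  have "v div A0 < Suc Mc" using assms A0 by (simp add: goals_def m0_def div_less_iff_less_mult)
  then show "v div A0 \<le> Mc" by simp
qed

lemma enc_A0: "okat W a \<Longrightarrow> enc W a < A0" unfolding A0_def by (rule enc_less[OF W0])

lemma vj_less: "okat W a \<Longrightarrow> j \<le> Mc \<Longrightarrow> vj j a < m0"
  using block_less[of j "enc W a"] block_less[of 0 "enc W a"] enc_A0[of a] by (auto simp: vj_def)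

text \<open>In a copy \<open>j \<ge> 1\<close> guesses lie below \<open>A0\<close> and all other
  atoms at \<open>j * A0\<close> or above, so the two kinds do not clash.\<close>

lemma vj_inj: assumes "okat W a" "okat W b" "1 \<le> j" "vj j a = vj j b" shows "a = b"
proof -
  have "enc W a < j * A0" "enc W b < j * A0"
    using enc_A0[OF assms(1)] enc_A0[OF assms(2)] assms(3) by (cases j; simp)+
  then have "enc W a = enc W b" using assms(4) unfolding vj_def by (simp split: if_splits)
  then show ?thesis by (rule enc_inj[OF W0 assms(1,2)])
qed

lemma Gam_rule: assumes "valid \<rho>" "1 \<le> j" "j \<le> Mc" shows "(vj j ` body \<rho>, vj j (head \<rho>)) \<in> Gam"
proof -
  from dr_surj[OF assms(1)] obtain r where r: "r < Rn" "dr (r mod 15) (\<lambda>i. r div 15 div W ^ i mod W) = \<rho>" by (auto simp: Rn_def)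
  let ?k = "(j - 1) * Rn + r"
  have d: "?k div Rn = j - 1" "?k mod Rn = r" using r(1) by simp_all
  have "?k < Suc (j - 1) * Rn" using r(1) by simp
  also have "\<dots> \<le> Mc * Rn" using assms by (intro mult_le_mono1) simp
  finally have k: "?k < Mc * Rn" .
  have "rl ?k = (vj j ` body \<rho>, vj j (head \<rho>))"
    using k assms r(2) unfolding rl_def ruj_def d validp by simp
  moreover have "?k < Gn" using k by (simp add: Gn_def)
  ultimately show ?thesis unfolding Gam_def by (metis image_eqI lessThan_iff)
qed

lemma Gam_goal: assumes "v < m0" "v \<notin> goals" shows "(goals, v) \<in> Gam"
proof -
  have "rl (Mc * Rn + v) = (goals, v)" using assms by (simp add: rl_def Gn_def)
  moreover have "Mc * Rn + v < Gn" using assms by (simp add: Gn_def)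
  ultimately show ?thesis unfolding Gam_def by (metis image_eqI lessThan_iff)
qed

lemma Gam_cases: assumes "(B, v) \<in> Gam"
  obtains j \<rho> where "1 \<le> j" "j \<le> Mc" "valid \<rho>" "B = vj j ` body \<rho>" "v = vj j (head \<rho>)"
    | "B = goals" "v < m0" "v \<notin> goals"
proof -
  from assms obtain k where k: "k < Gn" "rl k = (B, v)" by (auto simp: Gam_def)
  show ?thesis
  proof (cases "k < Mc * Rn")
    case True
    have j: "Suc (k div Rn) \<le> Mc" using True Rn0 by (simp add: div_less_iff_less_mult Suc_le_eq)
    have e: "ruj (Suc (k div Rn)) (k mod Rn mod 15) (\<lambda>i. k mod Rn div 15 div W ^ i mod W) = (B, v)"
      using k True by (simp add: rl_def)
    show ?thesis
    proof (cases "validp (k mod Rn mod 15) (\<lambda>i. k mod Rn div 15 div W ^ i mod W)")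
      case v: True
      show ?thesis by (rule that(1)[OF _ j v[unfolded validp]]) (use e v in \<open>auto simp: ruj_def\<close>)
    next
      case False
      then show ?thesis using e goals0 m0 by (intro that(2)) (auto simp: ruj_def)
    qed
  next
    case False
    have "k - Mc * Rn < m0" using k(1) False by (simp add: Gn_def)
    then show ?thesis using k False goals0 m0 by (intro that(2)) (auto simp: rl_def split: if_splits)
  qed
qed

lemma seed_image: "rl ` {Gn..<NC} = seed_rules m0 Gn {..<m0}"
proof (intro set_eqI iffI)
  fix r assume "r \<in> rl ` {Gn..<NC}"
  then obtain k where k: "Gn \<le> k" "k < NC" "r = rl k" by auto
  have "(k - Gn) div m0 < Gn" using k m0(1) by (simp add: NC_def div_less_iff_less_mult)
  moreover have "(k - Gn) mod m0 < m0" using m0 by simp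
  moreover have "r = ({m0 + (k - Gn) div m0}, (k - Gn) mod m0)" using k by (simp add: rl_def Gn_def)
  ultimately show "r \<in> seed_rules m0 Gn {..<m0}" by (auto simp: seed_rules_def)
next
  fix r assume "r \<in> seed_rules m0 Gn {..<m0}"
  then obtain i v where r: "r = ({m0 + i}, v)" "i < Gn" "v < m0" by (auto simp: seed_rules_def)
  let ?k = "Gn + (i * m0 + v)"
  have "i * m0 + v < Suc i * m0" using r by simp
  also have "\<dots> \<le> Gn * m0" using r by (intro mult_le_mono1) simp
  finally have "?k \<in> {Gn..<NC}" by (simp add: NC_def)
  moreover have "rl ?k = r" using r by (simp add: rl_def Gn_def)
  ultimately show "r \<in> rl ` {Gn..<NC}" by (metis image_eqI)
qed

sublocale horn_instance nn m0 Gn Gam Phi hfun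
proof
  show "m0 + Gn \<le> nn" by (simp add: nn_def NC_def)
  show "B \<subseteq> {..<m0} \<and> v < m0 \<and> v \<notin> B" if "(B, v) \<in> Gam" for B v
    using that
  proof (cases rule: Gam_cases)
    case (1 j \<rho>)
    have "vj j (head \<rho>) \<noteq> vj j a" if "a \<in> body \<rho>" for a
      using vj_inj[OF ok_head[OF 1(3)] ok_body[OF 1(3) that] 1(1)] head_notin_body that by metis
    then show ?thesis using 1 vj_less[OF ok_head[OF 1(3)] 1(2)] vj_less[OF ok_body[OF 1(3)] 1(2)] by auto
  next
    case 2
    then show ?thesis by (auto simp: goals_def)
  qed
  have "{..<NC} = {..<Gn} \<union> {Gn..<NC}" by (auto simp: NC_def)
  then have "rl ` {..<NC} = Gam \<union> seed_rules m0 Gn {..<m0}" unfolding Gam_def seed_image[symmetric] by (simp add: image_Un)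
  moreover have "set Phi = hcl ` rl ` {..<NC}" by (auto simp: Phi_def)
  ultimately show "set Phi = hcl ` (Gam \<union> seed_rules m0 Gn {..<m0})" by simp
  show "represents nn Phi hfun" by (simp add: represents_def hfun_def)
qed

lemma length_Phi: "length Phi \<le> nn" by (simp add: Phi_def nn_def)

text \<open>Shared guesses derive the goal in every copy, and all goals together imply every atom;
  each seed thus needs one clause per guess.\<close>

lemma yes_bound:
  assumes S: "finite S" "\<And>I a b. (I, a, b) \<in> S \<Longrightarrow> I < W \<and> a < W \<and> b < W" "der S AF"
  shows "min_clauses nn hfun \<le> Gn + Gn * card S"
proof -
  let ?f = "\<lambda>(I, a, b). enc W (AE I a b)"
  let ?H = "?f ` S"
  have ok: "okat W (AE I a b)" if "(I, a, b) \<in> S" for I a b using S(2)[OF that] by (simp add: okat_def)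
  have sub: "?H \<subseteq> {..<m0}" using vj_less[OF ok, of _ _ _ 0] by (auto simp: vj_def)
  have d: "vj j a \<in> hclos Gam ?H" if "der S a" "1 \<le> j" "j \<le> Mc" for a j
    using that(1)
  proof induction
    case (dE I c0 c1)
    show ?case by (rule hclos.base) (use dE in \<open>force simp: vj_def\<close>)
  next
    case (dR \<rho>)
    show ?case by (rule hclos.step[OF Gam_rule[OF dR(1) that(2,3)]]) (use dR in blast)
  qed
  have "vj j AF = j * A0 + 11" for j by (simp add: vj_def enc_def ec_def)
  then have g: "v \<in> hclos Gam ?H" if "v \<in> goals" for v using that d[OF S(3)] by (metis goals_elim)
  have "{..<m0} \<subseteq> hclos Gam ?H"
  proof
    fix v assume "v \<in> {..<m0}"
    then show "v \<in> hclos Gam ?H" using g hclos.step[OF Gam_goal[of v]] by (cases "v \<in> goals") auto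
  qed
  then have "min_clauses nn hfun \<le> length (map rl [0..<Gn]) + Gn * card ?H"
    by (intro min_clauses_le) (use sub S(1) in \<open>auto simp: Gam_def\<close>)
  also have "\<dots> \<le> Gn + Gn * card S" using card_image_le[OF S(1), of ?f] by simp
  finally show ?thesis .
qed

text \<open>A cheap generating set might contain atoms from inside the derivations, even goals.
  Having fewer than \<open>Mc\<close> elements, it misses some copy \<open>j\<close> altogether and
  can only use guesses there; these are fewer than \<open>Mc\<close>, so the goal of copy
  \<open>j\<close> is not reached and the clauses from the goals never fire. \<open>Mc\<close> is at
  once the number of copies and the bound on the guesses.\<close>

lemma no_bound:
  assumes no: "\<And>S. finite S \<Longrightarrow> card S < Mc \<Longrightarrow> \<not> der S AF"
  shows "Gn * Mc \<le> min_clauses nn hfun"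
proof (rule min_clauses_ge)
  fix H assume H: "H \<subseteq> {..<m0}" "{..<m0} \<subseteq> hclos Gam H"
  show "Mc \<le> card H"
  proof (rule ccontr)
    assume "\<not> Mc \<le> card H"
    then have c: "card H < Mc" by simp
    have fH: "finite H" using H(1) by (rule finite_subset) simp
    have "card ((\<lambda>v. v div A0) ` H) < card {1..Mc}" using card_image_le[OF fH, of "\<lambda>v. v div A0"] c by simp
    then have "\<not> {1..Mc} \<subseteq> (\<lambda>v. v div A0) ` H" using card_mono[of "(\<lambda>v. v div A0) ` H" "{1..Mc}"] fH by auto
    then obtain j where j: "1 \<le> j" "j \<le> Mc" "\<And>v. v \<in> H \<Longrightarrow> v div A0 \<noteq> j"
      by (metis atLeastAtMost_iff imageI subsetI)
    let ?f = "\<lambda>(I, a, b). enc W (AE I a b)"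
    define S where "S = {(I, a, b). okat W (AE I a b) \<and> enc W (AE I a b) \<in> H}"
    have inj: "inj_on ?f S" unfolding inj_on_def S_def using enc_inj[OF W0] by fastforce
    have im: "?f ` S \<subseteq> H" by (auto simp: S_def)
    have fS: "finite S" using inj_on_finite[OF inj im fH] .
    have cS: "card S < Mc" using card_inj_on_le[OF inj im fH] c by simp
    \<comment> \<open>A set closed under all clauses that lacks the goal of copy \<open>j\<close>:
      everything in the other copies, from block 0 only what \<open>H\<close> contains, and in copy
      \<open>j\<close> what is derivable from the guesses in \<open>H\<close>.\<close>
    define Y where "Y = {v. v div A0 \<noteq> 0 \<and> v div A0 \<noteq> j} \<union> {v. v div A0 = 0 \<and> v \<in> H} \<union> {vj j a |a. okat W a \<and> tag a \<noteq> 0 \<and> der S a}"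
    have dv: "vj i a div A0 = (if tag a = 0 then 0 else i)" if "okat W a" for i a
      using enc_A0[OF that] by (simp add: vj_def)
    have inY: "der S a" if inh: "vj j a \<in> Y" "okat W a" for a
    proof (cases "tag a = 0")
      case True
      then obtain I x y where a: "a = AE I x y" by (cases a) auto
      have v: "vj j a = enc W a" "vj j a div A0 = 0" using dv[OF inh(2), of j] True by (simp_all add: vj_def)
      have "vj j a \<noteq> vj j b" if "okat W b" "tag b \<noteq> 0" for b
        using dv[OF that(1), of j] that(2) v(2) j(1) by auto
      then have "enc W a \<in> H" using inh(1) v(2) unfolding Y_def v(1)[symmetric] by auto
      then show ?thesis unfolding a by (intro dE) (use inh(2) a in \<open>auto simp: S_def\<close>)
    next
      case False
      then obtain b where b: "vj j a = vj j b" "okat W b" "der S b"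
        using inh dv[OF inh(2), of j] j(1) unfolding Y_def by auto
      then show ?thesis using vj_inj[OF inh(2) b(2) j(1) b(1)] by simp
    qed
    have AF: "vj j AF = j * A0 + 11" "okat W AF" by (auto simp: vj_def enc_def ec_def okat_def)
    have nd: "\<not> der S AF" by (rule no[OF fS cS])
    have "hclos Gam H \<subseteq> Y"
    proof (rule hclos_least)
      show "H \<subseteq> Y" using j(3) by (auto simp: Y_def)
      fix B v assume r: "(B, v) \<in> Gam" and B: "B \<subseteq> Y"
      from r show "v \<in> Y"
      proof (cases rule: Gam_cases)
        case (1 i \<rho>)
        show ?thesis
        proof (cases "i = j")
          case True
          have "der S (head \<rho>)"
            by (rule dR[OF 1(3)]) (use B 1 True inY ok_body[OF 1(3)] in blast)
          then show ?thesis unfolding Y_def 1(5) True using ok_head[OF 1(3)] tag_head by blast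
        next
          case False
          then show ?thesis unfolding Y_def 1(5) using dv[OF ok_head[OF 1(3)], of i] tag_head[of \<rho>] 1(1) by simp
        qed
      next
        case 2
        have "vj j AF \<in> Y" using B 2 goals_mem[OF j(1,2)] AF by auto
        then show ?thesis using inY[OF _ AF(2)] nd by blast
      qed
    qed
    moreover have "vj j AF \<in> hclos Gam H" using H(2) vj_less[OF AF(2) j(2)] by blast
    ultimately show False using inY[OF _ AF(2)] nd by blast
  qed
qed

section \<open>The encoded formula bit by bit\<close>

definition negm :: "nat \<Rightarrow> nat \<Rightarrow> bool" where
  "negm k v \<longleftrightarrow> (if k < Mc * Rn \<and> validp (k mod Rn mod 15) (\<lambda>i. k mod Rn div 15 div W ^ i mod W)
    then v mod 12 = 0 \<and> bodyp W (k mod Rn mod 15) (\<lambda>i. k mod Rn div 15 div W ^ i mod W) v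
      \<or> (let w = v - Suc (k div Rn) * A0 in Suc (k div Rn) * A0 \<le> v \<and> w mod 12 \<noteq> 0
         \<and> bodyp W (k mod Rn mod 15) (\<lambda>i. k mod Rn div 15 div W ^ i mod W) w)
    else if k < Gn then A0 \<le> v \<and> v < m0 \<and> v mod A0 = 11 else v = m0 + (k - Gn) div m0)"

definition posv :: "nat \<Rightarrow> nat" where
  "posv k = (if k < Mc * Rn then
      (if validp (k mod Rn mod 15) (\<lambda>i. k mod Rn div 15 div W ^ i mod W)
       then Suc (k div Rn) * A0 + headp W (k mod Rn mod 15) (\<lambda>i. k mod Rn div 15 div W ^ i mod W) else 0)
    else if k < Gn then (let v = k - Mc * Rn in if A0 \<le> v \<and> v < m0 \<and> v mod A0 = 11 then 0 else v)
    else (k - Gn) mod m0)"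

lemma posv: "posv k = snd (rl k)"
  by (simp add: posv_def rl_def ruj_def goals_def vj_def tag_head headp Let_def)

lemma vj_image: assumes "valid (dr tg p)"
  shows "v \<in> vj j ` body (dr tg p) \<longleftrightarrow> v mod 12 = 0 \<and> bodyp W tg p v
      \<or> (let w = v - j * A0 in j * A0 \<le> v \<and> w mod 12 \<noteq> 0 \<and> bodyp W tg p w)"
  unfolding bodyp[OF assms] Let_def
proof
  assume "v \<in> vj j ` body (dr tg p)"
  then obtain a where a: "a \<in> body (dr tg p)" "v = vj j a" by blast
  then show "v mod 12 = 0 \<and> v \<in> enc W ` body (dr tg p) \<or> j * A0 \<le> v \<and> (v - j * A0) mod 12 \<noteq> 0 \<and> v - j * A0 \<in> enc W ` body (dr tg p)"
    by (cases "tag a = 0") (auto simp: vj_def enc_mod)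
next
  assume "v mod 12 = 0 \<and> v \<in> enc W ` body (dr tg p) \<or> j * A0 \<le> v \<and> (v - j * A0) mod 12 \<noteq> 0 \<and> v - j * A0 \<in> enc W ` body (dr tg p)"
  then show "v \<in> vj j ` body (dr tg p)"
  proof (elim disjE conjE imageE)
    fix a assume "v mod 12 = 0" "v = enc W a" "a \<in> body (dr tg p)"
    then show ?thesis by (intro image_eqI[of _ _ a]) (auto simp: vj_def enc_mod)
  next
    fix a assume "j * A0 \<le> v" "(v - j * A0) mod 12 \<noteq> 0" "v - j * A0 = enc W a" "a \<in> body (dr tg p)"
    then show ?thesis by (intro image_eqI[of _ _ a]) (auto simp: vj_def enc_mod)
  qed
qed

lemma negm: "negm k v \<longleftrightarrow> v \<in> fst (rl k)"
proof (cases "k < Mc * Rn")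
  case True
  then have "k < Gn" by (simp add: Gn_def)
  then show ?thesis using True vj_image[of "k mod Rn mod 15" "\<lambda>i. k mod Rn div 15 div W ^ i mod W" v "Suc (k div Rn)"]
    unfolding negm_def rl_def ruj_def validp by (simp add: goals_def)
next
  case False
  then show ?thesis unfolding negm_def rl_def by (simp add: goals_def)
qed

definition cbit :: "nat \<Rightarrow> bool" where
  "cbit i \<longleftrightarrow> (if i < nn then True else if i = nn then False else
     (let k = (i - nn - 1) div (2 * nn); off = (i - nn - 1) mod (2 * nn) in
      if off < nn then off = posv k else negm k (off - nn)))"

lemma concat_map_nth:
  "(\<And>k. length (f k) = L) \<Longrightarrow> 0 < L \<Longrightarrow> concat (map f [0..<N]) = map (\<lambda>i. f (i div L) ! (i mod L)) [0..<N * L]"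
proof (induction N)
  case (Suc N)
  have "[0..<Suc N * L] = [0..<N * L] @ [N * L..<N * L + L]" using upt_add_eq_append[of 0 "N * L" L] by (simp add: add.commute)
  moreover have "f N = map (\<lambda>i. f (i div L) ! (i mod L)) [N * L..<N * L + L]"
    by (rule nth_equalityI) (use Suc.prems in auto)
  ultimately show ?case using Suc by simp
qed simp

lemma encode_Phi: "encode_cnf nn Phi = map cbit [0..<nn + 1 + NC * (2 * nn)]"
proof -
  have n0: "0 < nn" using m0 by (simp add: nn_def)
  have c: "encode_clause nn (hcl (rl k)) ! off = (if off < nn then off = posv k else negm k (off - nn))" if "off < 2 * nn" for k off
    using that by (auto simp: encode_clause_def nth_append hcl_def posv negm)
  have L: "length (encode_clause nn C) = 2 * nn" for C by (simp add: encode_clause_def)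
  have "concat (map (encode_clause nn) Phi) = concat (map (\<lambda>k. encode_clause nn (hcl (rl k))) [0..<NC])"
    by (simp add: Phi_def comp_def)
  also have "\<dots> = map (\<lambda>i. encode_clause nn (hcl (rl (i div (2 * nn)))) ! (i mod (2 * nn))) [0..<NC * (2 * nn)]"
    by (rule concat_map_nth) (use L n0 in auto)
  also have "\<dots> = map (\<lambda>i. cbit (i + (nn + 1))) [0..<NC * (2 * nn)]"
    by (intro map_cong refl) (use n0 in \<open>simp add: c cbit_def Let_def\<close>)
  also have "\<dots> = map cbit [nn + 1..<NC * (2 * nn) + (nn + 1)]"
    unfolding map_add_upt[symmetric] by simp
  finally have 1: "concat (map (encode_clause nn) Phi) = map cbit [nn + 1..<nn + 1 + NC * (2 * nn)]" by (simp add: add.commute)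
  have 2: "replicate nn True @ [False] = map cbit [0..<nn + 1]"
    by (rule nth_equalityI) (auto simp: nth_append cbit_def)
  have "[0..<nn + 1 + NC * (2 * nn)] = [0..<nn + 1] @ [nn + 1..<nn + 1 + NC * (2 * nn)]"
    by (rule upt_add_eq_append) simp
  then show ?thesis unfolding encode_cnf_def using 1 2 by (metis append_assoc map_append)
qed

end

section \<open>Choice of parameters\<close>

text \<open>\<open>lamq\<close> with the unbounded minimum replaced by a search below
  \<open>q\<close>.\<close>

primrec lamm :: "nat \<Rightarrow> nat \<Rightarrow> nat \<Rightarrow> nat" where
  "lamm q K 0 = q - 1"
| "lamm q K (Suc l) = mu q (\<lambda>c. (c * Suc l + lamm q K l * (K - l)) mod q = 0)"

lemma lamm_eq: "prime q \<Longrightarrow> l < q \<Longrightarrow> lamm q K l = lamq q K l"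
proof (induction l)
  case (Suc l)
  have e: "lamm q K l = lamq q K l" using Suc by simp
  have "mu q (\<lambda>c. q dvd c * Suc l + lamq q K l * (K - l)) = lamq q K (Suc l)"
    unfolding lamq.simps(2) by (rule mu_Least[where P = "\<lambda>c. q dvd c * Suc l + lamq q K l * (K - l)", OF lamq_Suc[OF Suc.prems]])
  then show ?case unfolding lamm.simps e by (simp add: dvd_eq_mod_eq_0)
qed simp

lemma double_le_exp2: "1 \<le> T \<Longrightarrow> 2 * T \<le> 2 ^ T"
proof (induction T rule: nat_induct_at_least)
  case (Suc T)
  have "2 * Suc T \<le> 2 ^ T + 2" using Suc by simp
  also have "\<dots> \<le> 2 ^ T + 2 ^ T" using power_increasing[of 1 T "2::nat"] Suc by simp
  finally show ?case by simp
qed simp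

lemma four_pow_le_Dd: assumes "1 \<le> T" shows "4 ^ T \<le> Dd T"
proof -
  have "(4::nat) ^ T = (2 ^ 2) ^ T" by simp
  also have "\<dots> = 2 ^ (2 * T)" by (simp only: power_mult)
  also have "\<dots> \<le> 2 ^ (2 ^ T)" using double_le_exp2[OF assms] by (intro power_increasing) auto
  finally show ?thesis by (simp add: Dd_def)
qed

lemma T_le_Dd: "1 \<le> T \<Longrightarrow> T \<le> Dd (T - 1)"
proof -
  assume T: "1 \<le> T"
  have "T \<le> 2 ^ (T - 1)" using T less_exp[of "T - 1"] by linarith
  also have "(2::nat) ^ (T - 1) \<le> 2 ^ (2 ^ (T - 1))" using less_exp[of "T - 1"] by (intro power_increasing) auto
  finally show ?thesis by (simp add: Dd_def)
qed

text \<open>The exponents 1, 2, 4, ... add up to \<open>2 ^ T - 1\<close>. Therefore the losses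
  \<open>Dd t\<close> of all levels multiply to less than the gap allows.\<close>

lemma prod_Dd: "2 * (\<Prod>s<T. Dd s) = Dd T"
  by (induction T) (auto simp: Dd_Suc mult_ac)

lemma le_pow_mult: "a \<le> (K::nat) ^ i \<Longrightarrow> b \<le> K ^ j \<Longrightarrow> a * b \<le> K ^ (i + j)"
  by (simp add: power_add mult_mono)
lemma le_pow_pow: "a \<le> (K::nat) ^ i \<Longrightarrow> a ^ n \<le> K ^ (i * n)"
  using power_mono[of a "K ^ i" n] by (simp add: power_mult)
lemma le_pow_mono: "2 \<le> (K::nat) \<Longrightarrow> a \<le> K ^ i \<Longrightarrow> i \<le> j \<Longrightarrow> a \<le> K ^ j"
  using power_increasing[of i j K] by linarith
lemma le_pow_add: "2 \<le> (K::nat) \<Longrightarrow> a \<le> K ^ i \<Longrightarrow> b \<le> K ^ i \<Longrightarrow> a + b \<le> K ^ (i + 1)"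
proof -
  assume h: "2 \<le> K" "a \<le> K ^ i" "b \<le> K ^ i"
  have "2 * K ^ i \<le> K * K ^ i" using h(1) by (intro mult_right_mono) auto
  then show ?thesis using h(2,3) unfolding power_add power_one_right mult.commute[of _ K] by linarith
qed

text \<open>With at least 6 levels the additive constants in the exponents are absorbed, as in
  \<open>38 * (3 * TT x + 1) \<le> 121 * TT x\<close>. The bound on \<open>cb\<close> makes every
  cell content an element of the field.\<close>

locale params = tableau +
  fixes T0 :: nat
  assumes T0: "6 \<le> T0" and cbT: "cb \<le> Dd T0"
begin

text \<open>\<open>TT x\<close> is both the number of levels and the dimension. The grid side
  \<open>Dd (TT x - 1)\<close> is the square root of \<open>KK x\<close>, which keeps degrees on
  lines below \<open>KK x\<close>. The exponent 17 is computed in \<open>no\<close>.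
  \<open>Kt x\<close> counts the bottom strings, \<open>q ^ (2 * T)\<close> lines with
  \<open>(2 * q) ^ T\<close> strings each, and \<open>MM x\<close> is the number of guesses excluded
  by soundness.\<close>

definition TT where "TT x = (LEAST T. T0 \<le> T \<and> nkk x \<le> Dd (T - 1) ^ T)"
definition KK where "KK x = Dd (TT x)"
definition qq where "qq x = (LEAST q. prime q \<and> KK x ^ 17 < q)"
definition UU where "UU x = (2 * qq x) ^ (3 * TT x + 1)"
definition WW where "WW x = 2 * qq x * UU x + 2 * qq x"
definition Kt where "Kt x = qq x ^ (2 * TT x) * (2 * qq x) ^ TT x"
definition MM where "MM x = KK x * Kt x"
definition lm where "lm x = lamm (qq x) (KK x)"
definition iy where "iy x k i = bp (qq x) (Dd (TT x - 1)) (TT x) (ixx x k i)"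
definition C0 where "C0 = Dd T0 ^ T0"

lemma TT_ex: "T0 \<le> nkk x + T0 \<and> nkk x \<le> Dd (nkk x + T0 - 1) ^ (nkk x + T0)"
proof -
  have "nkk x + T0 \<le> 2 ^ (nkk x + T0)" using less_exp[of "nkk x + T0"] by simp
  also have "\<dots> \<le> Dd (nkk x + T0 - 1) ^ (nkk x + T0)" by (intro power_mono Dd_ge2) simp
  finally show ?thesis by simp
qed

lemma TT: "T0 \<le> TT x" "nkk x \<le> Dd (TT x - 1) ^ TT x"
  using LeastI[of "\<lambda>T. T0 \<le> T \<and> nkk x \<le> Dd (T - 1) ^ T", OF TT_ex] unfolding TT_def by auto

lemma TT6: "6 \<le> TT x" using TT(1)[of x] T0 by simp

lemma KK2: "2 \<le> KK x" unfolding KK_def by (rule Dd_ge2)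

text \<open>Minimality of \<open>TT x\<close> makes the formula polynomial in the input: one level
  less would not accommodate the tableau, and \<open>KK x\<close> is the fourth power of
  \<open>Dd (TT x - 2)\<close>. The constant \<open>C0\<close> covers the case that
  \<open>T0\<close> itself is the minimum.\<close>

lemma KT_bound: "KK x ^ TT x \<le> (nkk x + C0) ^ 8"
proof (cases "TT x = T0")
  case True
  have "C0 \<le> nkk x + C0" by simp
  also have "\<dots> \<le> (nkk x + C0) ^ 8" by (rule self_le_power) (auto simp: C0_def Suc_le_eq)
  finally show ?thesis unfolding KK_def True C0_def .
next
  case False
  then have g: "T0 < TT x" using TT(1)[of x] by simp
  have "\<not> (T0 \<le> TT x - 1 \<and> nkk x \<le> Dd (TT x - 1 - 1) ^ (TT x - 1))"
  proof (rule not_less_Least[where P = "\<lambda>T. T0 \<le> T \<and> nkk x \<le> Dd (T - 1) ^ T"])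
    have "TT x - 1 < TT x" using TT6[of x] by linarith
    then show "TT x - 1 < (LEAST T. T0 \<le> T \<and> nkk x \<le> Dd (T - 1) ^ T)" unfolding TT_def[symmetric] .
  qed
  then have l: "Dd (TT x - 2) ^ (TT x - 1) \<le> nkk x" using g by (auto simp: numeral_2_eq_2)
  have T2: "TT x = Suc (Suc (TT x - 2))" using TT6[of x] by simp
  have "KK x = Dd (TT x - 2) ^ 4" unfolding KK_def by (subst T2) (simp only: Dd_Suc power4_eq_xxxx mult.assoc)
  then have "KK x ^ TT x = Dd (TT x - 2) ^ (4 * TT x)" by (simp add: power_mult)
  also have "\<dots> \<le> Dd (TT x - 2) ^ ((TT x - 1) * 8)" using TT6[of x] Dd_ge2[of "TT x - 2"] by (intro power_increasing) linarith+
  also have "\<dots> = (Dd (TT x - 2) ^ (TT x - 1)) ^ 8" by (rule power_mult)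
  also have "\<dots> \<le> (nkk x + C0) ^ 8" using l by (intro power_mono) auto
  finally show ?thesis .
qed

lemma qq_ex: "\<exists>p. prime p \<and> KK x ^ 17 < p \<and> p \<le> 8 * (KK x ^ 17)\<^sup>2"
  by (rule prime_in_range) (use KK2[of x] in auto)

lemma qq: "prime (qq x)" "KK x ^ 17 < qq x" "qq x \<le> 8 * (KK x ^ 17)\<^sup>2"
proof -
  from qq_ex[of x] obtain p where p: "prime p" "KK x ^ 17 < p" "p \<le> 8 * (KK x ^ 17)\<^sup>2" by blast
  show "prime (qq x)" "KK x ^ 17 < qq x"
    using LeastI[of "\<lambda>q. prime q \<and> KK x ^ 17 < q" p] p unfolding qq_def by auto
  have "qq x \<le> p" unfolding qq_def by (rule Least_le) (use p in simp)
  then show "qq x \<le> 8 * (KK x ^ 17)\<^sup>2" using p by simp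
qed

lemma Kq: "KK x < qq x"
proof -
  have "KK x \<le> KK x ^ 17" using KK2[of x] by (intro self_le_power) auto
  then show ?thesis using qq(2)[of x] by simp
qed

lemma cb_q: "cb \<le> qq x"
  using cbT Dd_mono[OF TT(1)[of x]] Kq[of x] unfolding KK_def by linarith

section \<open>All sizes as powers of K with exponent linear in T\<close>

lemma eight: "8 \<le> KK x ^ 3"
  using power_mono[OF KK2[of x], of 3] by simp

lemma q_le: "2 * qq x \<le> KK x ^ 38"
proof -
  have "8 * (KK x ^ 17)\<^sup>2 \<le> KK x ^ (3 + 17 * 2)" by (intro le_pow_mult le_pow_pow eight) simp
  then have "qq x \<le> KK x ^ 37" using qq(3)[of x] by simp
  then show ?thesis using le_pow_add[OF KK2, of "qq x" x 37 "qq x"] by simp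
qed

lemma Uq: "qq x ^ (2 * TT x) * (2 * qq x) ^ TT x \<le> UU x" "qq x ^ (2 * TT x) \<le> UU x" "qq x ^ TT x \<le> UU x" "(2 * qq x) ^ TT x \<le> UU x"
proof -
  have q: "1 \<le> 2 * qq x" using Kq[of x] by simp
  have a: "qq x ^ i \<le> (2 * qq x) ^ i" for i by (intro power_mono) auto
  have b: "(2 * qq x) ^ i \<le> UU x" if "i \<le> 3 * TT x + 1" for i unfolding UU_def using that q by (intro power_increasing) auto
  have "qq x ^ (2 * TT x) * (2 * qq x) ^ TT x \<le> (2 * qq x) ^ (2 * TT x) * (2 * qq x) ^ TT x" using a by (intro mult_right_mono) auto
  also have "\<dots> = (2 * qq x) ^ (3 * TT x)" unfolding power_add[symmetric] by simp
  also have "\<dots> \<le> UU x" by (rule b) simp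
  finally show "qq x ^ (2 * TT x) * (2 * qq x) ^ TT x \<le> UU x" .
  show "qq x ^ (2 * TT x) \<le> UU x" by (rule le_trans[OF a b]) simp
  show "qq x ^ TT x \<le> UU x" by (rule le_trans[OF a b]) simp
  show "(2 * qq x) ^ TT x \<le> UU x" by (rule b) simp
qed

lemma UU_le: "UU x \<le> KK x ^ (121 * TT x)"
proof (rule le_pow_mono[OF KK2])
  show "UU x \<le> KK x ^ (38 * (3 * TT x + 1))" unfolding UU_def by (rule le_pow_pow[OF q_le])
  show "38 * (3 * TT x + 1) \<le> 121 * TT x" using TT6[of x] by simp
qed

lemma WW_le: "WW x \<le> KK x ^ (128 * TT x)"
proof (rule le_pow_mono[OF KK2])
  have "2 * qq x \<le> KK x ^ (38 + 121 * TT x)" by (rule le_pow_mono[OF KK2 q_le]) simp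
  then show "WW x \<le> KK x ^ (38 + 121 * TT x + 1)" unfolding WW_def
    by (rule le_pow_add[OF KK2 le_pow_mult[OF q_le UU_le]])
  show "38 + 121 * TT x + 1 \<le> 128 * TT x" using TT6[of x] by simp
qed

lemma MM_le: "MM x \<le> KK x ^ (122 * TT x)"
proof (rule le_pow_mono[OF KK2])
  show "MM x \<le> KK x ^ (1 + 121 * TT x)" unfolding MM_def Kt_def
    by (intro le_pow_mult le_trans[OF Uq(1) UU_le]) simp
qed (use TT6[of x] in simp)

lemma ixx_less: "k < nkk x \<Longrightarrow> ixx x k i < nkk x"
  unfolding ixx_def by (auto simp: ss_def)

lemma D0q: "Dd (TT x - 1) \<le> qq x"
  using Dd_mono[of "TT x - 1" "TT x"] Kq[of x] unfolding KK_def by simp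

lemma q0: "0 < qq x" using Kq[of x] by simp

lemma iy_less: "iy x k i < qq x ^ TT x"
  unfolding iy_def bp_def
proof (rule digit_sum_less[OF q0])
  fix j show "dig (Dd (TT x - 1)) (ixx x k i) j < qq x"
    using D0q[of x] unfolding dig_def by (meson Dd_pos less_le_trans mod_less_divisor)
qed

lemma nkk_qT: "nkk x \<le> qq x ^ TT x"
  using TT(2)[of x] power_mono[OF D0q[of x], of "TT x"] by simp

sublocale I: inst "qq x" "TT x" "TT x" "UU x" "nkk x" "lm x" "iy x" "alw x" "WW x" "MM x" for x
proof
  show "2 \<le> qq x" using Kq[of x] KK2[of x] by simp
  have U: "UU x \<le> 2 * qq x * UU x" using q0[of x] by (simp)
  show "2 * qq x * UU x + 2 * qq x \<le> WW x" by (simp add: WW_def)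
  show "qq x ^ (2 * TT x) \<le> WW x" "qq x ^ TT x \<le> WW x" "UU x \<le> WW x" "nkk x \<le> WW x"
    using U Uq[of x] nkk_qT[of x] unfolding WW_def by linarith+
  show 1: "Dd (TT x) < WW x" using Kq[of x] unfolding KK_def WW_def by linarith
  have "TT x \<le> Dd (TT x)" using T_le_Dd[of "TT x"] TT6[of x] Dd_mono[of "TT x - 1" "TT x"] by simp
  then show "TT x < WW x" using 1 by linarith
  show "iy x k i < WW x" for k i using iy_less[of x k i] U Uq(3)[of x] unfolding WW_def by linarith
qed

lemma m0_le: "I.m0 x \<le> KK x ^ (1151 * TT x)"
proof (rule le_pow_mono[OF KK2])
  have "Suc (MM x) \<le> KK x ^ (122 * TT x + 1)"
    using le_pow_add[OF KK2[of x] MM_le, of 1] KK2[of x] by simp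
  moreover have "12 \<le> KK x ^ 4" using power_mono[OF KK2[of x], of 4] by simp
  ultimately show "I.m0 x \<le> KK x ^ (122 * TT x + 1 + (4 + 128 * TT x * 8))" unfolding I.m0_def I.A0_def
    by (intro le_pow_mult le_pow_pow[OF WW_le])
  show "122 * TT x + 1 + (4 + 128 * TT x * 8) \<le> 1151 * TT x" using TT6[of x] by simp
qed

lemma Gn_le: "I.Gn x \<le> KK x ^ (1276 * TT x)"
proof (rule le_pow_mono[OF KK2])
  have "15 \<le> KK x ^ 4" using power_mono[OF KK2[of x], of 4] by simp
  then have "MM x * I.Rn x \<le> KK x ^ (122 * TT x + (4 + 128 * TT x * 9))"
    unfolding I.Rn_def by (intro le_pow_mult MM_le le_pow_pow[OF WW_le])
  moreover have "I.m0 x \<le> KK x ^ (122 * TT x + (4 + 128 * TT x * 9))" by (rule le_pow_mono[OF KK2 m0_le]) simp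
  ultimately show "I.Gn x \<le> KK x ^ (122 * TT x + (4 + 128 * TT x * 9) + 1)" unfolding I.Gn_def by (rule le_pow_add[OF KK2])
  show "122 * TT x + (4 + 128 * TT x * 9) + 1 \<le> 1276 * TT x" using TT6[of x] by simp
qed

text \<open>The constant in the exponent is generous; what matters for
  \<open>rho_below_double_exp\<close> is an exponent linear in \<open>TT x\<close>.\<close>

lemma nn_le: "I.nn x \<le> KK x ^ (3000 * TT x)"
proof (rule le_pow_mono[OF KK2])
  have a: "I.Gn x * I.m0 x \<le> KK x ^ (1276 * TT x + 1151 * TT x)" by (intro le_pow_mult Gn_le m0_le)
  have b: "I.Gn x \<le> KK x ^ (1276 * TT x + 1151 * TT x)" by (rule le_pow_mono[OF KK2 Gn_le]) simp
  have c: "I.m0 x \<le> KK x ^ (1276 * TT x + 1151 * TT x + 1)" by (rule le_pow_mono[OF KK2 m0_le]) simp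
  show "I.nn x \<le> KK x ^ (1276 * TT x + 1151 * TT x + 1 + 1)" unfolding I.nn_def I.NC_def
    by (intro le_pow_add KK2 a b c)
  show "1276 * TT x + 1151 * TT x + 1 + 1 \<le> 3000 * TT x" using TT6[of x] by simp
qed

lemma nn_ge: "KK x ^ 8 \<le> I.nn x"
proof -
  have "KK x ^ 8 \<le> WW x ^ 8" using I.W(3)[of x] unfolding KK_def by (intro power_mono) auto
  also have "\<dots> \<le> I.m0 x" by (simp add: I.m0_def I.A0_def)
  finally show ?thesis by (simp add: I.nn_def)
qed

lemma Kt_pos: "0 < Kt x" using q0[of x] by (simp add: Kt_def)

lemma yes:
  assumes "length y \<le> poly py (length x)" "pair_bits x y \<in> V"
  shows "min_clauses (I.nn x) (I.hfun x) \<le> 2 * I.Gn x * Kt x"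
proof -
  from tableau_complete[OF assms] obtain \<xi> where xi: "\<And>k. \<xi> k < cb"
    and sat: "\<And>k. k < nkk x \<Longrightarrow> alw x k (\<xi> (ixx x k 0)) (\<xi> (ixx x k 1)) (\<xi> (ixx x k 2)) (\<xi> (ixx x k 3))" by blast
  let ?D = "Dd (TT x - 1)"
  \<comment> \<open>With \<open>TT x \<le> ?D\<close> the degree \<open>TT x * (?D - 1)\<close> on a
    line is below \<open>?D * ?D = KK x\<close>.\<close>
  have KD: "KK x = ?D * ?D" using TT6[of x] Dd_Suc[of "TT x - 1"] unfolding KK_def by simp
  have "TT x * (?D - 1) \<le> ?D * (?D - 1)" using T_le_Dd[of "TT x"] TT6[of x] by (intro mult_right_mono) auto
  also have "\<dots> < KK x" unfolding KD using Dd_ge2[of "TT x - 1"] by (intro mult_strict_left_mono) auto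
  finally have dK: "TT x * (?D - 1) < KK x" .
  have "\<xi> k < qq x" for k using xi[of k] cb_q[of x] by linarith
  from low_degree_extension[where \<xi> = \<xi>, OF qq(1) Dd_pos D0q dK Kq this]
  obtain A rc where ar: "\<forall>p. A p < qq x" "\<forall>I j. rc I j < qq x"
    "\<forall>I s. hev (qq x) (KK x) (rc I) s = A (lin (qq x) (TT x) (I mod qq x ^ TT x) s (I div qq x ^ TT x))"
    "\<forall>p y. p < qq x ^ TT x \<longrightarrow> y < qq x ^ TT x \<longrightarrow> (\<Sum>l<KK x. lamq (qq x) (KK x) (Suc l) * A (lin (qq x) (TT x) p (Suc l) y)) mod qq x = A p"
    "\<forall>k<?D ^ TT x. A (bp (qq x) ?D (TT x) k) = \<xi> k"
    by (elim exE conjE) (rule that; assumption)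
  note A = ar(1)[rule_format] ar(2)[rule_format] and line = ar(3)[rule_format]
    and int = ar(4)[rule_format] and Axi = ar(5)[rule_format]
  have AI: "A (iy x k i) = \<xi> (ixx x k i)" if "k < nkk x" for k i
    unfolding iy_def by (rule Axi) (use ixx_less[OF that, of i] TT(2)[of x] in linarith)
  have d: "I.der x (I.hS x rc) AF"
  proof (rule I.completeness[where A = A])
    show "0 < qq x" by (rule q0)
    show "rc I j < qq x" "A p < qq x" for I j p by (rule A)+
    show "qq x ^ (2 * TT x) * (2 * qq x) ^ TT x \<le> UU x" by (rule Uq(1))
    show "hev (qq x) (Dd (TT x)) (rc I) s = A (lin (qq x) (TT x) (I mod qq x ^ TT x) s (I div qq x ^ TT x))" for I s
      using line unfolding KK_def .
    show "(\<Sum>l<Dd (TT x). lm x (Suc l) * A (lin (qq x) (TT x) p (Suc l) y)) mod qq x = A p"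
      if "p < qq x ^ TT x" "y < qq x ^ TT x" for p y
    proof -
      have "(\<Sum>l<Dd (TT x). lm x (Suc l) * A (lin (qq x) (TT x) p (Suc l) y)) = (\<Sum>l<KK x. lamq (qq x) (KK x) (Suc l) * A (lin (qq x) (TT x) p (Suc l) y))"
        unfolding lm_def KK_def[symmetric] using Kq[of x] by (intro sum.cong refl) (simp add: lamm_eq[OF qq(1)] del: lamm.simps)
      then show ?thesis using int[OF that] by simp
    qed
    show "iy x k i < qq x ^ TT x" for k i by (rule iy_less)
    show "alw x k (A (iy x k 0)) (A (iy x k 1)) (A (iy x k 2)) (A (iy x k 3))" if "k < nkk x" for k
      using sat[OF that] AI[OF that] by simp
  qed
  have "min_clauses (I.nn x) (I.hfun x) \<le> I.Gn x + I.Gn x * card (I.hS x rc)"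
  proof (rule I.yes_bound[OF I.finite_hS _ d])
    fix J a b assume "(J, a, b) \<in> I.hS x rc"
    then obtain J' where J: "J < Kt x" "a = I.labs x rc (TT x) J 0" "b = I.labs x rc (TT x) J 1"
      unfolding I.hS_def Kt_def by auto
    have "J < WW x" using J(1) Uq(1)[of x] I.W(7)[of x] unfolding Kt_def by linarith
    moreover have "I.labs x rc (TT x) J i < WW x" for i
      using I.labs_less[OF q0, of rc x "TT x" J i] A(2) I.qW[of x] by (meson less_trans)
    ultimately show "J < WW x \<and> a < WW x \<and> b < WW x" using J by simp
  qed
  also have "card (I.hS x rc) = Kt x" unfolding I.card_hS Kt_def ..
  finally show ?thesis using Kt_pos[of x] by (cases "Kt x") auto
qed

lemma no:
  assumes "\<not> (\<exists>y. length y \<le> poly py (length x) \<and> pair_bits x y \<in> V)"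
  shows "I.Gn x * (KK x * Kt x) \<le> min_clauses (I.nn x) (I.hfun x)"
  unfolding MM_def[symmetric]
proof (rule I.no_bound, rule notI)
  fix S assume S: "finite S" "card S < MM x" "I.der x S AF"
  let ?T = "TT x" and ?K = "KK x"
  \<comment> \<open>The recursion required by \<open>soundness\<close>, solved from the top level
    \<open>?T\<close> with \<open>B = ?K\<close>.\<close>
  define \<beta> where "\<beta> t = 8 * ?K * ?K * 4 ^ (?T - t) * (\<Prod>s\<in>{t..<?T}. Dd s)" for t
  have K0: "2 \<le> ?K" by (rule KK2)
  have "\<exists>\<xi>. \<forall>k<nkk x. alw x k (\<xi> (iy x k 0)) (\<xi> (iy x k 1)) (\<xi> (iy x k 2)) (\<xi> (iy x k 3))"
  proof (rule I.soundness[OF qq(1) S(1), where B = "KK x" and \<beta> = \<beta>])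
    show "\<beta> t = 4 * Dd t * \<beta> (Suc t)" if "t < ?T" for t
    proof -
      have "(4::nat) ^ (?T - t) = 4 * 4 ^ (?T - Suc t)" using that by (metis Suc_diff_Suc power_Suc)
      moreover have "(\<Prod>s\<in>{t..<?T}. Dd s) = Dd t * (\<Prod>s\<in>{Suc t..<?T}. Dd s)" by (rule prod.atLeast_Suc_lessThan[OF that])
      ultimately show ?thesis unfolding \<beta>_def by (simp only: mult_ac)
    qed
    show "\<beta> ?T = 8 * Dd ?T * ?K" by (simp add: \<beta>_def KK_def)
    show "0 < ?K" using K0 by simp
    show "Dd ?T < qq x" using Kq[of x] unfolding KK_def .
    show "card S \<le> ?K * (qq x ^ (2 * ?T) * (2 * qq x) ^ ?T)" using S(2) by (simp add: MM_def Kt_def)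
    show "I.der x S AF" by (rule S(3))
    have "4 ^ ?T \<le> ?K" unfolding KK_def by (rule four_pow_le_Dd) (use TT6[of x] in simp)
    moreover have "2 * (\<Prod>s\<in>{0..<?T}. Dd s) = ?K" using prod_Dd[of ?T] by (simp add: KK_def atLeast0LessThan)
    moreover have "\<beta> 0 = 4 * ?K * ?K * (4 ^ ?T * (2 * (\<Prod>s\<in>{0..<?T}. Dd s)))" by (simp add: \<beta>_def)
    \<comment> \<open>The product of all \<open>Dd s\<close> is half of \<open>?K\<close> and
      \<open>4 ^ ?T\<close> is at most \<open>?K\<close>, so the loss over all levels is a fixed
      power of \<open>?K\<close>.\<close>
    ultimately have b: "\<beta> 0 \<le> 4 * ?K * ?K * (?K * ?K)" by (simp add: mult_le_mono)
    have 4: "4 \<le> ?K ^ 2" using power_mono[OF K0, of 2] by simp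
    have b': "\<beta> 0 \<le> ?K ^ 6"
    proof -
      have "4 * ?K * ?K * (?K * ?K) \<le> ?K ^ (2 + 1 + 1 + (1 + 1))" by (intro le_pow_mult 4) auto
      then show ?thesis using b by simp
    qed
    \<comment> \<open>3 + (1 + 1 + 6 + 6) = 17 is the exponent in the definition of
      \<open>qq\<close>.\<close>
    have "8 * (?K * ?K * \<beta> 0 * \<beta> 0) \<le> ?K ^ (3 + (1 + 1 + 6 + 6))" by (intro le_pow_mult eight b') auto
    then show "8 * (Dd ?T * Dd ?T * \<beta> 0 * \<beta> 0) \<le> qq x" using qq(2)[of x] unfolding KK_def by simp
  qed
  then obtain \<xi> where xi: "\<And>k. k < nkk x \<Longrightarrow> alw x k (\<xi> (iy x k 0)) (\<xi> (iy x k 1)) (\<xi> (iy x k 2)) (\<xi> (iy x k 3))" by blast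
  have "\<exists>y. length y \<le> poly py (length x) \<and> pair_bits x y \<in> V"
    by (rule tableau_sound[where \<xi> = "\<lambda>j. \<xi> (bp (qq x) (Dd (TT x - 1)) (TT x) j)"]) (use xi in \<open>simp add: iy_def\<close>)
  then show False using assms by blast
qed

end

section \<open>Computing the formula\<close>

lemma pb_power_const: "pb k f \<Longrightarrow> pb k (\<lambda>\<omega>. f \<omega> ^ i)"
  by (induction i) (auto intro: pb_const pb_mult)

lemma pb_pow: assumes "pb k b" "pb k e" "pb k c" "\<And>x a. length a = k \<Longrightarrow> b (x, a) ^ e (x, a) \<le> c (x, a)"
  shows "pb k (\<lambda>\<omega>. b \<omega> ^ e \<omega>)"
  by (rule pb_cong[OF pb_powt[OF assms(1-3)]]) (use assms(4) in \<open>simp add: min_absorb1\<close>)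

lemma pbP_If: assumes "pbP k P" "pbP k A" "pbP k B" shows "pbP k (\<lambda>\<omega>. if P \<omega> then A \<omega> else B \<omega>)"
  by (rule pbP_I[OF pb_if[OF assms(1) assms(2,3)[unfolded pbP_def]]]) simp

text \<open>The inner and the outer power are capped by the same bound. If the inner cap is active,
  the outer power \<open>2 ^ n\<close> still exceeds \<open>n\<close>, so the result is the cap in
  either computation.\<close>

lemma pb_Dd: assumes "pb k f" "pb k g" shows "pb k (\<lambda>\<omega>. min (Dd (f \<omega>)) (g \<omega>))"
proof (rule pb_cong)
  show "pb k (\<lambda>\<omega>. min (2 ^ min (2 ^ f \<omega>) (g \<omega>)) (g \<omega>))" by (intro pb_powt pb_const assms)
  fix x and a :: "nat list"
  have "min (2 ^ min (2 ^ m) n) n = min (Dd m) n" for m n :: nat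
  proof (cases "2 ^ m \<le> n")
    case False
    have "2 ^ m \<le> Dd m" unfolding Dd_def by (rule less_imp_le[OF less_exp])
    then have "n \<le> Dd m" using False by linarith
    moreover have "n \<le> 2 ^ n" by (rule less_imp_le[OF less_exp])
    moreover have "n \<le> 2 ^ m" using False by simp
    ultimately show ?thesis by (simp only: min_absorb2)
  qed (simp add: Dd_def min_absorb1)
  then show "min (2 ^ min (2 ^ f (x, a)) (g (x, a))) (g (x, a)) = min (Dd (f (x, a))) (g (x, a))" .
qed

text \<open>Trial division by all smaller numbers is affordable because numbers are polynomially
  bounded.\<close>

lemma pbP_prime: assumes "pb k f" shows "pbP k (\<lambda>\<omega>. prime (f \<omega>))"
proof -
  have "pbP k (\<lambda>\<omega>. 1 < f \<omega> \<and> (\<forall>m<f \<omega>. f \<omega> mod m = 0 \<longrightarrow> m = 1))"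
  proof (intro pbP_conj pbP_less pb_const assms pbP_ball[where P = "\<lambda>\<omega> m. f \<omega> mod m = 0 \<longrightarrow> m = 1"])
    show "pbP (Suc k) (\<lambda>\<omega>. f (drp \<omega>) mod vr 0 \<omega> = 0 \<longrightarrow> vr 0 \<omega> = 1)"
      by (intro pbP_imp pbP_eq pb_mod pb_const pb_weak[OF assms] pb_vr) simp_all
  qed
  moreover have "1 < n \<and> (\<forall>m<n. n mod m = 0 \<longrightarrow> m = 1) \<longleftrightarrow> prime n" for n :: nat
  proof
    assume h: "1 < n \<and> (\<forall>m<n. n mod m = 0 \<longrightarrow> m = 1)"
    show "prime n" unfolding prime_nat_iff
    proof (intro conjI allI impI)
      fix m assume "m dvd n"
      have "m \<le> n" by (rule dvd_imp_le[OF \<open>m dvd n\<close>]) (use h in simp)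
      moreover have "n mod m = 0" using \<open>m dvd n\<close> by simp
      ultimately have "m < n \<Longrightarrow> m = 1" using h[THEN conjunct2, rule_format, of m] by simp
      then show "m = 1 \<or> m = n" using \<open>m \<le> n\<close> by linarith
    qed (use h in simp)
  next
    assume p: "prime n"
    show "1 < n \<and> (\<forall>m<n. n mod m = 0 \<longrightarrow> m = 1)"
    proof (intro conjI allI impI)
      show "1 < n" using prime_gt_1_nat[OF p] .
      fix m assume m: "m < n" "n mod m = 0"
      then have "m dvd n" by (simp only: dvd_eq_mod_eq_0)
      then have "m = 1 \<or> m = n" using p[unfolded prime_nat_iff, THEN conjunct2, rule_format, of m] by simp
      then show "m = 1" using m(1) by simp
    qed
  qed
  ultimately show ?thesis by (simp only:)
qed

lemma pow_cap: fixes q :: nat shows "0 < q \<Longrightarrow> q ^ d \<le> c \<Longrightarrow> i < d \<Longrightarrow> min (q ^ i) c = q ^ i"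
  using power_increasing[of i d q] by (simp add: min_absorb1)

text \<open>A cap \<open>c \<ge> q ^ d\<close> is inactive for the exponents below \<open>d\<close>
  that occur. Such a cap has to be supplied, for it certifies that the powers are polynomially
  bounded.\<close>

lemma pb_lin:
  assumes p: "pb k q" "pb k d" "pb k z" "pb k l" "pb k y" "pb k c"
    and c: "\<And>x a. length a = k \<Longrightarrow> 0 < q (x, a) \<and> q (x, a) ^ d (x, a) \<le> c (x, a)"
  shows "pb k (\<lambda>\<omega>. lin (q \<omega>) (d \<omega>) (z \<omega>) (l \<omega>) (y \<omega>))"
proof (rule pb_cong)
  define F where "F = (\<lambda>\<omega> i. ((z \<omega> div min (q \<omega> ^ i) (c \<omega>) mod q \<omega> + l \<omega> * (y \<omega> div min (q \<omega> ^ i) (c \<omega>) mod q \<omega>)) mod q \<omega>) * min (q \<omega> ^ i) (c \<omega>))"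
  show "pb k (\<lambda>\<omega>. \<Sum>i<d \<omega>. F \<omega> i)" unfolding F_def
    by (rule pb_sum[OF _ p(2)]) (intro pb_mult pb_mod pb_add pb_div pb_powt pb_weak[OF p(1)] pb_weak[OF p(3)] pb_weak[OF p(4)] pb_weak[OF p(5)] pb_weak[OF p(6)] pb_vr, simp_all)
  fix x and a :: "nat list" assume a: "length a = k"
  show "(\<Sum>i<d (x, a). F (x, a) i) = lin (q (x, a)) (d (x, a)) (z (x, a)) (l (x, a)) (y (x, a))"
    unfolding lin_def F_def dig_def
  proof (rule sum.cong[OF refl])
    fix i assume "i \<in> {..<d (x, a)}"
    then have "min (q (x, a) ^ i) (c (x, a)) = q (x, a) ^ i" using c[OF a, of x] by (intro pow_cap) auto
    then show "(z (x, a) div min (q (x, a) ^ i) (c (x, a)) mod q (x, a) + l (x, a) * (y (x, a) div min (q (x, a) ^ i) (c (x, a)) mod q (x, a))) mod q (x, a) * min (q (x, a) ^ i) (c (x, a))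
      = (z (x, a) div q (x, a) ^ i mod q (x, a) + l (x, a) * (y (x, a) div q (x, a) ^ i mod q (x, a))) mod q (x, a) * q (x, a) ^ i" by (simp only:)
  qed
qed

lemma pb_bp:
  assumes p: "pb k q" "pb k D" "pb k d" "pb k z" "pb k c"
    and c: "\<And>x a. length a = k \<Longrightarrow> 0 < q (x, a) \<and> q (x, a) ^ d (x, a) \<le> c (x, a) \<and> 0 < D (x, a) \<and> D (x, a) ^ d (x, a) \<le> c (x, a)"
  shows "pb k (\<lambda>\<omega>. bp (q \<omega>) (D \<omega>) (d \<omega>) (z \<omega>))"
proof (rule pb_cong)
  define F where "F = (\<lambda>\<omega> i. z \<omega> div min (D \<omega> ^ i) (c \<omega>) mod D \<omega> * min (q \<omega> ^ i) (c \<omega>))"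
  show "pb k (\<lambda>\<omega>. \<Sum>i<d \<omega>. F \<omega> i)" unfolding F_def
    by (rule pb_sum[OF _ p(3)]) (intro pb_mult pb_mod pb_div pb_powt pb_weak[OF p(1)] pb_weak[OF p(2)] pb_weak[OF p(4)] pb_weak[OF p(5)] pb_vr, simp_all)
  fix x and a :: "nat list" assume a: "length a = k"
  show "(\<Sum>i<d (x, a). F (x, a) i) = bp (q (x, a)) (D (x, a)) (d (x, a)) (z (x, a))"
    unfolding bp_def F_def dig_def
  proof (rule sum.cong[OF refl])
    fix i assume "i \<in> {..<d (x, a)}"
    then have "min (q (x, a) ^ i) (c (x, a)) = q (x, a) ^ i" "min (D (x, a) ^ i) (c (x, a)) = D (x, a) ^ i"
      using c[OF a, of x] by (auto intro!: pow_cap)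
    then show "z (x, a) div min (D (x, a) ^ i) (c (x, a)) mod D (x, a) * min (q (x, a) ^ i) (c (x, a)) = z (x, a) div D (x, a) ^ i mod D (x, a) * q (x, a) ^ i" by (simp only:)
  qed
qed

lemma mu_le: "mu n P \<le> n"
proof -
  have "mu n P \<le> (\<Sum>y<n. 1)" unfolding mu_def by (rule sum_mono) simp
  then show ?thesis by simp
qed

lemma lamm_rec: "lamm q K l = rec_nat (q - 1) (\<lambda>l a. mu q (\<lambda>c. (c * Suc l + a * (K - l)) mod q = 0)) l"
  by (induction l) auto

lemma lamm_le: "lamm q K l \<le> q" by (cases l) (auto simp: mu_le)

lemma pb_lamm: assumes p: "pb k q" "pb k K" "pb k l" shows "pb k (\<lambda>\<omega>. lamm (q \<omega>) (K \<omega>) (l \<omega>))"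
proof -
  obtain C where C: "\<And>x a. length a = k \<Longrightarrow> q (x, a) \<le> (sz (x, a) + 2) ^ C" using pb_boundE[OF p(1)] by blast
  show ?thesis unfolding lamm_rec
  proof (rule pb_recn[OF p(3), where B = "\<lambda>n. (n + 2) ^ C"])
    show "pb k (\<lambda>\<omega>. q \<omega> - 1)" by (intro pb_diff pb_const p)
    show "pol (\<lambda>n. (n + 2) ^ C)" by (intro pol_intros)
    have q2: "pb (Suc (Suc k)) (\<lambda>\<omega>. q (drp (drp \<omega>)))" by (rule pb_weak[OF pb_weak[OF p(1)]])
    have q3: "pb (Suc (Suc (Suc k))) (\<lambda>\<omega>. q (drp (drp (drp \<omega>))))" by (rule pb_weak[OF q2])
    have K3: "pb (Suc (Suc (Suc k))) (\<lambda>\<omega>. K (drp (drp (drp \<omega>))))" by (rule pb_weak[OF pb_weak[OF pb_weak[OF p(2)]]])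
    have v0: "pb (Suc (Suc (Suc k))) (\<lambda>\<omega>. vr 0 (drp \<omega>))" by (rule pb_weak[OF pb_vr]) simp
    have v1: "pb (Suc (Suc (Suc k))) (\<lambda>\<omega>. vr 1 (drp \<omega>))" by (rule pb_weak[OF pb_vr]) simp
    show "pb (Suc (Suc k)) (\<lambda>\<omega>. mu (q (drp (drp \<omega>))) (\<lambda>c. (c * Suc (vr 0 \<omega>) + vr 1 \<omega> * (K (drp (drp \<omega>)) - vr 0 \<omega>)) mod q (drp (drp \<omega>)) = 0))"
      by (rule pb_mu[OF _ q2]) (intro pbP_eq pb_mod pb_add pb_mult pb_Suc pb_diff pb_const q3 K3 v0 v1 pb_vr, simp)
    fix x a n assume "length (a::nat list) = k"
    then show "rec_nat (q (x, a) - 1) (\<lambda>l b. mu (q (x, a)) (\<lambda>c. (c * Suc l + b * (K (x, a) - l)) mod q (x, a) = 0)) n \<le> (sz (x, a) + 2) ^ C"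
      unfolding lamm_rec[symmetric] using lamm_le le_trans C by blast
  qed
qed

context params
begin

lemma pb_nkk: "pb k (\<lambda>\<omega>. nkk (fst \<omega>))"
  unfolding nkk_def tm_def ss_def zz_def tm_def wl_def pl_def by (intro pb_rules pb_poly)

text \<open>A polynomial bound for \<open>KK x ^ (121 * TT x)\<close> by \<open>KT_bound\<close>,
  hence for \<open>UU x\<close> and for the powers below it.\<close>

definition cap where "cap x = ((nkk x + C0) ^ 8) ^ 121"

lemma cap: "KK x ^ (121 * TT x) \<le> cap x"
  unfolding cap_def using power_mono[OF KT_bound[of x], of 121] by (simp add: power_mult[symmetric] mult.commute)

lemma pb_cap: "pb k (\<lambda>\<omega>. cap (fst \<omega>))"
  unfolding cap_def by (intro pb_power_const pb_add pb_const pb_nkk)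

lemma U_cap: "UU x \<le> cap x" by (rule le_trans[OF UU_le cap])

lemma K_cap: "KK x \<le> cap x"
  using cap[of x] TT6[of x] self_le_power[of "KK x" "121 * TT x"] KK2[of x] by simp

text \<open>A cap one above \<open>nkk x\<close> does not change a comparison with
  \<open>nkk x\<close>, so the doubly exponential search condition can be tested with small
  numbers.\<close>

lemma TT_test: "T0 \<le> T \<and> nkk x \<le> min ((min (Dd (T - 1)) (nkk x + 1)) ^ T) (nkk x + 1) \<longleftrightarrow> T0 \<le> T \<and> nkk x \<le> Dd (T - 1) ^ T"
proof (cases "T0 \<le> T")
  case True
  then have T: "0 < T" using T0 by simp
  show ?thesis
  proof (cases "Dd (T - 1) \<le> nkk x + 1")
    case False
    have a: "nkk x + 1 \<le> (nkk x + 1) ^ T" by (rule self_le_power) (use T in auto)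
    have b: "Dd (T - 1) \<le> Dd (T - 1) ^ T" by (rule self_le_power) (use T Dd_ge2[of "T - 1"] in auto)
    have c: "min (Dd (T - 1)) (nkk x + 1) = nkk x + 1" using False by simp
    show ?thesis unfolding c min_absorb2[OF a] using b False by simp
  qed (simp add: min_absorb1)
qed simp

lemma pb_TT: "pb k (\<lambda>\<omega>. TT (fst \<omega>))"
proof -
  have "pb k (\<lambda>\<omega>. mu (nkk (fst \<omega>) + T0 + 1) (\<lambda>T. T0 \<le> T \<and> nkk (fst \<omega>) \<le> min ((min (Dd (T - 1)) (nkk (fst \<omega>) + 1)) ^ T) (nkk (fst \<omega>) + 1)))"
  proof (rule pb_mu)
    show "pbP (Suc k) (\<lambda>\<omega>. T0 \<le> vr 0 \<omega> \<and> nkk (fst (drp \<omega>)) \<le> min ((min (Dd (vr 0 \<omega> - 1)) (nkk (fst (drp \<omega>)) + 1)) ^ vr 0 \<omega>) (nkk (fst (drp \<omega>)) + 1))"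
      unfolding fst_drp by (intro pbP_conj pbP_le pb_const pb_powt pb_Dd pb_diff pb_add pb_nkk pb_vr) simp_all
    show "pb k (\<lambda>\<omega>. nkk (fst \<omega>) + T0 + 1)" by (intro pb_add pb_const pb_nkk)
  qed
  moreover have "mu (nkk x + T0 + 1) (\<lambda>T. T0 \<le> T \<and> nkk x \<le> min ((min (Dd (T - 1)) (nkk x + 1)) ^ T) (nkk x + 1)) = TT x" for x
    unfolding TT_test TT_def by (rule mu_Least[where P = "\<lambda>T. T0 \<le> T \<and> nkk x \<le> Dd (T - 1) ^ T", OF TT_ex]) simp
  ultimately show ?thesis by (simp only:)
qed

lemma pb_KK: "pb k (\<lambda>\<omega>. KK (fst \<omega>))"
proof (rule pb_cong)
  show "pb k (\<lambda>\<omega>. min (Dd (TT (fst \<omega>))) (cap (fst \<omega>)))" by (intro pb_Dd pb_TT pb_cap)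
qed (use K_cap in \<open>simp add: KK_def min_absorb1\<close>)

lemma pb_qq: "pb k (\<lambda>\<omega>. qq (fst \<omega>))"
proof -
  have "pb k (\<lambda>\<omega>. mu (8 * (KK (fst \<omega>) ^ 17)\<^sup>2 + 1) (\<lambda>q. prime q \<and> KK (fst \<omega>) ^ 17 < q))"
  proof (rule pb_mu)
    show "pbP (Suc k) (\<lambda>\<omega>. prime (vr 0 \<omega>) \<and> KK (fst (drp \<omega>)) ^ 17 < vr 0 \<omega>)"
      unfolding fst_drp by (intro pbP_conj pbP_less pbP_prime pb_power_const pb_KK pb_vr) simp_all
    show "pb k (\<lambda>\<omega>. 8 * (KK (fst \<omega>) ^ 17)\<^sup>2 + 1)" by (intro pb_add pb_mult pb_const pb_power_const pb_KK)
  qed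
  moreover have "mu (8 * (KK x ^ 17)\<^sup>2 + 1) (\<lambda>q. prime q \<and> KK x ^ 17 < q) = qq x" for x
    unfolding qq_def by (rule mu_Least[where y = "qq x"]) (use qq[of x] in auto)
  ultimately show ?thesis by (simp only:)
qed

lemma pb_UU: "pb k (\<lambda>\<omega>. UU (fst \<omega>))" unfolding UU_def
proof (rule pb_pow[OF _ _ pb_cap])
  show "pb k (\<lambda>\<omega>. 2 * qq (fst \<omega>))" "pb k (\<lambda>\<omega>. 3 * TT (fst \<omega>) + 1)" by (intro pb_rules pb_qq pb_TT)+
qed (use U_cap in \<open>simp add: UU_def\<close>)

lemma pb_qT: "pb k (\<lambda>\<omega>. qq (fst \<omega>) ^ TT (fst \<omega>))"
  by (rule pb_pow[OF pb_qq pb_TT pb_UU]) (use Uq in simp)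

lemma pb_WW: "pb k (\<lambda>\<omega>. WW (fst \<omega>))" unfolding WW_def by (intro pb_rules pb_qq pb_UU)

lemma pb_Kt: "pb k (\<lambda>\<omega>. Kt (fst \<omega>))" unfolding Kt_def
proof (rule pb_mult)
  show "pb k (\<lambda>\<omega>. qq (fst \<omega>) ^ (2 * TT (fst \<omega>)))"
    by (rule pb_pow[OF pb_qq _ pb_UU], intro pb_mult pb_const pb_TT) (use Uq in simp)
  have "pb k (\<lambda>\<omega>. 2 * qq (fst \<omega>))" by (intro pb_rules pb_qq)
  then show "pb k (\<lambda>\<omega>. (2 * qq (fst \<omega>)) ^ TT (fst \<omega>))" by (rule pb_pow[OF _ pb_TT pb_UU]) (use Uq in simp)
qed

lemma pb_MM: "pb k (\<lambda>\<omega>. MM (fst \<omega>))" unfolding MM_def by (intro pb_mult pb_KK pb_Kt)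

lemma pb_A0: "pb k (\<lambda>\<omega>. I.A0 (fst \<omega>))" unfolding I.A0_def by (intro pb_mult pb_const pb_power_const pb_WW)
lemma pb_m0: "pb k (\<lambda>\<omega>. I.m0 (fst \<omega>))" unfolding I.m0_def by (intro pb_mult pb_Suc pb_MM pb_A0)
lemma pb_Rn: "pb k (\<lambda>\<omega>. I.Rn (fst \<omega>))" unfolding I.Rn_def by (intro pb_mult pb_const pb_power_const pb_WW)
lemma pb_Gn: "pb k (\<lambda>\<omega>. I.Gn (fst \<omega>))" unfolding I.Gn_def by (intro pb_mult pb_add pb_MM pb_Rn pb_m0)
lemma pb_NC: "pb k (\<lambda>\<omega>. I.NC (fst \<omega>))" unfolding I.NC_def by (intro pb_mult pb_add pb_Gn pb_m0)
lemma pb_nn: "pb k (\<lambda>\<omega>. I.nn (fst \<omega>))" unfolding I.nn_def by (intro pb_add pb_NC pb_m0)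

definition Dc where "Dc x t = min (Dd t) (KK x)"

lemma Dc: "t \<le> TT x \<Longrightarrow> Dc x t = Dd t"
  unfolding Dc_def KK_def using Dd_mono[of t "TT x"] by (simp add: min_absorb1)

lemma pb_Dc: "pb k f \<Longrightarrow> pb k (\<lambda>\<omega>. Dc (fst \<omega>) (f \<omega>))" unfolding Dc_def by (rule pb_Dd[OF _ pb_KK])

lemma pb_ixx: assumes "pb k f" shows "pb k (\<lambda>\<omega>. ixx (fst \<omega>) (f \<omega>) i)"
  unfolding ixx_def ss_def zz_def tm_def wl_def pl_def by (intro pb_rules pbP_eq pbP_less pbP_const pb_poly assms)

lemma pb_iy: assumes "pb k f" shows "pb k (\<lambda>\<omega>. iy (fst \<omega>) (f \<omega>) i)"
proof -
  have D: "pb k (\<lambda>\<omega>. Dd (TT (fst \<omega>) - 1))"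
  proof (rule pb_cong[OF pb_Dc])
    show "pb k (\<lambda>\<omega>. TT (fst \<omega>) - 1)" by (intro pb_diff pb_TT pb_const)
  qed (simp add: Dc)
  show ?thesis unfolding iy_def
  proof (rule pb_bp[OF pb_qq D pb_TT pb_ixx[OF assms] pb_UU], intro conjI)
    fix x and a :: "nat list"
    show "Dd (TT (fst (x, a)) - 1) ^ TT (fst (x, a)) \<le> UU (fst (x, a))"
      using power_mono[OF D0q[of x], of "TT x"] Uq(3)[of x] by simp
  qed (use q0 Uq in auto)
qed

lemma pb_lm: "pb k f \<Longrightarrow> pb k (\<lambda>\<omega>. lm (fst \<omega>) (f \<omega>))" unfolding lm_def by (intro pb_lamm pb_qq pb_KK)

lemma pb_linx: assumes "pb k z" "pb k l" "pb k y" shows "pb k (\<lambda>\<omega>. lin (qq (fst \<omega>)) (TT (fst \<omega>)) (z \<omega>) (l \<omega>) (y \<omega>))"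
  by (rule pb_lin[OF pb_qq pb_TT assms pb_UU]) (use q0 Uq in auto)

lemma pb_lnx: assumes "pb k z" "pb k l" "pb k y" shows "pb k (\<lambda>\<omega>. lncode (qq (fst \<omega>)) (TT (fst \<omega>)) (z \<omega>) (l \<omega>) (y \<omega>))"
  unfolding lncode_def by (intro pb_add pb_mult pb_linx pb_qT pb_diff pb_qq pb_const assms)

text \<open>\<open>nxt M\<close> as a table on codes of triples below \<open>cb\<close>. The
  contents of cells are bounded by a constant of the machine, so the table is finite and independent
  of the input.\<close>

definition ntab where "ntab c = nxt M (c mod cb) (c div cb mod cb) (c div cb div cb)"

lemma ntab: "b1 < cb \<and> b2 < cb \<and> b3 < cb \<and> b0 = nxt M b1 b2 b3 \<longleftrightarrow>
   b1 < cb \<and> b2 < cb \<and> b3 < cb \<and> b0 = (if b1 + cb * (b2 + cb * b3) < cb * (cb * cb) then ntab (b1 + cb * (b2 + cb * b3)) else 0)"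
proof (cases "b1 < cb \<and> b2 < cb \<and> b3 < cb")
  case True
  then have "b1 + cb * (b2 + cb * b3) < cb * Suc (b2 + cb * b3)" by simp
  also have "Suc (b2 + cb * b3) \<le> cb * Suc b3" using True by simp
  also have "cb * Suc b3 \<le> cb * cb" using True by (intro mult_le_mono2) simp
  finally have "b1 + cb * (b2 + cb * b3) < cb * (cb * cb)" by (simp add: mult_le_mono2)
  moreover have "ntab (b1 + cb * (b2 + cb * b3)) = nxt M b1 b2 b3" using True by (simp add: ntab_def)
  ultimately show ?thesis by simp
qed auto

lemma pbP_alw: assumes "pb k f" "pb k b0" "pb k b1" "pb k b2" "pb k b3"
  shows "pbP k (\<lambda>\<omega>. alw (fst \<omega>) (f \<omega>) (b0 \<omega>) (b1 \<omega>) (b2 \<omega>) (b3 \<omega>))"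
  unfolding alw_def ntab ini_def presym_def ss_def zz_def tm_def wl_def pl_def
  by (intro pbP_conj pbP_disj pbP_imp pbP_If pbP_eq pbP_less pbP_le pb_table pb_rules pb_poly assms)

lemmas pbx = pb_linx pb_lnx pb_lm pb_iy pbP_alw pb_Dc pb_qT pb_qq pb_TT pb_UU pb_WW pb_KK pb_nkk
  pbP_conj pbP_disj pbP_If pbP_eq pbP_less pbP_le pbP_not pbP_const pb_power_const
  pb_const pb_Suc pb_add pb_mult pb_diff pb_div pb_mod pb_if

lemma pbP_validq: assumes "pb k tg" "\<And>i. pb k (\<lambda>\<omega>. P \<omega> i)"
  shows "pbP k (\<lambda>\<omega>. I.validq (fst \<omega>) (Dc (fst \<omega>)) (tg \<omega>) (P \<omega>))"
  unfolding I.validq_def by (intro assms pbx)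

lemma pb_headp: assumes "pb k tg" "\<And>i. pb k (\<lambda>\<omega>. P \<omega> i)"
  shows "pb k (\<lambda>\<omega>. I.headp (fst \<omega>) (WW (fst \<omega>)) (tg \<omega>) (P \<omega>))"
  unfolding I.headp_def ec_def lc.simps by (intro assms pbx)

lemma pbP_bodyq: assumes "pb k tg" "\<And>i. pb k (\<lambda>\<omega>. P \<omega> i)" "pb k v"
  shows "pbP k (\<lambda>\<omega>. I.bodyq (fst \<omega>) (Dc (fst \<omega>)) (WW (fst \<omega>)) (tg \<omega>) (P \<omega>) (v \<omega>))"
  unfolding I.bodyq_def ec_def lc.simps ag_def by (intro assms pbx)

definition pp where "pp x n = (\<lambda>i. n mod I.Rn x div 15 div WW x ^ i mod WW x)"

lemma pb_pp: "pb k f \<Longrightarrow> pb k (\<lambda>\<omega>. pp (fst \<omega>) (f \<omega>) i)" unfolding pp_def by (intro pbx pb_Rn)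

lemma validp_alt: "I.validp x tg P = I.validq x (Dc x) tg P"
  by (rule I.validq_cong[OF Dc, symmetric])

lemma pb_posv: assumes f: "pb k f" shows "pb k (\<lambda>\<omega>. I.posv (fst \<omega>) (f \<omega>))"
  unfolding I.posv_def Let_def pp_def[symmetric] validp_alt
  by (intro pbP_validq pb_headp pb_pp f pbx pb_MM pb_Rn pb_Gn pb_A0 pb_m0)

lemma negm_alt: "I.negm x n v \<longleftrightarrow> (if n < MM x * I.Rn x \<and> I.validq x (Dc x) (n mod I.Rn x mod 15) (pp x n)
    then v mod 12 = 0 \<and> I.bodyq x (Dc x) (WW x) (n mod I.Rn x mod 15) (pp x n) v
      \<or> Suc (n div I.Rn x) * I.A0 x \<le> v \<and> \<not> (v - Suc (n div I.Rn x) * I.A0 x) mod 12 = 0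
         \<and> I.bodyq x (Dc x) (WW x) (n mod I.Rn x mod 15) (pp x n) (v - Suc (n div I.Rn x) * I.A0 x)
    else if n < I.Gn x then I.A0 x \<le> v \<and> v < I.m0 x \<and> v mod I.A0 x = 11 else v = I.m0 x + (n - I.Gn x) div I.m0 x)"
proof -
  have v: "I.validq x (Dc x) (n mod I.Rn x mod 15) (pp x n) = I.validp x (n mod I.Rn x mod 15) (pp x n)"
    by (rule validp_alt[symmetric])
  have b: "I.bodyq x (Dc x) (WW x) (n mod I.Rn x mod 15) (pp x n) w = I.bodyp x (WW x) (n mod I.Rn x mod 15) (pp x n) w"
    if "I.validp x (n mod I.Rn x mod 15) (pp x n)" for w by (rule I.bodyq_cong[OF Dc that])
  show ?thesis unfolding v I.negm_def Let_def pp_def[symmetric] using b by simp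
qed

lemma pbP_negm: assumes f: "pb k f" "pb k g" shows "pbP k (\<lambda>\<omega>. I.negm (fst \<omega>) (f \<omega>) (g \<omega>))"
  unfolding negm_alt
  by (intro pbP_validq pbP_bodyq pb_pp f pbx pb_MM pb_Rn pb_Gn pb_A0 pb_m0)

lemma pbP_cbit: assumes f: "pb k f" shows "pbP k (\<lambda>\<omega>. I.cbit (fst \<omega>) (f \<omega>))"
  unfolding I.cbit_def Let_def
  by (intro pbP_negm pb_posv f pbx pb_nn)

text \<open>The lower bound of the negative case and the largest power of two below it. Comparing a
  binary number with a power of two amounts to looking for a bit 1 in a high position, which the
  final scan of the machine can do.\<close>

definition gap where "gap x = I.Gn x * (KK x * Kt x)"
definition thr where "thr x = (LEAST e. gap x < 2 ^ (e + 1))"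

lemma thr_ex: "gap x < 2 ^ (gap x + 1)"
  using less_exp[of "gap x + 1"] by linarith

lemma pb_thr: "pb k (\<lambda>\<omega>. thr (fst \<omega>))"
proof -
  have g: "pb j (\<lambda>\<omega>. gap (fst \<omega>))" for j unfolding gap_def by (intro pb_mult pb_Gn pb_KK pb_Kt)
  have "pb k (\<lambda>\<omega>. mu (gap (fst \<omega>) + 1) (\<lambda>e. gap (fst \<omega>) < min (2 ^ (e + 1)) (gap (fst \<omega>) + 1)))"
  proof (rule pb_mu)
    show "pbP (Suc k) (\<lambda>\<omega>. gap (fst (drp \<omega>)) < min (2 ^ (vr 0 \<omega> + 1)) (gap (fst (drp \<omega>)) + 1))"
      unfolding fst_drp by (intro pbP_less g pb_powt pb_add pb_const pb_vr) simp_all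
    show "pb k (\<lambda>\<omega>. gap (fst \<omega>) + 1)" by (intro pb_add pb_const g)
  qed
  moreover have "mu (gap x + 1) (\<lambda>e. gap x < min (2 ^ (e + 1)) (gap x + 1)) = thr x" for x
  proof -
    have "mu (gap x + 1) (\<lambda>e. gap x < 2 ^ (e + 1)) = thr x" unfolding thr_def
      by (rule mu_Least[where P = "\<lambda>e. gap x < 2 ^ (e + 1)", OF thr_ex]) simp
    then show ?thesis by simp
  qed
  ultimately show ?thesis by (simp only:)
qed

lemma thr: "2 ^ thr x \<le> gap x" "gap x < 2 * 2 ^ thr x"
proof -
  show "gap x < 2 * 2 ^ thr x" using LeastI[of "\<lambda>e. gap x < 2 ^ (e + 1)", OF thr_ex] unfolding thr_def by simp
  show "2 ^ thr x \<le> gap x"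
  proof (cases "thr x")
    case 0
    have "0 < gap x" using Kt_pos[of x] KK2[of x] I.m0(1)[of x] by (simp add: gap_def I.Gn_def)
    then show ?thesis using 0 by simp
  next
    case (Suc e)
    then have "\<not> gap x < 2 ^ (e + 1)" using not_less_Least[of e "\<lambda>e. gap x < 2 ^ (e + 1)"] unfolding thr_def by simp
    then show ?thesis using Suc by simp
  qed
qed

end

section \<open>Hardness of approximation\<close>

lemma horner_sum_ge_power_iff:
  "2 ^ e \<le> (horner_sum of_bool 2 y :: nat) \<longleftrightarrow> (\<exists>i<length y. e \<le> i \<and> y ! i)"
proof (induction y arbitrary: e)
  case (Cons b y)
  have e: "horner_sum of_bool 2 (b # y) = of_bool b + 2 * (horner_sum of_bool 2 y :: nat)" by simp
  have ex: "(\<exists>i<length (b # y). e \<le> i \<and> (b # y) ! i) \<longleftrightarrow> e = 0 \<and> b \<or> (\<exists>i<length y. e \<le> Suc i \<and> y ! i)"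
    unfolding length_Cons Ex_less_Suc2 by simp
  show ?case
  proof (cases e)
    case 0
    have "1 \<le> (horner_sum of_bool 2 y :: nat) \<longleftrightarrow> (\<exists>i<length y. y ! i)" using Cons.IH[of 0] by simp
    moreover have "(1::nat) \<le> of_bool b + 2 * h \<longleftrightarrow> b \<or> 1 \<le> h" for h by (cases b) auto
    ultimately show ?thesis unfolding ex e using 0 by simp
  next
    case (Suc e')
    have "2 ^ Suc e' \<le> of_bool b + 2 * (h::nat) \<longleftrightarrow> 2 ^ e' \<le> h" for h by (cases b) auto
    then show ?thesis unfolding ex e using Suc Cons.IH[of e'] by simp
  qed
qed simp

context params
begin

text \<open>In the positive case twice the approximation is at most \<open>gap x\<close>, so the
  approximation is below \<open>2 ^ thr x\<close>; in the negative case it is at least the minimum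
  and hence at least \<open>2 ^ thr x\<close>. Of the factor 4 in \<open>r\<close>, one 2 pays for
  the upper bound \<open>2 * Gn * Kt\<close> and the other for rounding the threshold.\<close>

theorem decide_by_approximation:
  assumes ap: "min_clauses_approximable N (\<lambda>n. n) r"
    and N: "\<And>x. I.nn x \<in> N" and r: "\<And>x. 4 * r (I.nn x) \<le> real (KK x)"
  shows "{x. \<exists>y. length y \<le> poly py (length x) \<and> pair_bits x y \<in> V} \<in> class_P"
proof -
  let ?v = "\<lambda>y. horner_sum of_bool 2 y :: nat" and ?m = "\<lambda>x. min_clauses (I.nn x) (I.hfun x)"
  from ap obtain M' and p' :: "nat poly" where wf': "wf_tm M'" and
    M': "\<And>n \<Phi> h. n \<in> N \<Longrightarrow> pure_horn_cnf n \<Phi> \<and> represents n \<Phi> h \<and> length \<Phi> \<le> n \<Longrightarrow>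
      \<exists>y. outputs_within M' (encode_cnf n \<Phi>) (poly p' n) y \<and>
        (let a = ?v y in min_clauses n h \<le> a \<and> real a \<le> r n * real (min_clauses n h))"
    unfolding min_clauses_approximable_def by blast
  have "\<exists>y. outputs_within M' (encode_cnf (I.nn x) (I.Phi x)) (poly p' (I.nn x)) y \<and>
        ?m x \<le> ?v y \<and> real (?v y) \<le> r (I.nn x) * real (?m x)" for x
    using M'[OF N, of x "I.Phi x" "I.hfun x"] I.pure_Phi[of x] I.length_Phi[of x]
    by (simp add: Let_def represents_def I.hfun_def)
  then obtain y where y: "\<And>x. outputs_within M' (encode_cnf (I.nn x) (I.Phi x)) (poly p' (I.nn x)) (y x)"
    "\<And>x. ?m x \<le> ?v (y x)" "\<And>x. real (?v (y x)) \<le> r (I.nn x) * real (?m x)" by metis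
  have "pb 0 (\<lambda>\<omega>. poly p' (I.nn (fst \<omega>)))" by (intro pb_poly pb_nn)
  then obtain C where "\<And>x a. length a = 0 \<Longrightarrow> poly p' (I.nn (fst (x, a))) \<le> (sz (x, a) + 2) ^ C"
    using pb_boundE by blast
  from this[of "[]"] have C: "poly p' (I.nn x) \<le> (length x + 2) ^ C" for x :: "bool list" by (simp add: sz_def)
  have "{x. False = (\<exists>i<length (y x). thr (fst (x, []::nat list)) \<le> i \<and> y x ! i)} \<in> class_P"
  proof (rule pb_reduction[where thrf = "\<lambda>\<omega>. thr (fst \<omega>)" and y = y and fl = False
      and bitf = "\<lambda>\<omega>. of_bool (I.cbit (fst \<omega>) (vr 0 \<omega>))" and tt = "\<lambda>x. poly p' (I.nn x)"
      and lenf = "\<lambda>\<omega>. I.nn (fst \<omega>) + 1 + I.NC (fst \<omega>) * (2 * I.nn (fst \<omega>))", OF wf'])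
    show "pb 1 (\<lambda>\<omega>. of_bool (I.cbit (fst \<omega>) (vr 0 \<omega>)))" by (intro pb_of_bool pbP_cbit pb_vr) simp
    show "pb 0 (\<lambda>\<omega>. I.nn (fst \<omega>) + 1 + I.NC (fst \<omega>) * (2 * I.nn (fst \<omega>)))"
      by (intro pb_add pb_mult pb_const pb_nn pb_NC)
    show "pb 0 (\<lambda>\<omega>. thr (fst \<omega>))" by (rule pb_thr)
    show "outputs_within M' (map (\<lambda>i. of_bool (I.cbit (fst (x, [i])) (vr 0 (x, [i]))) \<noteq> (0::nat))
        [0..<I.nn (fst (x, []::nat list)) + 1 + I.NC (fst (x, []::nat list)) * (2 * I.nn (fst (x, []::nat list)))]) (poly p' (I.nn x)) (y x)" for x
      using y(1)[of x] unfolding I.encode_Phi by simp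
    show "poly p' (I.nn x) \<le> (length x + 2) ^ C" for x by (rule C)
  qed
  moreover have "False = (\<exists>i<length (y x). thr x \<le> i \<and> y x ! i) \<longleftrightarrow>
      (\<exists>z. length z \<le> poly py (length x) \<and> pair_bits x z \<in> V)" for x
    unfolding horner_sum_ge_power_iff[symmetric]
  proof (cases "\<exists>z. length z \<le> poly py (length x) \<and> pair_bits x z \<in> V")
    case True
    then have m: "?m x \<le> 2 * I.Gn x * Kt x" using yes by blast
    have "2 * real (?v (y x)) \<le> 2 * r (I.nn x) * real (?m x)" using y(3)[of x] by simp
    also have "\<dots> \<le> real (KK x) / 2 * real (?m x)" using r[of x] by (intro mult_right_mono) auto
    also have "\<dots> \<le> real (KK x) / 2 * real (2 * I.Gn x * Kt x)" by (rule mult_left_mono[OF iffD2[OF of_nat_le_iff m]]) simp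
    also have "\<dots> = real (gap x)" by (simp add: gap_def)
    finally have "real (2 * ?v (y x)) \<le> real (gap x)" by simp
    then have "2 * ?v (y x) \<le> gap x" by (simp only: of_nat_le_iff)
    then have "\<not> 2 ^ thr x \<le> ?v (y x)" using thr(2)[of x] by linarith
    then show "False = (2 ^ thr x \<le> ?v (y x)) \<longleftrightarrow> (\<exists>z. length z \<le> poly py (length x) \<and> pair_bits x z \<in> V)" using True by simp
  next
    case False
    from no[OF this] have "2 ^ thr x \<le> ?v (y x)" using thr(1)[of x] y(2)[of x] unfolding gap_def by linarith
    then show "False = (2 ^ thr x \<le> ?v (y x)) \<longleftrightarrow> (\<exists>z. length z \<le> poly py (length x) \<and> pair_bits x z \<in> V)" using False by simp
  qed
  ultimately show ?thesis by simp
qed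

end

text \<open>The verifier still has to undo the encoding of pairs: \<open>dec\<close> takes every
  second symbol of the doubled part. It is correct for an empty certificate, and the length bound
  \<open>poly 0\<close> admits no other.\<close>

lemma class_P_subset_NP: "class_P \<subseteq> class_NP"
proof
  fix L assume "L \<in> class_P"
  then obtain M and p :: "nat poly" where M: "wf_tm M" "\<And>x. outputs_within M x (poly p (length x)) [x \<in> L]"
    unfolding class_P_def by blast
  define dec where "dec w = map (\<lambda>i. of_bool (insym w (int (2 * i)) = 2) \<noteq> (0::nat)) [0..<(length w - 2) div 2]" for w
  have "pb 0 (\<lambda>\<omega>. poly p ((length (fst \<omega>) - 2) div 2))" by (intro pb_poly pb_rules)
  then obtain C where "\<And>x a. length a = 0 \<Longrightarrow> poly p ((length (fst (x, a)) - 2) div 2) \<le> (sz (x, a) + 2) ^ C"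
    using pb_boundE by blast
  from this[of "[]"] have C: "poly p ((length x - 2) div 2) \<le> (length x + 2) ^ C" for x :: "bool list" by (simp add: sz_def)
  have "{w. True = (\<exists>i<length [dec w \<in> L]. (\<lambda>_. 0) (w, []::nat list) \<le> i \<and> [dec w \<in> L] ! i)} \<in> class_P"
  proof (rule pb_reduction[where thrf = "\<lambda>_. 0" and y = "\<lambda>w. [dec w \<in> L]" and fl = True
      and bitf = "\<lambda>\<omega>. of_bool (insym (fst \<omega>) (int (2 * vr 0 \<omega>)) = 2)" and tt = "\<lambda>w. poly p ((length w - 2) div 2)"
      and lenf = "\<lambda>\<omega>. (length (fst \<omega>) - 2) div 2", OF M(1)])
    show "pb 1 (\<lambda>\<omega>. of_bool (insym (fst \<omega>) (int (2 * vr 0 \<omega>)) = 2))" by (intro pb_rules pbP_eq pb_vr) simp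
    show "pb 0 (\<lambda>\<omega>. (length (fst \<omega>) - 2) div 2)" by (intro pb_rules)
    show "pb 0 (\<lambda>_. 0)" by (rule pb_const)
    show "outputs_within M (map (\<lambda>i. of_bool (insym (fst (w, [i])) (int (2 * vr 0 (w, [i]))) = 2) \<noteq> (0::nat)) [0..<(length (fst (w, []::nat list)) - 2) div 2])
       (poly p ((length w - 2) div 2)) [dec w \<in> L]" for w
      using M(2)[of "dec w"] by (simp add: dec_def)
    show "poly p ((length w - 2) div 2) \<le> (length w + 2) ^ C" for w :: "bool list" by (rule C)
  qed
  then have V: "{w. dec w \<in> L} \<in> class_P" by simp
  have d: "dec (pair_bits x []) = x" for x
  proof (rule nth_equalityI)
    show l: "length (dec (pair_bits x [])) = length x" by (simp add: dec_def length_pair_bits)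
    fix i assume "i < length (dec (pair_bits x []))"
    then have i: "i < length x" using l by simp
    have "insym (pair_bits x []) (int (2 * i)) = bit_symbol (pair_bits x [] ! (2 * i))"
      using i by (simp add: insym_def length_pair_bits nat_mult_distrib)
    also have "\<dots> = presym x (2 * i)" by (rule pair_bits_prefix) (use i in simp)
    also have "\<dots> = bit_symbol (x ! i)" using i by (simp add: presym_def insym_def)
    finally show "dec (pair_bits x []) ! i = x ! i" using i by (simp add: dec_def length_pair_bits bit_symbol_def)
  qed
  have "x \<in> L \<longleftrightarrow> (\<exists>y. length y \<le> poly 0 (length x) \<and> pair_bits x y \<in> {w. dec w \<in> L})" for x
    using d by simp
  then show "L \<in> class_NP" unfolding class_NP_def using V by blast
qed

text \<open>The assumption on \<open>r\<close> is confined to the window of sizes in which the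
  formulas lie and to large \<open>T\<close>. The latter is arranged by starting the search for
  \<open>TT\<close> at a large \<open>T0\<close>, which affects only the constants of the
  reduction.\<close>

lemma class_NP_subset_P:
  assumes ap: "min_clauses_approximable N (\<lambda>n. n) r"
    and T1: "\<And>T n. T1 \<le> T \<Longrightarrow> (2 ^ 2 ^ T) ^ 8 \<le> n \<Longrightarrow> n \<le> (2 ^ 2 ^ T) ^ (3000 * T) \<Longrightarrow> n \<in> N \<and> 4 * r n \<le> 2 ^ 2 ^ T"
  shows "class_NP \<subseteq> class_P"
proof
  fix L assume "L \<in> class_NP"
  then obtain V and py :: "nat poly" where V: "V \<in> class_P"
    and L: "\<And>x. x \<in> L \<longleftrightarrow> (\<exists>y. length y \<le> poly py (length x) \<and> pair_bits x y \<in> V)"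
    unfolding class_NP_def by blast
  from V obtain M and p :: "nat poly" where M: "wf_tm M" "\<And>x. outputs_within M x (poly p (length x)) [x \<in> V]"
    unfolding class_P_def by blast
  interpret tb: tableau M V p py by standard (rule M)+
  define T0 where "T0 = max (max 6 tb.cb) T1"
  have "tb.cb \<le> Dd T0"
  proof -
    have "tb.cb \<le> T0" by (simp add: T0_def)
    also have "T0 \<le> 2 ^ T0" by (rule less_imp_le[OF less_exp])
    also have "(2::nat) ^ T0 \<le> 2 ^ 2 ^ T0" by (rule less_imp_le[OF less_exp])
    finally show ?thesis by (simp add: Dd_def)
  qed
  then interpret pr: params M V p py T0 by unfold_locales (simp add: T0_def)
  have b: "pr.I.nn x \<in> N \<and> 4 * r (pr.I.nn x) \<le> 2 ^ 2 ^ pr.TT x" for x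
  proof (rule T1)
    have "T1 \<le> T0" by (simp add: T0_def)
    then show "T1 \<le> pr.TT x" using pr.TT(1)[of x] by (rule le_trans)
    show "(2 ^ 2 ^ pr.TT x) ^ 8 \<le> pr.I.nn x" using pr.nn_ge[of x] unfolding pr.KK_def Dd_def .
    show "pr.I.nn x \<le> (2 ^ 2 ^ pr.TT x) ^ (3000 * pr.TT x)" using pr.nn_le[of x] unfolding pr.KK_def Dd_def .
  qed
  have "{x. \<exists>y. length y \<le> poly py (length x) \<and> pair_bits x y \<in> V} \<in> class_P"
    by (rule pr.decide_by_approximation[OF ap]) (use b in \<open>simp_all add: pr.KK_def Dd_def\<close>)
  moreover have "L = {x. \<exists>y. length y \<le> poly py (length x) \<and> pair_bits x y \<in> V}" using L by blast
  ultimately show "L \<in> class_P" by simp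
qed

theorem theorem2:
  fixes c :: real
  assumes "0 < c" and "c < 1 / 2"
  shows "\<exists>\<epsilon>::real. 0 < \<epsilon> \<and> \<epsilon> \<le> 1 / 4 \<and>
    (class_P \<noteq> class_NP \<longrightarrow>
      (\<exists>m :: nat \<Rightarrow> nat. (\<lambda>n. real (m n)) \<in> O(\<lambda>n. real n powr (1 + 2 * \<epsilon>)) \<and>
        \<not> min_clauses_approximable {n. real n powr \<epsilon> > 2} m (\<lambda>n. rho c (real n powr \<epsilon>)))) \<and>
    (\<forall>n::nat. real n powr \<epsilon> > 2 \<longrightarrow>
      rho c (real n powr \<epsilon>) \<ge> 2 powr (\<epsilon> * log 2 (real n) powr (1 - 1 / delta c (real n)))) \<and>
    (\<exists>f :: nat \<Rightarrow> real. f \<in> o(\<lambda>_. 1) \<and>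
      (\<forall>n::nat. real n powr \<epsilon> > 2 \<longrightarrow>
        2 powr (\<epsilon> * log 2 (real n) powr (1 - 1 / delta c (real n)))
          = 2 powr (log 2 (real n) powr (1 - f n))))"
proof (intro exI[of _ "1 / 4"] conjI impI allI)
  let ?\<epsilon> = "1 / 4 :: real"
  show "0 < ?\<epsilon>" "?\<epsilon> \<le> 1 / 4" by simp_all
  show "\<exists>m :: nat \<Rightarrow> nat. (\<lambda>n. real (m n)) \<in> O(\<lambda>n. real n powr (1 + 2 * ?\<epsilon>)) \<and>
      \<not> min_clauses_approximable {n. real n powr ?\<epsilon> > 2} m (\<lambda>n. rho c (real n powr ?\<epsilon>))"
    if "class_P \<noteq> class_NP"
  \<comment> \<open>The clause bound is the identity, well within n^(3/2): the formula has been
    padded so as to have no more clauses than variables.\<close>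
  proof (intro exI[of _ "\<lambda>n. n"] conjI notI)
    show "(\<lambda>n. real n) \<in> O(\<lambda>n. real n powr (1 + 2 * ?\<epsilon>))" by real_asymp
    assume ap: "min_clauses_approximable {n. real n powr ?\<epsilon> > 2} (\<lambda>n. n) (\<lambda>n. rho c (real n powr ?\<epsilon>))"
    from rho_below_double_exp[of c] assms obtain T1 where
      T1: "\<forall>T\<ge>T1. \<forall>n::nat. (2 ^ 2 ^ T) ^ 8 \<le> n \<and> n \<le> (2 ^ 2 ^ T) ^ (3000 * T) \<longrightarrow>
        4 * rho c (real n powr ?\<epsilon>) \<le> 2 ^ 2 ^ T \<and> 2 < real n powr ?\<epsilon>" by auto
    have "class_NP \<subseteq> class_P"
    proof (rule class_NP_subset_P[OF ap])
      fix T n :: nat assume "T1 \<le> T" "(2 ^ 2 ^ T) ^ 8 \<le> n" "n \<le> (2 ^ 2 ^ T) ^ (3000 * T)"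
      then have "4 * rho c (real n powr ?\<epsilon>) \<le> 2 ^ 2 ^ T \<and> 2 < real n powr ?\<epsilon>" using T1 by blast
      then show "n \<in> {n. real n powr ?\<epsilon> > 2} \<and> 4 * rho c (real n powr ?\<epsilon>) \<le> 2 ^ 2 ^ T" by blast
    qed
    then show False using class_P_subset_NP that by blast
  qed
  show "rho c (real n powr ?\<epsilon>) \<ge> 2 powr (?\<epsilon> * log 2 (real n) powr (1 - 1 / delta c (real n)))"
    if "real n powr ?\<epsilon> > 2" for n :: nat
    by (rule rho_powr_lower_bound) (use assms that in auto)
  show "\<exists>f :: nat \<Rightarrow> real. f \<in> o(\<lambda>_. 1) \<and>
      (\<forall>n::nat. real n powr ?\<epsilon> > 2 \<longrightarrow>
        2 powr (?\<epsilon> * log 2 (real n) powr (1 - 1 / delta c (real n)))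
          = 2 powr (log 2 (real n) powr (1 - f n)))"
    by (rule log_powr_one_minus_o1) (use assms in auto)
qed


end
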